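(* Let $Z$ be a reduced analytic variety of pure codimension $p$, let $x\in Z$, and let $\mathcal I_x$ be the corresponding local ideal at $x$ (the germs at $x$ of holomorphic functions vanishing on $Z$). If $$\operatorname{codim} Z_{\mathrm{sing},x}\ge 2+p$$ and $$\operatorname{codim} Z_{k,x}\ge 2+k\quad\text{for all }k>p,$$ then $x$ is a normal point of $Z$.
   Context: $Z$ is an analytic variety in a neighborhood of the closed unit ball in $\mathbb C^n$, $\mathcal I=\mathcal I_Z$ is the ideal sheaf of holomorphic functions vanishing on $Z$, and $\mathcal O_Z=\mathcal O/\mathcal I_Z$ is the sheaf of (strongly) holomorphic functions on $Z$. $Z_{\mathrm{sing}}$ and $Z_{\mathrm{reg}}$ are the singular and regular parts of $Z$. A function is weakly holomorphic on $Z$ if it is holomorphic on $Z_{\mathrm{reg}}$ and locally bounded at $Z_{\mathrm{sing}}$. The point $x\in Z$ is normal if each germ at $x$ of a weakly holomorphic function is strongly holomorphic. Let $0\to \mathcal O(E_N)\xrightarrow{f_N}\cdots\xrightarrow{f_2}\mathcal O(E_1)\xrightarrow{f_1}\mathcal O(E_0)$ be a free resolution of $\mathcal O/\mathcal I_Z$ ($E_k$ trivial vector bundles, $E_0\simeq\mathbb C$, $\operatorname{im}f_1=\mathcal I_Z$). $Z_k$ is the analytic set where $f_k$ does not have optimal (i.e. its generic, maximal) rank; $Z_k=\emptyset$ for $k>N$. These sets are independent of the choice of resolution. $Z_{\mathrm{sing},x}$ and $Z_{k,x}$ denote the germs at $x$. Codimensions are in $\mathbb C^n$, and the empty germ has codimension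 $\infty$. *)

theory Defs
  imports "HOL-Analysis.Analysis" "Jordan_Normal_Form.DL_Rank"
begin

text \<open>
  Points of \<open>\<complex>\<^sup>n\<close> are elements of \<^typ>\<open>complex^'n\<close>. Fibres of the trivial bundles \<open>E\<^sub>k\<close>, whose rank
  depends on \<open>k\<close>, are carriers of the dimension-free vectors of \<open>Jordan_Normal_Form\<close>; the notation
  \<open>$\<close> refers to those.
\<close>

unbundle no vec_syntax

section \<open>Holomorphic functions of several variables and their germs\<close>

definition has_complex_derivative ::
  "(complex^'n \<Rightarrow> complex) \<Rightarrow> (complex^'n \<Rightarrow> complex) \<Rightarrow> complex^'n \<Rightarrow> bool" where
  "has_complex_derivative f D z \<longleftrightarrow>
     (f has_derivative D) (at z) \<and> (\<forall>c v. D (c *s v) = c * D v)"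

definition holo_on :: "(complex^'n \<Rightarrow> complex) \<Rightarrow> (complex^'n) set \<Rightarrow> bool" where
  "holo_on f U \<longleftrightarrow> open U \<and> (\<forall>z\<in>U. \<exists>D. has_complex_derivative f D z)"

text \<open>
  Germs at \<open>a\<close> are handled through representatives: total functions that are holomorphic near \<open>a\<close>,
  with equality of germs being equality eventually in \<^term>\<open>nhds a\<close>.
\<close>

definition holo_at :: "(complex^'n \<Rightarrow> complex) \<Rightarrow> complex^'n \<Rightarrow> bool" where
  "holo_at f a \<longleftrightarrow> (\<exists>U. a \<in> U \<and> holo_on f U)"


section \<open>Analytic varieties\<close>

definition analytic_variety_in :: "(complex^'n) set \<Rightarrow> (complex^'n) set \<Rightarrow> bool" where
  "analytic_variety_in \<Omega> Z \<longleftrightarrow> Z \<subseteq> \<Omega> \<and>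
     (\<forall>a\<in>\<Omega>. \<exists>U F. a \<in> U \<and> U \<subseteq> \<Omega> \<and> open U \<and> finite F \<and> (\<forall>g\<in>F. holo_on g U) \<and>
        Z \<inter> U = {z\<in>U. \<forall>g\<in>F. g z = 0})"

text \<open>
  Near \<open>a\<close> the set \<open>A\<close> is a complex submanifold of codimension \<open>c\<close>: the common zero set of \<open>c\<close>
  holomorphic functions whose differentials at \<open>a\<close> are linearly independent over \<open>\<complex>\<close>.
\<close>

definition regular_point :: "(complex^'n) set \<Rightarrow> nat \<Rightarrow> complex^'n \<Rightarrow> bool" where
  "regular_point A c a \<longleftrightarrow> a \<in> A \<and>
     (\<exists>U g D. a \<in> U \<and> (\<forall>i<c. holo_on (g i) U) \<and> open U \<and>
        A \<inter> U = {z\<in>U. \<forall>i<c. g i z = 0} \<and>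
        (\<forall>i<c. has_complex_derivative (g i) (D i) a) \<and>
        (\<forall>b :: nat \<Rightarrow> complex. (\<forall>v. (\<Sum>i<c. b i * D i v) = 0) \<longrightarrow> (\<forall>i<c. b i = 0)))"

definition reg_part :: "(complex^'n) set \<Rightarrow> (complex^'n) set" where
  "reg_part A = {a. \<exists>c. regular_point A c a}"

definition sing_part :: "(complex^'n) set \<Rightarrow> (complex^'n) set" where
  "sing_part A = A - reg_part A"

text \<open>
  The dimension at \<open>x\<close> of an analytic set is the largest dimension of its regular points accumulating
  at \<open>x\<close> (or equal to \<open>x\<close>), so its codimension is the least codimension of those. The regular points
  are dense, hence the infimum is over the empty set (and equals \<open>\<infinity>\<close>) exactly when the germ is empty.
\<close>

definition codim_at :: "(complex^'n) set \<Rightarrow> complex^'n \<Rightarrow> enat" where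
  "codim_at A x = Inf {enat c |c. x \<in> closure {z. regular_point A c z}}"

definition pure_codim :: "(complex^'n) set \<Rightarrow> nat \<Rightarrow> bool" where
  "pure_codim Z p \<longleftrightarrow> (\<forall>z\<in>Z. codim_at Z z = enat p)"

definition ideal_at :: "(complex^'n) set \<Rightarrow> complex^'n \<Rightarrow> (complex^'n \<Rightarrow> complex) set" where
  "ideal_at Z a = {h. holo_at h a \<and> (\<forall>\<^sub>F z in nhds a. z \<in> Z \<longrightarrow> h z = 0)}"


section \<open>Free resolutions and the associated sets \<open>Z\<^sub>k\<close>\<close>

definition section_at :: "nat \<Rightarrow> complex^'n \<Rightarrow> (complex^'n \<Rightarrow> complex Matrix.vec) \<Rightarrow> bool" where
  "section_at m a \<phi> \<longleftrightarrow>
     (\<forall>\<^sub>F z in nhds a. \<phi> z \<in> carrier_vec m) \<and> (\<forall>i<m. holo_at (\<lambda>z. \<phi> z $ i) a)"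

text \<open>
  Kernel and image, on the stalks at \<open>a\<close>, of the sheaf map \<open>\<O>\<^sup>s \<rightarrow> \<O>\<^sup>m\<close> given by a matrix-valued
  function \<open>M\<close>.
\<close>

definition stalk_ker ::
  "nat \<Rightarrow> nat \<Rightarrow> (complex^'n \<Rightarrow> complex mat) \<Rightarrow> complex^'n \<Rightarrow> (complex^'n \<Rightarrow> complex Matrix.vec) set" where
  "stalk_ker m s M a = {\<phi>. section_at s a \<phi> \<and> (\<forall>\<^sub>F z in nhds a. M z *\<^sub>v \<phi> z = 0\<^sub>v m)}"

definition stalk_im ::
  "nat \<Rightarrow> nat \<Rightarrow> (complex^'n \<Rightarrow> complex mat) \<Rightarrow> complex^'n \<Rightarrow> (complex^'n \<Rightarrow> complex Matrix.vec) set" where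
  "stalk_im m s M a =
     {\<phi>. section_at m a \<phi> \<and> (\<exists>\<psi>. section_at s a \<psi> \<and> (\<forall>\<^sub>F z in nhds a. \<phi> z = M z *\<^sub>v \<psi> z))}"

text \<open>
  A free resolution \<open>0 \<rightarrow> \<O>(E\<^sub>N) \<rightarrow> \<dots> \<rightarrow> \<O>(E\<^sub>1) \<rightarrow> \<O>(E\<^sub>0)\<close> of \<open>\<O>/\<I>\<^sub>Z\<close> over \<open>\<Omega>\<close>, where \<open>r k\<close> is the rank
  of \<open>E\<^sub>k\<close> and \<open>f k : E\<^sub>k \<rightarrow> E\<^bsub>k-1\<^esub>\<close>. Setting \<open>E\<^sub>k = 0\<close> for \<open>k > N\<close> makes injectivity of \<open>f N\<close> the case
  \<open>k = N\<close> of exactness.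
\<close>

definition free_resolution ::
  "(complex^'n) set \<Rightarrow> (complex^'n) set \<Rightarrow> nat \<Rightarrow> (nat \<Rightarrow> nat) \<Rightarrow>
   (nat \<Rightarrow> complex^'n \<Rightarrow> complex mat) \<Rightarrow> bool" where
  "free_resolution \<Omega> Z N r f \<longleftrightarrow>
     r 0 = 1 \<and> (\<forall>k>N. r k = 0) \<and>
     (\<forall>k\<ge>1. (\<forall>z\<in>\<Omega>. f k z \<in> carrier_mat (r (k - 1)) (r k)) \<and>
            (\<forall>i<r (k - 1). \<forall>j<r k. holo_on (\<lambda>z. f k z $$ (i, j)) \<Omega>)) \<and>
     (\<forall>a\<in>\<Omega>.
        stalk_im 1 (r 1) (f 1) a = {\<phi>. section_at 1 a \<phi> \<and> (\<lambda>z. \<phi> z $ 0) \<in> ideal_at Z a} \<and>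
        (\<forall>k\<ge>1. stalk_ker (r (k - 1)) (r k) (f k) a = stalk_im (r k) (r (k + 1)) (f (k + 1)) a))"

text \<open>
  The set where \<open>f k\<close> does not attain its maximal rank; it is empty for \<open>k > N\<close>, where \<open>f k\<close> has
  no columns.
\<close>

definition nonoptimal_rank_set ::
  "(complex^'n) set \<Rightarrow> (nat \<Rightarrow> nat) \<Rightarrow> (nat \<Rightarrow> complex^'n \<Rightarrow> complex mat) \<Rightarrow> nat \<Rightarrow> (complex^'n) set" where
  "nonoptimal_rank_set \<Omega> r f k =
     {z\<in>\<Omega>. vec_space.rank (r (k - 1)) (f k z) < Max ((\<lambda>w. vec_space.rank (r (k - 1)) (f k w)) ` \<Omega>)}"


section \<open>Weakly holomorphic functions and normal points\<close>

text \<open>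
  Functions on \<open>Z\<^sub>r\<^sub>e\<^sub>g\<close> are total functions whose values off \<open>Z\<^sub>r\<^sub>e\<^sub>g\<close> are ignored. Near \<open>a\<close> such a function
  is (strongly) holomorphic if it is the restriction of an ambient holomorphic function, i.e. a
  section of \<open>\<O>/\<I>\<^sub>Z\<close>. At a regular point this is holomorphy on the manifold \<open>Z\<^sub>r\<^sub>e\<^sub>g\<close>.
\<close>

definition strongly_holomorphic_at ::
  "(complex^'n) set \<Rightarrow> (complex^'n \<Rightarrow> complex) \<Rightarrow> complex^'n \<Rightarrow> bool" where
  "strongly_holomorphic_at Z \<phi> a \<longleftrightarrow>
     (\<exists>h. holo_at h a \<and> (\<forall>\<^sub>F z in nhds a. z \<in> reg_part Z \<longrightarrow> \<phi> z = h z))"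

definition weakly_holomorphic_on ::
  "(complex^'n) set \<Rightarrow> (complex^'n) set \<Rightarrow> (complex^'n \<Rightarrow> complex) \<Rightarrow> bool" where
  "weakly_holomorphic_on Z U \<phi> \<longleftrightarrow>
     (\<forall>a\<in>reg_part Z \<inter> U. strongly_holomorphic_at Z \<phi> a) \<and>
     (\<forall>a\<in>sing_part Z \<inter> U. \<exists>C. \<forall>\<^sub>F z in nhds a. z \<in> reg_part Z \<longrightarrow> norm (\<phi> z) \<le> C)"

definition normal_point :: "(complex^'n) set \<Rightarrow> complex^'n \<Rightarrow> bool" where
  "normal_point Z x \<longleftrightarrow>
     (\<forall>U \<phi>. open U \<and> x \<in> U \<and> weakly_holomorphic_on Z U \<phi> \<longrightarrow> strongly_holomorphic_at Z \<phi> x)"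

end

theory Submission
  imports Defs "HOL-Complex_Analysis.Complex_Analysis"
begin

text \<open>
  Let \<open>B\<close> be the set of points near \<open>x\<close> at which a given weakly holomorphic function \<open>\<phi>\<close> is not strongly
  holomorphic; it lies in \<open>Z\<^sub>s\<^sub>i\<^sub>n\<^sub>g\<close>. If it is not empty, let \<open>k \<ge> p\<close> be the largest number such that \<open>k = p\<close>
  or \<open>B \<subseteq> Z\<^sub>k\<close> on some open set meeting \<open>B\<close>, and shrink this open set so that \<open>f\<^bsub>k+1\<^esub>\<close> has constant
  rank on it. At a point of \<open>B\<close> where the differentials of germs vanishing on \<open>B\<close> have maximal rank
  \<open>c\<close>, those germs cut out a manifold \<open>M\<close> of codimension \<open>c\<close>, and every germ that vanishes on \<open>B\<close>
  vanishes on \<open>M\<close>. Hence \<open>M\<close> is contained in the analytic set \<open>Z\<^sub>s\<^sub>i\<^sub>n\<^sub>g\<close> (respectively \<open>Z\<^sub>k\<close>), and the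
  hypothesis on its codimension gives \<open>c \<ge> k + 2\<close>. Off \<open>M\<close> the function \<open>\<phi>\<close> defines a section of
  \<open>\<O>/\<I>\<^sub>Z\<close>. As \<open>f\<^bsub>k+1\<^esub>\<close> has a holomorphic generalized inverse, the resolution may be cut off at \<open>E\<^sub>k\<close>, and since
  the Laurent cohomology of the complement of a manifold of codimension \<open>c\<close> vanishes in degrees
  \<open>1, \<dots>, c - 2\<close>, Cartan's theorem on boxes and a diagram chase extend the section across \<open>M\<close>.
\<close>

text \<open>The set \<open>B\<close> is not known to be analytic, so no codimension can be attached
  to it directly; the manifold \<open>M\<close> stands in for its Zariski closure near a generic
  point of \<open>B\<close>. One inequality from dimension theory then suffices: an analytic set
  that contains a manifold germ of codimension c has, arbitrarily close, regular points of
  codimension at most c. The bound c \<ge> k + 2 is exactly what the diagram chase consumes. Local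
  representatives of the section form a cochain of degree 0 modulo the image of f_1, and each lift
  to the next bundle raises the Cech degree by one, so k lifts end in degree k, which has to be at
  most c - 2. The chase can stop at E_k because, by the maximality of k, some point of
  \<open>B\<close> lies outside Z_{k+1}. All sections live on compact boxes, possibly with discs
  removed: a section over a compact set is a function that represents the right germ at each point
  of the set, and gluing is done across flat cuts of such boxes.\<close>

no_notation vec_index (infixl "$" 100)
no_notation fps_nth (infixl "$" 75)

lemmas cvec_eq_iff = Finite_Cartesian_Product.vec_eq_iff

section \<open>Changing one coordinate of a point\<close>

definition upd :: "complex^'n \<Rightarrow> 'n \<Rightarrow> complex \<Rightarrow> complex^'n" where
  "upd z j t = (\<chi> i. if i = j then t else z $ i)"

lemma upd_nth [simp]: "upd z j t $ i = (if i = j then t else z $ i)"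
  by (simp add: upd_def)

lemma upd_same [simp]: "upd z j (z $ j) = z"
  by (simp add: cvec_eq_iff)

lemma upd_upd [simp]: "upd (upd z j s) j t = upd z j t"
  by (simp add: cvec_eq_iff)

lemma norm_scalar_mult_vec: "norm (c *s v) = norm c * norm v" for v :: "complex^'n"
proof -
  have "L2_set (\<lambda>i. norm c * norm (v $ i)) UNIV = norm c * L2_set (\<lambda>i. norm (v $ i)) UNIV"
    by (simp add: L2_set_right_distrib)
  then show ?thesis by (simp add: norm_vec_def norm_mult)
qed

lemma norm_upd_diff: "norm (upd (z::complex^'n) j t - z) = norm (t - z $ j)"
proof -
  have "upd z j t - z = (t - z $ j) *s axis j 1" by (simp add: cvec_eq_iff axis_def)
  moreover have "norm (axis j 1 :: complex^'n) = 1"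
    by (simp add: norm_vec_def L2_set_def axis_def if_distrib[of norm] if_distrib[of "\<lambda>x. x\<^sup>2"] cong: if_cong)
  ultimately show ?thesis by (simp only: norm_scalar_mult_vec mult_1_right)
qed

lemma dist_upd: "dist (upd z j t) z = dist t (z $ j)"
  by (simp add: dist_norm norm_upd_diff)

lemma upd_diff: "upd z j t - upd w j t = upd (z - w) j 0"
  by (simp add: cvec_eq_iff)

lemma norm_upd_0_le: "norm (upd z j 0) \<le> norm z"
  unfolding norm_vec_def by (rule L2_set_mono) auto

lemma dist_upd_upd_le: "dist (upd z j t) (upd w j t) \<le> dist z w"
  by (simp add: dist_norm upd_diff norm_upd_0_le)

lemma bounded_linear_scalar_mult_vec: "bounded_linear (\<lambda>v::complex^'n. c *s v)"
  by (rule bounded_linear_intro[where K="norm c"])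
     (auto simp: norm_scalar_mult_vec cvec_eq_iff algebra_simps)

lemma bounded_linear_scalar_mult_vec_left: "bounded_linear (\<lambda>c. c *s (v::complex^'n))"
  by (rule bounded_linear_intro[where K="norm v"])
     (auto simp: norm_scalar_mult_vec cvec_eq_iff algebra_simps)

lemmas scalar_mult_vec_continuous [continuous_intros] =
  bounded_linear.continuous_on[OF bounded_linear_scalar_mult_vec]
  bounded_linear.continuous_on[OF bounded_linear_scalar_mult_vec_left]

lemma continuous_on_upd [continuous_intros]:
  assumes "continuous_on S f" "continuous_on S g"
  shows "continuous_on S (\<lambda>x. upd (f x) j (g x))"
  unfolding upd_def
proof (rule continuous_on_vec_lambda)
  fix i show "continuous_on S (\<lambda>x. if i = j then g x else f x $ i)"
    by (cases "i = j") (auto intro!: continuous_intros assms)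
qed

lemma has_derivative_vec_componentwise:
  fixes G :: "'a::real_normed_vector \<Rightarrow> complex^'m"
  assumes "\<And>i. ((\<lambda>x. G x $ i) has_derivative (\<lambda>v. D v $ i)) F"
  shows "(G has_derivative D) F"
  using assms
  unfolding has_derivative_componentwise_within has_derivative_def 
proof -
  have bl: "bounded_linear D"
  proof -
    have b: "\<And>i. bounded_linear (\<lambda>v. D v $ i)"
      using has_derivative_bounded_linear[OF assms] .
    show ?thesis
    proof (rule bounded_linear_intro[where K="\<Sum>i\<in>UNIV. onorm (\<lambda>v. D v $ i)"])
      show "D (x + y) = D x + D y" for x y
        using linear_add[OF bounded_linear.linear[OF b]] by (simp add: cvec_eq_iff)
      show "D (r *\<^sub>R x) = r *\<^sub>R D x" for r x
        using linear_scale[OF bounded_linear.linear[OF b]] by (simp add: cvec_eq_iff)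
      have "norm (D x) \<le> (\<Sum>i\<in>UNIV. norm (D x $ i))" for x
        by (simp add: norm_vec_def L2_set_le_sum)
      also have "\<dots>x \<le> (\<Sum>i\<in>UNIV. onorm (\<lambda>v. D v $ i) * norm x)" for x
        by (intro sum_mono onorm b)
      finally show "norm (D x) \<le> norm x * (\<Sum>i\<in>UNIV. onorm (\<lambda>v. D v $ i))" for x
        by (simp add: sum_distrib_right sum_distrib_left mult.commute)
    qed
  qed
  \<comment> \<open>For a general filter the definition of the derivative uses the limit of the
    identity along \<open>F\<close> as its base point.\<close>
  have "((\<lambda>y. (G y - G (Lim F (\<lambda>x. x)) - D (y - Lim F (\<lambda>x. x))) /\<^sub>R norm (y - Lim F (\<lambda>x. x))) \<longlongrightarrow> 0) F"
  proof (rule vec_tendstoI)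
    fix i
    show "((\<lambda>y. ((G y - G (Lim F (\<lambda>x. x)) - D (y - Lim F (\<lambda>x. x))) /\<^sub>R norm (y - Lim F (\<lambda>x. x))) $ i) \<longlongrightarrow> 0 $ i) F"
      using assms[of i] unfolding has_derivative_def by simp
  qed
  with bl show "bounded_linear D \<and> ((\<lambda>y. (G y - G (Lim F (\<lambda>x. x)) - D (y - Lim F (\<lambda>x. x))) /\<^sub>R norm (y - Lim F (\<lambda>x. x))) \<longlongrightarrow> 0) F"
    by blast
qed

subsection \<open>Complex derivatives\<close>

lemma has_complex_derivative_linear:
  assumes "has_complex_derivative f D z"
  shows "linear D" "D (v + w) = D v + D w" "D (c *s v) = c * D v" "D 0 = 0" "D (v - w) = D v - D w"
    "D (- v) = - D v"
proof -
  show l: "linear D" using assms has_derivative_linear[of f D "at z"] by (simp add: has_complex_derivative_def)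
  show "D (c *s v) = c * D v" using assms unfolding has_complex_derivative_def by blast
  show "D (v + w) = D v + D w" "D 0 = 0" "D (v - w) = D v - D w" "D (- v) = - D v"
    using l by (auto simp: linear_add linear_0 linear_diff linear_neg)
qed

lemma has_complex_derivative_expand:
  assumes "has_complex_derivative f D z"
  shows "D v = (\<Sum>i\<in>UNIV. v $ i * D (axis i 1))"
proof -
  have "D v = D (\<Sum>i\<in>UNIV. v $ i *s axis i 1)" by (simp add: basis_expansion)
  also have "\<dots> = (\<Sum>i\<in>UNIV. D (v $ i *s axis i 1))"
    using has_complex_derivative_linear(1)[OF assms] by (simp add: linear_sum)
  also have "\<dots> = (\<Sum>i\<in>UNIV. v $ i * D (axis i 1))"
    by (simp add: has_complex_derivative_linear(3)[OF assms])
  finally show ?thesis .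
qed

lemma has_complex_derivative_line:
  assumes "has_complex_derivative f D (z + t *s v)"
  shows "((\<lambda>s. f (z + s *s v)) has_field_derivative D v) (at t)"
proof -
  have "((\<lambda>s. z + s *s v) has_derivative (\<lambda>s. s *s v)) (at t)"
    by (auto intro!: derivative_eq_intros bounded_linear.has_derivative[OF bounded_linear_scalar_mult_vec_left])
  from has_derivative_compose[OF this, of f D] assms
  have "((\<lambda>s. f (z + s *s v)) has_derivative (\<lambda>s. D (s *s v))) (at t)"
    by (simp add: has_complex_derivative_def)
  moreover have "(\<lambda>s. D (s *s v)) = (*) (D v)"
    using has_complex_derivative_linear(3)[OF assms] by (auto simp: mult.commute)
  ultimately show ?thesis by (simp add: has_field_derivative_def)
qed

lemma has_complex_derivative_upd:
  assumes "has_complex_derivative f D (upd z j t)"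
  shows "((\<lambda>s. f (upd z j s)) has_field_derivative D (axis j 1)) (at t)"
proof -
  have e: "upd z j s = upd z j 0 + s *s axis j 1" for s
    by (simp add: cvec_eq_iff axis_def)
  from assms have "has_complex_derivative f D (upd z j 0 + t *s axis j 1)" by (subst (asm) e)
  from has_complex_derivative_line[OF this] show ?thesis by (subst e)
qed

lemma holo_onD: "holo_on f U \<Longrightarrow> z \<in> U \<Longrightarrow> \<exists>D. has_complex_derivative f D z"
  unfolding holo_on_def by blast

lemma holo_on_open: "holo_on f U \<Longrightarrow> open U"
  unfolding holo_on_def by blast

lemma holo_on_subset: "holo_on f U \<Longrightarrow> open V \<Longrightarrow> V \<subseteq> U \<Longrightarrow> holo_on f V"
  unfolding holo_on_def by blast

lemma has_complex_derivative_transform: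
  assumes "has_complex_derivative f D z" "\<forall>\<^sub>F y in nhds z. f y = g y"
  shows "has_complex_derivative g D z"
proof -
  obtain S where "open S" "z \<in> S" "\<And>y. y \<in> S \<Longrightarrow> f y = g y"
    using assms(2) unfolding eventually_nhds by blast
  then show ?thesis
    using assms(1) has_derivative_transform_within_open[of f D z UNIV S g] by (simp add: has_complex_derivative_def)
qed

lemma holo_on_cong:
  assumes "holo_on f U" "\<And>z. z \<in> U \<Longrightarrow> f z = g z"
  shows "holo_on g U"
  unfolding holo_on_def
proof (intro conjI ballI)
  show "open U" using assms holo_on_open by blast
  fix z assume z: "z \<in> U"
  then obtain D where "has_complex_derivative f D z" using assms holo_onD by blast
  moreover have "\<forall>\<^sub>F y in nhds z. f y = g y"
    using \<open>open U\<close> z assms(2) unfolding eventually_nhds by blast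
  ultimately show "\<exists>D. has_complex_derivative g D z" using has_complex_derivative_transform by blast
qed

lemma holo_on_continuous: "holo_on f U \<Longrightarrow> continuous_on U f"
  by (intro continuous_at_imp_continuous_on ballI)
     (auto simp: holo_on_def has_complex_derivative_def dest!: bspec intro: has_derivative_continuous)

lemma holo_on_Union: "(\<And>V. V \<in> \<V> \<Longrightarrow> holo_on f V) \<Longrightarrow> holo_on f (\<Union>\<V>)"
  unfolding holo_on_def by blast

lemma has_complex_derivative_const: "has_complex_derivative (\<lambda>_. c) (\<lambda>_. 0) z"
  unfolding has_complex_derivative_def by (auto intro: derivative_eq_intros)

lemma has_complex_derivative_nth: "has_complex_derivative (\<lambda>z. z $ i) (\<lambda>v. v $ i) z"
  unfolding has_complex_derivative_def
  by (auto intro: bounded_linear.has_derivative[OF bounded_linear_vec_nth] has_derivative_ident)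

lemma has_complex_derivative_add:
  assumes "has_complex_derivative f D z" "has_complex_derivative g E z"
  shows "has_complex_derivative (\<lambda>z. f z + g z) (\<lambda>v. D v + E v) z"
  using assms unfolding has_complex_derivative_def
  by (auto intro!: derivative_intros simp: algebra_simps)

lemma has_complex_derivative_mult:
  assumes "has_complex_derivative f D z" "has_complex_derivative g E z"
  shows "has_complex_derivative (\<lambda>z. f z * g z) (\<lambda>v. f z * E v + D v * g z) z"
  using assms unfolding has_complex_derivative_def
  by (auto intro!: has_derivative_mult simp: distrib_left mult.assoc mult.left_commute)

lemma has_complex_derivative_chain:
  fixes G :: "complex^'n \<Rightarrow> complex^'m"
  assumes "has_complex_derivative f D (G z)" "\<And>i. has_complex_derivative (\<lambda>z. G z $ i) (\<lambda>v. E v $ i) z"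
  shows "has_complex_derivative (\<lambda>z. f (G z)) (\<lambda>v. D (E v)) z"
proof -
  have "(G has_derivative E) (at z)"
    using assms(2) by (intro has_derivative_vec_componentwise) (auto simp: has_complex_derivative_def)
  then have "((\<lambda>z. f (G z)) has_derivative (\<lambda>v. D (E v))) (at z)"
    using assms(1) has_derivative_compose[of G E z UNIV f D] by (simp add: has_complex_derivative_def)
  moreover have "E (c *s v) = c *s E v" for c v
    using assms(2) by (simp add: has_complex_derivative_def cvec_eq_iff)
  ultimately show ?thesis
    using assms(1) by (auto simp: has_complex_derivative_def)
qed

lemma has_complex_derivative_outer:
  assumes "(h has_field_derivative d) (at (f z))" "has_complex_derivative f D z"
  shows "has_complex_derivative (\<lambda>z. h (f z)) (\<lambda>v. d * D v) z"
  using assms has_derivative_compose[of f D z UNIV h "(*) d"]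
  by (simp add: has_complex_derivative_def has_field_derivative_def)

named_theorems holo_intros

lemma holo_on_const [holo_intros]: "open U \<Longrightarrow> holo_on (\<lambda>_. c) U"
  unfolding holo_on_def using has_complex_derivative_const by blast

lemma holo_on_nth [holo_intros]: "open U \<Longrightarrow> holo_on (\<lambda>z. z $ i) U"
  unfolding holo_on_def using has_complex_derivative_nth by blast

lemma holo_on_add [holo_intros]: "holo_on f U \<Longrightarrow> holo_on g U \<Longrightarrow> holo_on (\<lambda>z. f z + g z) U"
  unfolding holo_on_def using has_complex_derivative_add by blast

lemma holo_on_mult [holo_intros]: "holo_on f U \<Longrightarrow> holo_on g U \<Longrightarrow> holo_on (\<lambda>z. f z * g z) U"
  unfolding holo_on_def using has_complex_derivative_mult by blast

lemma holo_on_minus [holo_intros]: "holo_on f U \<Longrightarrow> holo_on (\<lambda>z. - f z) U"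
  using holo_on_mult[OF holo_on_const[of U "-1"], of f] by (simp add: holo_on_open)

lemma holo_on_diff [holo_intros]: "holo_on f U \<Longrightarrow> holo_on g U \<Longrightarrow> holo_on (\<lambda>z. f z - g z) U"
  using holo_on_add[OF _ holo_on_minus, of f U g] by simp

lemma holo_on_sum [holo_intros]:
  "open U \<Longrightarrow> (\<And>i. i \<in> I \<Longrightarrow> holo_on (f i) U) \<Longrightarrow> holo_on (\<lambda>z. \<Sum>i\<in>I. f i z) U"
  by (induction I rule: infinite_finite_induct) (auto intro!: holo_intros)

lemma holo_on_prod [holo_intros]:
  "open U \<Longrightarrow> (\<And>i. i \<in> I \<Longrightarrow> holo_on (f i) U) \<Longrightarrow> holo_on (\<lambda>z. \<Prod>i\<in>I. f i z) U"
  by (induction I rule: infinite_finite_induct) (auto intro!: holo_intros)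

lemma holo_on_power [holo_intros]: "holo_on f U \<Longrightarrow> holo_on (\<lambda>z. f z ^ k) U"
  by (induction k) (auto intro!: holo_intros simp: holo_on_open)

lemma holo_on_outer:
  assumes "h holomorphic_on S" "open S" "holo_on f U" "f ` U \<subseteq> S"
  shows "holo_on (\<lambda>z. h (f z)) U"
  unfolding holo_on_def
proof (intro conjI ballI)
  show "open U" using assms holo_on_open by blast
  fix z assume z: "z \<in> U"
  then obtain D where "has_complex_derivative f D z" using assms holo_onD by blast
  moreover obtain d where "(h has_field_derivative d) (at (f z))"
    using assms z holomorphic_derivI by blast
  ultimately show "\<exists>D. has_complex_derivative (\<lambda>z. h (f z)) D z"
    using has_complex_derivative_outer by blast
qed

lemma holo_on_inverse [holo_intros]:
  assumes "holo_on f U" "\<And>z. z \<in> U \<Longrightarrow> f z \<noteq> 0"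
  shows "holo_on (\<lambda>z. inverse (f z)) U"
proof (rule holo_on_outer[where h=inverse and S="-{0}"])
  show "inverse holomorphic_on (-{0})" by (intro holomorphic_intros) auto
qed (use assms in auto)

lemma holo_on_divide [holo_intros]:
  assumes "holo_on f U" "holo_on g U" "\<And>z. z \<in> U \<Longrightarrow> g z \<noteq> 0"
  shows "holo_on (\<lambda>z. f z / g z) U"
  using holo_on_mult[OF assms(1) holo_on_inverse[OF assms(2,3)]] by (simp add: divide_inverse)

lemma holo_on_compose:
  fixes G :: "complex^'n \<Rightarrow> complex^'m"
  assumes "holo_on f V" "open U" "\<And>i. holo_on (\<lambda>z. G z $ i) U" "G ` U \<subseteq> V"
  shows "holo_on (\<lambda>z. f (G z)) U"
  unfolding holo_on_def
proof (intro conjI ballI)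
  show "open U" by fact
  fix z assume z: "z \<in> U"
  then obtain D where D: "has_complex_derivative f D (G z)" using assms holo_onD by blast
  have "\<exists>E. has_complex_derivative (\<lambda>z. G z $ i) E z" for i using assms z holo_onD by blast
  then obtain E where E: "\<And>i. has_complex_derivative (\<lambda>z. G z $ i) (E i) z" by metis
  show "\<exists>D. has_complex_derivative (\<lambda>z. f (G z)) D z"
    using has_complex_derivative_chain[of f D G z "\<lambda>v. \<chi> i. E i v"] D E by auto
qed

lemma holo_on_upd [holo_intros]: "open U \<Longrightarrow> holo_on (\<lambda>z. upd z j t $ i) U"
  by (cases "i = j") (auto intro!: holo_intros)

lemma vec_of_holo_continuous:
  assumes "\<And>i. holo_on (\<lambda>z. G z $ i) U"
  shows "continuous_on U G"
proof -
  have "continuous_on U (\<lambda>z. \<chi> i. G z $ i)"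
    using assms by (intro continuous_on_vec_lambda holo_on_continuous)
  then show ?thesis by simp
qed

section \<open>Partial derivatives and separate holomorphy\<close>

definition pd :: "'n \<Rightarrow> (complex^'n \<Rightarrow> complex) \<Rightarrow> complex^'n \<Rightarrow> complex" where
  "pd j f z = deriv (\<lambda>t. f (upd z j t)) (z $ j)"

abbreviation ucirc :: "real \<Rightarrow> complex" where
  "ucirc t \<equiv> exp (2 * of_real pi * \<i> * of_real t)"

text \<open>Osgood's form of holomorphy, equivalent to \<open>holo_on\<close> by
  \<open>holo_on_iff_sep\<close>. It is the form that can be checked for integrals depending on a
  parameter, since it asks only for continuity and one-variable derivatives.\<close>

definition sep_holo_on :: "(complex^'n \<Rightarrow> complex) \<Rightarrow> (complex^'n) set \<Rightarrow> bool" where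
  "sep_holo_on f U \<longleftrightarrow> open U \<and> continuous_on U f \<and>
     (\<forall>z\<in>U. \<forall>j. (\<lambda>t. f (upd z j t)) field_differentiable (at (z $ j)))"

lemma upd_in_cball: "dist t (z $ j) \<le> r \<Longrightarrow> cball z r \<subseteq> U \<Longrightarrow> upd z j t \<in> U"
  using dist_upd[of z j t] by (auto simp: dist_commute)

lemma upd_in_ball: "dist t (z $ j) < r \<Longrightarrow> ball z r \<subseteq> U \<Longrightarrow> upd z j t \<in> U"
  using dist_upd[of z j t] by (auto simp: dist_commute subset_iff)

lemma sep_holo_on_holomorphic:
  assumes "sep_holo_on f U" "\<And>t. t \<in> S \<Longrightarrow> upd z j t \<in> U"
  shows "(\<lambda>t. f (upd z j t)) holomorphic_on S"
  unfolding holomorphic_on_def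
proof
  fix t assume "t \<in> S"
  then have "upd z j t \<in> U" using assms by blast
  then have "(\<lambda>s. f (upd (upd z j t) j s)) field_differentiable (at (upd z j t $ j))"
    using assms(1) unfolding sep_holo_on_def by blast
  then show "(\<lambda>t. f (upd z j t)) field_differentiable at t within S"
    by (simp add: field_differentiable_at_within)
qed

text \<open>Cauchy's formula for the first derivative, with the circle parametrized over the unit
  interval, so that theorems on parameter integrals govern the dependence on
  \<open>z\<close>.\<close>

lemma pd_integral:
  assumes "sep_holo_on f U" "cball z r \<subseteq> U" "r > 0"
  shows "pd j f z = integral {0..1} (\<lambda>t. f (upd z j (z $ j + r * ucirc t)) / (r * ucirc t))"
proof -
  have hol: "(\<lambda>t. f (upd z j t)) holomorphic_on cball (z $ j) r"
    using assms by (intro sep_holo_on_holomorphic[OF assms(1)] upd_in_cball) (auto simp: dist_commute)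
  have "contour_integral (circlepath (z $ j) r) (\<lambda>u. f (upd z j u) / (u - z $ j)\<^sup>2) = 2 * pi * \<i> * pd j f z"
    unfolding pd_def using assms(3)
    by (intro Cauchy_contour_integral_circlepath_2 holomorphic_on_imp_continuous_on hol
        holomorphic_on_subset[OF hol]) auto
  then have "2 * pi * \<i> * pd j f z = integral {0..1} (\<lambda>t. f (upd z j (circlepath (z $ j) r t)) / (circlepath (z $ j) r t - z $ j)\<^sup>2 *
     vector_derivative (circlepath (z $ j) r) (at t))"
    by (simp add: contour_integral_integral)
  also have "\<dots> = integral {0..1} (\<lambda>t. 2 * pi * \<i> * (f (upd z j (z $ j + r * ucirc t)) / (r * ucirc t)))"
  proof (rule Henstock_Kurzweil_Integration.integral_cong)
    fix t :: real
    have "circlepath (z $ j) r t = z $ j + r * ucirc t"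
      by (simp add: circlepath mult.commute mult.left_commute)
    then show "f (upd z j (circlepath (z $ j) r t)) / (circlepath (z $ j) r t - z $ j)\<^sup>2 *
         vector_derivative (circlepath (z $ j) r) (at t) =
         2 * pi * \<i> * (f (upd z j (z $ j + r * ucirc t)) / (r * ucirc t))"
      using assms(3) by (simp add: vector_derivative_circlepath power2_eq_square field_simps)
  qed
  also have "\<dots> = 2 * pi * \<i> * integral {0..1} (\<lambda>t. f (upd z j (z $ j + r * ucirc t)) / (r * ucirc t))"
    by (rule integral_mult_right)
  finally show ?thesis by simp
qed

lemma pd_has_field_derivative:
  assumes "sep_holo_on f U" "upd z j t \<in> U"
  shows "((\<lambda>s. f (upd z j s)) has_field_derivative pd j f (upd z j t)) (at t)"
proof -
  have "(\<lambda>s. f (upd (upd z j t) j s)) field_differentiable (at (upd z j t $ j))"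
    using assms unfolding sep_holo_on_def by blast
  then show ?thesis by (simp add: pd_def field_differentiable_derivI)
qed

lemma ball_cball_half:
  fixes z y :: "'a::real_normed_vector"
  assumes "cball z (2 * r) \<subseteq> U" "y \<in> ball z r"
  shows "cball y r \<subseteq> U"
proof
  fix w assume "w \<in> cball y r"
  then have "dist z w \<le> 2 * r"
    using assms(2) dist_triangle[of z w y] by simp
  then show "w \<in> U" using assms(1) by auto
qed

lemma open_contains_cball_2:
  fixes z :: "'a::real_normed_vector"
  assumes "open U" "z \<in> U"
  obtains r where "r > 0" "cball z (2 * r) \<subseteq> U"
proof -
  obtain e where "e > 0" "cball z e \<subseteq> U" using assms open_contains_cball by blast
  then show ?thesis using that[of "e/2"] by simp
qed

text \<open>Locally \<open>pd\<close> is a Cauchy integral over a circle of fixed radius with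
  jointly continuous integrand. The parameter \<open>t\<close> is carried along because
  differentiation under the integral sign in \<open>holo_on_integral\<close> asks for joint
  continuity.\<close>

lemma continuous_on_pd_param:
  fixes G :: "complex^'n \<Rightarrow> 'a::metric_space \<Rightarrow> complex"
  assumes "continuous_on (U \<times> T) (\<lambda>(z, t). G z t)" "\<And>t. t \<in> T \<Longrightarrow> sep_holo_on (\<lambda>z. G z t) U" "open U"
  shows "continuous_on (U \<times> T) (\<lambda>(z, t). pd j (\<lambda>z. G z t) z)"
proof -
  have loc: "\<exists>V. open V \<and> z \<in> V \<and> V \<subseteq> U \<and> continuous_on (V \<times> T) (\<lambda>(z, t). pd j (\<lambda>z. G z t) z)" if "z \<in> U" for z
  proof -
    obtain r where r: "r > 0" "cball z (2 * r) \<subseteq> U" using open_contains_cball_2[OF assms(3) \<open>z \<in> U\<close>] .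
    have sub: "cball y r \<subseteq> U" if "y \<in> ball z r" for y using ball_cball_half[OF r(2) that] .
    have in_U: "upd y j (y $ j + r * ucirc \<tau>) \<in> U" if "y \<in> ball z r" for y \<tau>
      using r(1) by (intro upd_in_cball[OF _ sub[OF that]]) (simp add: dist_norm norm_mult)
    have "continuous_on ((ball z r \<times> T) \<times> cbox 0 1) (\<lambda>(p, \<tau>). case p of (y, t) \<Rightarrow> G (upd y j (y $ j + r * ucirc \<tau>)) t / (r * ucirc \<tau>))"
      unfolding split_beta
      by (intro continuous_intros continuous_on_compose2[OF assms(1)[unfolded split_beta], where f="\<lambda>q. (upd (fst (fst q)) j (fst (fst q) $ j + r * ucirc (snd q)), snd (fst q))", simplified])
         (use r(1) in_U in auto)
    then have "continuous_on (ball z r \<times> T) (\<lambda>p. integral (cbox 0 1) (\<lambda>\<tau>. case p of (y, t) \<Rightarrow> G (upd y j (y $ j + r * ucirc \<tau>)) t / (r * ucirc \<tau>)))"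
      by (rule integral_continuous_on_param)
    moreover have "pd j (\<lambda>z. G z t) y = integral (cbox 0 1) (\<lambda>\<tau>. G (upd y j (y $ j + r * ucirc \<tau>)) t / (r * ucirc \<tau>))"
      if "y \<in> ball z r" "t \<in> T" for y t
      using pd_integral[OF assms(2)[OF that(2)] sub[OF that(1)] r(1)] by simp
    ultimately have "continuous_on (ball z r \<times> T) (\<lambda>(z, t). pd j (\<lambda>z. G z t) z)"
      by (subst continuous_on_cong[OF refl, where g="\<lambda>p. integral (cbox 0 1) (\<lambda>\<tau>. case p of (y, t) \<Rightarrow> G (upd y j (y $ j + r * ucirc \<tau>)) t / (r * ucirc \<tau>))"]) auto
    moreover have "ball z r \<subseteq> U" using r by (force simp: subset_iff)
    ultimately show ?thesis using r(1) by (intro exI[of _ "ball z r"]) auto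
  qed
  show ?thesis
    unfolding continuous_on_eq_continuous_within
  proof
    fix q assume q: "q \<in> U \<times> T"
    then obtain V where V: "open V" "fst q \<in> V" "V \<subseteq> U" "continuous_on (V \<times> T) (\<lambda>(z, t). pd j (\<lambda>z. G z t) z)"
      using loc[of "fst q"] by auto
    have "continuous (at q within V \<times> T) (\<lambda>(z, t). pd j (\<lambda>z. G z t) z)"
      using V(2,4) q by (auto simp: continuous_on_eq_continuous_within)
    moreover have "at q within V \<times> T = at q within U \<times> T"
    proof (rule at_within_nhd[of _ "V \<times> UNIV"])
      show "q \<in> V \<times> UNIV" using V(2) by (metis UNIV_I mem_Sigma_iff prod.collapse)
    qed (use V in \<open>auto simp: open_Times\<close>)
    ultimately show "continuous (at q within U \<times> T) (\<lambda>(z, t). pd j (\<lambda>z. G z t) z)" by simp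
  qed
qed

lemma continuous_on_pd:
  assumes "sep_holo_on f U"
  shows "continuous_on U (pd j f)"
proof -
  have "continuous_on (U \<times> {0::real}) (\<lambda>(z, t). pd j (\<lambda>z. f z) z)"
    using assms unfolding sep_holo_on_def
    by (intro continuous_on_pd_param assms)
       (auto simp: split_beta intro!: continuous_on_compose2[of U f _ fst] continuous_intros)
  then have "continuous_on U (\<lambda>z. (\<lambda>(z, t). pd j (\<lambda>z. f z) z) (z, 0 :: real))"
    by (rule continuous_on_compose2[where f="\<lambda>z. (z, 0)"]) (auto intro!: continuous_intros)
  then show ?thesis by simp
qed

text \<open>The coordinates of the increment are switched on one at a time. Each switch is
  controlled by the mean value inequality for \<open>f\<close> minus its linear part in that
  variable, whose derivative is small because the partial derivatives are continuous.\<close>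

lemma sep_holo_on_frechet:
  fixes z :: "complex^'n"
  assumes "sep_holo_on f U" "z \<in> U"
  shows "has_complex_derivative f (\<lambda>v. \<Sum>j\<in>UNIV. v $ j * pd j f z) z"
proof -
  \<comment> \<open>\<open>?r h S\<close> keeps only the coordinates of \<open>h\<close> that lie in
    \<open>S\<close>; the expansion is proved by induction on \<open>S\<close>.\<close>
  let ?r = "\<lambda>h S. \<chi> i. if i \<in> S then h $ i else 0"
  have openU: "open U" using assms(1) by (simp add: sep_holo_on_def)
  have nr: "norm (?r h S :: complex^'n) \<le> norm h" for h :: "complex^'n" and S
    unfolding norm_vec_def by (rule L2_set_mono) auto
  have main: "\<forall>e>0. \<exists>d>0. \<forall>h. norm h < d \<longrightarrow>
      norm (f (z + ?r h S) - f z - (\<Sum>j\<in>S. h $ j * pd j f z)) \<le> e * norm h" for S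
  proof (induction S rule: infinite_finite_induct)
    case empty
    have "(\<chi> i. 0) = (0 :: complex^'n)" by (simp add: cvec_eq_iff)
    then show ?case by (auto intro!: exI[of _ 1])
  next
    case (insert j S)
    show ?case
    proof (intro allI impI)
      fix e :: real assume e: "e > 0"
      obtain d1 where d1: "d1 > 0" "\<And>h. norm h < d1 \<Longrightarrow>
          norm (f (z + ?r h S) - f z - (\<Sum>j\<in>S. h $ j * pd j f z)) \<le> e/2 * norm h"
        using insert.IH e by (meson half_gt_zero)
      have "isCont (pd j f) z"
        using continuous_on_pd[OF assms(1)] assms(2) openU continuous_on_eq_continuous_at by blast
      then obtain d2 where d2: "d2 > 0" "\<And>y. dist y z < d2 \<Longrightarrow> dist (pd j f y) (pd j f z) < e/2"
        using e by (metis continuous_at_eps_delta half_gt_zero)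
      obtain d3 where d3: "d3 > 0" "ball z d3 \<subseteq> U" using openU assms(2) open_contains_ball by blast
      \<comment> \<open>The factor 2: the way from \<open>z\<close> to \<open>upd y j t\<close>
        consists of two pieces, each of length at most \<open>norm h\<close>.\<close>
      define d where "d = min d1 (min d2 d3 / 2)"
      have "d > 0" using d1 d2 d3 by (simp add: d_def)
      moreover have "norm (f (z + ?r h (insert j S)) - f z - (\<Sum>j\<in>insert j S. h $ j * pd j f z)) \<le> e * norm h"
        if h: "norm h < d" for h
      proof -
        define y where "y = z + ?r h S"
        have yj: "y $ j = z $ j" using insert.hyps by (simp add: y_def)
        have y': "z + ?r h (insert j S) = upd y j (z $ j + h $ j)"
          using insert.hyps by (auto simp: cvec_eq_iff y_def)
        have near: "dist (upd y j t) z < min d2 d3" if t: "t \<in> closed_segment (z $ j) (z $ j + h $ j)" for t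
        proof -
          have "norm (t - z $ j) \<le> norm (h $ j)"
            using segment_bound[OF t] by (simp add: norm_minus_commute)
          moreover have "dist (upd y j t) z \<le> dist (upd y j t) y + dist y z" by (rule dist_triangle)
          moreover have "dist (upd y j t) y = norm (t - z $ j)" using dist_upd[of y j t] yj by (simp add: dist_norm)
          moreover have "dist y z \<le> norm h" using nr[of S h] by (simp add: y_def dist_norm)
          moreover have "norm (h $ j) \<le> norm h" by (rule Finite_Cartesian_Product.norm_nth_le)
          ultimately show ?thesis using h by (simp add: d_def)
        qed
        have "norm ((f (upd y j (z $ j + h $ j)) - (z $ j + h $ j) * pd j f z) - (f (upd y j (z $ j)) - z $ j * pd j f z))
           \<le> e/2 * norm ((z $ j + h $ j) - z $ j)"
        proof (rule field_differentiable_bound[where f'="\<lambda>t. pd j f (upd y j t) - pd j f z"])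
          fix t assume t: "t \<in> closed_segment (z $ j) (z $ j + h $ j)"
          have "upd y j t \<in> U" using near[OF t] d3 by (auto simp: subset_iff dist_commute)
          from pd_has_field_derivative[OF assms(1) this]
          show "((\<lambda>t. f (upd y j t) - t * pd j f z) has_field_derivative pd j f (upd y j t) - pd j f z)
             (at t within closed_segment (z $ j) (z $ j + h $ j))"
            by (auto intro!: derivative_eq_intros dest: has_field_derivative_at_within)
          show "norm (pd j f (upd y j t) - pd j f z) \<le> e/2"
            using d2(2)[of "upd y j t"] near[OF t] by (simp add: dist_norm)
        qed auto
        moreover have "upd y j (z $ j) = y" using upd_same[of y j] yj by simp
        ultimately have "norm (f (upd y j (z $ j + h $ j)) - f y - h $ j * pd j f z) \<le> e/2 * norm (h $ j)"
          by (simp add: algebra_simps)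
        also have "\<dots> \<le> e/2 * norm h" using e by (intro mult_left_mono Finite_Cartesian_Product.norm_nth_le) auto
        finally have 1: "norm (f (upd y j (z $ j + h $ j)) - f y - h $ j * pd j f z) \<le> e/2 * norm h" .
        have 2: "norm (f y - f z - (\<Sum>j\<in>S. h $ j * pd j f z)) \<le> e/2 * norm h"
          using d1(2)[of h] h by (simp add: d_def y_def)
        have "f (z + ?r h (insert j S)) - f z - (\<Sum>j\<in>insert j S. h $ j * pd j f z) =
           (f (upd y j (z $ j + h $ j)) - f y - h $ j * pd j f z) + (f y - f z - (\<Sum>j\<in>S. h $ j * pd j f z))"
          unfolding y' using insert.hyps by simp
        moreover have "e/2 * norm h + e/2 * norm h = e * norm h" by simp
        ultimately show ?thesis using norm_triangle_le[OF add_mono[OF 1 2]] by metis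
      qed
      ultimately show "\<exists>d>0. \<forall>h. norm h < d \<longrightarrow>
        norm (f (z + ?r h (insert j S)) - f z - (\<Sum>j\<in>insert j S. h $ j * pd j f z)) \<le> e * norm h" by blast
    qed
  qed auto
  have "(f has_derivative (\<lambda>v. \<Sum>j\<in>UNIV. v $ j * pd j f z)) (at z)"
    unfolding has_derivative_at_alt
  proof (intro conjI)
    show "bounded_linear (\<lambda>v. \<Sum>j\<in>UNIV. v $ j * pd j f z)"
      by (intro bounded_linear_sum bounded_linear_mult_left[THEN bounded_linear_compose] bounded_linear_vec_nth)
    show "\<forall>e>0. \<exists>d>0. \<forall>y. norm (y - z) < d \<longrightarrow>
      norm (f y - f z - (\<Sum>j\<in>UNIV. (y - z) $ j * pd j f z)) \<le> e * norm (y - z)"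
    proof (intro allI impI)
      fix e :: real assume "e > 0"
      with main[of UNIV] obtain d where d: "d > 0" "\<And>h. norm h < d \<Longrightarrow>
        norm (f (z + ?r h UNIV) - f z - (\<Sum>j\<in>UNIV. h $ j * pd j f z)) \<le> e * norm h" by blast
      then show "\<exists>d>0. \<forall>y. norm (y - z) < d \<longrightarrow>
        norm (f y - f z - (\<Sum>j\<in>UNIV. (y - z) $ j * pd j f z)) \<le> e * norm (y - z)"
      proof (intro exI[of _ d] conjI allI impI)
        fix y :: "complex^'n" assume "norm (y - z) < d"
        with d(2)[of "y - z"] have "norm (f (z + ?r (y - z) UNIV) - f z - (\<Sum>j\<in>UNIV. (y - z) $ j * pd j f z)) \<le> e * norm (y - z)"
          by blast
        moreover have "z + ?r (y - z) UNIV = y" by (simp add: cvec_eq_iff)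
        ultimately show "norm (f y - f z - (\<Sum>j\<in>UNIV. (y - z) $ j * pd j f z)) \<le> e * norm (y - z)"
          by simp
      qed (use d in auto)
    qed
  qed
  then show ?thesis
    unfolding has_complex_derivative_def by (auto simp: sum_distrib_left mult.assoc)
qed

lemma holo_on_iff_sep: "holo_on f U \<longleftrightarrow> sep_holo_on f U"
proof
  assume f: "holo_on f U"
  show "sep_holo_on f U"
    unfolding sep_holo_on_def
  proof (intro conjI ballI allI)
    fix z j assume "z \<in> U"
    then obtain D where "has_complex_derivative f D z" using f holo_onD by blast
    then have "((\<lambda>s. f (upd z j s)) has_field_derivative D (axis j 1)) (at (z $ j))"
      by (intro has_complex_derivative_upd) simp
    then show "(\<lambda>t. f (upd z j t)) field_differentiable at (z $ j)"
      unfolding field_differentiable_def by blast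
  qed (use f holo_on_open holo_on_continuous in auto)
next
  assume "sep_holo_on f U"
  then show "holo_on f U"
    using sep_holo_on_frechet unfolding holo_on_def sep_holo_on_def by blast
qed

lemma has_complex_derivative_pd:
  assumes "holo_on f U" "z \<in> U"
  shows "has_complex_derivative f (\<lambda>v. \<Sum>j\<in>UNIV. v $ j * pd j f z) z"
  using sep_holo_on_frechet assms holo_on_iff_sep by blast

lemma has_complex_derivative_axis:
  assumes "has_complex_derivative f D z"
  shows "D (axis j 1) = pd j f z"
  using has_complex_derivative_upd[of f D z j "z $ j"] assms
  by (simp add: pd_def DERIV_imp_deriv)

lemma holo_on_holomorphic_upd:
  assumes "holo_on f U" "\<And>t. t \<in> S \<Longrightarrow> upd z j t \<in> U"
  shows "(\<lambda>t. f (upd z j t)) holomorphic_on S"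
  using assms sep_holo_on_holomorphic holo_on_iff_sep by blast

lemma holo_on_has_field_derivative:
  assumes "holo_on f U" "upd z j t \<in> U"
  shows "((\<lambda>s. f (upd z j s)) has_field_derivative pd j f (upd z j t)) (at t)"
  using pd_has_field_derivative assms holo_on_iff_sep by blast

lemma holo_on_integral:
  fixes G :: "complex^'n \<Rightarrow> real \<Rightarrow> complex"
  assumes "open U" "continuous_on (U \<times> {0..1}) (\<lambda>(z, t). G z t)" "\<And>t. t \<in> {0..1} \<Longrightarrow> holo_on (\<lambda>z. G z t) U"
  shows "holo_on (\<lambda>z. integral {0..1} (G z)) U"
  unfolding holo_on_iff_sep sep_holo_on_def
proof (intro conjI ballI allI)
  show "open U" by fact
  show "continuous_on U (\<lambda>z. integral {0..1} (G z))"
    using integral_continuous_on_param[of U 0 1 G] assms(2) by simp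
  fix z j assume "z \<in> U"
  then obtain r where r: "r > 0" "ball z r \<subseteq> U" using assms(1) open_contains_ball by blast
  let ?B = "ball (z $ j) r"
  have inU: "upd z j s \<in> U" if "s \<in> ?B" for s
    using upd_in_ball[of s z j r U] that r by (simp add: dist_commute)
  have c: "continuous_on (U \<times> {0..1}) (\<lambda>(z, t). pd j (\<lambda>z. G z t) z)"
    using assms by (intro continuous_on_pd_param) (auto simp: holo_on_iff_sep)
  have "((\<lambda>s. integral (cbox 0 1) (G (upd z j s))) has_field_derivative
      integral (cbox 0 1) (\<lambda>t. pd j (\<lambda>z. G z t) (upd z j (z $ j)))) (at (z $ j) within ?B)"
  proof (rule leibniz_rule_field_derivative)
    fix s t assume st: "s \<in> ?B" "(t::real) \<in> cbox 0 1"
    show "((\<lambda>x. G (upd z j x) t) has_field_derivative pd j (\<lambda>z. G z t) (upd z j s)) (at s within ?B)"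
      using st(2) by (intro has_field_derivative_at_within[OF
            holo_on_has_field_derivative[of "\<lambda>z. G z t", OF assms(3) inU[OF st(1)]]]) simp
  next
    fix s assume "s \<in> ?B"
    have "continuous_on {0..1} (\<lambda>t. (\<lambda>(z, t). G z t) (upd z j s, t))"
      using inU[OF \<open>s \<in> ?B\<close>] by (intro continuous_on_compose2[OF assms(2)] continuous_intros) auto
    then show "G (upd z j s) integrable_on cbox 0 1" using integrable_continuous_real by simp
  next
    have "continuous_on (?B \<times> cbox 0 1) (\<lambda>p. (\<lambda>(z, t). pd j (\<lambda>z. G z t) z) (upd z j (fst p), snd p))"
      by (intro continuous_on_compose2[OF c] continuous_intros) (use inU in auto)
    then show "continuous_on (?B \<times> cbox 0 1) (\<lambda>(x, t). pd j (\<lambda>z. G z t) (upd z j x))"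
      by (simp add: split_beta)
  qed (use r in auto)
  then show "(\<lambda>t. integral {0..1} (G (upd z j t))) field_differentiable at (z $ j)"
    using r(1) unfolding field_differentiable_def by (auto simp: at_within_open[of _ ?B])
qed

text \<open>The integrand of the Cauchy integral for \<open>pd\<close> is holomorphic in the centre
  of the circle, so \<open>holo_on_integral\<close> applies.\<close>

lemma holo_on_pd [holo_intros]:
  assumes "holo_on f U"
  shows "holo_on (pd j f) U"
proof -
  have "\<exists>V. z \<in> V \<and> holo_on (pd j f) V" if "z \<in> U" for z
  proof -
    obtain r where r: "r > 0" "cball z (2 * r) \<subseteq> U" using open_contains_cball_2[OF holo_on_open[OF assms] \<open>z \<in> U\<close>] .
    have sub: "cball y r \<subseteq> U" if "y \<in> ball z r" for y using ball_cball_half[OF r(2) that] .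
    have in_U: "upd y j (y $ j + r * ucirc \<tau>) \<in> U" if "y \<in> ball z r" for y \<tau>
      using r(1) by (intro upd_in_cball[OF _ sub[OF that]]) (simp add: dist_norm norm_mult)
    have "holo_on (\<lambda>y. integral {0..1} (\<lambda>t. f (upd y j (y $ j + r * ucirc t)) / (r * ucirc t))) (ball z r)"
    proof (rule holo_on_integral)
      show "continuous_on (ball z r \<times> {0..1}) (\<lambda>(y, t). f (upd y j (y $ j + r * ucirc t)) / (r * ucirc t))"
        unfolding split_beta
        by (intro continuous_intros continuous_on_compose2[OF holo_on_continuous[OF assms], where f="\<lambda>q. upd (fst q) j (fst q $ j + r * ucirc (snd q))"])
           (use r(1) in_U in auto)
      fix t :: real
      have "holo_on (\<lambda>z. upd z j (z $ j + r * ucirc t) $ i) (ball z r)" for i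
        by (cases "i = j") (auto intro!: holo_intros)
      then show "holo_on (\<lambda>y. f (upd y j (y $ j + r * ucirc t)) / (r * ucirc t)) (ball z r)"
        by (intro holo_on_divide holo_on_compose[OF assms] holo_on_const) (use r(1) in_U in auto)
    qed auto
    then have "holo_on (pd j f) (ball z r)"
      by (rule holo_on_cong) (use pd_integral[OF _ sub r(1)] assms in \<open>auto simp: holo_on_iff_sep\<close>)
    then show ?thesis using r(1) by (intro exI[of _ "ball z r"]) auto
  qed
  then show ?thesis
    using holo_on_open[OF assms] unfolding holo_on_def by blast
qed

text \<open>The identity theorem on the complex line through \<open>a\<close> and \<open>b\<close>;
  convexity of \<open>U\<close> makes its intersection with the line connected.\<close>

lemma holo_on_eq_0_line:
  assumes f: "holo_on f U" and cvx: "convex U" and ab: "a \<in> U" "b \<in> U"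
    and lim: "\<forall>\<^sub>F t in nhds 0. f (a + t *s (b - a)) = 0"
  shows "f b = 0"
proof -
  define S where "S = {t. a + t *s (b - a) \<in> U}"
  have openS: "open S"
    unfolding S_def using holo_on_open[OF f] 
    by (intro open_vimage[unfolded vimage_def] continuous_intros)
  have "a + (u * s + v * t) *s (b - a) \<in> U" if "a + s *s (b - a) \<in> U" "a + t *s (b - a) \<in> U" "0 \<le> u" "0 \<le> v" "u + v = 1" for u v :: real and s t :: complex
  proof -
    have "u *\<^sub>R (a + s *s (b - a)) + v *\<^sub>R (a + t *s (b - a)) = (u + v) *\<^sub>R a + (u * s + v * t) *s (b - a)"
      by (simp add: cvec_eq_iff algebra_simps scaleR_conv_of_real[where 'a=complex])
    then show ?thesis using cvx that unfolding convex_def by fastforce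
  qed
  then have cvxS: "convex S"
    unfolding convex_def S_def by (auto simp: scaleR_conv_of_real)
  have hol: "(\<lambda>t. f (a + t *s (b - a))) holomorphic_on S"
    unfolding holomorphic_on_def
  proof
    fix t assume "t \<in> S"
    then obtain D where "has_complex_derivative f D (a + t *s (b - a))"
      using f holo_onD unfolding S_def by blast
    then show "(\<lambda>t. f (a + t *s (b - a))) field_differentiable at t within S"
      using has_complex_derivative_line field_differentiable_def field_differentiable_at_within by blast
  qed
  obtain T where T: "open T" "0 \<in> T" "\<And>t. t \<in> T \<Longrightarrow> f (a + t *s (b - a)) = 0"
    using lim unfolding eventually_nhds by blast
  have "f (a + 1 *s (b - a)) = 0"
  proof (rule analytic_continuation[OF hol openS, where U="S \<inter> T" and \<xi>=0])
    show "connected S" using cvxS convex_connected by blast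
    have 0: "0 \<in> S" using ab by (simp add: S_def)
    then show "0 \<in> S" .
    show "0 islimpt S \<inter> T"
      using 0 T openS by (intro interior_limit_point) (simp add: interior_open open_Int)
    show "1 \<in> S" using ab by (simp add: S_def)
  qed (use T in auto)
  then show ?thesis by simp
qed

section \<open>Rules for partial derivatives\<close>

lemma pd_eqI: "has_complex_derivative f D z \<Longrightarrow> pd j f z = D (axis j 1)"
  by (simp add: has_complex_derivative_axis)

lemma pd_cong:
  assumes "holo_on f U" "z \<in> U" "\<And>y. y \<in> U \<Longrightarrow> f y = g y"
  shows "pd j f z = pd j g z"
proof -
  obtain D where D: "has_complex_derivative f D z" using assms holo_onD by blast
  moreover have "\<forall>\<^sub>F y in nhds z. f y = g y"
    using assms holo_on_open[OF assms(1)] unfolding eventually_nhds by blast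
  ultimately have "has_complex_derivative g D z" by (rule has_complex_derivative_transform)
  with D show ?thesis by (simp add: pd_eqI)
qed

lemma pd_nth: "pd j (\<lambda>z. z $ i) z = (if i = j then 1 else 0)"
  using pd_eqI[OF has_complex_derivative_nth[of i z], of j] by (simp add: axis_def)

lemma pd_add:
  assumes "holo_on f U" "holo_on g U" "z \<in> U"
  shows "pd j (\<lambda>z. f z + g z) z = pd j f z + pd j g z"
proof -
  obtain D E where "has_complex_derivative f D z" "has_complex_derivative g E z"
    using assms holo_onD by metis
  then show ?thesis using has_complex_derivative_add[of f D z g E] by (simp add: pd_eqI)
qed

lemma pd_mult:
  assumes "holo_on f U" "holo_on g U" "z \<in> U"
  shows "pd j (\<lambda>z. f z * g z) z = f z * pd j g z + pd j f z * g z"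
proof -
  obtain D E where "has_complex_derivative f D z" "has_complex_derivative g E z"
    using assms holo_onD by metis
  then show ?thesis using has_complex_derivative_mult[of f D z g E] by (simp add: pd_eqI)
qed

lemma pd_const [simp]: "pd j (\<lambda>_. c) z = 0"
  using pd_eqI[OF has_complex_derivative_const[of c z], of j] by simp

lemma pd_sum:
  assumes "finite I" "open U" "\<And>i. i \<in> I \<Longrightarrow> holo_on (f i) U" "z \<in> U"
  shows "pd j (\<lambda>z. \<Sum>i\<in>I. f i z) z = (\<Sum>i\<in>I. pd j (f i) z)"
  using assms(1,3)
proof (induction I rule: finite_induct)
  case (insert i I)
  have "pd j (\<lambda>z. \<Sum>i\<in>insert i I. f i z) z = pd j (\<lambda>z. f i z + (\<Sum>i\<in>I. f i z)) z"
    using insert by simp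
  also have "\<dots> = pd j (f i) z + pd j (\<lambda>z. \<Sum>i\<in>I. f i z) z"
    using insert assms by (intro pd_add[of _ U]) (auto intro!: holo_intros)
  finally show ?case using insert by simp
qed simp

lemma pd_chain:
  fixes H :: "complex^'n \<Rightarrow> complex^'m"
  assumes "holo_on f V" "\<And>i. holo_on (\<lambda>y. H y $ i) W" "y \<in> W" "H y \<in> V"
  shows "pd l (\<lambda>y. f (H y)) y = (\<Sum>m\<in>UNIV. pd m f (H y) * pd l (\<lambda>y. H y $ m) y)"
proof -
  have "has_complex_derivative (\<lambda>y. f (H y)) (\<lambda>v. \<Sum>m\<in>UNIV. (\<chi> i. \<Sum>j\<in>UNIV. v $ j * pd j (\<lambda>y. H y $ i) y) $ m * pd m f (H y)) y"
    by (rule has_complex_derivative_chain[of f _ H y, OF has_complex_derivative_pd[OF assms(1,4)]])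
       (use has_complex_derivative_pd[OF assms(2,3)] in simp)
  from pd_eqI[OF this, of l] show ?thesis
    by (simp add: axis_def if_distrib[of "\<lambda>x. x * _"] cong: if_cong) (simp add: mult.commute)
qed

subsection \<open>Biholomorphic maps\<close>

definition biholo :: "(complex^'n \<Rightarrow> complex^'n) \<Rightarrow> (complex^'n \<Rightarrow> complex^'n) \<Rightarrow> (complex^'n) set \<Rightarrow> (complex^'n) set \<Rightarrow> bool" where
  "biholo G H V W \<longleftrightarrow> open V \<and> open W \<and> (\<forall>z\<in>V. G z \<in> W \<and> H (G z) = z) \<and> (\<forall>y\<in>W. H y \<in> V \<and> G (H y) = y) \<and>
     (\<forall>i. holo_on (\<lambda>z. G z $ i) V) \<and> (\<forall>i. holo_on (\<lambda>y. H y $ i) W)"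

lemma biholoD:
  assumes "biholo G H V W"
  shows "open V" "open W" "\<And>z. z \<in> V \<Longrightarrow> G z \<in> W" "\<And>z. z \<in> V \<Longrightarrow> H (G z) = z"
    "\<And>y. y \<in> W \<Longrightarrow> H y \<in> V" "\<And>y. y \<in> W \<Longrightarrow> G (H y) = y"
    "\<And>i. holo_on (\<lambda>z. G z $ i) V" "\<And>i. holo_on (\<lambda>y. H y $ i) W"
    "continuous_on V G" "continuous_on W H"
  using assms vec_of_holo_continuous[of G V] vec_of_holo_continuous[of H W] unfolding biholo_def by auto

lemma biholo_sym: "biholo G H V W \<Longrightarrow> biholo H G W V"
  unfolding biholo_def by blast

lemma biholo_holo_compose:
  assumes "biholo G H V W" "holo_on f U"
  shows "holo_on (\<lambda>y. f (H y)) (W \<inter> H -` U)"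
proof (rule holo_on_compose[OF assms(2)])
  note b = biholoD[OF assms(1)]
  show o: "open (W \<inter> H -` U)" using b(10,2) holo_on_open[OF assms(2)] by (rule continuous_open_preimage)
  show "holo_on (\<lambda>z. H z $ i) (W \<inter> H -` U)" for i
    using holo_on_subset[OF b(8) o] by blast
qed auto

lemma biholo_restrict:
  assumes "biholo G H V W" "open V'" "V' \<subseteq> V"
  shows "biholo G H V' (W \<inter> H -` V')"
proof -
  note b = biholoD[OF assms(1)]
  have o: "open (W \<inter> H -` V')" using b(10,2) assms(2) by (rule continuous_open_preimage)
  show ?thesis
    unfolding biholo_def
    using b assms o holo_on_subset[OF b(7) assms(2,3)] holo_on_subset[OF b(8) o] by (auto simp: subset_iff)
qed

lemma bounded_linear_sum_mult_vec: "bounded_linear (\<lambda>v::complex^'n. \<chi> i. \<Sum>j\<in>UNIV. v $ j * (M i j :: complex))"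
proof -
  have "linear (\<lambda>v::complex^'n. \<chi> i. \<Sum>j\<in>UNIV. v $ j * M i j)"
    by (rule linearI) (auto simp: cvec_eq_iff algebra_simps sum.distrib scaleR_sum_right)
  then show ?thesis by (rule linear_conv_bounded_linear[THEN iffD1])
qed

text \<open>The real inverse function theorem gives \<open>H\<close>. It is holomorphic because its
  derivative is the inverse of a complex linear bijection and so is complex linear itself.\<close>

lemma holomorphic_inverse_function:
  fixes G :: "complex^'n \<Rightarrow> complex^'n"
  assumes hol: "\<And>i. holo_on (\<lambda>z. G z $ i) U" and z0: "z0 \<in> U"
    and inj: "\<And>v. (\<And>i. (\<Sum>j\<in>UNIV. v $ j * pd j (\<lambda>z. G z $ i) z0) = 0) \<Longrightarrow> v = 0"
  obtains V W H where "biholo G H V W" "z0 \<in> V" "V \<subseteq> U"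
proof -
  define D where "D z v = (\<chi> i. \<Sum>j\<in>UNIV. v $ j * pd j (\<lambda>z. G z $ i) z)" for z v
  have bl: "bounded_linear (D z)" for z
    unfolding D_def by (rule bounded_linear_sum_mult_vec)
  have D: "(G has_derivative D z) (at z)" if "z \<in> U" for z
    using has_complex_derivative_pd[OF hol that]
    by (intro has_derivative_vec_componentwise) (auto simp: D_def has_complex_derivative_def)
  have D_scale: "D z (c *s v) = c *s D z v" for z c v
    by (simp add: D_def cvec_eq_iff sum_distrib_left mult.assoc)
  define f' where "f' z = Blinfun (D z)" for z
  have f': "blinfun_apply (f' z) = D z" for z
    unfolding f'_def by (rule bounded_linear_Blinfun_apply[OF bl])
  have openU: "open U" using hol holo_on_open by blast
  have inj0: "D z0 v = 0 \<Longrightarrow> v = 0" for v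
    by (rule inj) (simp add: D_def cvec_eq_iff)
  have "inj (D z0)"
    using inj0 bounded_linear.linear[OF bl] linear_injective_0 by blast
  then obtain E where E: "linear E" "E \<circ> D z0 = id"
    using linear_injective_left_inverse bounded_linear.linear[OF bl] by metis
  have "invf = Blinfun E \<Longrightarrow> invf o\<^sub>L f' z0 = id_blinfun" for invf
    using E by (intro blinfun_eqI) (simp add: f' bounded_linear_Blinfun_apply linear_conv_bounded_linear[symmetric] fun_eq_iff)
  then have invf: "Blinfun E o\<^sub>L f' z0 = id_blinfun" by simp
  have contf: "continuous_on U f'"
  proof (rule continuous_on_blinfun_componentwise)
    fix b :: "complex^'n"
    show "continuous_on U (\<lambda>x. blinfun_apply (f' x) b)"
      unfolding f' D_def by (intro continuous_intros holo_on_continuous holo_on_pd hol)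
  qed
  obtain V W H H' where inv: "open V" "V \<subseteq> U" "z0 \<in> V" "open W" "homeomorphism V W G H"
    "\<And>y. y \<in> W \<Longrightarrow> (H has_derivative H' y) (at y)"
    "\<And>y. y \<in> W \<Longrightarrow> H' y = Hilbert_Choice.inv (blinfun_apply (f' (H y)))"
    "\<And>y. y \<in> W \<Longrightarrow> bij (blinfun_apply (f' (H y)))"
    using inverse_function_theorem[OF openU, of G f' z0 "Blinfun E"] D f' contf z0 invf by metis
  have "holo_on (\<lambda>y. H y $ i) W" for i
    unfolding holo_on_def
  proof (intro conjI ballI exI)
    fix y assume y: "y \<in> W"
    have bij: "bij (D (H y))" and H': "H' y = Hilbert_Choice.inv (D (H y))" using inv(7,8)[OF y] f' by auto
    have "H' y (c *s v) = c *s H' y v" for c v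
      using bij unfolding H' by (metis D_scale bij_inv_eq_iff)
    then show "has_complex_derivative (\<lambda>y. H y $ i) (\<lambda>v. H' y v $ i) y"
      using bounded_linear.has_derivative[OF bounded_linear_vec_nth inv(6)[OF y]]
      by (simp add: has_complex_derivative_def)
  qed fact
  moreover have "holo_on (\<lambda>z. G z $ i) V" for i using holo_on_subset[OF hol inv(1,2)] .
  ultimately have "biholo G H V W"
    using inv(1,4,5) unfolding biholo_def homeomorphism_def by auto
  then show ?thesis using that inv by blast
qed

subsection \<open>Independent differentials\<close>

definition indep_at :: "nat \<Rightarrow> (nat \<Rightarrow> complex^'n \<Rightarrow> complex) \<Rightarrow> complex^'n \<Rightarrow> bool" where
  "indep_at c g a \<longleftrightarrow> (\<forall>b. (\<forall>j. (\<Sum>i<c. b i * pd j (g i) a) = 0) \<longrightarrow> (\<forall>i<c. b i = 0))"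

definition grad :: "(complex^'n \<Rightarrow> complex) \<Rightarrow> complex^'n \<Rightarrow> complex^'n" where
  "grad f z = (\<chi> j. pd j f z)"

lemma grad_nth [simp]: "grad f z $ j = pd j f z"
  by (simp add: grad_def)

text \<open>The bridge to the linear algebra of \<open>vec\<close>. Injectivity appears because a
  set of gradients would not notice a repetition.\<close>

lemma indep_at_iff:
  "indep_at c g a \<longleftrightarrow> inj_on (\<lambda>i. grad (g i) a) {..<c} \<and> vec.independent ((\<lambda>i. grad (g i) a) ` {..<c})"
proof
  assume ind: "indep_at c g a"
  have inj: "inj_on (\<lambda>i. grad (g i) a) {..<c}"
  proof (rule inj_onI, rule ccontr)
    fix i k assume ik: "i \<in> {..<c}" "k \<in> {..<c}" "grad (g i) a = grad (g k) a" "i \<noteq> k"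
    define b where "b l = (if l = i then 1 else if l = k then -1 else 0 :: complex)" for l
    have "(\<Sum>l<c. b l * pd j (g l) a) = (\<Sum>l\<in>{i, k}. b l * pd j (g l) a)" for j
      using ik by (intro sum.mono_neutral_right) (auto simp: b_def)
    also have "\<dots>j = pd j (g i) a - pd j (g k) a" for j using ik(4) by (simp add: b_def)
    also have "\<dots>j = 0" for j using arg_cong[OF ik(3), of "\<lambda>v. v $ j"] by simp
    finally have "b i = 0" using ind ik unfolding indep_at_def by blast
    then show False by (simp add: b_def)
  qed
  have "vec.independent ((\<lambda>i. grad (g i) a) ` {..<c})"
  proof (rule vec.independent_if_scalars_zero)
    fix u x assume s: "(\<Sum>x\<in>(\<lambda>i. grad (g i) a) ` {..<c}. u x *s x) = 0" and x: "x \<in> (\<lambda>i. grad (g i) a) ` {..<c}"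
    have "(\<Sum>i<c. u (grad (g i) a) * pd j (g i) a) = 0" for j
      using arg_cong[OF s, of "\<lambda>v. v $ j"] by (simp add: sum.reindex[OF inj])
    then have "\<forall>i<c. u (grad (g i) a) = 0"
      using ind[unfolded indep_at_def, rule_format, of "\<lambda>i. u (grad (g i) a)"] by blast
    then show "u x = 0" using x by auto
  qed simp
  with inj show "inj_on (\<lambda>i. grad (g i) a) {..<c} \<and> vec.independent ((\<lambda>i. grad (g i) a) ` {..<c})" by blast
next
  assume *: "inj_on (\<lambda>i. grad (g i) a) {..<c} \<and> vec.independent ((\<lambda>i. grad (g i) a) ` {..<c})"
  show "indep_at c g a"
    unfolding indep_at_def
  proof (intro allI impI)
    fix b i assume s: "\<forall>j. (\<Sum>i<c. b i * pd j (g i) a) = 0" and i: "i < c"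
    define u where "u x = b (the_inv_into {..<c} (\<lambda>i. grad (g i) a) x)" for x
    have u: "u (grad (g k) a) = b k" if "k < c" for k
      using the_inv_into_f_f[of "\<lambda>i. grad (g i) a" "{..<c}" k] * that by (simp add: u_def)
    have "(\<Sum>x\<in>(\<lambda>i. grad (g i) a) ` {..<c}. u x *s x) = (\<Sum>k<c. b k *s grad (g k) a)"
      using * u by (subst sum.reindex) (auto intro!: sum.cong)
    also have "\<dots> = 0" using s by (simp add: cvec_eq_iff)
    finally show "b i = 0"
      using * i u[OF i] by (auto simp: vec.independent_explicit)
  qed
qed

text \<open>Exchange against the standard basis: the vectors of \<open>S\<close> are completed by
  unit vectors, and \<open>J\<close> indexes the unit vectors left out, which are the coordinates to
  be replaced in a chart.\<close>

lemma exists_axis_complement: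
  assumes "vec.independent S"
  obtains J :: "'n::finite set" where "card J = card S" "S \<inter> (\<lambda>i. axis i (1::complex)) ` (- J) = {}" 
    "vec.independent (S \<union> (\<lambda>i. axis i 1) ` (- J))"
    "vec.span (S \<union> (\<lambda>i. axis i 1) ` (- J)) = UNIV"
proof -
  have ax: "range (\<lambda>i::'n. axis i (1::complex)) = cart_basis" by (auto simp: cart_basis_def)
  obtain B where B: "S \<subseteq> B" "B \<subseteq> S \<union> cart_basis" "vec.independent B" "S \<union> cart_basis \<subseteq> vec.span B"
    using vec.maximal_independent_subset_extend[of S "S \<union> cart_basis"] assms by blast
  have span: "vec.span B = UNIV"
    using B(4) span_cart_basis vec.span_mono[of cart_basis "vec.span B"] by (auto simp: vec.span_span)
  have finB: "finite B" using B(3) vec.independent_bound_general by blast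
  have cardB: "card B = CARD('n)"
    using vec.dim_eq_card[of B UNIV] span B(3) by (simp add: card_cart_basis vec_dim_card vec.span_UNIV)
  define J where "J = - {i. axis i 1 \<in> B - S}"
  have inj: "inj (\<lambda>i::'n. axis i (1::complex))" by (auto simp: inj_def axis_eq_axis)
  have im: "(\<lambda>i. axis i 1) ` (- J) = B - S"
    using B(2) by (auto simp: J_def cart_basis_def)
  then have "card (- J) = card B - card S"
    using card_image[OF inj_on_subset[OF inj subset_UNIV[of "- J"]]] card_Diff_subset[of S B] B(1) finB finite_subset
    by metis
  moreover have "card (- J) = CARD('n) - card J" by (simp add: Compl_eq_Diff_UNIV card_Diff_subset)
  moreover have "card J \<le> CARD('n)" by (simp add: card_mono)
  moreover have "card S \<le> card B" using B(1) finB by (simp add: card_mono)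
  ultimately have "card J = card S" using cardB by linarith
  moreover have "S \<union> (B - S) = B" using B(1) by blast
  ultimately show ?thesis using that[of J] B(3) span im by simp
qed

lemma span_UNIV_orthogonal:
  fixes v :: "complex^'n"
  assumes "vec.span B = UNIV" "\<And>x. x \<in> B \<Longrightarrow> (\<Sum>l\<in>UNIV. v $ l * x $ l) = 0"
  shows "v = 0"
proof -
  have "vec.subspace {x::complex^'n. (\<Sum>l\<in>UNIV. v $ l * x $ l) = 0}"
    by (rule vec.subspaceI) (auto simp: algebra_simps sum.distrib sum_distrib_left[symmetric] mult.left_commute)
  then have "vec.span B \<subseteq> {x. (\<Sum>l\<in>UNIV. v $ l * x $ l) = 0}"
    using assms(2) by (intro vec.span_minimal) auto
  then have "(\<Sum>l\<in>UNIV. v $ l * axis k 1 $ l) = 0" for k using assms(1) by blast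
  then show ?thesis by (simp add: cvec_eq_iff axis_def if_distrib cong: if_cong)
qed

lemma bij_betw_lessThan_obtain: "bij_betw \<sigma> J {..<c::nat} \<Longrightarrow> i < c \<Longrightarrow> \<exists>j\<in>J. \<sigma> j = i"
  unfolding bij_betw_def by (metis imageE lessThan_iff)

text \<open>The functions are completed to a chart by coordinates transversal to their differentials.\<close>

lemma straightening:
  fixes a :: "complex^'n"
  assumes hol: "\<And>i. i < c \<Longrightarrow> holo_on (g i) U" and openU: "open U" and a: "a \<in> U" and ind: "indep_at c g a"
    and ga: "\<And>i. i < c \<Longrightarrow> g i a = 0"
  obtains G H V W J \<sigma> where "biholo G H V W" "a \<in> V" "V \<subseteq> U" "card J = c" "bij_betw \<sigma> J {..<c}"
    "\<And>z j. z \<in> V \<Longrightarrow> j \<in> J \<Longrightarrow> G z $ j = g (\<sigma> j) z" "G a = 0"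
proof -
  define S where "S = (\<lambda>i. grad (g i) a) ` {..<c}"
  have inj: "inj_on (\<lambda>i. grad (g i) a) {..<c}" and indS: "vec.independent S"
    using ind unfolding indep_at_iff S_def by auto
  have cardS: "card S = c" unfolding S_def using card_image[OF inj] by simp
  obtain J where J: "card J = card S" "vec.span (S \<union> (\<lambda>i. axis i 1) ` (- J)) = UNIV"
    using exists_axis_complement[OF indS] by metis
  obtain \<sigma> where \<sigma>: "bij_betw \<sigma> J {..<c}"
    using J(1) cardS by (metis card_lessThan finite finite_lessThan finite_same_card_bij)
  \<comment> \<open>Subtracting \<open>a\<close> in the coordinates outside \<open>J\<close> places
    the image of \<open>a\<close> at the origin.\<close>
  define G where "G z = (\<chi> j. if j \<in> J then g (\<sigma> j) z else z $ j - a $ j)" for z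
  have \<sigma>J: "\<sigma> j < c" if "j \<in> J" for j using \<sigma> that by (auto simp: bij_betw_def)
  have holG: "holo_on (\<lambda>z. G z $ j) U" for j
    using hol[OF \<sigma>J] openU by (cases "j \<in> J") (auto simp: G_def intro!: holo_intros)
  obtain V W H where "biholo G H V W" "a \<in> V" "V \<subseteq> U"
  proof (rule holomorphic_inverse_function[OF holG a])
    fix v assume v: "\<And>i. (\<Sum>j\<in>UNIV. v $ j * pd j (\<lambda>z. G z $ i) a) = 0"
    show "v = 0"
    proof (rule span_UNIV_orthogonal[OF J(2)])
      fix x assume "x \<in> S \<union> (\<lambda>i. axis i 1) ` (- J)"
      then show "(\<Sum>l\<in>UNIV. v $ l * x $ l) = 0"
      proof
        assume "x \<in> S"
        then obtain i where i: "i < c" "x = grad (g i) a" by (auto simp: S_def)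
        then obtain j where j: "j \<in> J" "\<sigma> j = i" using bij_betw_lessThan_obtain[OF \<sigma>] by blast
        then show ?thesis using v[of j] i by (simp add: G_def)
      next
        assume "x \<in> (\<lambda>i. axis i 1) ` (- J)"
        then obtain j where j: "j \<notin> J" "x = axis j 1" by auto
        have "pd l (\<lambda>z. G z $ j) a = axis j 1 $ l" for l
        proof -
          have "has_complex_derivative (\<lambda>z. z $ j + (- (a $ j))) (\<lambda>v. v $ j + 0) a"
            by (intro has_complex_derivative_add has_complex_derivative_nth has_complex_derivative_const)
          from pd_eqI[OF this, of l] show ?thesis using j by (simp add: G_def axis_def eq_commute)
        qed
        then show ?thesis using v[of j] j by simp
      qed
    qed
  qed
  moreover have "G a = 0" using ga[OF \<sigma>J] by (simp add: G_def cvec_eq_iff)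
  ultimately show ?thesis using that[of G H V W J \<sigma>] J(1) cardS \<sigma> by (simp add: G_def)
qed

text \<open>In the chart \<open>q\<close> is the j-th coordinate, so the chain rule for
  \<open>q\<close> after \<open>H\<close> produces a Kronecker delta.\<close>

lemma chart_pd:
  assumes b: "biholo G H V W" and y: "y \<in> W" and G: "\<And>z. z \<in> V \<Longrightarrow> G z $ j = q z" and hq: "holo_on q V"
  shows "(\<Sum>m\<in>UNIV. pd m q (H y) * pd l (\<lambda>y. H y $ m) y) = (if j = l then 1 else 0)"
proof -
  note b = biholoD[OF b]
  have "(\<Sum>m\<in>UNIV. pd m q (H y) * pd l (\<lambda>y. H y $ m) y) = pd l (\<lambda>y. q (H y)) y"
    using pd_chain[OF hq b(8) y b(5)[OF y]] by simp
  also have "\<dots> = pd l (\<lambda>y. y $ j) y"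
    by (rule pd_cong[symmetric, of _ W]) (use b y G in \<open>auto intro!: holo_intros simp flip: G\<close>)
  finally show ?thesis by (simp add: pd_nth)
qed

text \<open>Pairing a relation between the differentials with the l-th column of the derivative of
  \<open>H\<close> leaves the single coefficient that belongs to \<open>l\<close>.\<close>

lemma chart_indep:
  assumes b: "biholo G H V W" and \<sigma>: "bij_betw \<sigma> J {..<c}" and G: "\<And>z j. z \<in> V \<Longrightarrow> j \<in> J \<Longrightarrow> G z $ j = g (\<sigma> j) z"
    and z: "z \<in> V"
  shows "indep_at c g z"
  unfolding indep_at_def
proof (intro allI impI)
  note b' = biholoD[OF b]
  fix \<beta> i assume s: "\<forall>j. (\<Sum>i<c. \<beta> i * pd j (g i) z) = 0" and i: "i < c"
  obtain l where l: "l \<in> J" "\<sigma> l = i" using bij_betw_lessThan_obtain[OF \<sigma> i] by blast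
  have hg: "holo_on (g k) V" if "k < c" for k
  proof -
    obtain j where "j \<in> J" "\<sigma> j = k" using bij_betw_lessThan_obtain[OF \<sigma> \<open>k < c\<close>] by blast
    then show ?thesis using holo_on_cong[OF b'(7)[of j]] G by auto
  qed
  define y where "y = G z"
  have y: "y \<in> W" "H y = z" using b' z by (auto simp: y_def)
  have *: "(\<Sum>m\<in>UNIV. pd m (g k) z * pd l (\<lambda>y. H y $ m) y) = (if k = i then 1 else 0)" if k: "k < c" for k
  proof -
    obtain j where j: "j \<in> J" "\<sigma> j = k" using bij_betw_lessThan_obtain[OF \<sigma> k] by blast
    have "j = l \<longleftrightarrow> k = i" using j l \<sigma> by (auto simp: bij_betw_def inj_on_def)
    then show ?thesis using chart_pd[OF b y(1) _ hg[OF k], of j l] G j y by simp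
  qed
  have "0 = (\<Sum>m\<in>UNIV. (\<Sum>k<c. \<beta> k * pd m (g k) z) * pd l (\<lambda>y. H y $ m) y)" using s by simp
  also have "\<dots> = (\<Sum>k<c. \<beta> k * (\<Sum>m\<in>UNIV. pd m (g k) z * pd l (\<lambda>y. H y $ m) y))"
    by (simp add: sum_distrib_left sum_distrib_right mult.assoc) (rule sum.swap)
  also have "\<dots> = (\<Sum>k<c. \<beta> k * (if k = i then 1 else 0))" by (rule sum.cong) (simp_all only: * lessThan_iff)
  also have "\<dots> = \<beta> i" using i by (simp add: if_distrib cong: if_cong)
  finally show "\<beta> i = 0" by simp
qed

section \<open>Germs of holomorphic functions and regular points\<close>

lemma holo_atI: "holo_on f U \<Longrightarrow> a \<in> U \<Longrightarrow> holo_at f a"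
  unfolding holo_at_def by blast

lemma holo_at_eventually: "holo_at f a \<Longrightarrow> \<forall>\<^sub>F z in nhds a. holo_at f z"
  unfolding holo_at_def eventually_nhds by (auto dest: holo_on_open)

lemma ideal_atE:
  assumes "h \<in> ideal_at B b" "open V" "b \<in> V"
  obtains U where "open U" "b \<in> U" "U \<subseteq> V" "holo_on h U" "\<And>z. z \<in> U \<Longrightarrow> z \<in> B \<Longrightarrow> h z = 0"
proof -
  obtain U1 where U1: "b \<in> U1" "holo_on h U1" using assms unfolding ideal_at_def holo_at_def by blast
  have "\<forall>\<^sub>F z in nhds b. z \<in> B \<longrightarrow> h z = 0" using assms unfolding ideal_at_def by blast
  then obtain U2 where U2: "open U2" "b \<in> U2" "\<And>z. z \<in> U2 \<Longrightarrow> z \<in> B \<Longrightarrow> h z = 0"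
    unfolding eventually_nhds by blast
  show ?thesis
  proof (rule that[of "U1 \<inter> U2 \<inter> V"])
    show o: "open (U1 \<inter> U2 \<inter> V)" using U1 U2 assms holo_on_open by blast
    show "holo_on h (U1 \<inter> U2 \<inter> V)" using holo_on_subset[OF U1(2) o] by blast
  qed (use U1 U2 assms in auto)
qed

lemma ideal_atI:
  assumes "holo_on h U" "b \<in> U" "\<And>z. z \<in> U \<Longrightarrow> z \<in> B \<Longrightarrow> h z = 0"
  shows "h \<in> ideal_at B b"
proof -
  have "\<forall>\<^sub>F z in nhds b. z \<in> B \<longrightarrow> h z = 0"
    unfolding eventually_nhds using assms holo_on_open[OF assms(1)] by (intro exI[of _ U]) simp
  then show ?thesis using holo_atI[OF assms(1,2)] by (simp add: ideal_at_def)
qed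

lemma pd_cong_nhds:
  assumes "holo_at f z" "\<forall>\<^sub>F y in nhds z. f y = g y"
  shows "pd j f z = pd j g z"
proof -
  obtain U where "z \<in> U" "holo_on f U" using assms unfolding holo_at_def by blast
  then obtain D where D: "has_complex_derivative f D z" using holo_onD by blast
  with has_complex_derivative_transform[OF D assms(2)] show ?thesis by (simp add: pd_eqI)
qed

lemma finite_nbhd:
  assumes "\<And>i. i < (c::nat) \<Longrightarrow> \<exists>U. open U \<and> b \<in> U \<and> P i U"
    and mono: "\<And>i U U'. i < c \<Longrightarrow> P i U \<Longrightarrow> open U' \<Longrightarrow> U' \<subseteq> U \<Longrightarrow> P i U'"
  shows "\<exists>U. open U \<and> b \<in> U \<and> (\<forall>i<c. P i U)"
proof -
  from assms(1) obtain U where U: "\<And>i. i < c \<Longrightarrow> open (U i) \<and> b \<in> U i \<and> P i (U i)" by metis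
  have o: "open (\<Inter>i<c. U i)" using U by (intro open_INT) auto
  show ?thesis
    by (rule exI[of _ "\<Inter>i<c. U i"]) (use U o mono[OF _ _ o] in blast)
qed

text \<open>Differentials are complex linear, so a relation between them need only be tested on unit
  vectors; this removes the chosen derivatives from the definition.\<close>

lemma regular_point_iff:
  "regular_point A c a \<longleftrightarrow> a \<in> A \<and> (\<exists>U g. a \<in> U \<and> open U \<and> (\<forall>i<c. holo_on (g i) U) \<and>
     A \<inter> U = {z\<in>U. \<forall>i<c. g i z = 0} \<and> indep_at c g a)"
proof -
  have *: "(\<forall>b :: nat \<Rightarrow> complex. (\<forall>v. (\<Sum>i<c. b i * D i v) = 0) \<longrightarrow> (\<forall>i<c. b i = 0)) \<longleftrightarrow> indep_at c g a"
    if D: "\<forall>i<c. has_complex_derivative (g i) (D i) a" for g D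
  proof -
    have ax: "D i (axis j 1) = pd j (g i) a" if "i < c" for i j
      using D that has_complex_derivative_axis[of "g i" "D i" a j] by blast
    have "(\<forall>v. (\<Sum>i<c. b i * D i v) = 0) \<longleftrightarrow> (\<forall>j. (\<Sum>i<c. b i * pd j (g i) a) = 0)" for b
    proof
      assume "\<forall>v. (\<Sum>i<c. b i * D i v) = 0"
      then have "(\<Sum>i<c. b i * D i (axis j 1)) = 0" for j by blast
      then show "\<forall>j. (\<Sum>i<c. b i * pd j (g i) a) = 0" using ax by simp
    next
      assume s: "\<forall>j. (\<Sum>i<c. b i * pd j (g i) a) = 0"
      show "\<forall>v. (\<Sum>i<c. b i * D i v) = 0"
      proof
        fix v
        have "(\<Sum>i<c. b i * D i v) = (\<Sum>i<c. b i * (\<Sum>j\<in>UNIV. v $ j * pd j (g i) a))"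
        proof (intro sum.cong refl)
          fix i assume "i \<in> {..<c}"
          then show "b i * D i v = b i * (\<Sum>j\<in>UNIV. v $ j * pd j (g i) a)"
            using D ax[of i] has_complex_derivative_expand[of "g i" "D i" a v] by simp
        qed
        also have "\<dots> = (\<Sum>j\<in>UNIV. v $ j * (\<Sum>i<c. b i * pd j (g i) a))"
          by (simp add: sum_distrib_left mult.left_commute) (rule sum.swap)
        finally show "(\<Sum>i<c. b i * D i v) = 0" using s by simp
      qed
    qed
    then show ?thesis unfolding indep_at_def by blast
  qed
  have ex: "\<exists>D. \<forall>i<c. has_complex_derivative (g i) (D i) a" if "\<forall>i<c. holo_on (g i) U" "a \<in> U" for g U
    using that has_complex_derivative_pd
    by (intro exI[of _ "\<lambda>i v. \<Sum>j\<in>UNIV. v $ j * pd j (g i) a"]) blast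
  show ?thesis
  proof
    assume "regular_point A c a"
    then show "a \<in> A \<and> (\<exists>U g. a \<in> U \<and> open U \<and> (\<forall>i<c. holo_on (g i) U) \<and>
     A \<inter> U = {z\<in>U. \<forall>i<c. g i z = 0} \<and> indep_at c g a)"
      unfolding regular_point_def using * by blast
  next
    assume r: "a \<in> A \<and> (\<exists>U g. a \<in> U \<and> open U \<and> (\<forall>i<c. holo_on (g i) U) \<and>
     A \<inter> U = {z\<in>U. \<forall>i<c. g i z = 0} \<and> indep_at c g a)"
    then obtain U g where U: "a \<in> U" "open U" "\<forall>i<c. holo_on (g i) U"
     "A \<inter> U = {z\<in>U. \<forall>i<c. g i z = 0}" "indep_at c g a" by blast
    obtain D where D: "\<forall>i<c. has_complex_derivative (g i) (D i) a" using ex[OF U(3,1)] by blast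
    show "regular_point A c a"
      unfolding regular_point_def using r U D *[OF D] by blast
  qed
qed

lemma indep_at_compose:
  assumes b: "biholo G H V W" and z: "z \<in> V" and ind: "indep_at c h z"
    and hol: "\<And>i. i < c \<Longrightarrow> holo_at (h i) z"
  shows "indep_at c (\<lambda>i y. h i (H y)) (G z)"
  unfolding indep_at_def
proof (intro allI impI)
  note b' = biholoD[OF b]
  fix \<beta> i assume s: "\<forall>l. (\<Sum>i<c. \<beta> i * pd l (\<lambda>y. h i (H y)) (G z)) = 0" and i: "i < c"
  have *: "pd m (h i) z = (\<Sum>l\<in>UNIV. pd l (\<lambda>y. h i (H y)) (G z) * pd m (\<lambda>z. G z $ l) z)" if "i < c" for i m
  proof -
    obtain U where U: "z \<in> U" "holo_on (h i) U" using hol[OF \<open>i < c\<close>] unfolding holo_at_def by blast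
    have "pd m (\<lambda>z. h i (H (G z))) z = (\<Sum>l\<in>UNIV. pd l (\<lambda>y. h i (H y)) (G z) * pd m (\<lambda>z. G z $ l) z)"
      by (rule pd_chain[OF biholo_holo_compose[OF b U(2)] b'(7) z]) (use b' z U in auto)
    moreover have "pd m (\<lambda>z. h i (H (G z))) z = pd m (h i) z"
      using b' z U(1) holo_on_open[OF U(2)]
      by (intro pd_cong[of _ "U \<inter> V", symmetric] holo_on_subset[OF U(2)]) auto
    ultimately show ?thesis by simp
  qed
  have "(\<Sum>i<c. \<beta> i * pd m (h i) z) = 0" for m
  proof -
    have "(\<Sum>i<c. \<beta> i * pd m (h i) z) = (\<Sum>i<c. \<Sum>l\<in>UNIV. \<beta> i * pd l (\<lambda>y. h i (H y)) (G z) * pd m (\<lambda>z. G z $ l) z)"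
      using * by (intro sum.cong) (auto simp: sum_distrib_left mult.assoc)
    also have "\<dots> = (\<Sum>l\<in>UNIV. (\<Sum>i<c. \<beta> i * pd l (\<lambda>y. h i (H y)) (G z)) * pd m (\<lambda>z. G z $ l) z)"
      by (subst sum.swap) (simp add: sum_distrib_right)
    finally show ?thesis using s by simp
  qed
  then show "\<beta> i = 0" using ind i unfolding indep_at_def by blast
qed

lemma regular_point_biholo:
  assumes b: "biholo G H V W" and a: "a \<in> V" and r: "regular_point A c a"
    and A': "\<And>y. y \<in> W \<Longrightarrow> y \<in> A' \<longleftrightarrow> H y \<in> A"
  shows "regular_point A' c (G a)"
proof -
  note b' = biholoD[OF b]
  obtain U g where U: "a \<in> A" "a \<in> U" "open U" "\<forall>i<c. holo_on (g i) U"
     "A \<inter> U = {z\<in>U. \<forall>i<c. g i z = 0}" "indep_at c g a" using r unfolding regular_point_iff by blast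
  define W' where "W' = W \<inter> H -` U"
  have "G a \<in> A'" using A'[of "G a"] b' a U(1) by simp
  moreover have "G a \<in> W'" using b' a U(2) by (simp add: W'_def)
  moreover have "open W'" unfolding W'_def using b'(10,2) U(3) by (rule continuous_open_preimage)
  moreover have "\<forall>i<c. holo_on (\<lambda>y. g i (H y)) W'"
    using U(4) biholo_holo_compose[OF b] by (auto simp: W'_def)
  moreover have "A' \<inter> W' = {y\<in>W'. \<forall>i<c. g i (H y) = 0}"
    using A' U(5) by (auto simp: W'_def set_eq_iff)
  moreover have "indep_at c (\<lambda>i y. g i (H y)) (G a)"
    using indep_at_compose[OF b a U(6)] U(4,2) holo_atI by blast
  ultimately show ?thesis unfolding regular_point_iff
    by (intro conjI exI[of _ W'] exI[of _ "\<lambda>i y. g i (H y)"]) auto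
qed

lemma regular_point_local:
  assumes "regular_point A c a" "open V" "a \<in> V" "A \<inter> V = A' \<inter> V"
  shows "regular_point A' c a"
proof -
  obtain U g where U: "a \<in> A" "a \<in> U" "open U" "\<forall>i<c. holo_on (g i) U"
     "A \<inter> U = {z\<in>U. \<forall>i<c. g i z = 0}" "indep_at c g a" using assms(1) unfolding regular_point_iff by blast
  have o: "open (U \<inter> V)" using U assms by blast
  have "\<forall>i<c. holo_on (g i) (U \<inter> V)" using U(4) holo_on_subset[OF _ o] by blast
  moreover have "A' \<inter> (U \<inter> V) = {z\<in>U \<inter> V. \<forall>i<c. g i z = 0}" using U(5) assms(4) by blast
  moreover have "a \<in> A'" using assms U by blast
  ultimately show ?thesis unfolding regular_point_iff using U assms o by blast
qed

text \<open>The same \<open>c\<close> functions serve at nearby points, because their differentials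
  stay independent throughout a chart.\<close>

lemma regular_point_open:
  assumes "regular_point A c a"
  obtains V where "open V" "a \<in> V" "\<And>z. z \<in> V \<Longrightarrow> z \<in> A \<Longrightarrow> regular_point A c z"
proof -
  obtain U g where U: "a \<in> A" "a \<in> U" "open U" "\<forall>i<c. holo_on (g i) U"
     "A \<inter> U = {z\<in>U. \<forall>i<c. g i z = 0}" "indep_at c g a" using assms(1) unfolding regular_point_iff by blast
  obtain G H V W J \<sigma> where ch: "biholo G H V W" "a \<in> V" "V \<subseteq> U" "card J = c" "bij_betw \<sigma> J {..<c}"
    "\<And>z j. z \<in> V \<Longrightarrow> j \<in> J \<Longrightarrow> G z $ j = g (\<sigma> j) z" "G a = 0"
    by (rule straightening[of c g U a]) (use U in auto)
  show ?thesis
  proof (rule that[of V])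
    fix z assume z: "z \<in> V" "z \<in> A"
    have "indep_at c g z" using chart_indep[OF ch(1,5,6)] z by blast
    then show "regular_point A c z" unfolding regular_point_iff using U ch z by blast
  qed (use ch biholoD in auto)
qed

subsection \<open>Zariski hulls\<close>

definition dir_deriv :: "complex^'n \<Rightarrow> (complex^'n \<Rightarrow> complex) \<Rightarrow> complex^'n \<Rightarrow> complex" where
  "dir_deriv v q z = (\<Sum>l\<in>UNIV. v $ l * pd l q z)"

lemma holo_on_dir_deriv_funpow: "holo_on q U \<Longrightarrow> holo_on ((dir_deriv v ^^ k) q) U"
  by (induction k) (auto simp: dir_deriv_def[abs_def] holo_on_open intro!: holo_intros)

lemma higher_deriv_line:
  assumes q: "holo_on q U" and "t *s v \<in> U"
  shows "(deriv ^^ k) (\<lambda>t. q (t *s v)) t = (dir_deriv v ^^ k) q (t *s v)"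
  using assms(2)
proof (induction k arbitrary: t)
  case (Suc k)
  have "open {t. t *s v \<in> U}"
    using holo_on_open[OF q] by (intro open_vimage[unfolded vimage_def] continuous_intros)
  then have "\<forall>\<^sub>F s in nhds t. (deriv ^^ k) (\<lambda>t. q (t *s v)) s = (dir_deriv v ^^ k) q (s *s v)"
    using Suc unfolding eventually_nhds by blast
  then have "(deriv ^^ Suc k) (\<lambda>t. q (t *s v)) t = deriv (\<lambda>s. (dir_deriv v ^^ k) q (s *s v)) t"
    by (simp add: deriv_cong_ev)
  also have "\<dots> = (\<Sum>j\<in>UNIV. v $ j * pd j ((dir_deriv v ^^ k) q) (t *s v))"
    using has_complex_derivative_line[of "(dir_deriv v ^^ k) q" _ 0 t v,
        OF has_complex_derivative_pd[OF holo_on_dir_deriv_funpow[OF q]]] Suc.prems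
    by (intro DERIV_imp_deriv) simp
  finally show ?case by (simp add: dir_deriv_def[of v "(dir_deriv v ^^ k) q"])
qed simp

text \<open>Maximality of the rank makes the functions vanishing on \<open>B\<close> stable under the derivatives
  tangent to \<open>{g = 0}\<close>, so that their Taylor series along this manifold vanish.\<close>

lemma hull_core:
  fixes b0 :: "complex^'n"
  assumes B: "b0 \<in> B" and U: "open U" "b0 \<in> U" and hol: "\<And>i. i < c \<Longrightarrow> holo_on (g i) U"
    and gB: "\<And>i b. i < c \<Longrightarrow> b \<in> B \<Longrightarrow> b \<in> U \<Longrightarrow> g i b = 0" and ind: "indep_at c g b0"
    and max: "\<And>b h. b \<in> B \<Longrightarrow> b \<in> U \<Longrightarrow> (\<And>i. i < Suc c \<Longrightarrow> h i \<in> ideal_at B b) \<Longrightarrow> \<not> indep_at (Suc c) h b"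
    and h: "h \<in> ideal_at B b0"
  shows "\<forall>\<^sub>F z in nhds b0. (\<forall>i<c. g i z = 0) \<longrightarrow> h z = 0"
proof -
  obtain G H V W J \<sigma> where ch: "biholo G H V W" "b0 \<in> V" "V \<subseteq> U" "card J = c" "bij_betw \<sigma> J {..<c}"
    "\<And>z j. z \<in> V \<Longrightarrow> j \<in> J \<Longrightarrow> G z $ j = g (\<sigma> j) z" "G b0 = 0"
    by (rule straightening[of c g U b0]) (use assms in auto)
  note b = biholoD[OF ch(1)]
  obtain U1 where U1: "open U1" "b0 \<in> U1" "U1 \<subseteq> V" "holo_on h U1" "\<And>z. z \<in> U1 \<Longrightarrow> z \<in> B \<Longrightarrow> h z = 0"
    using ideal_atE[OF h b(1) ch(2)] by blast
  have H0: "0 \<in> W" "H 0 = b0" using b(3,4)[OF ch(2)] ch(7) by auto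
  have "open (W \<inter> H -` U1)" using b(10,2) U1(1) by (rule continuous_open_preimage)
  moreover have "0 \<in> W \<inter> H -` U1" using H0 U1 by simp
  ultimately obtain r where r: "r > 0" "ball 0 r \<subseteq> W \<inter> H -` U1" using open_contains_ball by blast
  define Q where "Q = {q. holo_on q (ball 0 r) \<and> (\<forall>y\<in>ball 0 r. H y \<in> B \<longrightarrow> q y = 0)}"
  have hQ: "(\<lambda>y. h (H y)) \<in> Q"
    unfolding Q_def using biholo_holo_compose[OF ch(1) U1(4)] r U1(5) by (auto intro: holo_on_subset)
  \<comment> \<open>If \<open>pd l q\<close> were nonzero at a point over \<open>B\<close>, then
    \<open>q\<close> together with the \<open>c\<close> functions \<open>g\<close> would give
    \<open>Suc c\<close> germs vanishing on \<open>B\<close> with independent differentials, against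
    maximality.\<close>
  have pdQ: "pd l q \<in> Q" if q: "q \<in> Q" and l: "l \<notin> J" for q l
  proof -
    have holq: "holo_on q (ball 0 r)" using q by (simp add: Q_def)
    have "pd l q y = 0" if y: "y \<in> ball 0 r" "H y \<in> B" for y
    proof (rule ccontr)
      assume nz: "pd l q y \<noteq> 0"
      have yW: "y \<in> W" and HyU: "H y \<in> U1" using y r by auto
      have HyV: "H y \<in> V" using HyU U1 by blast
      define hh where "hh i = (if i < c then g i else (\<lambda>z. q (G z)))" for i
      have bs: "biholo H G W V" using biholo_sym[OF ch(1)] .
      have holqG: "holo_on (\<lambda>z. q (G z)) (V \<inter> G -` ball 0 r)"
        using biholo_holo_compose[OF bs holq] .
      have "hh i \<in> ideal_at B (H y)" if "i < Suc c" for i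
      proof (cases "i < c")
        case True
        then show ?thesis using HyV ch(3) ideal_atI[OF hol[OF True], of "H y" B] gB[OF True] by (auto simp: hh_def)
      next
        case False
        have "H y \<in> V \<inter> G -` ball 0 r" using HyV b(6)[OF yW] y by simp
        moreover have "q (G z) = 0" if "z \<in> V \<inter> G -` ball 0 r" "z \<in> B" for z
          using q that b(4) by (auto simp: Q_def)
        ultimately show ?thesis using False ideal_atI[OF holqG] by (simp add: hh_def)
      qed
      moreover have "indep_at (Suc c) hh (H y)"
        unfolding indep_at_def
      proof (intro allI impI)
        fix \<beta> i assume s: "\<forall>m. (\<Sum>i<Suc c. \<beta> i * pd m (hh i) (H y)) = 0" and i: "i < Suc c"
        have s': "(\<Sum>i<c. \<beta> i * pd m (g i) (H y)) + \<beta> c * pd m (\<lambda>z. q (G z)) (H y) = 0" for m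
          using s[rule_format, of m] by (simp add: hh_def)
        \<comment> \<open>The l-th coordinate vector of the chart is tangent to the zero set of
          \<open>g\<close>, because \<open>l\<close> lies outside \<open>J\<close>. Applied to the
          relation, it isolates the coefficient of \<open>q\<close>.\<close>
        have e1: "(\<Sum>m\<in>UNIV. pd m (g k) (H y) * pd l (\<lambda>y. H y $ m) y) = 0" if k: "k < c" for k
        proof -
          obtain j where j: "j \<in> J" "\<sigma> j = k" using bij_betw_lessThan_obtain[OF ch(5) k] by blast
          have "(\<Sum>m\<in>UNIV. pd m (g k) (H y) * pd l (\<lambda>y. H y $ m) y) = (if j = l then 1 else 0)"
            by (rule chart_pd[OF ch(1) yW]) (use ch(6) j holo_on_subset[OF hol[OF k] b(1) ch(3)] in auto)
          then show ?thesis using j l by auto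
        qed
        have e2: "(\<Sum>m\<in>UNIV. pd m (\<lambda>z. q (G z)) (H y) * pd l (\<lambda>y. H y $ m) y) = pd l q y"
        proof -
          have "(\<Sum>m\<in>UNIV. pd m (\<lambda>z. q (G z)) (H y) * pd l (\<lambda>y. H y $ m) y) = pd l (\<lambda>y. q (G (H y))) y"
            by (rule pd_chain[symmetric, OF holqG b(8) yW]) (use HyV b(6)[OF yW] y in auto)
          also have "\<dots> = pd l q y"
            by (rule pd_cong[symmetric, OF holq y(1)]) (use b(6) r in auto)
          finally show ?thesis .
        qed
        have "0 = (\<Sum>m\<in>UNIV. ((\<Sum>i<c. \<beta> i * pd m (g i) (H y)) + \<beta> c * pd m (\<lambda>z. q (G z)) (H y)) * pd l (\<lambda>y. H y $ m) y)"
          using s' by simp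
        also have "\<dots> = (\<Sum>m\<in>UNIV. \<Sum>i<c. \<beta> i * (pd m (g i) (H y) * pd l (\<lambda>y. H y $ m) y))
             + \<beta> c * (\<Sum>m\<in>UNIV. pd m (\<lambda>z. q (G z)) (H y) * pd l (\<lambda>y. H y $ m) y)"
          by (simp add: distrib_right sum.distrib sum_distrib_left sum_distrib_right mult.assoc)
        also have "(\<Sum>m\<in>UNIV. \<Sum>i<c. \<beta> i * (pd m (g i) (H y) * pd l (\<lambda>y. H y $ m) y))
             = (\<Sum>i<c. \<beta> i * (\<Sum>m\<in>UNIV. pd m (g i) (H y) * pd l (\<lambda>y. H y $ m) y))"
          by (subst sum.swap) (simp add: sum_distrib_left)
        finally have "\<beta> c = 0" using e1 e2 nz by simp
        then have "\<forall>m. (\<Sum>i<c. \<beta> i * pd m (g i) (H y)) = 0" using s' by simp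
        moreover have "indep_at c g (H y)" using chart_indep[OF ch(1,5,6) HyV] .
        ultimately have "\<forall>i<c. \<beta> i = 0" unfolding indep_at_def by blast
        then show "\<beta> i = 0" using \<open>\<beta> c = 0\<close> i less_Suc_eq by auto
      qed
      ultimately show False using max[of "H y" hh] y HyV ch(3) by blast
    qed
    then show ?thesis using holq by (auto simp: Q_def intro!: holo_intros)
  qed
  have dirQ: "dir_deriv v q \<in> Q" if q: "q \<in> Q" and v: "\<And>j. j \<in> J \<Longrightarrow> v $ j = 0" for q v
  proof -
    have "holo_on q (ball 0 r)" using q by (simp add: Q_def)
    then have "holo_on (dir_deriv v q) (ball 0 r)" unfolding dir_deriv_def[abs_def] by (auto intro!: holo_intros)
    moreover have "dir_deriv v q y = 0" if "y \<in> ball 0 r" "H y \<in> B" for y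
      unfolding dir_deriv_def
    proof (rule sum.neutral, rule ballI)
      fix l show "v $ l * pd l q y = 0"
        using v[of l] pdQ[OF q, of l] that by (cases "l \<in> J") (auto simp: Q_def)
    qed
    ultimately show ?thesis by (simp add: Q_def)
  qed
  \<comment> \<open>On the complex line through the origin and \<open>y\<close> all derivatives at 0
    vanish: the iterated directional derivatives stay in \<open>Q\<close>, and
    \<open>H 0 = b0\<close> lies in \<open>B\<close>.\<close>
  have van: "h (H y) = 0" if y: "y \<in> ball 0 r" "\<And>j. j \<in> J \<Longrightarrow> y $ j = 0" for y
  proof (cases "y = 0")
    case True
    then show ?thesis using H0 B U1 by simp
  next
    case False
    have holh: "holo_on (\<lambda>y. h (H y)) (ball 0 r)" using hQ by (simp add: Q_def)
    have inb: "t *s y \<in> ball 0 r \<longleftrightarrow> t \<in> ball 0 (r / norm y)" for t :: complex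
      using False by (simp add: norm_scalar_mult_vec pos_less_divide_eq)
    have "(\<lambda>t. h (H (t *s y))) holomorphic_on ball 0 (r / norm y)"
      unfolding holomorphic_on_def
    proof
      fix t :: complex assume "t \<in> ball 0 (r / norm y)"
      then have "0 + t *s y \<in> ball 0 r" using inb by simp
      then obtain D where "has_complex_derivative (\<lambda>y. h (H y)) D (0 + t *s y)" using holh holo_onD by blast
      from has_complex_derivative_line[OF this]
      show "(\<lambda>t. h (H (t *s y))) field_differentiable at t within ball 0 (r / norm y)"
        using field_differentiable_def field_differentiable_at_within by force
    qed
    moreover have "(1::complex) \<in> ball 0 (r / norm y)" using inb[of 1] y by simp
    moreover have "(deriv ^^ k) (\<lambda>t. h (H (t *s y))) 0 = 0" for k
    proof -
      have "(dir_deriv y ^^ k) (\<lambda>y. h (H y)) \<in> Q"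
        using y(2) by (induction k) (auto intro: hQ dirQ)
      then have "(dir_deriv y ^^ k) (\<lambda>y. h (H y)) 0 = 0" using r H0 B by (auto simp: Q_def)
      moreover have "(0::complex) *s y = 0" by (simp add: cvec_eq_iff)
      ultimately show ?thesis using higher_deriv_line[OF holh, of 0 y k] r(1) by simp
    qed
    ultimately have "h (H (1 *s y)) = 0"
      by (rule holomorphic_fun_eq_0_on_ball)
    then show ?thesis by simp
  qed
  have "open (V \<inter> G -` ball 0 r)" using b(9,1) by (rule continuous_open_preimage) simp
  moreover have "b0 \<in> V \<inter> G -` ball 0 r" using ch(2,7) r(1) by simp
  moreover have "h z = 0" if z: "z \<in> V \<inter> G -` ball 0 r" "\<forall>i<c. g i z = 0" for z
  proof -
    have "h (H (G z)) = 0"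
    proof (rule van)
      fix j assume "j \<in> J"
      moreover have "\<sigma> j < c" using ch(5) \<open>j \<in> J\<close> by (auto simp: bij_betw_def)
      ultimately show "G z $ j = 0" using ch(6) z by auto
    qed (use z in auto)
    then show ?thesis using b(4) z by simp
  qed
  ultimately show ?thesis unfolding eventually_nhds by blast
qed

lemma indep_at_le_card:
  fixes a :: "complex^'n"
  assumes "indep_at c g a" shows "c \<le> CARD('n)"
proof -
  have "card ((\<lambda>i. grad (g i) a) ` {..<c}) = c"
    using assms card_image[of "\<lambda>i. grad (g i) a" "{..<c}"] unfolding indep_at_iff by simp
  moreover have "card ((\<lambda>i. grad (g i) a) ` {..<c}) \<le> vec.dim (UNIV :: (complex^'n) set)"
    using assms by (intro vec.independent_card_le_dim) (auto simp: indep_at_iff)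
  ultimately show ?thesis by (simp add: vec_dim_card card_cart_basis)
qed

text \<open>\<open>c\<close> is the greatest number of germs vanishing on \<open>B\<close> with
  independent differentials, taken over all points of \<open>B\<close> in \<open>V\<close> and not
  only at \<open>b0\<close>. This makes the maximality hypothesis of \<open>hull_core\<close>
  available at every point of \<open>B\<close> near \<open>b0\<close>.\<close>

lemma analytic_hull:
  fixes B :: "(complex^'n) set"
  assumes "open V" "B \<inter> V \<noteq> {}"
  obtains b0 c g U where "b0 \<in> B" "b0 \<in> U" "open U" "U \<subseteq> V" "\<And>i. i < c \<Longrightarrow> holo_on (g i) U"
    "\<And>i b. i < c \<Longrightarrow> b \<in> B \<Longrightarrow> b \<in> U \<Longrightarrow> g i b = 0" "indep_at c g b0"
    "\<And>h. h \<in> ideal_at B b0 \<Longrightarrow> \<forall>\<^sub>F z in nhds b0. (\<forall>i<c. g i z = 0) \<longrightarrow> h z = 0"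
proof -
  define P where "P c \<longleftrightarrow> (\<exists>b\<in>B \<inter> V. \<exists>g. (\<forall>i<c. g i \<in> ideal_at B b) \<and> indep_at c g b)" for c
  have "P 0" using assms(2) by (auto simp: P_def indep_at_def)
  moreover have "c \<le> CARD('n)" if "P c" for c using that indep_at_le_card unfolding P_def by blast
  ultimately have Pc: "P (Greatest P)" and max: "\<And>k. P k \<Longrightarrow> k \<le> Greatest P"
    using GreatestI_nat[of P 0 "CARD('n)"] Greatest_le_nat[of P _ "CARD('n)"] by blast+
  define c where "c = Greatest P"
  obtain b0 g where b0: "b0 \<in> B" "b0 \<in> V" "\<And>i. i < c \<Longrightarrow> g i \<in> ideal_at B b0" "indep_at c g b0"
    using Pc unfolding P_def c_def by blast
  have "\<exists>U. open U \<and> b0 \<in> U \<and> (\<forall>i<c. U \<subseteq> V \<and> holo_on (g i) U \<and> (\<forall>z\<in>U. z \<in> B \<longrightarrow> g i z = 0))"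
  proof (rule finite_nbhd)
    fix i assume "i < c"
    show "\<exists>U. open U \<and> b0 \<in> U \<and> U \<subseteq> V \<and> holo_on (g i) U \<and> (\<forall>z\<in>U. z \<in> B \<longrightarrow> g i z = 0)"
      using ideal_atE[OF b0(3)[OF \<open>i < c\<close>] assms(1) b0(2)] by metis
  next
    fix i U U' assume "U \<subseteq> V \<and> holo_on (g i) U \<and> (\<forall>z\<in>U. z \<in> B \<longrightarrow> g i z = 0)" "open U'" "U' \<subseteq> U"
    then show "U' \<subseteq> V \<and> holo_on (g i) U' \<and> (\<forall>z\<in>U'. z \<in> B \<longrightarrow> g i z = 0)"
      using holo_on_subset by blast
  qed
  then obtain U0 where U0: "open U0" "b0 \<in> U0" "\<And>i. i < c \<Longrightarrow> U0 \<subseteq> V \<and> holo_on (g i) U0 \<and> (\<forall>z\<in>U0. z \<in> B \<longrightarrow> g i z = 0)"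
    by blast
  define U where "U = U0 \<inter> V"
  have U: "open U" "b0 \<in> U" "U \<subseteq> V" using U0 assms b0 by (auto simp: U_def)
  have hol: "\<And>i. i < c \<Longrightarrow> holo_on (g i) U" using U0(3) U(1) holo_on_subset unfolding U_def by blast
  have gB: "\<And>i b. i < c \<Longrightarrow> b \<in> B \<Longrightarrow> b \<in> U \<Longrightarrow> g i b = 0" using U0(3) unfolding U_def by blast
  have mx: "\<not> indep_at (Suc c) h b" if "b \<in> B" "b \<in> U" "\<And>i. i < Suc c \<Longrightarrow> h i \<in> ideal_at B b" for b h
    using max[of "Suc c"] that U unfolding P_def c_def by fastforce
  show ?thesis
    by (rule that[OF b0(1) U(2,1,3) hol gB b0(4)])
       (use hull_core[OF b0(1) U(1,2) hol gB b0(4) mx] in blast)+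
qed

text \<open>In a chart in which \<open>Z\<close> is the plane where the \<open>p\<close> coordinates
  in \<open>J\<close> vanish, the differential at the origin of a function vanishing on
  \<open>Z\<close> involves only these coordinates.\<close>

lemma regular_rank_bound:
  fixes a :: "complex^'n"
  assumes r: "regular_point Z p a" and h: "\<And>i. i < k \<Longrightarrow> h i \<in> ideal_at Z a" and ind: "indep_at k h a"
  shows "k \<le> p"
proof -
  obtain U g where U: "a \<in> Z" "a \<in> U" "open U" "\<forall>i<p. holo_on (g i) U"
     "Z \<inter> U = {z\<in>U. \<forall>i<p. g i z = 0}" "indep_at p g a" using r unfolding regular_point_iff by blast
  obtain G H V W J \<sigma> where ch: "biholo G H V W" "a \<in> V" "V \<subseteq> U" "card J = p" "bij_betw \<sigma> J {..<p}"
    "\<And>z j. z \<in> V \<Longrightarrow> j \<in> J \<Longrightarrow> G z $ j = g (\<sigma> j) z" "G a = 0"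
    by (rule straightening[of p g U a]) (use U in auto)
  note b = biholoD[OF ch(1)]
  have H0: "0 \<in> W" "H 0 = a" using b(3,4)[OF ch(2)] ch(7) by auto
  have ind': "indep_at k (\<lambda>i y. h i (H y)) 0"
    using indep_at_compose[OF ch(1,2) ind] h ch(7) by (auto simp: ideal_at_def)
  have zero: "pd l (\<lambda>y. h i (H y)) 0 = 0" if i: "i < k" and l: "l \<notin> J" for i l
  proof -
    obtain U1 where U1: "open U1" "a \<in> U1" "U1 \<subseteq> V" "holo_on (h i) U1" "\<And>z. z \<in> U1 \<Longrightarrow> z \<in> Z \<Longrightarrow> h i z = 0"
      using ideal_atE[OF h[OF i] b(1) ch(2)] by blast
    have oW: "open (W \<inter> H -` U1)" using b(10,2) U1(1) by (rule continuous_open_preimage)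
    moreover have in0: "0 \<in> W \<inter> H -` U1" using H0 U1 by simp
    ultimately obtain \<rho> where \<rho>: "\<rho> > 0" "ball 0 \<rho> \<subseteq> W \<inter> H -` U1" using open_contains_ball by blast
    have van: "h i (H (upd 0 l t)) = 0" if "norm t < \<rho>" for t
    proof -
      have "dist (upd 0 l t) 0 < \<rho>" using that dist_upd[of 0 l t] by simp
      then have y: "upd 0 l t \<in> W" "H (upd 0 l t) \<in> U1" using \<rho> by (auto simp: subset_iff dist_commute)
      have "g m (H (upd 0 l t)) = 0" if "m < p" for m
      proof -
        obtain j where j: "j \<in> J" "\<sigma> j = m" using bij_betw_lessThan_obtain[OF ch(5) \<open>m < p\<close>] by blast
        have "g m (H (upd 0 l t)) = G (H (upd 0 l t)) $ j" using ch(6)[of _ j] j b(5)[OF y(1)] by simp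
        then show ?thesis using b(6)[OF y(1)] j l by auto
      qed
      then have "H (upd 0 l t) \<in> Z" using U(5) b(5)[OF y(1)] ch(3) by blast
      then show ?thesis using U1(5) y by blast
    qed
    have "deriv (\<lambda>t. h i (H (upd 0 l t))) 0 = deriv (\<lambda>t. 0) 0"
    proof (rule deriv_cong_ev)
      show "\<forall>\<^sub>F t in nhds 0. h i (H (upd 0 l t)) = 0"
        unfolding eventually_nhds using van \<rho>(1) by (intro exI[of _ "ball 0 \<rho>"]) auto
    qed simp
    then show ?thesis by (simp add: pd_def)
  qed
  define S where "S = (\<lambda>i. grad (\<lambda>y. h i (H y)) 0) ` {..<k}"
  have cS: "card S = k" "vec.independent S"
    using ind' card_image[of "\<lambda>i. grad (\<lambda>y. h i (H y)) 0" "{..<k}"] unfolding indep_at_iff S_def by auto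
  have "S \<subseteq> vec.span ((\<lambda>j. axis j 1) ` J)"
  proof
    fix x assume "x \<in> S"
    then have x0: "x $ l = 0" if "l \<notin> J" for l using zero[OF _ that] by (auto simp: S_def)
    have "x = (\<Sum>j\<in>UNIV. x $ j *s axis j 1)" by (simp add: basis_expansion)
    also have "\<dots> = (\<Sum>j\<in>J. x $ j *s axis j 1)"
      using x0 by (intro sum.mono_neutral_right) auto
    also have "\<dots> \<in> vec.span ((\<lambda>j. axis j 1) ` J)"
      by (intro vec.span_sum vec.span_scale vec.span_base) auto
    finally show "x \<in> vec.span ((\<lambda>j. axis j 1) ` J)" .
  qed
  then have "card S \<le> card ((\<lambda>j. axis j (1::complex)) ` J)"
    using vec.independent_span_bound[of "(\<lambda>j. axis j (1::complex)) ` J" S] cS(2) by simp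
  also have "\<dots> \<le> card J" by (rule card_image_le) simp
  finally show ?thesis using cS ch(4) by simp
qed

subsection \<open>Newton's identities\<close>

text \<open>\<open>newton p k\<close> is the \<open>k\<close>-th elementary symmetric function if \<open>p i\<close> is the \<open>i\<close>-th power sum.\<close>

fun newton :: "(nat \<Rightarrow> complex) \<Rightarrow> nat \<Rightarrow> complex" where
  "newton p 0 = 1"
| "newton p (Suc k) = (\<Sum>i\<le>k. (-1) ^ i * newton p (k - i) * p (Suc i)) / of_nat (Suc k)"

lemma holo_on_newton:
  assumes "open U" "\<And>i. holo_on (\<lambda>z. p z i) U"
  shows "holo_on (\<lambda>z. newton (p z) k) U"
proof (induction k rule: less_induct)
  case (less k)
  show ?case
  proof (cases k)
    case (Suc m)
    have "holo_on (\<lambda>z. (\<Sum>i\<le>m. (-1) ^ i * newton (p z) (m - i) * p z (Suc i)) / of_nat (Suc m)) U"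
      using less Suc assms by (intro holo_intros) (auto simp del: of_nat_Suc)
    then show ?thesis using Suc by simp
  qed (use assms in \<open>auto intro!: holo_intros\<close>)
qed

lemma newton_cong: "(\<And>i. p i = q i) \<Longrightarrow> newton p k = newton q k"
  by (metis ext)

text \<open>The generating function of the elementary symmetric functions of the list.\<close>

definition esym_fps :: "complex list \<Rightarrow> complex fps" where
  "esym_fps xs = prod_list (map (\<lambda>x. 1 + fps_const x * fps_X) xs)"

lemma esym_fps_simps [simp]: "esym_fps [] = 1" "esym_fps (x # xs) = (1 + fps_const x * fps_X) * esym_fps xs"
  by (simp_all add: esym_fps_def)

lemma esym_fps_nth_Suc: "fps_nth (esym_fps (x # xs)) (Suc n) = fps_nth (esym_fps xs) (Suc n) + x * fps_nth (esym_fps xs) n"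
  by (simp add: distrib_right mult.assoc)

lemma esym_fps_top:
  "(\<forall>n>length xs. fps_nth (esym_fps xs) n = 0) \<and> fps_nth (esym_fps xs) (length xs) = prod_list xs"
proof (induction xs)
  case (Cons x xs)
  show ?case
  proof (intro conjI allI impI)
    fix n assume "length (x # xs) < n"
    then obtain m where "n = Suc m" "length xs < m" by (cases n) auto
    then show "fps_nth (esym_fps (x # xs)) n = 0" using Cons by (simp only: esym_fps_nth_Suc) simp
  next
    show "fps_nth (esym_fps (x # xs)) (length (x # xs)) = prod_list (x # xs)"
      using Cons by (simp only: esym_fps_nth_Suc length_Cons) simp
  qed
qed auto

text \<open>The logarithmic derivative of the product is the sum of x / (1 + xX), whose coefficients
  are signed power sums. Newton's identities are this equation read coefficient by
  coefficient.\<close>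

lemma esym_fps_deriv:
  "fps_deriv (esym_fps xs) = esym_fps xs * Abs_fps (\<lambda>k. (\<Sum>x\<leftarrow>xs. x * (- x) ^ k))"
proof (induction xs)
  case Nil
  have "Abs_fps (\<lambda>k. 0 :: complex) = 0" by (simp add: fps_ext)
  then show ?case by simp
next
  case (Cons x xs)
  define L where "L = Abs_fps (\<lambda>k. (\<Sum>x\<leftarrow>xs. x * (- x) ^ k))"
  define G where "G = Abs_fps (\<lambda>k. x * (- x) ^ k)"
  have s: "Abs_fps (\<lambda>k. (\<Sum>x\<leftarrow>x # xs. x * (- x) ^ k)) = G + L"
    by (rule fps_ext) (simp add: G_def L_def)
  have G: "(1 + fps_const x * fps_X) * G = fps_const x"
  proof (rule fps_ext)
    fix n
    show "fps_nth ((1 + fps_const x * fps_X) * G) n = fps_nth (fps_const x) n"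
      by (cases n) (simp_all add: G_def distrib_right mult.assoc)
  qed
  have "fps_deriv (esym_fps (x # xs)) = fps_const x * esym_fps xs + (1 + fps_const x * fps_X) * fps_deriv (esym_fps xs)"
    by simp
  also have "\<dots> = ((1 + fps_const x * fps_X) * G) * esym_fps xs + (1 + fps_const x * fps_X) * (esym_fps xs * L)"
    using Cons G by (simp add: L_def)
  also have "\<dots> = esym_fps (x # xs) * (G + L)" by (simp add: algebra_simps)
  finally show ?case by (simp only: s)
qed

lemma newton_eq_esym:
  assumes "\<And>k. p (Suc k) = (\<Sum>x\<leftarrow>xs. x ^ Suc k)"
  shows "newton p k = fps_nth (esym_fps xs) k"
proof (induction k rule: less_induct)
  case (less k)
  show ?case
  proof (cases k)
    case 0
    have "fps_nth (esym_fps xs) 0 = 1" by (induction xs) auto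
    then show ?thesis using 0 by simp
  next
    case (Suc m)
    have sg: "(\<Sum>x\<leftarrow>xs. x * (- x) ^ i) = (- 1) ^ i * p (Suc i)" for i
    proof -
      have "x * (- x) ^ i = (-1) ^ i * x ^ Suc i" for x :: complex by (subst power_minus) simp
      then have "(\<Sum>x\<leftarrow>xs. x * (- x) ^ i) = (\<Sum>x\<leftarrow>xs. (-1) ^ i * x ^ Suc i)" by presburger
      also have "\<dots> = (-1) ^ i * (\<Sum>x\<leftarrow>xs. x ^ Suc i)" by (rule sum_list_const_mult)
      finally show ?thesis using assms by simp
    qed
    have "of_nat (Suc m) * fps_nth (esym_fps xs) (Suc m) = fps_nth (fps_deriv (esym_fps xs)) m"
      by simp
    also have "\<dots> = (\<Sum>i=0..m. fps_nth (esym_fps xs) i * ((- 1) ^ (m - i) * p (Suc (m - i))))"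
      by (simp only: esym_fps_deriv fps_mult_nth sg fps_nth_Abs_fps)
    also have "\<dots> = (\<Sum>i=0..m. fps_nth (esym_fps xs) (m - i) * ((- 1) ^ i * p (Suc i)))"
      by (subst sum.atLeastAtMost_rev) simp
    also have "\<dots> = (\<Sum>i\<le>m. (-1) ^ i * newton p (m - i) * p (Suc i))"
      using less Suc by (intro sum.cong) (auto simp: atLeast0AtMost)
    finally have "of_nat (Suc m) * fps_nth (esym_fps xs) (Suc m) = (\<Sum>i\<le>m. (-1) ^ i * newton p (m - i) * p (Suc i))" .
    then have "fps_nth (esym_fps xs) (Suc m) = (\<Sum>i\<le>m. (-1) ^ i * newton p (m - i) * p (Suc i)) / of_nat (Suc m)"
      by (metis mult.commute nonzero_mult_div_cancel_right of_nat_Suc of_nat_neq_0)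
    then show ?thesis using Suc by simp
  qed
qed

text \<open>The top elementary symmetric function is the product, so a norm taken over roots is a
  polynomial in power sums. Power sums are contour integrals, which gives holomorphic dependence on
  parameters without labelling the roots.\<close>

lemma newton_length:
  assumes "\<And>k. p (Suc k) = (\<Sum>x\<leftarrow>xs. x ^ Suc k)"
  shows "newton p (length xs) = prod_list xs"
  using newton_eq_esym[of p xs, OF assms] esym_fps_top[of xs] by simp

subsection \<open>Sums over roots depending on parameters\<close>

text \<open>The argument principle with a weight. The list \<open>ts\<close> repeats each zero
  according to its multiplicity and is the same for all weights \<open>h\<close>.\<close>

lemma roots_in_disc:
  assumes S: "open S" "cball \<tau> \<eta> \<subseteq> S" "\<eta> > 0" and g: "g holomorphic_on S"
    and nz: "\<And>t. t \<in> sphere \<tau> \<eta> \<Longrightarrow> g t \<noteq> 0"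
  obtains ts where "set ts = {t\<in>ball \<tau> \<eta>. g t = 0}"
    "\<And>h. h holomorphic_on S \<Longrightarrow>
      contour_integral (circlepath \<tau> \<eta>) (\<lambda>t. deriv g t * h t / g t) = 2 * pi * \<i> * (\<Sum>t\<leftarrow>ts. h t)"
proof -
  \<comment> \<open>The argument principle asks for an open set around the closed disc. A slightly
    larger disc inside \<open>S\<close> is found first; \<open>e2\<close> below then shrinks it
    until it has no zeros besides those inside the circle.\<close>
  obtain e where e: "e > 0" "{x. infdist x (cball \<tau> \<eta>) \<le> e} \<subseteq> S"
    using compact_in_open_separated[of "cball \<tau> \<eta>" S] S by auto
  define S' where "S' = ball \<tau> (\<eta> + e)"
  have S'S: "S' \<subseteq> S"
  proof
    fix x assume x: "x \<in> S'"
    show "x \<in> S"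
    proof (cases "x \<in> cball \<tau> \<eta>")
      case False
      define y where "y = \<tau> + (\<eta> / dist \<tau> x) *\<^sub>R (x - \<tau>)"
      have dp: "dist \<tau> x > \<eta>" using False by simp
      have "x \<noteq> \<tau>" using dp S(3) by auto
      then have "dist \<tau> y = \<eta>" using dp S(3) by (simp add: y_def dist_norm norm_minus_commute)
      moreover have "x - y = (1 - \<eta> / dist \<tau> x) *\<^sub>R (x - \<tau>)" by (simp add: y_def algebra_simps)
      then have "dist x y = \<bar>1 - \<eta> / dist \<tau> x\<bar> * dist \<tau> x" by (simp add: dist_norm norm_minus_commute)
      moreover have "\<dots> = dist \<tau> x - \<eta>" using dp S(3) \<open>x \<noteq> \<tau>\<close> by (simp add: field_simps abs_if)
      ultimately have "infdist x (cball \<tau> \<eta>) \<le> e"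
        using x infdist_le[of y "cball \<tau> \<eta>" x] by (simp add: S'_def)
      then show ?thesis using e by blast
    qed (use S in auto)
  qed
  have "open S'" "connected S'" by (auto simp: S'_def)
  have gS': "g holomorphic_on S'" using g S'S holomorphic_on_subset by blast
  have sub: "cball \<tau> \<eta> \<subseteq> S'" using e by (auto simp: S'_def)
  have nc: "\<not> g constant_on S'" if "t0 \<in> cball \<tau> \<eta>" "g t0 = 0" for t0
  proof
    assume "g constant_on S'"
    moreover have "\<tau> + of_real \<eta> \<in> sphere \<tau> \<eta>" using S(3) by (simp add: dist_norm)
    moreover from this have "\<tau> + of_real \<eta> \<in> S'" using sub by auto
    ultimately show False using nz that sub unfolding constant_on_def by (metis subsetD)
  qed
  have fin: "finite {t\<in>cball \<tau> \<eta>. g t = 0}"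
  proof (cases "\<exists>t0\<in>cball \<tau> \<eta>. g t0 = 0")
    case True
    then show ?thesis
      using holomorphic_compact_finite_zeros[OF gS' \<open>open S'\<close> \<open>connected S'\<close> compact_cball sub] nc by blast
  next
    case False
    then have "{t\<in>cball \<tau> \<eta>. g t = 0} = {}" by blast
    then show ?thesis by (simp only: finite.emptyI)
  qed
  define R where "R = {t\<in>ball \<tau> \<eta>. g t = 0}"
  have finR: "finite R" using fin by (rule finite_subset[rotated]) (auto simp: R_def)
  obtain e2 where e2: "e2 > 0" "e2 \<le> e" "\<And>t. t \<in> ball \<tau> (\<eta> + e2) \<Longrightarrow> g t = 0 \<Longrightarrow> t \<in> R"
  proof -
    have oN: "open (S' \<inter> {t. t \<in> S' \<and> g t \<noteq> 0})"
      using holomorphic_on_imp_continuous_on[OF gS'] \<open>open S'\<close>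
        continuous_open_preimage[of S' g "- {0}"] by (auto simp: Int_def vimage_def conj_commute)
    have "compact (sphere \<tau> \<eta>)" by simp
    moreover have "sphere \<tau> \<eta> \<subseteq> S' \<inter> {t. t \<in> S' \<and> g t \<noteq> 0}" using nz sub by auto
    moreover have "sphere \<tau> \<eta> \<noteq> {}" using S(3) by simp
    ultimately obtain d where d: "d > 0" "{x. infdist x (sphere \<tau> \<eta>) \<le> d} \<subseteq> S' \<inter> {t. t \<in> S' \<and> g t \<noteq> 0}"
      using compact_in_open_separated[of "sphere \<tau> \<eta>"] oN by blast
    show ?thesis
    proof (rule that[of "min e d"])
      fix t assume t: "t \<in> ball \<tau> (\<eta> + min e d)" "g t = 0"
      show "t \<in> R"
      proof (rule ccontr)
        assume "t \<notin> R"
        then have dp: "dist \<tau> t \<ge> \<eta>" using t by (auto simp: R_def)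
        define y where "y = \<tau> + (\<eta> / dist \<tau> t) *\<^sub>R (t - \<tau>)"
        have "t \<noteq> \<tau>" using dp S(3) by auto
        then have "dist \<tau> y = \<eta>" using dp S(3) by (simp add: y_def dist_norm norm_minus_commute)
        moreover have "t - y = (1 - \<eta> / dist \<tau> t) *\<^sub>R (t - \<tau>)" by (simp add: y_def algebra_simps)
        then have "dist t y = \<bar>1 - \<eta> / dist \<tau> t\<bar> * dist \<tau> t" by (simp add: dist_norm norm_minus_commute)
        moreover have "\<dots> = dist \<tau> t - \<eta>" using dp S(3) \<open>t \<noteq> \<tau>\<close> by (simp add: field_simps abs_if)
        ultimately have "infdist t (sphere \<tau> \<eta>) \<le> d"
          using t infdist_le[of y "sphere \<tau> \<eta>" t] by simp
        then show False using d t by blast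
      qed
    qed (use e d in auto)
  qed
  define T where "T = ball \<tau> (\<eta> + e2)"
  have TS: "T \<subseteq> S" using S'S e2 unfolding T_def S'_def by (meson add_left_mono order_trans subset_ball)
  have RT: "{w\<in>T. g w = 0} = R" using e2 by (auto simp: T_def R_def)
  have zpos: "zorder g t > 0" if "t \<in> R" for t
  proof -
    have an: "g analytic_on {t}" 
    proof -
      have "t \<in> S" using that S(2) by (auto simp: R_def)
      then show ?thesis using S(1) g unfolding analytic_at by blast
    qed
    have "\<exists>\<^sub>F z in at t. g z \<noteq> 0"
    proof -
      obtain \<beta> where \<beta>: "\<beta> \<in> S'" "g \<beta> \<noteq> 0"
      proof -
        have "\<tau> + of_real \<eta> \<in> sphere \<tau> \<eta>" "\<tau> + of_real \<eta> \<in> cball \<tau> \<eta>"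
          using S(3) by (auto simp: dist_norm)
        then show ?thesis using that[of "\<tau> + of_real \<eta>"] nz sub by blast
      qed
      have tS': "t \<in> S'" "g t = 0" using that sub by (auto simp: R_def)
      obtain r where r: "r > 0" "ball t r \<subseteq> S'" "\<And>z. z \<in> ball t r - {t} \<Longrightarrow> g z \<noteq> 0"
        using isolated_zeros[OF gS' \<open>open S'\<close> \<open>connected S'\<close> tS' \<beta>] by metis
      have "\<forall>\<^sub>F z in at t. g z \<noteq> 0"
        unfolding eventually_at using r by (intro exI[of _ r]) (auto simp: dist_commute)
      then show ?thesis using eventually_frequently at_neq_bot by blast
    qed
    then show ?thesis using zorder_pos_iff'[OF an] that by (simp add: R_def)
  qed
  obtain rs where rs: "set rs = R" "distinct rs" using finite_distinct_list[OF finR] by blast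
  \<comment> \<open>\<open>zorder\<close> is the multiplicity. It is positive at each zero because
    \<open>g\<close> does not vanish identically on the disc \<open>S'\<close>.\<close>
  define ts where "ts = concat (map (\<lambda>t. replicate (nat (zorder g t)) t) rs)"
  have "set (replicate (nat (zorder g t)) t) = {t}" if "t \<in> R" for t
    using zpos[OF that] by (intro set_replicate) simp
  then have "set ts = R" using rs by (auto simp: ts_def simp del: set_replicate_conv_if)
  moreover have "contour_integral (circlepath \<tau> \<eta>) (\<lambda>t. deriv g t * h t / g t) = 2 * pi * \<i> * (\<Sum>t\<leftarrow>ts. h t)"
    if h: "h holomorphic_on S" for h
  proof -
    have "contour_integral (circlepath \<tau> \<eta>) (\<lambda>t. deriv g t * h t / g t) =
      2 * pi * \<i> * (\<Sum>p\<in>{w\<in>T. g w = 0 \<or> w \<in> {}}. winding_number (circlepath \<tau> \<eta>) p * h p * zorder g p)"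
    proof (rule argument_principle)
      show "path_image (circlepath \<tau> \<eta>) \<subseteq> T - {w \<in> T. g w = 0 \<or> w \<in> {}}"
        using nz e2(1) S(3) by (auto simp: T_def)
      show "\<forall>z. z \<notin> T \<longrightarrow> winding_number (circlepath \<tau> \<eta>) z = 0"
        using e2(1) S(3) by (intro allI impI winding_number_zero_outside[of _ "cball \<tau> \<eta>"]) (auto simp: T_def)
      show "finite {w \<in> T. g w = 0 \<or> w \<in> {}}" using finR RT by simp
    qed (use g h TS in \<open>auto simp: T_def intro: holomorphic_on_subset\<close>)
    also have "{w\<in>T. g w = 0 \<or> w \<in> {}} = R" using RT by simp
    also have "(\<Sum>p\<in>R. winding_number (circlepath \<tau> \<eta>) p * h p * zorder g p) = (\<Sum>p\<in>R. h p * zorder g p)"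
      by (intro sum.cong refl) (simp add: R_def winding_number_circlepath dist_norm norm_minus_commute)
    also have "\<dots> = (\<Sum>p\<leftarrow>rs. h p * zorder g p)"
      using rs by (simp add: sum_list_distinct_conv_sum_set)
    also have "\<dots> = (\<Sum>t\<leftarrow>ts. h t)"
    proof -
      have "(\<Sum>p\<leftarrow>xs. h p * zorder g p) = (\<Sum>t\<leftarrow>concat (map (\<lambda>t. replicate (nat (zorder g t)) t) xs). h t)"
        if "set xs \<subseteq> R" for xs
        using that
      proof (induction xs)
        case (Cons x xs)
        have "zorder g x > 0" using zpos Cons by simp
        then have "of_nat (nat (zorder g x)) = (of_int (zorder g x) :: complex)" by simp
        then show ?case using Cons by (simp add: sum_list_replicate mult.commute)
      qed simp
      then show ?thesis using rs by (simp add: ts_def)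
    qed
    finally show ?thesis .
  qed
  ultimately show ?thesis using that unfolding R_def by blast
qed

text \<open>By the argument principle this is the sum of \<open>q\<close> over the zeros of
  \<open>g\<close> in the j-th coordinate inside the circle, with multiplicities
  (\<open>root_sum_eq\<close>). The integral form shows that it is holomorphic in
  \<open>z\<close>.\<close>

definition root_sum :: "'n \<Rightarrow> complex \<Rightarrow> real \<Rightarrow> (complex^'n \<Rightarrow> complex) \<Rightarrow> (complex^'n \<Rightarrow> complex) \<Rightarrow> complex^'n \<Rightarrow> complex" where
  "root_sum j \<tau> \<eta> g q z = contour_integral (circlepath \<tau> \<eta>) (\<lambda>t. pd j g (upd z j t) * q (upd z j t) / g (upd z j t)) / (2 * pi * \<i>)"

lemma root_sum_eq:
  assumes S: "\<And>t. t \<in> cball \<tau> \<eta> \<Longrightarrow> upd z j t \<in> U" "\<eta> > 0" and g: "holo_on g U"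
    and nz: "\<And>t. t \<in> sphere \<tau> \<eta> \<Longrightarrow> g (upd z j t) \<noteq> 0"
  obtains ts where "set ts = {t\<in>ball \<tau> \<eta>. g (upd z j t) = 0}"
    "\<And>q. holo_on q U \<Longrightarrow> root_sum j \<tau> \<eta> g q z = (\<Sum>t\<leftarrow>ts. q (upd z j t))"
proof -
  define S where "S = {t. upd z j t \<in> U}"
  have oS: "open S"
    unfolding S_def using holo_on_open[OF g] by (intro open_vimage[unfolded vimage_def] continuous_intros)
  have sub: "cball \<tau> \<eta> \<subseteq> S" using assms(1) by (auto simp: S_def)
  have hol: "(\<lambda>t. q (upd z j t)) holomorphic_on S" if "holo_on q U" for q
    by (rule holo_on_holomorphic_upd[OF that]) (simp add: S_def)
  obtain ts where ts: "set ts = {t\<in>ball \<tau> \<eta>. g (upd z j t) = 0}"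
    "\<And>h. h holomorphic_on S \<Longrightarrow>
      contour_integral (circlepath \<tau> \<eta>) (\<lambda>t. deriv (\<lambda>t. g (upd z j t)) t * h t / g (upd z j t)) = 2 * pi * \<i> * (\<Sum>t\<leftarrow>ts. h t)"
    by (rule roots_in_disc[OF oS sub assms(2) hol[OF g] nz]) blast+
  show ?thesis
  proof (rule that[OF ts(1)])
    fix q assume q: "holo_on q U"
    have "pd j g (upd z j t) = deriv (\<lambda>t. g (upd z j t)) t" for t by (simp add: pd_def)
    then have "root_sum j \<tau> \<eta> g q z = (2 * pi * \<i> * (\<Sum>t\<leftarrow>ts. q (upd z j t))) / (2 * pi * \<i>)"
      using ts(2)[OF hol[OF q]] by (simp add: root_sum_def)
    then show "root_sum j \<tau> \<eta> g q z = (\<Sum>t\<leftarrow>ts. q (upd z j t))" by simp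
  qed
qed

lemma holo_on_root_sum:
  assumes V: "open V" and S: "\<And>z t. z \<in> V \<Longrightarrow> t \<in> sphere \<tau> \<eta> \<Longrightarrow> upd z j t \<in> U" "\<eta> > 0" 
    and g: "holo_on g U" and q: "holo_on q U"
    and nz: "\<And>z t. z \<in> V \<Longrightarrow> t \<in> sphere \<tau> \<eta> \<Longrightarrow> g (upd z j t) \<noteq> 0"
  shows "holo_on (root_sum j \<tau> \<eta> g q) V"
proof -
  define c where "c t = \<tau> + of_real \<eta> * ucirc t" for t
  define c' where "c' t = 2 * pi * \<i> * \<eta> * ucirc t" for t
  have csph: "c t \<in> sphere \<tau> \<eta>" for t using S(2) by (simp add: c_def dist_norm norm_mult)
  have "holo_on (\<lambda>z. integral {0..1} (\<lambda>t. pd j g (upd z j (c t)) * q (upd z j (c t)) / g (upd z j (c t)) * c' t)) V"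
  proof (rule holo_on_integral[OF V])
    have cont: "continuous_on (V \<times> {0..1}) (\<lambda>p. f (upd (fst p) j (c (snd p))))" if "holo_on f U" for f
      unfolding c_def
      by (rule continuous_on_compose2[OF holo_on_continuous[OF that]])
         (use S(1) csph in \<open>auto intro!: continuous_intros simp: c_def\<close>)
    show "continuous_on (V \<times> {0..1}) (\<lambda>(z, t). pd j g (upd z j (c t)) * q (upd z j (c t)) / g (upd z j (c t)) * c' t)"
      unfolding split_beta c'_def
      by (intro continuous_intros cont g q holo_on_pd) (use nz csph in auto)
    fix t :: real
    have h: "holo_on (\<lambda>z. f (upd z j (c t))) V" if "holo_on f U" for f
      by (rule holo_on_compose[OF that V]) (use S csph in \<open>auto simp del: upd_nth intro!: holo_on_upd V\<close>)
    show "holo_on (\<lambda>z. pd j g (upd z j (c t)) * q (upd z j (c t)) / g (upd z j (c t)) * c' t) V"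
      using nz csph V by (intro holo_intros h g q holo_on_pd) auto
  qed
  then have "holo_on (\<lambda>z. integral {0..1} (\<lambda>t. pd j g (upd z j (c t)) * q (upd z j (c t)) / g (upd z j (c t)) * c' t) / (2 * pi * \<i>)) V"
    by (intro holo_on_divide holo_on_const V) auto
  moreover have "circlepath \<tau> \<eta> t = c t" for t
    by (simp add: circlepath c_def mult.commute mult.left_commute)
  moreover have "vector_derivative (circlepath \<tau> \<eta>) (at t) = c' t" for t
    by (simp add: vector_derivative_circlepath c'_def mult.commute mult.left_commute)
  ultimately show ?thesis
    by (simp add: root_sum_def[abs_def] contour_integral_integral)
qed

text \<open>The number of roots is \<open>root_sum\<close> with weight 1, a continuous function with
  integer values on a connected set.\<close>

lemma root_count_constant:
  assumes V: "open V" "connected V" and S: "\<And>z t. z \<in> V \<Longrightarrow> t \<in> cball \<tau> \<eta> \<Longrightarrow> upd z j t \<in> U" "\<eta> > 0" 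
    and g: "holo_on g U" and nz: "\<And>z t. z \<in> V \<Longrightarrow> t \<in> sphere \<tau> \<eta> \<Longrightarrow> g (upd z j t) \<noteq> 0"
  obtains e :: nat where
    "\<And>z. z \<in> V \<Longrightarrow> \<exists>ts. length ts = e \<and> set ts = {t\<in>ball \<tau> \<eta>. g (upd z j t) = 0} \<and>
       (\<forall>q. holo_on q U \<longrightarrow> root_sum j \<tau> \<eta> g q z = (\<Sum>t\<leftarrow>ts. q (upd z j t)))"
proof (cases "V = {}")
  case False
  then obtain z0 where z0: "z0 \<in> V" by blast
  define N where "N = root_sum j \<tau> \<eta> g (\<lambda>_. 1)"
  have one: "holo_on (\<lambda>_. 1) U" using g holo_on_open by (auto intro: holo_on_const)
  have ex: "\<exists>ts. set ts = {t\<in>ball \<tau> \<eta>. g (upd z j t) = 0} \<and> 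
     (\<forall>q. holo_on q U \<longrightarrow> root_sum j \<tau> \<eta> g q z = (\<Sum>t\<leftarrow>ts. q (upd z j t)))" if "z \<in> V" for z
    by (rule root_sum_eq[OF S(1)[OF that] S(2) g nz[OF that]]) blast+
  have N: "N z = of_nat (length ts)" if "\<forall>q. holo_on q U \<longrightarrow> root_sum j \<tau> \<eta> g q z = (\<Sum>t\<leftarrow>ts. q (upd z j t))" for z ts
    using that one by (auto simp: N_def sum_list_triv)
  have Nnat: "\<exists>m::nat. N z = of_nat m" if "z \<in> V" for z
    using ex[OF that] N[of z] by blast
  have "N constant_on V"
  proof (rule continuous_discrete_range_constant[OF V(2)])
    show "continuous_on V N"
      unfolding N_def by (rule holo_on_continuous[OF holo_on_root_sum[OF V(1) _ S(2) g one nz]]) (use S in auto)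
    fix x assume x: "x \<in> V"
    show "\<exists>e>0. \<forall>y. y \<in> V \<and> N y \<noteq> N x \<longrightarrow> e \<le> norm (N y - N x)"
    proof (intro exI[of _ 1] conjI allI impI)
      fix y assume y: "y \<in> V \<and> N y \<noteq> N x"
      obtain m where m: "N x = of_nat m" using Nnat[OF x] by blast
      obtain n where n: "N y = of_nat n" using Nnat[of y] y by blast
      note mn = m n
      then have "norm (N y - N x) = \<bar>real n - real m\<bar>"
        using norm_of_real[of "real n - real m", where 'a=complex] mn by simp
      moreover have "n \<noteq> m" using mn y by auto
      ultimately show "1 \<le> norm (N y - N x)" by linarith
    qed simp
  qed
  then obtain c where c: "\<And>z. z \<in> V \<Longrightarrow> N z = c" unfolding constant_on_def by blast
  obtain e :: nat where e: "c = of_nat e" using c[OF z0] Nnat[OF z0] by auto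
  show ?thesis
  proof (rule that[of e])
    fix z assume z: "z \<in> V"
    obtain ts where ts: "set ts = {t\<in>ball \<tau> \<eta>. g (upd z j t) = 0}"
     "\<forall>q. holo_on q U \<longrightarrow> root_sum j \<tau> \<eta> g q z = (\<Sum>t\<leftarrow>ts. q (upd z j t))" using ex[OF z] by blast
    have "of_nat (length ts) = (of_nat e :: complex)" using N[OF ts(2)] c[OF z] e by simp
    then show "\<exists>ts. length ts = e \<and> set ts = {t\<in>ball \<tau> \<eta>. g (upd z j t) = 0} \<and>
       (\<forall>q. holo_on q U \<longrightarrow> root_sum j \<tau> \<eta> g q z = (\<Sum>t\<leftarrow>ts. q (upd z j t)))"
      using ts of_nat_eq_iff by blast
  qed
qed (use that in blast)

subsection \<open>Projections of analytic sets\<close>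

text \<open>A Weierstrass situation: above each point of \<open>U\<close> the function
  \<open>g\<close> has no zeros on the circle of radius \<epsilon> in direction \<open>j\<close>.
  The projection along \<open>j\<close> is kept as a subset of the same space, invariant in that
  direction inside \<open>U\<close>, so that codimensions before and after can be compared
  directly.\<close>

locale projection =
  fixes j :: "'n::finite" and \<epsilon> :: real and U1 U :: "(complex^'n) set"
    and F :: "(complex^'n \<Rightarrow> complex) set" and g :: "complex^'n \<Rightarrow> complex"
  assumes eps: "\<epsilon> > 0" and openU: "open U" and connU: "connected U"
    and cyl: "\<And>z t. z \<in> U \<Longrightarrow> t \<in> cball 0 \<epsilon> \<Longrightarrow> upd z j t \<in> U1"
    and cylU: "\<And>z t. z \<in> U \<Longrightarrow> t \<in> ball 0 \<epsilon> \<Longrightarrow> upd z j t \<in> U"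
    and nthU: "\<And>z. z \<in> U \<Longrightarrow> z $ j \<in> ball 0 \<epsilon>"
    and finF: "finite F" and hol: "\<And>q. q \<in> F \<Longrightarrow> holo_on q U1" and gF: "g \<in> F"
    and nz: "\<And>z t. z \<in> U \<Longrightarrow> t \<in> sphere 0 \<epsilon> \<Longrightarrow> g (upd z j t) \<noteq> 0"
begin

definition "proj = {z\<in>U. \<exists>t\<in>ball 0 \<epsilon>. \<forall>q\<in>F. q (upd z j t) = 0}"

lemma subU1: "U \<subseteq> U1"
proof
  fix z assume "z \<in> U"
  then have "upd z j (z $ j) \<in> U1" using nthU[of z] by (intro cyl) auto
  then show "z \<in> U1" by simp
qed

text \<open>The equations are norms: for a number s, the product over the roots of \<open>g\<close>
  of the combination \<open>G s\<close> of the functions in \<open>F\<close> with coefficients s^l.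
  All norms vanish over the projection. Elsewhere each root leaves a nonzero polynomial in s, so
  among enough values of s one gives a nonzero norm. The last clause says that the norms inherit
  from \<open>F\<close> its independence of other coordinates.\<close>

lemma proj_functions:
  "\<exists>F'. finite F' \<and> (\<forall>f\<in>F'. holo_on f U) \<and> {z\<in>U. \<forall>f\<in>F'. f z = 0} = proj \<and>
    (\<forall>f\<in>F'. \<forall>z\<in>U. \<forall>z'\<in>U.
       (\<forall>q\<in>F. \<forall>t. upd z j t \<in> U1 \<longrightarrow> upd z' j t \<in> U1 \<longrightarrow> q (upd z j t) = q (upd z' j t)) \<longrightarrow> f z = f z')"
proof -
  have openU1: "open U1" using hol[OF gF] holo_on_open by blast
  obtain e where e: "\<And>z. z \<in> U \<Longrightarrow> \<exists>ts. length ts = e \<and> set ts = {t\<in>ball 0 \<epsilon>. g (upd z j t) = 0} \<and>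
       (\<forall>q. holo_on q U1 \<longrightarrow> root_sum j 0 \<epsilon> g q z = (\<Sum>t\<leftarrow>ts. q (upd z j t)))"
    by (rule root_count_constant[OF openU connU cyl eps hol[OF gF] nz]) blast+
  obtain gs where gs: "set gs = F" using finite_list[OF finF] by blast
  define n where "n = length gs"
  define G where "G s z = (\<Sum>l<n. of_nat s ^ l * (gs ! l) z)" for s :: nat and z
  define N where "N s z = newton (\<lambda>k. root_sum j 0 \<epsilon> g (\<lambda>z. G s z ^ k) z) e" for s z
  have holG: "holo_on (G s) U1" for s
    unfolding G_def[abs_def] using hol gs openU1 by (intro holo_intros) (auto simp: n_def)
  have Neq: "N s z = (\<Prod>t\<leftarrow>ts. G s (upd z j t))"
    if "length ts = e" "\<forall>q. holo_on q U1 \<longrightarrow> root_sum j 0 \<epsilon> g q z = (\<Sum>t\<leftarrow>ts. q (upd z j t))" for s z ts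
  proof -
    define xs where "xs = map (\<lambda>t. G s (upd z j t)) ts"
    have "newton (\<lambda>k. root_sum j 0 \<epsilon> g (\<lambda>z. G s z ^ k) z) (length xs) = prod_list xs"
    proof (rule newton_length)
      fix k
      show "root_sum j 0 \<epsilon> g (\<lambda>z. G s z ^ Suc k) z = (\<Sum>x\<leftarrow>xs. x ^ Suc k)"
        using that(2)[rule_format, OF holo_on_power[OF holG[of s], of "Suc k"]] by (simp add: xs_def o_def)
    qed
    then show ?thesis using that(1) by (simp add: N_def xs_def)
  qed
  \<comment> \<open>There are at most \<open>e\<close> distinct roots, and each excludes at most
    \<open>n\<close> values of \<open>s\<close>; one of the \<open>e * n + 1\<close> values
    therefore survives.\<close>
  define F' where "F' = N ` {..e * n}"
  show ?thesis
  proof (intro exI[of _ F'] conjI ballI impI)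
    show "finite F'" by (simp add: F'_def)
    fix f assume "f \<in> F'"
    then obtain s where f: "f = N s" by (auto simp: F'_def)
    have "holo_on (root_sum j 0 \<epsilon> g (\<lambda>z. G s z ^ k)) U" for k
      by (rule holo_on_root_sum[OF openU _ eps hol[OF gF] holo_on_power[OF holG] nz]) (use cyl in auto)
    then show "holo_on f U"
      unfolding f N_def[abs_def] by (intro holo_on_newton openU)
  next
    fix f z z' assume "f \<in> F'" and z: "z \<in> U" "z' \<in> U"
      and eq': "\<forall>q\<in>F. \<forall>t. upd z j t \<in> U1 \<longrightarrow> upd z' j t \<in> U1 \<longrightarrow> q (upd z j t) = q (upd z' j t)"
    have eq: "q (upd z j t) = q (upd z' j t)" if "q \<in> F" "upd z j t \<in> U1" "upd z' j t \<in> U1" for q t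
      using eq' that by blast
    obtain s where f: "f = N s" using \<open>f \<in> F'\<close> by (auto simp: F'_def)
    have "root_sum j 0 \<epsilon> g (\<lambda>z. G s z ^ k) z = root_sum j 0 \<epsilon> g (\<lambda>z. G s z ^ k) z'" for k
    proof -
      have "contour_integral (circlepath 0 \<epsilon>) (\<lambda>t. pd j g (upd z j t) * G s (upd z j t) ^ k / g (upd z j t)) =
        contour_integral (circlepath 0 \<epsilon>) (\<lambda>t. pd j g (upd z' j t) * G s (upd z' j t) ^ k / g (upd z' j t))"
    proof (rule contour_integral_eq)
      fix t assume "t \<in> path_image (circlepath 0 \<epsilon>)"
      then have t: "t \<in> cball 0 \<epsilon>" using eps by auto
      have tU: "upd z j t \<in> U1" "upd z' j t \<in> U1" using cyl t z by auto
      have o: "open {t. upd z j t \<in> U1 \<and> upd z' j t \<in> U1}"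
        using openU1 by (intro open_Collect_conj open_vimage[unfolded vimage_def] continuous_intros)
      have "\<forall>\<^sub>F s in nhds t. g (upd z j s) = g (upd z' j s)"
        unfolding eventually_nhds using o tU eq[OF gF]
        by (intro exI[of _ "{t. upd z j t \<in> U1 \<and> upd z' j t \<in> U1}"]) auto
      then have "deriv (\<lambda>s. g (upd z j s)) t = deriv (\<lambda>s. g (upd z' j s)) t"
        by (intro deriv_cong_ev) auto
      then have "pd j g (upd z j t) = pd j g (upd z' j t)" by (simp add: pd_def)
      moreover have "G s (upd z j t) = G s (upd z' j t)"
        unfolding G_def using eq[OF _ tU] gs by (intro sum.cong) (auto simp: n_def)
      ultimately show "pd j g (upd z j t) * G s (upd z j t) ^ k / g (upd z j t) =
         pd j g (upd z' j t) * G s (upd z' j t) ^ k / g (upd z' j t)"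
        using eq[OF gF tU] by simp
    qed
      then show ?thesis by (simp add: root_sum_def)
    qed
    then have "newton (\<lambda>k. root_sum j 0 \<epsilon> g (\<lambda>z. G s z ^ k) z) e = newton (\<lambda>k. root_sum j 0 \<epsilon> g (\<lambda>z. G s z ^ k) z') e"
      by (rule newton_cong)
    then have "f z = f z'" by (simp add: f N_def)
    then show "f z = f z'" .
  next
    show "{z\<in>U. \<forall>f\<in>F'. f z = 0} = proj"
    proof (intro Set.set_eqI)
      fix z
      show "z \<in> {z\<in>U. \<forall>f\<in>F'. f z = 0} \<longleftrightarrow> z \<in> proj"
      proof (cases "z \<in> U")
        case True
        obtain ts where ts: "length ts = e" "set ts = {t\<in>ball 0 \<epsilon>. g (upd z j t) = 0}"
         "\<forall>q. holo_on q U1 \<longrightarrow> root_sum j 0 \<epsilon> g q z = (\<Sum>t\<leftarrow>ts. q (upd z j t))" using e[OF True] by blast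
        have N0: "N s z = 0 \<longleftrightarrow> (\<exists>t\<in>set ts. G s (upd z j t) = 0)" for s
          unfolding Neq[OF ts(1,3)] by (auto simp: prod_list_zero_iff)
        show ?thesis
        proof
          assume "z \<in> proj"
          then obtain t where t: "t \<in> ball 0 \<epsilon>" "\<forall>q\<in>F. q (upd z j t) = 0" by (auto simp: proj_def)
          then have "t \<in> set ts" using ts(2) gF by blast
          moreover have "G s (upd z j t) = 0" for s
            unfolding G_def using t(2) gs by (intro sum.neutral) (auto simp: n_def)
          ultimately show "z \<in> {z\<in>U. \<forall>f\<in>F'. f z = 0}" using True N0 by (auto simp: F'_def)
        next
          assume "z \<in> {z\<in>U. \<forall>f\<in>F'. f z = 0}"
          then have all: "\<exists>t\<in>set ts. G s (upd z j t) = 0" if "s \<le> e * n" for s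
            using N0 that by (auto simp: F'_def)
          have "\<exists>t\<in>set ts. \<forall>q\<in>F. q (upd z j t) = 0"
          proof (rule ccontr)
            assume none: "\<not> (\<exists>t\<in>set ts. \<forall>q\<in>F. q (upd z j t) = 0)"
            have small: "finite {s. G s (upd z j t) = 0} \<and> card {s. G s (upd z j t) = 0} \<le> n" if t: "t \<in> set ts" for t
            proof -
              define P where "P = (\<Sum>l<n. monom ((gs ! l) (upd z j t)) l)"
              have cf: "coeff P l = (if l < n then (gs ! l) (upd z j t) else 0)" for l
                by (simp add: P_def coeff_sum)
              obtain q where "q \<in> F" "q (upd z j t) \<noteq> 0" using none t by blast
              then obtain l where "l < n" "(gs ! l) (upd z j t) \<noteq> 0" using gs by (auto simp: n_def in_set_conv_nth)
              then have P0: "P \<noteq> 0" using cf[of l] by auto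
              have "degree P \<le> n" using cf by (intro degree_le) auto
              have pv: "poly P (of_nat s) = G s (upd z j t)" for s
                by (simp add: P_def G_def poly_sum poly_monom mult.commute)
              have sub: "of_nat ` {s. G s (upd z j t) = 0} \<subseteq> {x. poly P x = 0}" using pv by auto
              have inj: "inj_on (of_nat :: nat \<Rightarrow> complex) {s. G s (upd z j t) = 0}" by (simp add: inj_on_def)
              have "finite {s. G s (upd z j t) = 0}"
                using finite_imageD[OF finite_subset[OF sub poly_roots_finite[OF P0]] inj] .
              moreover have "card {s. G s (upd z j t) = 0} \<le> card {x. poly P x = 0}"
                using card_mono[OF poly_roots_finite[OF P0] sub] card_image[OF inj] by simp
              ultimately show ?thesis using card_poly_roots_bound[OF P0] \<open>degree P \<le> n\<close> by simp
            qed
            have "{..e * n} \<subseteq> (\<Union>t\<in>set ts. {s. G s (upd z j t) = 0})" using all by auto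
            then have "card {..e * n} \<le> card (\<Union>t\<in>set ts. {s. G s (upd z j t) = 0})"
              using small by (intro card_mono) auto
            also have "\<dots> \<le> (\<Sum>t\<in>set ts. card {s. G s (upd z j t) = 0})" by (rule card_UN_le) simp
            also have "\<dots> \<le> (\<Sum>t\<in>set ts. n)" using small by (intro sum_mono) auto
            also have "\<dots> \<le> e * n" using card_length[of ts] ts(1) by simp
            finally show False by simp
          qed
          then show "z \<in> proj" using True ts(2) by (auto simp: proj_def)
        qed
      qed (auto simp: proj_def)
    qed
  qed
qed

end

text \<open>A finite Baire argument: if one set of the cover does not contain all of
  \<open>S\<close>, pass to a nonempty open part of \<open>S\<close> that misses it and continue
  with the other sets.\<close>

lemma finite_closed_cover:
  assumes "finite I" "S \<noteq> {}" "S \<subseteq> (\<Union>i\<in>I. C i)"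
    and "\<And>i z. i \<in> I \<Longrightarrow> z \<in> S \<Longrightarrow> z \<notin> C i \<Longrightarrow> \<exists>V. open V \<and> z \<in> V \<and> S \<inter> V \<inter> C i = {}"
  shows "\<exists>i\<in>I. \<exists>V. open V \<and> S \<inter> V \<noteq> {} \<and> S \<inter> V \<subseteq> C i"
  using assms
proof (induction I arbitrary: S rule: finite_induct)
  case (insert i I)
  show ?case
  proof (cases "S \<subseteq> C i")
    case True
    then show ?thesis using insert by (intro bexI[of _ i] exI[of _ UNIV]) auto
  next
    case False
    then obtain z where z: "z \<in> S" "z \<notin> C i" by blast
    obtain V where V: "open V" "z \<in> V" "S \<inter> V \<inter> C i = {}" using insert.prems(3)[OF _ z] by blast
    have "\<exists>k\<in>I. \<exists>V'. open V' \<and> (S \<inter> V) \<inter> V' \<noteq> {} \<and> (S \<inter> V) \<inter> V' \<subseteq> C k"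
    proof (rule insert.IH)
      show "S \<inter> V \<noteq> {}" using z V by blast
      show "S \<inter> V \<subseteq> (\<Union>i\<in>I. C i)" using insert.prems(2) V by blast
      fix k y assume k: "k \<in> I" "y \<in> S \<inter> V" "y \<notin> C k"
      then obtain V' where "open V'" "y \<in> V'" "S \<inter> V' \<inter> C k = {}" using insert.prems(3)[of k y] by blast
      then show "\<exists>V'. open V' \<and> y \<in> V' \<and> S \<inter> V \<inter> V' \<inter> C k = {}" by blast
    qed
    then obtain k V' where "k \<in> I" "open V'" "(S \<inter> V) \<inter> V' \<noteq> {}" "(S \<inter> V) \<inter> V' \<subseteq> C k" by blast
    then show ?thesis using V(1) by (intro bexI[of _ k] exI[of _ "V \<inter> V'"]) auto
  qed
qed auto

context projection
begin

lemma proj_cylinder: "z \<in> proj \<Longrightarrow> upd z j t \<in> U \<Longrightarrow> upd z j t \<in> proj"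
  by (auto simp: proj_def)

text \<open>Compactness of the circle turns nonvanishing over \<open>a\<close> into nonvanishing
  over a whole ball.\<close>

lemma sphere_avoid:
  assumes a: "a \<in> U" "open V" "a \<in> V" "V \<subseteq> U" and \<eta>: "\<eta> > 0" "cball \<tau> \<eta> \<subseteq> ball 0 \<epsilon>"
    and nzs: "\<And>t. t \<in> sphere \<tau> \<eta> \<Longrightarrow> g (upd a j t) \<noteq> 0"
  obtains d where "d > 0" "ball a d \<subseteq> V" "\<And>z t. z \<in> ball a d \<Longrightarrow> t \<in> sphere \<tau> \<eta> \<Longrightarrow> g (upd z j t) \<noteq> 0"
proof -
  define C where "C = (\<lambda>t. upd a j t) ` sphere \<tau> \<eta>"
  have "compact C" unfolding C_def by (intro compact_continuous_image continuous_intros) simp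
  have holg: "holo_on g U" using holo_on_subset[OF hol[OF gF] openU subU1] .
  define N where "N = U \<inter> {z. z \<in> U \<and> g z \<noteq> 0}"
  have "open N"
    unfolding N_def using holo_on_continuous[OF holg] openU continuous_open_preimage[of U g "- {0}"]
    by (auto simp: Int_def vimage_def conj_commute)
  have "sphere \<tau> \<eta> \<noteq> {}" using \<eta> by simp
  then have "C \<noteq> {}" by (auto simp: C_def)
  have "C \<subseteq> N"
  proof
    fix x assume "x \<in> C"
    then obtain t where t: "t \<in> sphere \<tau> \<eta>" "x = upd a j t" by (auto simp: C_def)
    then have "t \<in> ball 0 \<epsilon>" using \<eta>(2) by auto
    then show "x \<in> N" using t nzs cylU a by (auto simp: N_def)
  qed
  obtain d1 where d1: "d1 > 0" "{x. infdist x C \<le> d1} \<subseteq> N"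
    using compact_in_open_separated[OF \<open>C \<noteq> {}\<close> \<open>compact C\<close> \<open>open N\<close> \<open>C \<subseteq> N\<close>] by blast
  obtain d2 where d2: "d2 > 0" "ball a d2 \<subseteq> V" using a open_contains_ball by blast
  show ?thesis
  proof (rule that[of "min d1 d2"])
    fix z t assume z: "z \<in> ball a (min d1 d2)" and t: "t \<in> sphere \<tau> \<eta>"
    have "upd a j t \<in> C" using t by (auto simp: C_def)
    moreover have "dist (upd z j t) (upd a j t) \<le> d1"
      using dist_upd_upd_le[of z j t a] z by (simp add: dist_commute)
    ultimately have "infdist (upd z j t) C \<le> d1" using infdist_le order_trans by blast
    then show "g (upd z j t) \<noteq> 0" using d1 by (auto simp: N_def)
  qed (use d1 d2 in auto)
qed

text \<open>Over a point where the number of distinct roots is maximal, the roots are holomorphic functions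
  of the base point, and one of their graphs fills up the analytic set.\<close>

lemma proj_lift:
  assumes reg: "regular_point proj c a0" 
  obtains a where "a \<in> U" "regular_point {z\<in>U. \<forall>q\<in>F. q z = 0} (Suc c) a"
proof -
  have openU1: "open U1" using hol[OF gF] holo_on_open by blast
  have holU: "holo_on q U" if "q \<in> F" for q using holo_on_subset[OF hol[OF that] openU subU1] .
  obtain V00 where V00: "open V00" "a0 \<in> V00" "\<And>z. z \<in> V00 \<Longrightarrow> z \<in> proj \<Longrightarrow> regular_point proj c z"
    using regular_point_open[OF reg] by blast
  define V0 where "V0 = V00 \<inter> U"
  have a0: "a0 \<in> proj" "a0 \<in> U" using reg by (auto simp: regular_point_iff proj_def)
  have V0: "open V0" "a0 \<in> V0" "V0 \<subseteq> U" using V00 a0 openU by (auto simp: V0_def)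
  define R where "R z = {t\<in>ball 0 \<epsilon>. g (upd z j t) = 0}" for z
  obtain e where e: "\<And>z. z \<in> U \<Longrightarrow> \<exists>ts. length ts = e \<and> set ts = R z \<and>
       (\<forall>q. holo_on q U1 \<longrightarrow> root_sum j 0 \<epsilon> g q z = (\<Sum>t\<leftarrow>ts. q (upd z j t)))"
    unfolding R_def by (rule root_count_constant[OF openU connU cyl eps hol[OF gF] nz]) blast+
  have finR: "finite (R z)" and cardR: "card (R z) \<le> e" if "z \<in> U" for z
    using e[OF that] card_length by (metis List.finite_set)+
  define P where "P k \<longleftrightarrow> (\<exists>z\<in>proj \<inter> V0. card (R z) = k)" for k
  have "P (card (R a0))" using a0 V0 by (auto simp: P_def)
  moreover have "k \<le> e" if "P k" for k using that cardR V0(3) by (auto simp: P_def)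
  ultimately have PG: "P (Greatest P)" "\<And>k. P k \<Longrightarrow> k \<le> Greatest P"
    using GreatestI_nat[of P] Greatest_le_nat[of P] by blast+
  then obtain a1 where a1: "a1 \<in> proj" "a1 \<in> V0" "\<And>z. z \<in> proj \<Longrightarrow> z \<in> V0 \<Longrightarrow> card (R z) \<le> card (R a1)"
    unfolding P_def by (metis IntI IntE)
  have a1U: "a1 \<in> U" using a1 V0 by blast
  obtain \<eta> where \<eta>: "\<eta> > 0" "\<And>t. t \<in> R a1 \<Longrightarrow> cball t \<eta> \<subseteq> ball 0 \<epsilon>"
    "\<And>s t. s \<in> R a1 \<Longrightarrow> t \<in> R a1 \<Longrightarrow> s \<noteq> t \<Longrightarrow> cball s \<eta> \<inter> cball t \<eta> = {}"
  proof -
    have "\<exists>\<eta>>0. \<forall>t\<in>R a1. cball t \<eta> \<subseteq> ball 0 \<epsilon>"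
    proof -
      have "\<forall>t\<in>R a1. \<exists>\<eta>>0. cball t \<eta> \<subseteq> ball 0 \<epsilon>"
        using open_contains_cball[of "ball 0 \<epsilon> :: complex set"] by (auto simp: R_def)
      then obtain h where h: "\<And>t. t \<in> R a1 \<Longrightarrow> h t > 0 \<and> cball t (h t) \<subseteq> ball 0 \<epsilon>" by metis
      have "Min (insert 1 (h ` R a1)) > 0" using finR[OF a1U] h by auto
      moreover have "cball t (Min (insert 1 (h ` R a1))) \<subseteq> ball 0 \<epsilon>" if "t \<in> R a1" for t
        using h[OF that] finR[OF a1U] that by (meson Min_le finite_imageI finite_insert image_eqI insertI2 order_trans subset_cball)
      ultimately show ?thesis by blast
    qed
    then obtain \<eta>1 where \<eta>1: "\<eta>1 > 0" "\<And>t. t \<in> R a1 \<Longrightarrow> cball t \<eta>1 \<subseteq> ball 0 \<epsilon>" by blast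
    define DD where "DD = (\<lambda>(s, t). dist s t) ` {(s, t) \<in> R a1 \<times> R a1. s \<noteq> t}"
    have "finite {(s, t) \<in> R a1 \<times> R a1. s \<noteq> t}"
      using finR[OF a1U] by (intro finite_subset[OF _ finite_cartesian_product[of "R a1" "R a1"]]) auto
    then have finDD: "finite DD" by (simp add: DD_def)
    define m where "m = Min (insert 1 DD)"
    have m: "m > 0" unfolding m_def using finDD by (auto simp: DD_def)
    have mle: "m \<le> dist s t" if "s \<in> R a1" "t \<in> R a1" "s \<noteq> t" for s t
      unfolding m_def using finDD that by (intro Min_le) (auto simp: DD_def image_iff)
    show ?thesis
    proof (rule that[of "min \<eta>1 (m / 3)"])
      fix s t assume st: "s \<in> R a1" "t \<in> R a1" "s \<noteq> t"
      show "cball s (min \<eta>1 (m / 3)) \<inter> cball t (min \<eta>1 (m / 3)) = {}"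
      proof (rule ccontr)
        assume "cball s (min \<eta>1 (m / 3)) \<inter> cball t (min \<eta>1 (m / 3)) \<noteq> {}"
        then obtain x where "dist s x \<le> m / 3" "dist t x \<le> m / 3" by auto
        then have "dist s t \<le> m / 3 + m / 3" using dist_triangle2[of s t x] by linarith
        then show False using mle[OF st] m by simp
      qed
    next
      fix t assume "t \<in> R a1"
      then show "cball t (min \<eta>1 (m / 3)) \<subseteq> ball 0 \<epsilon>"
        using \<eta>1(2) subset_cball[of "min \<eta>1 (m / 3)" \<eta>1 t] by auto
    qed (use \<eta>1 m in auto)
  qed
  have nzs: "g (upd a1 j t) \<noteq> 0" if "\<tau> \<in> R a1" "t \<in> sphere \<tau> \<eta>" for \<tau> t
  proof
    assume "g (upd a1 j t) = 0"
    then have "t \<in> R a1" using \<eta>(2)[OF that(1)] that(2) by (auto simp: R_def)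
    moreover have "t \<noteq> \<tau>" using that(2) \<eta>(1) by auto
    moreover have "t \<in> cball \<tau> \<eta>" "t \<in> cball t \<eta>" using that(2) \<eta>(1) by auto
    ultimately show False using \<eta>(3)[of t \<tau>] that(1) by blast
  qed
  have "\<exists>d>0. ball a1 d \<subseteq> V0 \<and> (\<forall>\<tau>\<in>R a1. \<forall>z\<in>ball a1 d. \<forall>t\<in>sphere \<tau> \<eta>. g (upd z j t) \<noteq> 0)"
  proof -
    have "\<forall>\<tau>\<in>R a1. \<exists>d>0. ball a1 d \<subseteq> V0 \<and> (\<forall>z\<in>ball a1 d. \<forall>t\<in>sphere \<tau> \<eta>. g (upd z j t) \<noteq> 0)"
    proof
      fix \<tau> assume t: "\<tau> \<in> R a1"
      show "\<exists>d>0. ball a1 d \<subseteq> V0 \<and> (\<forall>z\<in>ball a1 d. \<forall>t\<in>sphere \<tau> \<eta>. g (upd z j t) \<noteq> 0)"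
        by (rule sphere_avoid[OF a1U V0(1) a1(2) V0(3) \<eta>(1) \<eta>(2)[OF t] nzs[OF t]]) blast+
    qed
    then obtain h where h: "\<And>\<tau>. \<tau> \<in> R a1 \<Longrightarrow> h \<tau> > 0 \<and> ball a1 (h \<tau>) \<subseteq> V0 \<and> (\<forall>z\<in>ball a1 (h \<tau>). \<forall>t\<in>sphere \<tau> \<eta>. g (upd z j t) \<noteq> 0)"
      by metis
    obtain d0 where d0: "d0 > 0" "ball a1 d0 \<subseteq> V0" using V0(1) a1(2) open_contains_ball by blast
    define d where "d = Min (insert d0 (h ` R a1))"
    have "d > 0" unfolding d_def using finR[OF a1U] h d0 by auto
    moreover have "d \<le> d0" "\<And>\<tau>. \<tau> \<in> R a1 \<Longrightarrow> d \<le> h \<tau>" unfolding d_def using finR[OF a1U] by auto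
    ultimately show ?thesis using d0 h by (intro exI[of _ d]) fastforce
  qed
  then obtain d where d: "d > 0" "ball a1 d \<subseteq> V0" and
    nzd: "\<And>\<tau> z t. \<tau> \<in> R a1 \<Longrightarrow> z \<in> ball a1 d \<Longrightarrow> t \<in> sphere \<tau> \<eta> \<Longrightarrow> g (upd z j t) \<noteq> 0" by blast
  define V1 where "V1 = ball a1 d"
  have V1: "open V1" "connected V1" "a1 \<in> V1" "V1 \<subseteq> V0" using d by (auto simp: V1_def)
  have V1U: "V1 \<subseteq> U" using V1 V0 by blast
  have cyl\<tau>: "upd z j t \<in> U1" if "\<tau> \<in> R a1" "z \<in> V1" "t \<in> cball \<tau> \<eta>" for \<tau> z t
    using \<eta>(2)[OF that(1)] that cyl V1U by (auto simp: subset_iff)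
  have "\<forall>\<tau>\<in>R a1. \<exists>m. \<forall>z\<in>V1. \<exists>ts. length ts = m \<and> set ts = {t\<in>ball \<tau> \<eta>. g (upd z j t) = 0} \<and>
       (\<forall>q. holo_on q U1 \<longrightarrow> root_sum j \<tau> \<eta> g q z = (\<Sum>t\<leftarrow>ts. q (upd z j t)))"
  proof
    fix \<tau> assume t: "\<tau> \<in> R a1"
    show "\<exists>m. \<forall>z\<in>V1. \<exists>ts. length ts = m \<and> set ts = {t\<in>ball \<tau> \<eta>. g (upd z j t) = 0} \<and>
       (\<forall>q. holo_on q U1 \<longrightarrow> root_sum j \<tau> \<eta> g q z = (\<Sum>t\<leftarrow>ts. q (upd z j t)))"
      by (rule root_count_constant[OF V1(1,2) cyl\<tau>[OF t] \<eta>(1) hol[OF gF] nzd[OF t, folded V1_def]]) blast+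
  qed
  from bchoice[OF this] obtain mlt where mlt: "\<And>\<tau> z. \<tau> \<in> R a1 \<Longrightarrow> z \<in> V1 \<Longrightarrow> \<exists>ts. length ts = mlt \<tau> \<and> set ts = {t\<in>ball \<tau> \<eta>. g (upd z j t) = 0} \<and>
       (\<forall>q. holo_on q U1 \<longrightarrow> root_sum j \<tau> \<eta> g q z = (\<Sum>t\<leftarrow>ts. q (upd z j t)))" by blast
  have mpos: "mlt \<tau> > 0" if t: "\<tau> \<in> R a1" for \<tau>
  proof -
    obtain ts where ts: "length ts = mlt \<tau>" "set ts = {t\<in>ball \<tau> \<eta>. g (upd a1 j t) = 0}" using mlt[OF t V1(3)] by blast
    have "\<tau> \<in> set ts" using ts t \<eta>(1) by (auto simp: R_def)
    then show ?thesis using ts(1) by (metis length_pos_if_in_set)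
  qed
  have exroot: "\<exists>t\<in>ball \<tau> \<eta>. g (upd z j t) = 0" if t: "\<tau> \<in> R a1" and z: "z \<in> V1" for \<tau> z
  proof -
    obtain ts where ts: "length ts = mlt \<tau>" "set ts = {t\<in>ball \<tau> \<eta>. g (upd z j t) = 0}" using mlt[OF t z] by blast
    have "ts \<noteq> []" using ts(1) mpos[OF t] by auto
    then have "hd ts \<in> set ts" by simp
    then show ?thesis using ts(2) by blast
  qed
  \<comment> \<open>The mean of the roots in the disc around \<tau>, counted with multiplicity. Over
    \<open>proj\<close> only one distinct root lies in the disc, so the mean is that root, while the
    integral formula makes it holomorphic on all of \<open>V1\<close>.\<close>
  define T where "T \<tau> z = root_sum j \<tau> \<eta> g (\<lambda>z. z $ j) z / of_nat (mlt \<tau>)" for \<tau> z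
  have holT: "holo_on (T \<tau>) V1" if t: "\<tau> \<in> R a1" for \<tau>
    unfolding T_def[abs_def] using mpos[OF t]
    by (intro holo_on_divide holo_on_const V1(1)
        holo_on_root_sum[OF V1(1) _ \<eta>(1) hol[OF gF] holo_on_nth[OF openU1] nzd[OF t, folded V1_def]])
       (use cyl\<tau>[OF t] in auto)
  \<comment> \<open>Each disc contains a root, and over \<open>proj\<close> there are no more
    distinct roots than over \<open>a1\<close>; so the roots correspond to the discs one to
    one.\<close>
  have one: "\<exists>h. bij_betw h (R a1) (R z) \<and> (\<forall>\<tau>\<in>R a1. h \<tau> \<in> ball \<tau> \<eta>)" if z: "z \<in> V1" "z \<in> proj" for z
  proof -
    obtain h where h: "\<And>\<tau>. \<tau> \<in> R a1 \<Longrightarrow> h \<tau> \<in> ball \<tau> \<eta> \<and> g (upd z j (h \<tau>)) = 0" using exroot[OF _ z(1)] by metis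
    have hR: "h ` R a1 \<subseteq> R z" using h \<eta>(2) by (fastforce simp: R_def subset_iff)
    have inj: "inj_on h (R a1)"
    proof (rule inj_onI, rule ccontr)
      fix s t assume st: "s \<in> R a1" "t \<in> R a1" "h s = h t" "s \<noteq> t"
      have "h s \<in> cball s \<eta> \<inter> cball t \<eta>" using h[OF st(1)] h[OF st(2)] st(3) by auto
      then show False using \<eta>(3)[OF st(1,2,4)] by blast
    qed
    have zU: "z \<in> U" using z V1U by blast
    have "card (R z) \<le> card (R a1)" using a1(3) z V1(4) by blast
    then have "h ` R a1 = R z"
      using card_image[OF inj] hR finR[OF zU] by (intro card_seteq) auto
    then show ?thesis using inj h by (auto simp: bij_betw_def)
  qed
  have Troot: "t = T \<tau> z" if as: "z \<in> V1" "z \<in> proj" "\<tau> \<in> R a1" "t \<in> ball \<tau> \<eta>" "t \<in> R z" for z \<tau> t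
  proof -
    obtain h where h: "bij_betw h (R a1) (R z)" "\<And>\<tau>. \<tau> \<in> R a1 \<Longrightarrow> h \<tau> \<in> ball \<tau> \<eta>" using one[OF as(1,2)] by blast
    note \<tau>R = \<open>\<tau> \<in> R a1\<close> and zV = \<open>z \<in> V1\<close>
    have un: "s = h \<tau>" if s: "s \<in> R z" "s \<in> ball \<tau> \<eta>" for s
    proof -
      obtain \<sigma> where \<sigma>: "\<sigma> \<in> R a1" "s = h \<sigma>" using h(1) s(1) by (auto simp: bij_betw_def)
      have "s \<in> cball \<sigma> \<eta> \<inter> cball \<tau> \<eta>" using h(2)[OF \<sigma>(1)] \<sigma>(2) s(2) by auto
      then have "\<sigma> = \<tau>" using \<eta>(3)[OF \<sigma>(1) \<open>\<tau> \<in> R a1\<close>] by blast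
      then show ?thesis using \<sigma> by simp
    qed
    obtain ts where ts: "length ts = mlt \<tau>" "set ts = {t\<in>ball \<tau> \<eta>. g (upd z j t) = 0}"
      "\<forall>q. holo_on q U1 \<longrightarrow> root_sum j \<tau> \<eta> g q z = (\<Sum>t\<leftarrow>ts. q (upd z j t))" using mlt[OF as(3,1)] by blast
    have "set ts \<subseteq> {h \<tau>}"
      using un ts(2) \<eta>(2)[OF as(3)] by (fastforce simp: R_def subset_iff)
    then have "ts = replicate (mlt \<tau>) (h \<tau>)" using ts(1) by (metis replicate_eqI singletonD subsetD)
    moreover have "root_sum j \<tau> \<eta> g (\<lambda>z. z $ j) z = (\<Sum>t\<leftarrow>ts. t)" using ts(3) holo_on_nth[OF openU1] by simp
    ultimately have "T \<tau> z = h \<tau>" using mpos[OF as(3)] by (simp add: T_def sum_list_replicate)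
    then show ?thesis using un as by simp
  qed
  have Tin: "T \<tau> z \<in> ball \<tau> \<eta> \<and> T \<tau> z \<in> R z" if as: "z \<in> V1" "z \<in> proj" "\<tau> \<in> R a1" for z \<tau>
  proof -
    obtain t where t: "t \<in> ball \<tau> \<eta>" "g (upd z j t) = 0" using exroot[OF as(3,1)] by blast
    have "t \<in> R z" using t \<eta>(2)[OF as(3)] by (fastforce simp: R_def subset_iff)
    then show ?thesis using Troot[OF as t(1)] t by simp
  qed
  \<comment> \<open>The points over which the graph of \<open>T \<tau>\<close> meets the zero set.
    These finitely many sets are relatively closed and cover \<open>proj\<close> near
    \<open>a1\<close>, so one of them contains an open part of it.\<close>
  define C where "C \<tau> = {z. \<forall>q\<in>F. q (upd z j (T \<tau> z)) = 0}" for \<tau>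
  have holq: "holo_on (\<lambda>z. upd z j (T \<tau> z) $ i) V1" if "\<tau> \<in> R a1" for \<tau> i
    using holT[OF that] V1(1) by (cases "i = j") (auto intro!: holo_intros)
  have "\<exists>\<tau>\<in>R a1. \<exists>V. open V \<and> (proj \<inter> V1) \<inter> V \<noteq> {} \<and> (proj \<inter> V1) \<inter> V \<subseteq> C \<tau>"
  proof (rule finite_closed_cover[OF finR[OF a1U]])
    show "proj \<inter> V1 \<noteq> {}" using a1 V1 by blast
    show "proj \<inter> V1 \<subseteq> (\<Union>\<tau>\<in>R a1. C \<tau>)"
    proof
      fix z assume z: "z \<in> proj \<inter> V1"
      then obtain t where t: "t \<in> ball 0 \<epsilon>" "\<forall>q\<in>F. q (upd z j t) = 0" by (auto simp: proj_def)
      then have tR: "t \<in> R z" using gF by (auto simp: R_def)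
      obtain h where h: "bij_betw h (R a1) (R z)" "\<And>\<tau>. \<tau> \<in> R a1 \<Longrightarrow> h \<tau> \<in> ball \<tau> \<eta>" using one z by blast
      obtain \<tau> where \<tau>: "\<tau> \<in> R a1" "t = h \<tau>" using h(1) tR by (auto simp: bij_betw_def)
      then have "t = T \<tau> z" using Troot[of z \<tau> t] z tR h(2)[OF \<tau>(1)] by blast
      then show "z \<in> (\<Union>\<tau>\<in>R a1. C \<tau>)" using \<tau>(1) t(2) by (auto simp: C_def)
    qed
    fix \<tau> z assume \<tau>: "\<tau> \<in> R a1" and z: "z \<in> proj \<inter> V1" "z \<notin> C \<tau>"
    then obtain q where q: "q \<in> F" "q (upd z j (T \<tau> z)) \<noteq> 0" by (auto simp: C_def)
    have oV: "open (V1 \<inter> (\<lambda>z. upd z j (T \<tau> z)) -` U1)"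
      using vec_of_holo_continuous[OF holq[OF \<tau>]] V1(1) openU1 by (rule continuous_open_preimage)
    have zin: "z \<in> V1 \<inter> (\<lambda>z. upd z j (T \<tau> z)) -` U1"
      using z Tin[of z \<tau>] \<tau> cyl\<tau>[OF \<tau>, of z "T \<tau> z"] by auto
    have "holo_on (\<lambda>z. q (upd z j (T \<tau> z))) (V1 \<inter> (\<lambda>z. upd z j (T \<tau> z)) -` U1)"
      by (rule holo_on_compose[OF hol[OF q(1)] oV]) (use holo_on_subset[OF holq[OF \<tau>] oV] in auto)
    then have "continuous_on (V1 \<inter> (\<lambda>z. upd z j (T \<tau> z)) -` U1) (\<lambda>z. q (upd z j (T \<tau> z)))"
      by (rule holo_on_continuous)
    then have "open ((V1 \<inter> (\<lambda>z. upd z j (T \<tau> z)) -` U1) \<inter> (\<lambda>z. q (upd z j (T \<tau> z))) -` (- {0}))"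
      using oV by (rule continuous_open_preimage) auto
    then show "\<exists>V. open V \<and> z \<in> V \<and> (proj \<inter> V1) \<inter> V \<inter> C \<tau> = {}"
      using q zin by (intro exI[of _ "(V1 \<inter> (\<lambda>z. upd z j (T \<tau> z)) -` U1) \<inter> (\<lambda>z. q (upd z j (T \<tau> z))) -` (- {0})"])
        (auto simp: C_def)
  qed
  then obtain \<tau> V2 a2 where \<tau>: "\<tau> \<in> R a1" and V2: "open V2" "a2 \<in> proj" "a2 \<in> V1" "a2 \<in> V2"
    "proj \<inter> V1 \<inter> V2 \<subseteq> C \<tau>" by blast
  have "regular_point proj c a2" using V00(3) V2 V1(4) by (auto simp: V0_def)
  then obtain U3 h where U3: "a2 \<in> U3" "open U3" "\<forall>i<c. holo_on (h i) U3"
     "proj \<inter> U3 = {z\<in>U3. \<forall>i<c. h i z = 0}" "indep_at c h a2" unfolding regular_point_iff by blast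
  define U4 where "U4 = U3 \<inter> V2 \<inter> V1"
  have U4: "open U4" "a2 \<in> U4" using U3 V2 V1 by (auto simp: U4_def)
  have projU4: "proj \<inter> U4 = {z\<in>U4. \<forall>i<c. h i z = 0}" using U3(4) by (auto simp: U4_def)
  have hU4: "holo_on (h i) U4" if "i < c" for i using U3(3) that holo_on_subset[OF _ U4(1)] by (auto simp: U4_def)
  define \<alpha> where "\<alpha> = a2 $ j"
  define a where "a = upd a2 j (T \<tau> a2)"
  have a2U: "a2 \<in> U" using V2 V1U by blast
  have Ta2: "T \<tau> a2 \<in> ball \<tau> \<eta>" "T \<tau> a2 \<in> ball 0 \<epsilon>" using Tin[OF V2(3,2) \<tau>] by (auto simp: R_def)
  have aU: "a \<in> U" using cylU[OF a2U Ta2(2)] by (simp add: a_def)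
  have aa2: "upd a j \<alpha> = a2" by (simp add: a_def \<alpha>_def)
  define U5 where "U5 = U \<inter> {z. upd z j \<alpha> \<in> U4} \<inter> {z. z $ j \<in> ball \<tau> \<eta>}"
  have oU5: "open U5"
    unfolding U5_def using openU U4(1)
    by (intro open_Int open_vimage[unfolded vimage_def] continuous_intros) auto
  have aU5: "a \<in> U5" using aU aa2 U4(2) Ta2(1) by (simp add: U5_def) (simp add: a_def)
  \<comment> \<open>The \<open>c\<close> equations of \<open>proj\<close>, made independent of the
    coordinate \<open>j\<close> by freezing it at \<alpha>, together with the equation of the
    graph.\<close>
  define hh where "hh i z = (if i < c then h i (upd z j \<alpha>) else z $ j - T \<tau> (upd z j \<alpha>))" for i z
  have holh: "holo_on (\<lambda>z. f (upd z j \<alpha>)) U5" if "holo_on f U4" for f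
    by (rule holo_on_compose[OF that oU5 holo_on_upd[OF oU5]]) (auto simp: U5_def)
  have TU4: "holo_on (T \<tau>) U4" using holo_on_subset[OF holT[OF \<tau>] U4(1)] by (auto simp: U4_def)
  have holhh: "holo_on (hh i) U5" for i
    unfolding hh_def[abs_def] using holh[OF hU4[of i]] holh[OF TU4] oU5
    by (cases "i < c") (auto intro!: holo_intros)
  have zeros: "{z\<in>U. \<forall>q\<in>F. q z = 0} \<inter> U5 = {z\<in>U5. \<forall>i<Suc c. hh i z = 0}"
  proof (intro Set.set_eqI)
    fix z
    show "z \<in> {z\<in>U. \<forall>q\<in>F. q z = 0} \<inter> U5 \<longleftrightarrow> z \<in> {z\<in>U5. \<forall>i<Suc c. hh i z = 0}"
    proof (cases "z \<in> U5")
      case True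
      then have z: "z \<in> U" "upd z j \<alpha> \<in> U4" "z $ j \<in> ball \<tau> \<eta>" by (auto simp: U5_def)
      have zj: "z $ j \<in> ball 0 \<epsilon>" using nthU[OF z(1)] .
      have zz: "upd (upd z j \<alpha>) j (z $ j) = z" by simp
      have zhU: "upd z j \<alpha> \<in> U" "upd z j \<alpha> \<in> V1" using z(2) V1U by (auto simp: U4_def)
      show ?thesis
      proof
        assume "z \<in> {z\<in>U. \<forall>q\<in>F. q z = 0} \<inter> U5"
        then have q0: "\<forall>q\<in>F. q z = 0" by blast
        then have pr: "upd z j \<alpha> \<in> proj" unfolding proj_def using zhU zj by (auto intro!: bexI[of _ "z $ j"])
        have "h i (upd z j \<alpha>) = 0" if "i < c" for i using pr z(2) projU4 that by blast
        moreover have "z $ j \<in> R (upd z j \<alpha>)" using q0 gF zj zz by (auto simp: R_def)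
        then have "z $ j = T \<tau> (upd z j \<alpha>)" using Troot[OF zhU(2) pr \<tau> z(3)] by blast
        ultimately show "z \<in> {z\<in>U5. \<forall>i<Suc c. hh i z = 0}" using True by (auto simp: hh_def)
      next
        assume "z \<in> {z\<in>U5. \<forall>i<Suc c. hh i z = 0}"
        then have hz: "hh i z = 0" if "i < Suc c" for i using that by blast
        have "h i (upd z j \<alpha>) = 0" if "i < c" for i using hz[of i] that by (simp add: hh_def)
        then have "upd z j \<alpha> \<in> proj" using z(2) projU4 by blast
        then have "upd z j \<alpha> \<in> C \<tau>" using z(2) V2(5) by (auto simp: U4_def)
        moreover have "T \<tau> (upd z j \<alpha>) = z $ j" using hz[of c] by (simp add: hh_def)
        ultimately have "\<forall>q\<in>F. q z = 0" using zz by (auto simp: C_def)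
        then show "z \<in> {z\<in>U. \<forall>q\<in>F. q z = 0} \<inter> U5" using True z by blast
      qed
    qed blast
  qed
  have pdh: "pd m (\<lambda>z. f (upd z j \<alpha>)) a = (if m = j then 0 else pd m f a2)" if "holo_on f U4" for f m
  proof -
    have "pd m (\<lambda>z. f (upd z j \<alpha>)) a = (\<Sum>l\<in>UNIV. pd l f a2 * pd m (\<lambda>z. upd z j \<alpha> $ l) a)"
      using pd_chain[OF that holo_on_upd[OF oU5] aU5, of j \<alpha> m] aa2 U4(2) by simp
    also have "\<dots> = (\<Sum>l\<in>UNIV. if l = m then (if m = j then 0 else pd m f a2) else 0)"
    proof (intro sum.cong refl)
      fix l
      have "pd m (\<lambda>z. upd z j \<alpha> $ l) a = (if l = j then 0 else if l = m then 1 else 0)"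
        by (cases "l = j") (auto simp: pd_nth)
      then show "pd l f a2 * pd m (\<lambda>z. upd z j \<alpha> $ l) a = (if l = m then (if m = j then 0 else pd m f a2) else 0)"
        by auto
    qed
    finally show ?thesis by simp
  qed
  \<comment> \<open>\<open>proj\<close> is a cylinder in direction \<open>j\<close>, so its
    equations vanish along the line through \<open>a2\<close> in that direction.\<close>
  have pdj0: "pd j (h i) a2 = 0" if i: "i < c" for i
  proof -
    have "open {t. upd a2 j t \<in> U4}" using U4(1) by (intro open_vimage[unfolded vimage_def] continuous_intros)
    moreover have "a2 $ j \<in> {t. upd a2 j t \<in> U4}" using U4(2) by simp
    moreover have "h i (upd a2 j t) = 0" if "t \<in> {t. upd a2 j t \<in> U4}" for t
    proof -
      have "upd a2 j t \<in> U" using that V1U by (auto simp: U4_def)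
      then have "upd a2 j t \<in> proj" using proj_cylinder V2(2) by blast
      then show ?thesis using that projU4 i by blast
    qed
    ultimately have "\<forall>\<^sub>F t in nhds (a2 $ j). h i (upd a2 j t) = 0" unfolding eventually_nhds by blast
    then have "deriv (\<lambda>t. h i (upd a2 j t)) (a2 $ j) = deriv (\<lambda>t. 0) (a2 $ j)" by (intro deriv_cong_ev) auto
    then show ?thesis by (simp add: pd_def)
  qed
  have "indep_at (Suc c) hh a"
    unfolding indep_at_def
  proof (intro allI impI)
    fix \<beta> i assume s: "\<forall>m. (\<Sum>i<Suc c. \<beta> i * pd m (hh i) a) = 0" and i: "i < Suc c"
    have hhi: "pd m (hh i) a = (if m = j then 0 else pd m (h i) a2)" if "i < c" for i m
      using pdh[OF hU4[OF that], of m] that by (simp add: hh_def[abs_def])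
    have hhc: "pd j (hh c) a = 1"
    proof -
      have "pd j (\<lambda>z. z $ j + (-1) * T \<tau> (upd z j \<alpha>)) a = pd j (\<lambda>z. z $ j) a + pd j (\<lambda>z. (-1) * T \<tau> (upd z j \<alpha>)) a"
        by (rule pd_add[OF holo_on_nth[OF oU5] _ aU5]) (intro holo_intros holh TU4 oU5)
      also have "pd j (\<lambda>z. (-1) * T \<tau> (upd z j \<alpha>)) a = 0"
        using pd_mult[OF holo_on_const[OF oU5, of "-1"] holh[OF TU4] aU5, of j] pdh[OF TU4, of j] by simp
      finally show ?thesis by (simp add: hh_def[abs_def] pd_nth)
    qed
    have "(\<Sum>i<c. \<beta> i * pd j (hh i) a) = 0" using hhi by (intro sum.neutral) auto
    then have bc: "\<beta> c = 0" using s[rule_format, of j] hhc by simp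
    have "(\<Sum>i<c. \<beta> i * pd m (h i) a2) = 0" for m
    proof (cases "m = j")
      case True
      then show ?thesis using pdj0 by (intro sum.neutral) auto
    next
      case False
      have "(\<Sum>i<c. \<beta> i * pd m (h i) a2) = (\<Sum>i<c. \<beta> i * pd m (hh i) a)"
        using hhi False by (intro sum.cong) auto
      then show ?thesis using s[rule_format, of m] bc by simp
    qed
    then have "\<forall>i<c. \<beta> i = 0" using U3(5) unfolding indep_at_def by blast
    then show "\<beta> i = 0" using bc i less_Suc_eq by auto
  qed
  moreover have "a \<in> {z\<in>U. \<forall>q\<in>F. q z = 0}"
    using V2 aU by (auto simp: C_def a_def)
  ultimately have "regular_point {z\<in>U. \<forall>q\<in>F. q z = 0} (Suc c) a"
    unfolding regular_point_iff using aU5 oU5 holhh zeros by blast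
  then show ?thesis using that aU by blast
qed

end

section \<open>Polydiscs\<close>

definition pdisc :: "complex^'n \<Rightarrow> ('n \<Rightarrow> real) \<Rightarrow> (complex^'n) set" where
  "pdisc b \<rho> = {z. \<forall>i. dist (z $ i) (b $ i) < \<rho> i}"

lemma pdisc_eq_INT: "pdisc b \<rho> = (\<Inter>i. (\<lambda>z. z $ i) -` ball (b $ i) (\<rho> i))"
  by (auto simp: pdisc_def dist_commute)

lemma open_pdisc [simp]: "open (pdisc b \<rho>)"
  unfolding pdisc_eq_INT by (intro open_INT ballI finite_class.finite_UNIV open_vimage open_ball continuous_intros)

lemma convex_pdisc [simp]: "convex (pdisc b \<rho>)"
  unfolding pdisc_eq_INT
  by (intro convex_INT convex_linear_vimage bounded_linear.linear[OF bounded_linear_vec_nth] convex_ball)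

lemma centre_in_pdisc: "(\<And>i. \<rho> i > 0) \<Longrightarrow> b \<in> pdisc b \<rho>"
  by (simp add: pdisc_def)

lemma norm_vec_le_sum: "norm (x :: complex^'n) \<le> (\<Sum>i\<in>UNIV. norm (x $ i))"
  unfolding norm_vec_def by (rule L2_set_le_sum) auto

lemma pdisc_subset_ball:
  fixes b :: "complex^'n"
  shows "pdisc b (\<lambda>_. d / CARD('n)) \<subseteq> ball b d"
proof
  fix z assume "z \<in> pdisc b (\<lambda>_. d / CARD('n))"
  then have "norm ((z - b) $ i) < d / CARD('n)" for i by (simp add: pdisc_def dist_norm)
  then have "(\<Sum>i\<in>UNIV. norm ((z - b) $ i)) < (\<Sum>i::'n\<in>UNIV. d / CARD('n))" by (intro sum_strict_mono) auto
  then have "norm (z - b) < d" using norm_vec_le_sum[of "z - b"] by simp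
  then show "z \<in> ball b d" by (simp add: dist_norm norm_minus_commute)
qed

lemma open_contains_pdisc:
  fixes b :: "complex^'n"
  assumes "open U" "b \<in> U"
  obtains r where "r > 0" "pdisc b (\<lambda>_. r) \<subseteq> U"
proof -
  obtain d where "d > 0" "ball b d \<subseteq> U" using assms open_contains_ball by blast
  then show ?thesis using that[of "d / CARD('n)"] pdisc_subset_ball[of b d] by auto
qed

subsection \<open>Dimension of analytic sets\<close>

text \<open>The set \<open>{F = 0}\<close> contains \<open>{z\<^sub>j = 0, j \<in> J}\<close> and is invariant in the directions \<open>A\<close>. If it is not everything,
  projecting along a further coordinate, by taking norms over the roots of some \<open>q \<in> F\<close>, increases \<open>A\<close>.\<close>

lemma dimension_induct:
  fixes A J :: "'n::finite set" and b :: "complex^'n"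
  assumes "A \<subseteq> J" "finite F" "\<And>j. j \<in> J \<Longrightarrow> b $ j = 0" "\<And>i. \<rho> i > 0"
    and "\<And>q. q \<in> F \<Longrightarrow> holo_on q (pdisc b \<rho>)"
    and "\<And>q z z'. q \<in> F \<Longrightarrow> z \<in> pdisc b \<rho> \<Longrightarrow> z' \<in> pdisc b \<rho> \<Longrightarrow> (\<And>i. i \<notin> A \<Longrightarrow> z $ i = z' $ i) \<Longrightarrow> q z = q z'"
    and "\<And>q z. q \<in> F \<Longrightarrow> z \<in> pdisc b \<rho> \<Longrightarrow> (\<And>j. j \<in> J \<Longrightarrow> z $ j = 0) \<Longrightarrow> q z = 0"
  shows "\<exists>a\<in>pdisc b \<rho>. \<exists>c. c + card A \<le> card J \<and> regular_point {z\<in>pdisc b \<rho>. \<forall>q\<in>F. q z = 0} c a"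
  using assms
\<comment> \<open>Being invariant in the directions \<open>A\<close>, the zero set contains, inside
  the polydisc, the larger plane where only the coordinates in \<open>J - A\<close> vanish. Hence
  codimension at most \<open>card J - card A\<close> is to be expected.\<close>
proof (induction "card (J - A)" arbitrary: A F b \<rho> rule: less_induct)
  case (less A F b \<rho>)
  note AJ = less.prems(1) and finF = less.prems(2) and bJ = less.prems(3) and \<rho> = less.prems(4)
    and hol = less.prems(5) and indepA = less.prems(6) and van = less.prems(7)
  define U where "U = pdisc b \<rho>"
  have bU: "b \<in> U" using \<rho> by (simp add: U_def centre_in_pdisc)
  have openU: "open U" and cvxU: "convex U" by (auto simp: U_def)
  show ?case
  proof (cases "\<forall>q\<in>F. \<forall>z\<in>U. q z = 0")
    case True
    have "regular_point {z\<in>pdisc b \<rho>. \<forall>q\<in>F. q z = 0} 0 b"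
      unfolding regular_point_iff
      using True bU openU by (auto simp: U_def indep_at_def intro!: exI[of _ U])
    moreover have "0 + card A \<le> card J" using AJ by (simp add: card_mono)
    ultimately show ?thesis using bU unfolding U_def by blast
  next
    case False
    then obtain g0 z1 where g0: "g0 \<in> F" and z1: "z1 \<in> U" "g0 z1 \<noteq> 0" by blast
    \<comment> \<open>\<open>b1\<close> is the point of the plane below \<open>z1\<close>. The point
      \<open>y0\<close> differs from \<open>z1\<close> only in the directions \<open>A\<close>, in
      which the functions of \<open>F\<close> are constant, so \<open>g0 y0\<close> is
      nonzero.\<close>
    define b1 where "b1 = (\<chi> i. if i \<in> J then 0 else z1 $ i)"
    have b1J: "b1 $ j = 0" if "j \<in> J" for j using that by (simp add: b1_def)
    define y0 where "y0 = (\<chi> i. if i \<in> A then 0 else z1 $ i)"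
    have y0U: "y0 \<in> U" using z1 bJ AJ \<rho> by (auto simp: y0_def U_def pdisc_def subset_iff)
    have b1U: "b1 \<in> U" using z1 bJ \<rho> by (auto simp: b1_def U_def pdisc_def)
    have gy0: "g0 y0 \<noteq> 0" using indepA[OF g0, of y0 z1] y0U z1 by (auto simp: U_def y0_def)
    have gb1: "g0 b1 = 0" using van[OF g0] b1U b1J by (auto simp: U_def)
    have "\<exists>j\<in>J - A. z1 $ j \<noteq> 0"
    proof (rule ccontr)
      assume "\<not> ?thesis"
      then have "y0 = b1" using AJ by (auto simp: y0_def b1_def cvec_eq_iff)
      then show False using gy0 gb1 by simp
    qed
    then obtain j where j: "j \<in> J" "j \<notin> A" "z1 $ j \<noteq> 0" by blast
    \<comment> \<open>The shear \<open>L\<close> sends the line through \<open>b1\<close> in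
      direction \<open>j\<close> to the line through \<open>b1\<close> and \<open>y0\<close>, on
      which \<open>g0\<close> is not identically zero. It fixes the hyperplane z_j = 0 pointwise
      and, since \<open>w\<close> has no component in \<open>A\<close>, it respects the invariance
      in the directions \<open>A\<close>.\<close>
    define w where "w = (\<chi> i. if i \<in> J - A - {j} then z1 $ i / z1 $ j else 0)"
    define L where "L z = z + z $ j *s w" for z :: "complex^'n"
    define L' where "L' z = z - z $ j *s w" for z :: "complex^'n"
    have wj: "w $ j = 0" by (simp add: w_def)
    have LL': "L (L' z) = z" "L' (L z) = z" for z by (simp_all add: L_def L'_def wj cvec_eq_iff algebra_simps)
    have contL: "continuous_on S L" for S unfolding L_def[abs_def] by (intro continuous_intros)
    have contL': "continuous_on S L'" for S unfolding L'_def[abs_def] by (intro continuous_intros)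
    have holL: "holo_on (\<lambda>z. L z $ i) S" if "open S" for S i
      unfolding L_def using that by (auto intro!: holo_intros)
    have holL': "holo_on (\<lambda>z. L' z $ i) S" if "open S" for S i
      unfolding L'_def using that by (auto intro!: holo_intros)
    have Lfix: "L z = z" if "z $ j = 0" for z by (simp add: L_def that cvec_eq_iff)
    have Ly0: "L (upd b1 j (s * z1 $ j)) = b1 + s *s (y0 - b1)" for s
      using j AJ by (auto simp: L_def w_def y0_def b1_def cvec_eq_iff)
    have "open (L -` U)" using openU contL by (intro open_vimage)
    moreover have "b1 \<in> L -` U" using Lfix[OF b1J[OF j(1)]] b1U by simp
    ultimately obtain r0 where r0: "r0 > 0" "pdisc b1 (\<lambda>_. r0) \<subseteq> L -` U" by (rule open_contains_pdisc)
    define U1 where "U1 = pdisc b1 (\<lambda>_. r0)"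
    have openU1: "open U1" by (simp add: U1_def)
    have LU1: "L z \<in> U" if "z \<in> U1" for z using r0 that by (auto simp: U1_def)
    have holqL: "holo_on (\<lambda>z. q (L z)) U1" if "q \<in> F" for q
      by (rule holo_on_compose[OF hol[OF that] openU1 holL[OF openU1]]) (use LU1 in \<open>auto simp: U_def\<close>)
    have updU1: "upd b1 j t \<in> U1" if "norm t < r0" for t
      using that r0(1) b1J[OF j(1)] by (auto simp: U1_def pdisc_def)
    define u where "u t = g0 (L (upd b1 j t))" for t
    have holu: "u holomorphic_on ball 0 r0"
      unfolding u_def[abs_def] by (rule holo_on_holomorphic_upd[OF holqL[OF g0]]) (use updU1 in auto)
    have u0: "u 0 = 0" using Lfix[of "upd b1 j 0"] gb1 b1J[OF j(1)] upd_same[of b1 j] by (simp add: u_def)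
    have "\<exists>\<beta>\<in>ball 0 r0. u \<beta> \<noteq> 0"
    proof (rule ccontr)
      assume "\<not> ?thesis"
      then have u_zero: "u t = 0" if "norm t < r0" for t using that by auto
      have "\<forall>\<^sub>F s in nhds 0. g0 (b1 + s *s (y0 - b1)) = 0"
        unfolding eventually_nhds
      proof (intro exI[of _ "ball 0 (r0 / norm (z1 $ j))"] conjI ballI)
        fix s :: complex assume "s \<in> ball 0 (r0 / norm (z1 $ j))"
        then have "norm (s * z1 $ j) < r0" using j(3) by (simp add: norm_mult pos_less_divide_eq)
        then show "g0 (b1 + s *s (y0 - b1)) = 0" using u_zero[of "s * z1 $ j"] unfolding u_def Ly0 by blast
      qed (use r0 j(3) in auto)
      then have "g0 y0 = 0"
        using holo_on_eq_0_line[OF hol[OF g0, folded U_def] cvxU b1U y0U] by blast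
      then show False using gy0 by simp
    qed
    then obtain \<beta> where \<beta>: "\<beta> \<in> ball 0 r0" "u \<beta> \<noteq> 0" by blast
    have z0: "(0::complex) \<in> ball 0 r0" using r0(1) by simp
    have "\<exists>r>0. ball 0 r \<subseteq> ball (0::complex) r0 \<and> (\<forall>t\<in>ball 0 r - {0}. u t \<noteq> 0)"
    proof (rule isolated_zeros[OF holu open_ball connected_ball z0 u0 \<beta>])
      fix r assume "0 < r" "ball 0 r \<subseteq> ball (0::complex) r0" "\<And>z. z \<in> ball 0 r - {0} \<Longrightarrow> u z \<noteq> 0"
      then show "\<exists>r>0. ball 0 r \<subseteq> ball (0::complex) r0 \<and> (\<forall>t\<in>ball 0 r - {0}. u t \<noteq> 0)"
        by (intro exI[of _ r] conjI ballI)
    qed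
    then obtain r where r: "r > 0" "ball 0 r \<subseteq> ball (0::complex) r0" "\<And>t. t \<in> ball 0 r - {0} \<Longrightarrow> u t \<noteq> 0"
      by blast
    \<comment> \<open>Half the radius, so that the closed disc contains no zero of \<open>u\<close>
      except its centre.\<close>
    define \<epsilon> where "\<epsilon> = r / 2"
    have eps: "\<epsilon> > 0" "cball 0 \<epsilon> \<subseteq> ball (0::complex) r0"
      using r(1,2) by (auto simp: \<epsilon>_def subset_iff)
    define C where "C = (\<lambda>t. upd b1 j t) ` sphere 0 \<epsilon>"
    define N where "N = U1 \<inter> {z. z \<in> U1 \<and> g0 (L z) \<noteq> 0}"
    have "open N"
      unfolding N_def using holo_on_continuous[OF holqL[OF g0]] openU1 continuous_open_preimage[of U1 "\<lambda>z. g0 (L z)" "- {0}"]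
      by (auto simp: Int_def vimage_def conj_commute)
    moreover have "compact C" unfolding C_def by (intro compact_continuous_image continuous_intros) simp
    moreover have "sphere (0::complex) \<epsilon> \<noteq> {}" using eps by simp
    then have "C \<noteq> {}" by (auto simp: C_def)
    moreover have "C \<subseteq> N"
    proof
      fix x assume "x \<in> C"
      then obtain t where t: "norm t = \<epsilon>" "x = upd b1 j t" by (auto simp: C_def)
      then have "t \<in> ball 0 r - {0}" using r(1) by (auto simp: \<epsilon>_def)
      then have "u t \<noteq> 0" "norm t < r0" using r by auto
      then show "x \<in> N" using t updU1 by (auto simp: N_def u_def)
    qed
    ultimately obtain e where e: "e > 0" "{x. infdist x C \<le> e} \<subseteq> N"
      using compact_in_open_separated[of C N] by blast
    \<comment> \<open>The margin \<open>e\<close> around the circle is shared equally among the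
      coordinates, because the norm is bounded by the sum of the moduli.\<close>
    define \<delta> where "\<delta> = min r0 (e / CARD('n))"
    have \<delta>: "\<delta> > 0" using r0 e by (simp add: \<delta>_def)
    define \<rho>' where "\<rho>' i = (if i = j then \<epsilon> else \<delta>)" for i
    define U' where "U' = pdisc b1 \<rho>'"
    have \<rho>'pos: "\<rho>' i > 0" for i using eps \<delta> by (simp add: \<rho>'_def)
    have cyl: "upd z j t \<in> U1" if "z \<in> U'" "t \<in> cball 0 \<epsilon>" for z t
      using that eps(2) b1J[OF j(1)] by (auto simp: U'_def U1_def pdisc_def \<rho>'_def \<delta>_def subset_iff split: if_splits)
    have nz: "g0 (L (upd z j t)) \<noteq> 0" if z: "z \<in> U'" and t: "t \<in> sphere 0 \<epsilon>" for z t
    proof -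
      have "norm ((upd z j t - upd b1 j t) $ i) \<le> e / CARD('n)" for i
        using z e(1) unfolding U'_def pdisc_def \<rho>'_def \<delta>_def
        by (auto simp: dist_norm dest!: spec[of _ i] split: if_splits)
      then have "(\<Sum>i\<in>UNIV. norm ((upd z j t - upd b1 j t) $ i)) \<le> (\<Sum>i::'n\<in>UNIV. e / CARD('n))" by (intro sum_mono)
      then have "dist (upd z j t) (upd b1 j t) \<le> e"
        using norm_vec_le_sum[of "upd z j t - upd b1 j t"] by (simp add: dist_norm)
      moreover have "upd b1 j t \<in> C" using t by (auto simp: C_def)
      ultimately have "infdist (upd z j t) C \<le> e" using infdist_le order_trans by blast
      then show ?thesis using e by (auto simp: N_def)
    qed
    define F1 where "F1 = (\<lambda>q z. q (L z)) ` F"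
    interpret projection j \<epsilon> U1 U' F1 "\<lambda>z. g0 (L z)"
    proof
      show "connected U'" by (simp add: U'_def convex_connected)
      show "upd z j t \<in> U'" if z: "z \<in> U'" "t \<in> ball 0 \<epsilon>" for z t
      proof -
        have "dist (upd z j t $ i) (b1 $ i) < \<rho>' i" for i
        proof (cases "i = j")
          case True
          then show ?thesis using z(2) b1J[OF j(1)] by (simp add: \<rho>'_def)
        next
          case False
          then show ?thesis using z(1) by (simp add: U'_def pdisc_def)
        qed
        then show ?thesis by (simp add: U'_def pdisc_def)
      qed
      show "z $ j \<in> ball 0 \<epsilon>" if "z \<in> U'" for z
        using that b1J[OF j(1)] by (auto simp: U'_def pdisc_def \<rho>'_def dest!: spec[of _ j])
    qed (use eps cyl nz finF holqL g0 in \<open>auto simp: F1_def U'_def\<close>)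
    have agree: "L (upd z j t) $ i = L (upd z' j t) $ i" if "\<And>i. i \<notin> insert j A \<Longrightarrow> z $ i = z' $ i" "i \<notin> A" for z z' t i
      using that by (auto simp: L_def)
    have T': "z \<in> proj" if z: "z \<in> U'" "\<And>i. i \<in> J \<Longrightarrow> z $ i = 0" for z
    proof -
      have "upd z j 0 = z" using upd_same[of z j] z(2)[OF j(1)] by simp
      moreover have "q (L z) = 0" if "q \<in> F" for q
      proof -
        have "L z = z" using z(2)[OF j(1)] Lfix by simp
        moreover have "z \<in> U" using LU1[of z] subU1 z(1) \<open>L z = z\<close> by auto
        ultimately show ?thesis using van[OF that] z(2) by (simp add: U_def)
      qed
      ultimately have "\<forall>q\<in>F1. q (upd z j 0) = 0" by (simp add: F1_def)
      then show ?thesis using z(1) eps(1) by (auto simp: proj_def intro!: bexI[of _ 0])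
    qed
    obtain F' where F'_all: "finite F' \<and> (\<forall>f\<in>F'. holo_on f U') \<and> {z\<in>U'. \<forall>f\<in>F'. f z = 0} = proj \<and>
      (\<forall>f\<in>F'. \<forall>z\<in>U'. \<forall>z'\<in>U'.
         (\<forall>q\<in>F1. \<forall>t. upd z j t \<in> U1 \<longrightarrow> upd z' j t \<in> U1 \<longrightarrow> q (upd z j t) = q (upd z' j t)) \<longrightarrow> f z = f z')"
      using proj_functions by (rule exE)
    have F': "finite F'" "\<And>f. f \<in> F' \<Longrightarrow> holo_on f U'" "{z\<in>U'. \<forall>f\<in>F'. f z = 0} = proj"
      using F'_all by auto
    note F'4 = F'_all[THEN conjunct2, THEN conjunct2, THEN conjunct2, rule_format]
    have "J - insert j A \<subset> J - A" using j by blast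
    then have smaller: "card (J - insert j A) < card (J - A)" by (intro psubset_card_mono) auto
    have "\<exists>a\<in>U'. \<exists>c. c + card (insert j A) \<le> card J \<and> regular_point {z\<in>U'. \<forall>q\<in>F'. q z = 0} c a"
      unfolding U'_def
    proof (rule less.hyps[OF smaller])
      fix q z z' assume q: "q \<in> F'" and z: "z \<in> pdisc b1 \<rho>'" "z' \<in> pdisc b1 \<rho>'" and eq: "\<And>i. i \<notin> insert j A \<Longrightarrow> z $ i = z' $ i"
      show "q z = q z'"
      proof (rule F'4[OF q z[folded U'_def]])
        fix f t assume f: "f \<in> F1" and tU: "upd z j t \<in> U1" "upd z' j t \<in> U1"
        obtain q0 where q0: "q0 \<in> F" "f = (\<lambda>z. q0 (L z))" using f by (auto simp: F1_def)
        have "q0 (L (upd z j t)) = q0 (L (upd z' j t))"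
          using indepA[OF q0(1)] LU1[OF tU(1)] LU1[OF tU(2)] agree[OF eq] unfolding U_def by blast
        then show "f (upd z j t) = f (upd z' j t)" by (simp add: q0(2))
      qed
    next
      fix q z assume "q \<in> F'" "z \<in> pdisc b1 \<rho>'" "\<And>i. i \<in> J \<Longrightarrow> z $ i = 0"
      then show "q z = 0" using T' F'(3) by (auto simp: U'_def)
    qed (use F' AJ j b1J \<rho>'pos in \<open>auto simp: U'_def\<close>)
    then obtain a' c where a': "a' \<in> U'" "c + card (insert j A) \<le> card J" "regular_point proj c a'"
      unfolding F'(3) by blast
    \<comment> \<open>The lift raises the codimension by one, and \<open>insert j A\<close> has one
      element more than \<open>A\<close>, so the inequality survives.\<close>
    obtain a where a: "a \<in> U'" "regular_point {z\<in>U'. \<forall>q\<in>F1. q z = 0} (Suc c) a" using proj_lift[OF a'(3)] .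
    have "biholo L L' U' (L' -` U')"
      unfolding biholo_def
      using LL' holL[OF openU] holL'[OF open_vimage[OF openU contL']] open_vimage[OF openU contL']
        holL[of U'] holL'[of "L' -` U'"] openU contL' by (auto intro!: open_vimage simp: U'_def)
    then have "regular_point {z\<in>U. \<forall>q\<in>F. q z = 0} (Suc c) (L a)"
    proof (rule regular_point_biholo[OF _ a])
      fix y assume y: "y \<in> L' -` U'"
      then have "y \<in> U" using LU1[of "L' y"] LL' subU1 by auto
      then show "y \<in> {z\<in>U. \<forall>q\<in>F. q z = 0} \<longleftrightarrow> L' y \<in> {z\<in>U'. \<forall>q\<in>F1. q z = 0}"
        using y LL' by (auto simp: F1_def)
    qed
    moreover have "L a \<in> U" using LU1 subU1 a(1) by auto
    moreover have "Suc c + card A \<le> card J" using a'(2) j by (simp add: card_insert_if)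
    ultimately show ?thesis unfolding U_def by blast
  qed
qed

text \<open>The inequality from dimension theory: an analytic set containing the germ of a manifold
  of codimension \<open>m\<close> has regular points of codimension at most \<open>m\<close> in
  \<open>U\<close>. In a chart of the functions \<open>h\<close> it is
  \<open>dimension_induct\<close> with \<open>A\<close> empty and the manifold as the coordinate
  plane.\<close>

theorem dimension_le:
  fixes b :: "complex^'n"
  assumes U: "open U" "b \<in> U" and F: "finite F" "\<And>q. q \<in> F \<Longrightarrow> holo_on q U"
    and h: "\<And>i. i < m \<Longrightarrow> holo_at (h i) b" "\<And>i. i < m \<Longrightarrow> h i b = 0" "indep_at m h b"
    and sub: "\<And>q. q \<in> F \<Longrightarrow> \<forall>\<^sub>F z in nhds b. (\<forall>i<m. h i z = 0) \<longrightarrow> q z = 0"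
  obtains a c where "a \<in> U" "c \<le> m" "regular_point {z\<in>U. \<forall>q\<in>F. q z = 0} c a"
proof -
  have "\<exists>O1. open O1 \<and> b \<in> O1 \<and> (\<forall>i<m. holo_on (h i) O1)"
  proof (rule finite_nbhd)
    fix i assume "i < m"
    then obtain O1 where "b \<in> O1" "holo_on (h i) O1" using h(1) unfolding holo_at_def by blast
    then show "\<exists>O1. open O1 \<and> b \<in> O1 \<and> holo_on (h i) O1" using holo_on_open by blast
  qed (rule holo_on_subset)
  then obtain O1 where O1: "open O1" "b \<in> O1" "\<And>i. i < m \<Longrightarrow> holo_on (h i) O1" by blast
  have "\<forall>\<^sub>F z in nhds b. \<forall>q\<in>F. (\<forall>i<m. h i z = 0) \<longrightarrow> q z = 0"
    by (rule eventually_ball_finite[OF F(1)]) (use sub in blast)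
  then obtain O2 where O2: "open O2" "b \<in> O2" "\<And>z q. z \<in> O2 \<Longrightarrow> q \<in> F \<Longrightarrow> (\<forall>i<m. h i z = 0) \<Longrightarrow> q z = 0"
    unfolding eventually_nhds by blast
  define O3 where "O3 = U \<inter> O1 \<inter> O2"
  have O3: "open O3" "b \<in> O3" using U O1 O2 by (auto simp: O3_def)
  have hO3: "holo_on (h i) O3" if "i < m" for i using holo_on_subset[OF O1(3)[OF that] O3(1)] by (auto simp: O3_def)
  obtain G H V W J \<sigma> where ch: "biholo G H V W" "b \<in> V" "V \<subseteq> O3" "card J = m" "bij_betw \<sigma> J {..<m}"
    "\<And>z j. z \<in> V \<Longrightarrow> j \<in> J \<Longrightarrow> G z $ j = h (\<sigma> j) z" "G b = 0"
    by (rule straightening[of m h O3 b]) (use hO3 O3 h in auto)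
  note bh = biholoD[OF ch(1)]
  have "0 \<in> W" using bh(3)[OF ch(2)] ch(7) by simp
  then obtain r where r: "r > 0" "pdisc 0 (\<lambda>_. r) \<subseteq> W" using open_contains_pdisc[OF bh(2)] by blast
  define P where "P = pdisc (0::complex^'n) (\<lambda>_. r)"
  define F' where "F' = (\<lambda>q y. q (H y)) ` F"
  have holF': "holo_on (\<lambda>y. q (H y)) P" if "q \<in> F" for q
    by (rule holo_on_subset[OF biholo_holo_compose[OF ch(1) F(2)[OF that]]])
       (use r bh(5) ch(3) in \<open>auto simp: P_def O3_def subset_iff\<close>)
  have "\<exists>a\<in>P. \<exists>c. c + card ({} :: 'n set) \<le> card J \<and> regular_point {z\<in>P. \<forall>q\<in>F'. q z = 0} c a"
    unfolding P_def
  proof (rule dimension_induct)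
    fix q z z' assume "\<And>i. i \<notin> {} \<Longrightarrow> z $ i = (z' :: complex^'n) $ i"
    then have "z = z'" by (simp add: cvec_eq_iff)
    then show "q z = (q z' :: complex)" by simp
  next
    fix q z assume q: "q \<in> F'" and z: "z \<in> pdisc 0 (\<lambda>_. r)" and J0: "\<And>j. j \<in> J \<Longrightarrow> z $ j = 0"
    obtain q0 where q0: "q0 \<in> F" "q = (\<lambda>y. q0 (H y))" using q by (auto simp: F'_def)
    have zW: "z \<in> W" using r z by blast
    have "h i (H z) = 0" if i: "i < m" for i
    proof -
      obtain j where jj: "j \<in> J" "\<sigma> j = i" using bij_betw_lessThan_obtain[OF ch(5) i] by blast
      have "h i (H z) = G (H z) $ j" using ch(6)[OF bh(5)[OF zW] jj(1)] jj(2) by simp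
      then show ?thesis using bh(6)[OF zW] J0 jj by simp
    qed
    moreover have "H z \<in> O2" using bh(5)[OF zW] ch(3) by (auto simp: O3_def)
    ultimately show "q z = 0" using O2(3) q0 by auto
  qed (use F r holF' in \<open>auto simp: F'_def P_def\<close>)
  then obtain a c where a: "a \<in> P" "c \<le> m" "regular_point {z\<in>P. \<forall>q\<in>F'. q z = 0} c a" using ch(4) by auto
  have bP: "biholo H G P (V \<inter> G -` P)"
    by (rule biholo_restrict[OF biholo_sym[OF ch(1)]]) (use r in \<open>auto simp: P_def\<close>)
  have "regular_point {z\<in>U. \<forall>q\<in>F. q z = 0} c (H a)"
  proof (rule regular_point_biholo[OF bP a(1,3)])
    fix y assume y: "y \<in> V \<inter> G -` P"
    then show "y \<in> {z\<in>U. \<forall>q\<in>F. q z = 0} \<longleftrightarrow> G y \<in> {z\<in>P. \<forall>q\<in>F'. q z = 0}"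
      using bh(4) ch(3) by (auto simp: F'_def O3_def)
  qed
  moreover have "H a \<in> U" using a(1) r(2) bh(5) ch(3) by (auto simp: P_def O3_def subset_iff)
  ultimately show ?thesis using that a(2) by blast
qed

subsection \<open>The Cousin problem for a cut box\<close>

text \<open>The Cauchy integral in the j-th variable along one segment, without the factor 1 / (2 pi
  i). Taking the sides of a rectangle separately matters because each gives a function holomorphic
  wherever z_j avoids that side.\<close>

definition slice_int :: "complex \<Rightarrow> complex \<Rightarrow> 'n \<Rightarrow> (complex^'n \<Rightarrow> complex) \<Rightarrow> complex^'n \<Rightarrow> complex" where
  "slice_int p q j h z = contour_integral (linepath p q) (\<lambda>\<zeta>. h (upd z j \<zeta>) / (\<zeta> - z $ j))"

lemma holo_on_slice_int:
  assumes V: "open V" and h: "holo_on h U"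
    and sub: "\<And>z \<zeta>. z \<in> V \<Longrightarrow> \<zeta> \<in> closed_segment p q \<Longrightarrow> upd z j \<zeta> \<in> U \<and> \<zeta> \<noteq> z $ j"
  shows "holo_on (slice_int p q j h) V"
proof -
  have l: "linepath p q t \<in> closed_segment p q" if "t \<in> {0..1}" for t
    using that linepath_in_path by auto
  have "holo_on (\<lambda>z. integral {0..1} (\<lambda>t. h (upd z j (linepath p q t)) / (linepath p q t - z $ j) * (q - p))) V"
  proof (rule holo_on_integral[OF V])
    show "continuous_on (V \<times> {0..1}) (\<lambda>(z, t). h (upd z j (linepath p q t)) / (linepath p q t - z $ j) * (q - p))"
      unfolding split_beta
    proof (intro continuous_on_mult continuous_on_divide continuous_on_const)
      show "continuous_on (V \<times> {0..1}) (\<lambda>x. h (upd (fst x) j (linepath p q (snd x))))"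
        by (rule continuous_on_compose2[OF holo_on_continuous[OF h]])
           (use sub l in \<open>auto intro!: continuous_intros simp: linepath_def\<close>)
      show "continuous_on (V \<times> {0..1}) (\<lambda>x. linepath p q (snd x) - fst x $ j)"
        unfolding linepath_def by (intro continuous_intros)
      show "\<forall>x\<in>V \<times> {0..1}. linepath p q (snd x) - fst x $ j \<noteq> 0"
        using sub l by auto
    qed
    fix t :: real assume t: "t \<in> {0..1}"
    show "holo_on (\<lambda>z. h (upd z j (linepath p q t)) / (linepath p q t - z $ j) * (q - p)) V"
    proof (intro holo_on_mult holo_on_divide holo_on_diff holo_on_const holo_on_nth V)
      show "holo_on (\<lambda>z. h (upd z j (linepath p q t))) V"
        by (rule holo_on_compose[OF h V holo_on_upd[OF V]]) (use sub l[OF t] in auto)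
      show "\<And>z. z \<in> V \<Longrightarrow> linepath p q t - z $ j \<noteq> 0" using sub l[OF t] by auto
    qed
  qed
  then show ?thesis by (simp add: slice_int_def[abs_def] contour_integral_integral)
qed

definition rect_int :: "real \<Rightarrow> real \<Rightarrow> real \<Rightarrow> real \<Rightarrow> 'n \<Rightarrow> (complex^'n \<Rightarrow> complex) \<Rightarrow> complex^'n \<Rightarrow> complex" where
  "rect_int x1 x2 y1 y2 j h z =
     slice_int (Complex x1 y1) (Complex x2 y1) j h z + slice_int (Complex x2 y1) (Complex x2 y2) j h z +
     slice_int (Complex x2 y2) (Complex x1 y2) j h z + slice_int (Complex x1 y2) (Complex x1 y1) j h z"

lemma rect_int_eq_rectpath:
  assumes h: "holo_on h U" and R: "\<And>\<zeta>. \<zeta> \<in> cbox (Complex x1 y1) (Complex x2 y2) \<Longrightarrow> upd z j \<zeta> \<in> U"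
    and le: "x1 \<le> x2" "y1 \<le> y2" and nb: "z $ j \<notin> path_image (rectpath (Complex x1 y1) (Complex x2 y2))"
  shows "contour_integral (rectpath (Complex x1 y1) (Complex x2 y2)) (\<lambda>\<zeta>. h (upd z j \<zeta>) / (\<zeta> - z $ j)) = rect_int x1 x2 y1 y2 j h z"
proof -
  let ?f = "\<lambda>\<zeta>. h (upd z j \<zeta>) / (\<zeta> - z $ j)"
  let ?P = "path_image (rectpath (Complex x1 y1) (Complex x2 y2))"
  have "?P \<subseteq> cbox (Complex x1 y1) (Complex x2 y2)"
    using le by (intro path_image_rectpath_subset_cbox) auto
  then have cont: "continuous_on ?P ?f"
    using nb R by (intro continuous_intros continuous_on_compose2[OF holo_on_continuous[OF h]]) auto
  have ci: "?f contour_integrable_on linepath u v" if "closed_segment u v \<subseteq> ?P" for u v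
    using continuous_on_subset[OF cont that] by (rule contour_integrable_continuous_linepath)
  have im: "?P = closed_segment (Complex x1 y1) (Complex x2 y1) \<union> closed_segment (Complex x2 y1) (Complex x2 y2) \<union>
      closed_segment (Complex x2 y2) (Complex x1 y2) \<union> closed_segment (Complex x1 y2) (Complex x1 y1)"
    by (simp add: rectpath_def Let_def path_image_join Un_assoc)
  have c: "?f contour_integrable_on linepath (Complex x1 y1) (Complex x2 y1)"
    "?f contour_integrable_on linepath (Complex x2 y1) (Complex x2 y2)"
    "?f contour_integrable_on linepath (Complex x2 y2) (Complex x1 y2)"
    "?f contour_integrable_on linepath (Complex x1 y2) (Complex x1 y1)"
    by (rule ci; subst im; blast)+
  show ?thesis
    using c by (simp add: rectpath_def Let_def rect_int_def slice_int_def contour_integrable_join)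
qed

lemma rect_int_inside:
  assumes h: "holo_on h U" and R: "\<And>\<zeta>. \<zeta> \<in> cbox (Complex x1 y1) (Complex x2 y2) \<Longrightarrow> upd z j \<zeta> \<in> U"
    and z: "z $ j \<in> box (Complex x1 y1) (Complex x2 y2)"
  shows "rect_int x1 x2 y1 y2 j h z = 2 * pi * \<i> * h z"
proof -
  let ?R = "cbox (Complex x1 y1) (Complex x2 y2)"
  let ?\<gamma> = "rectpath (Complex x1 y1) (Complex x2 y2)"
  have le: "x1 \<le> x2" "y1 \<le> y2" using z by (auto simp: in_box_complex_iff)
  have im: "path_image ?\<gamma> = ?R - box (Complex x1 y1) (Complex x2 y2)"
    using le by (intro path_image_rectpath_cbox_minus_box) auto
  have "((\<lambda>\<zeta>. h (upd z j \<zeta>) / (\<zeta> - z $ j)) has_contour_integral (2 * pi * \<i> * winding_number ?\<gamma> (z $ j) * h (upd z j (z $ j)))) ?\<gamma>"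
  proof (rule Cauchy_integral_formula_convex_simple)
    show "(\<lambda>\<zeta>. h (upd z j \<zeta>)) holomorphic_on ?R" using R by (intro holo_on_holomorphic_upd[OF h]) auto
    show "path_image ?\<gamma> \<subseteq> ?R - {z $ j}" using im z by auto
  qed (use z in auto)
  then have "contour_integral ?\<gamma> (\<lambda>\<zeta>. h (upd z j \<zeta>) / (\<zeta> - z $ j)) = 2 * pi * \<i> * h z"
    using winding_number_rectpath[OF z] by (simp add: contour_integral_unique)
  then show ?thesis using rect_int_eq_rectpath[OF h R le] im z by auto
qed

lemma rect_int_outside:
  assumes h: "holo_on h U" and R: "\<And>\<zeta>. \<zeta> \<in> cbox (Complex x1 y1) (Complex x2 y2) \<Longrightarrow> upd z j \<zeta> \<in> U"
    and le: "x1 \<le> x2" "y1 \<le> y2" and z: "z $ j \<notin> cbox (Complex x1 y1) (Complex x2 y2)"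
  shows "rect_int x1 x2 y1 y2 j h z = 0"
proof -
  let ?R = "cbox (Complex x1 y1) (Complex x2 y2)"
  let ?\<gamma> = "rectpath (Complex x1 y1) (Complex x2 y2)"
  have im: "path_image ?\<gamma> \<subseteq> ?R" using le by (intro path_image_rectpath_subset_cbox) auto
  have "((\<lambda>\<zeta>. h (upd z j \<zeta>) / (\<zeta> - z $ j)) has_contour_integral 0) ?\<gamma>"
  proof (rule Cauchy_theorem_convex_simple)
    show "(\<lambda>\<zeta>. h (upd z j \<zeta>) / (\<zeta> - z $ j)) holomorphic_on ?R"
      using z R by (intro holomorphic_intros holo_on_holomorphic_upd[OF h]) auto
  qed (use im in auto)
  then show ?thesis using rect_int_eq_rectpath[OF h R le] im z by (auto simp: contour_integral_unique)
qed

lemma holo_on_holo_at: "holo_on h {z. holo_at h z}"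
proof -
  have "{z. holo_at h z} = \<Union>{U. holo_on h U}" by (auto simp: holo_at_def)
  then show ?thesis using holo_on_Union[of "{U. holo_on h U}" h] by auto
qed

lemma open_holo_at: "open {z. holo_at h z}"
  using holo_on_open[OF holo_on_holo_at] .

text \<open>A Cauchy integral over a thin rectangle around the part of the cut with imaginary part
  between \<alpha>' and \<beta>' equals \<open>h\<close> inside and 0 outside. Its sides split into
  a part holomorphic to the left of the cut and one holomorphic to the right. Only one segment of
  the cut is treated, because a removed disc can break the cut into two.\<close>

lemma cousin_strip:
  fixes K :: "(complex^'n) set"
  assumes K: "compact K" and bnd: "\<alpha> < \<alpha>'" "\<alpha>' \<le> \<beta>'" "\<beta>' < \<beta>"
    and gap: "\<And>z. z \<in> K \<Longrightarrow> Re (z $ j) = c \<Longrightarrow> \<alpha> \<le> Im (z $ j) \<Longrightarrow> Im (z $ j) \<le> \<beta> \<Longrightarrow> \<alpha>' \<le> Im (z $ j) \<and> Im (z $ j) \<le> \<beta>'"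
    and full: "\<And>z y. z \<in> K \<Longrightarrow> \<alpha>' \<le> y \<Longrightarrow> y \<le> \<beta>' \<Longrightarrow> upd z j (Complex c y) \<in> K"
    and h: "\<And>a. a \<in> K \<Longrightarrow> Re (a $ j) = c \<Longrightarrow> \<alpha>' \<le> Im (a $ j) \<Longrightarrow> Im (a $ j) \<le> \<beta>' \<Longrightarrow> holo_at h a"
  shows "\<exists>h1 h2. (\<forall>a\<in>K. Re (a $ j) \<le> c \<longrightarrow> holo_at h1 a) \<and> (\<forall>a\<in>K. c \<le> Re (a $ j) \<longrightarrow> holo_at h2 a) \<and>
     (\<forall>a\<in>K. Re (a $ j) = c \<longrightarrow> (\<forall>\<^sub>F z in nhds a. h1 z - h2 z = (if \<alpha>' \<le> Im (a $ j) \<and> Im (a $ j) \<le> \<beta>' then h z else 0)))"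
proof (cases "K = {}")
  case True
  then show ?thesis by simp
next
  case False
  then obtain k0 where k0: "k0 \<in> K" by blast
  define S where "S = {z\<in>K. Re (z $ j) = c \<and> \<alpha>' \<le> Im (z $ j) \<and> Im (z $ j) \<le> \<beta>'}"
  have "closed {z :: complex^'n. Re (z $ j) = c \<and> \<alpha>' \<le> Im (z $ j) \<and> Im (z $ j) \<le> \<beta>'}"
    by (intro closed_Collect_conj closed_Collect_eq closed_Collect_le continuous_intros)
  moreover have "S = K \<inter> {z. Re (z $ j) = c \<and> \<alpha>' \<le> Im (z $ j) \<and> Im (z $ j) \<le> \<beta>'}" by (auto simp: S_def)
  ultimately have "compact S" using compact_Int_closed[OF K] by simp
  have "upd k0 j (Complex c \<alpha>') \<in> S" using full[OF k0, of \<alpha>'] bnd by (simp add: S_def)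
  then have "S \<noteq> {}" by blast
  define Oh where "Oh = {z. holo_at h z}"
  have "S \<subseteq> Oh" using h by (auto simp: S_def Oh_def)
  then obtain e where e: "e > 0" "{x. infdist x S \<le> e} \<subseteq> Oh"
    using compact_in_open_separated[OF \<open>S \<noteq> {}\<close> \<open>compact S\<close> _ \<open>S \<subseteq> Oh\<close>] open_holo_at by (auto simp: Oh_def)
  have hO: "holo_on h Oh" using holo_on_holo_at by (simp add: Oh_def)
  \<comment> \<open>The horizontal sides, at heights \<alpha>1 and \<beta>1, cross the line Re = c
    inside the gaps, where it contains no point of the j-th projection of \<open>K\<close>.\<close>
  define \<alpha>1 where "\<alpha>1 = max \<alpha> (\<alpha>' - e / 2)"
  define \<beta>1 where "\<beta>1 = min \<beta> (\<beta>' + e / 2)"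
  have ab1: "\<alpha> \<le> \<alpha>1" "\<alpha>1 < \<alpha>'" "\<alpha>' - \<alpha>1 \<le> e / 2" "\<beta>1 \<le> \<beta>" "\<beta>' < \<beta>1" "\<beta>1 - \<beta>' \<le> e / 2" "\<alpha>1 < \<beta>1"
    using bnd e(1) by (auto simp: \<alpha>1_def \<beta>1_def max_def min_def)
  define Kj where "Kj = (\<lambda>z. z $ j) ` K"
  have "compact Kj" unfolding Kj_def using K by (intro compact_continuous_image continuous_intros)
  then have oK: "open (- Kj)" using compact_imp_closed by blast
  have "Complex c y \<in> - Kj" if y: "y = \<alpha>1 \<or> y = \<beta>1" for y
  proof
    assume "Complex c y \<in> Kj"
    then obtain z where z: "z \<in> K" "z $ j = Complex c y" by (auto simp: Kj_def)
    show False using gap[OF z(1)] z(2) y ab1 bnd by auto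
  qed
  then have "Complex c \<alpha>1 \<in> - Kj" "Complex c \<beta>1 \<in> - Kj" by auto
  then obtain e3 e4 where e34: "e3 > 0" "ball (Complex c \<alpha>1) e3 \<subseteq> - Kj" "e4 > 0" "ball (Complex c \<beta>1) e4 \<subseteq> - Kj"
    using oK open_contains_ball by metis
  define e5 where "e5 = min e3 e4"
  have e5: "e5 > 0" "ball (Complex c \<alpha>1) e5 \<subseteq> - Kj" "ball (Complex c \<beta>1) e5 \<subseteq> - Kj"
    using e34 by (auto simp: e5_def)
  \<comment> \<open>With \<eta> \<le> e / 4 a point of the rectangle, moved by \<eta> in the other
    variables, stays within \<eta> + (\<eta> + e / 2) \<le> e of \<open>S\<close>. With \<eta> \<le>
    e5 / 2 the horizontal sides stay away from nearby values of z_j.\<close>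
  define \<eta> where "\<eta> = min (e / 4) (e5 / 2)"
  have \<eta>: "\<eta> > 0" "\<eta> \<le> e / 4" "\<eta> \<le> e5 / 2" using e e5 by (auto simp: \<eta>_def)
  define R where "R = cbox (Complex (c - \<eta>) \<alpha>1) (Complex (c + \<eta>) \<beta>1)"
  have inO: "upd z j \<zeta> \<in> Oh" if a: "a \<in> K" and z: "z \<in> ball a \<eta>" and \<zeta>: "\<zeta> \<in> R" for a z \<zeta>
  proof -
    define y where "y = max \<alpha>' (min \<beta>' (Im \<zeta>))"
    define s where "s = upd a j (Complex c y)"
    have y: "\<alpha>' \<le> y" "y \<le> \<beta>'" using bnd by (auto simp: y_def)
    have "s \<in> S" using full[OF a y] y by (simp add: S_def s_def)
    have "\<bar>Im \<zeta> - y\<bar> \<le> e / 2" "\<bar>Re \<zeta> - c\<bar> \<le> \<eta>"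
      using \<zeta> ab1 bnd e(1) by (auto simp: R_def in_cbox_complex_iff y_def max_def min_def)
    then have "norm (\<zeta> - Complex c y) \<le> \<eta> + e / 2"
      using cmod_le[of "\<zeta> - Complex c y"] by simp
    then have "dist (upd a j \<zeta>) s \<le> \<eta> + e / 2"
      using dist_upd[of s j \<zeta>] by (simp add: s_def dist_norm)
    moreover have "dist (upd z j \<zeta>) (upd a j \<zeta>) \<le> \<eta>"
      using dist_upd_upd_le[of z j \<zeta> a] z by (simp add: dist_commute)
    ultimately have "dist (upd z j \<zeta>) s \<le> e"
      using dist_triangle[of "upd z j \<zeta>" s "upd a j \<zeta>"] \<eta>(2) e(1) by linarith
    then have "infdist (upd z j \<zeta>) S \<le> e" using infdist_le[OF \<open>s \<in> S\<close>] order_trans by blast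
    then show ?thesis using e by blast
  qed
  have near: "dist (z $ j) (a $ j) < \<eta>" if "z \<in> ball a \<eta>" for z a :: "complex^'n"
    using that Finite_Cartesian_Product.norm_nth_le[of "z - a" j] by (simp add: dist_norm norm_minus_commute)
  have seg_h: "closed_segment (Complex x1 y) (Complex x2 y) \<subseteq> {\<zeta>. Im \<zeta> = y \<and> min x1 x2 \<le> Re \<zeta> \<and> Re \<zeta> \<le> max x1 x2}" for x1 x2 y
    by (auto simp: closed_segment_same_Im closed_segment_eq_real_ivl split: if_splits)
  have seg_v: "closed_segment (Complex x y1) (Complex x y2) \<subseteq> {\<zeta>. Re \<zeta> = x \<and> min y1 y2 \<le> Im \<zeta> \<and> Im \<zeta> \<le> max y1 y2}" for x y1 y2
    by (auto simp: closed_segment_same_Re closed_segment_eq_real_ivl split: if_splits)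
  have hor: "z $ j \<noteq> \<zeta>" if a: "a \<in> K" and z: "z \<in> ball a \<eta>" and \<zeta>: "\<bar>Re \<zeta> - c\<bar> \<le> \<eta>" "Im \<zeta> = y" "y = \<alpha>1 \<or> y = \<beta>1" for a z \<zeta> y
  proof
    assume eq: "z $ j = \<zeta>"
    have "norm (\<zeta> - Complex c y) \<le> \<eta>" using \<zeta> cmod_le[of "\<zeta> - Complex c y"] by simp
    then have "dist (a $ j) (Complex c y) < e5"
      using near[OF z] dist_triangle[of "a $ j" "Complex c y" "z $ j"] \<eta>(3) e5(1) by (simp add: eq dist_norm norm_minus_commute)
    then have "a $ j \<in> ball (Complex c y) e5" by (simp add: dist_commute)
    then have "a $ j \<in> - Kj" using e5(2,3) \<zeta>(3) by blast
    then show False using a by (auto simp: Kj_def)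
  qed
  let ?bot = "slice_int (Complex (c - \<eta>) \<alpha>1) (Complex (c + \<eta>) \<alpha>1) j h"
  let ?rig = "slice_int (Complex (c + \<eta>) \<alpha>1) (Complex (c + \<eta>) \<beta>1) j h"
  let ?top = "slice_int (Complex (c + \<eta>) \<beta>1) (Complex (c - \<eta>) \<beta>1) j h"
  let ?lef = "slice_int (Complex (c - \<eta>) \<beta>1) (Complex (c - \<eta>) \<alpha>1) j h"
  have bot: "holo_on ?bot (ball a \<eta>)" if "a \<in> K" for a
  proof (rule holo_on_slice_int[OF open_ball hO])
    fix z \<zeta> assume z: "z \<in> ball a \<eta>" and "\<zeta> \<in> closed_segment (Complex (c - \<eta>) \<alpha>1) (Complex (c + \<eta>) \<alpha>1)"
    then have \<zeta>: "Im \<zeta> = \<alpha>1" "c - \<eta> \<le> Re \<zeta>" "Re \<zeta> \<le> c + \<eta>" using seg_h[of "c - \<eta>" \<alpha>1 "c + \<eta>"] \<eta>(1) by auto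
    then have "\<zeta> \<in> R" using ab1 by (auto simp: R_def in_cbox_complex_iff)
    then show "upd z j \<zeta> \<in> Oh \<and> \<zeta> \<noteq> z $ j" using inO[OF that z] hor[OF that z, of \<zeta> \<alpha>1] \<zeta> by force
  qed
  have top: "holo_on ?top (ball a \<eta>)" if "a \<in> K" for a
  proof (rule holo_on_slice_int[OF open_ball hO])
    fix z \<zeta> assume z: "z \<in> ball a \<eta>" and "\<zeta> \<in> closed_segment (Complex (c + \<eta>) \<beta>1) (Complex (c - \<eta>) \<beta>1)"
    then have \<zeta>: "Im \<zeta> = \<beta>1" "c - \<eta> \<le> Re \<zeta>" "Re \<zeta> \<le> c + \<eta>" using seg_h[of "c + \<eta>" \<beta>1 "c - \<eta>"] \<eta>(1) by auto
    then have "\<zeta> \<in> R" using ab1 by (auto simp: R_def in_cbox_complex_iff)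
    then show "upd z j \<zeta> \<in> Oh \<and> \<zeta> \<noteq> z $ j" using inO[OF that z] hor[OF that z, of \<zeta> \<beta>1] \<zeta> by force
  qed
  have rig: "holo_on ?rig (ball a \<eta>)" if "a \<in> K" "Re (a $ j) \<le> c" for a
  proof (rule holo_on_slice_int[OF open_ball hO])
    fix z \<zeta> assume z: "z \<in> ball a \<eta>" and "\<zeta> \<in> closed_segment (Complex (c + \<eta>) \<alpha>1) (Complex (c + \<eta>) \<beta>1)"
    then have \<zeta>: "Re \<zeta> = c + \<eta>" "\<alpha>1 \<le> Im \<zeta>" "Im \<zeta> \<le> \<beta>1" using seg_v[of "c + \<eta>" \<alpha>1 \<beta>1] ab1 by auto
    then have "\<zeta> \<in> R" using \<eta>(1) by (auto simp: R_def in_cbox_complex_iff)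
    moreover have "\<bar>Re (z $ j - a $ j)\<bar> < \<eta>" using near[OF z] abs_Re_le_cmod[of "z $ j - a $ j"] by (simp add: dist_norm)
    ultimately show "upd z j \<zeta> \<in> Oh \<and> \<zeta> \<noteq> z $ j" using inO[OF that(1) z] \<zeta> that(2) by auto
  qed
  have lef: "holo_on ?lef (ball a \<eta>)" if "a \<in> K" "c \<le> Re (a $ j)" for a
  proof (rule holo_on_slice_int[OF open_ball hO])
    fix z \<zeta> assume z: "z \<in> ball a \<eta>" and "\<zeta> \<in> closed_segment (Complex (c - \<eta>) \<beta>1) (Complex (c - \<eta>) \<alpha>1)"
    then have \<zeta>: "Re \<zeta> = c - \<eta>" "\<alpha>1 \<le> Im \<zeta>" "Im \<zeta> \<le> \<beta>1" using seg_v[of "c - \<eta>" \<beta>1 \<alpha>1] ab1 by auto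
    then have "\<zeta> \<in> R" using \<eta>(1) by (auto simp: R_def in_cbox_complex_iff)
    moreover have "\<bar>Re (z $ j - a $ j)\<bar> < \<eta>" using near[OF z] abs_Re_le_cmod[of "z $ j - a $ j"] by (simp add: dist_norm)
    ultimately show "upd z j \<zeta> \<in> Oh \<and> \<zeta> \<noteq> z $ j" using inO[OF that(1) z] \<zeta> that(2) by auto
  qed
  \<comment> \<open>The right side stays away from points of \<open>K\<close> with Re \<le> c, the
    left side from those with Re \<ge> c, and the horizontal sides from all of them.\<close>
  define h1 where "h1 z = (?bot z + ?rig z + ?top z) / (2 * pi * \<i>)" for z
  define h2 where "h2 z = - ?lef z / (2 * pi * \<i>)" for z
  have h12: "h1 z - h2 z = rect_int (c - \<eta>) (c + \<eta>) \<alpha>1 \<beta>1 j h z / (2 * pi * \<i>)" for z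
    by (simp add: h1_def h2_def rect_int_def field_simps)
  have "holo_at h1 a" if "a \<in> K" "Re (a $ j) \<le> c" for a
  proof (rule holo_atI)
    show "holo_on h1 (ball a \<eta>)"
      unfolding h1_def[abs_def] using bot top rig that by (intro holo_intros) auto
  qed (use \<eta> in auto)
  moreover have "holo_at h2 a" if "a \<in> K" "c \<le> Re (a $ j)" for a
  proof (rule holo_atI)
    show "holo_on h2 (ball a \<eta>)"
      unfolding h2_def[abs_def] using lef that by (intro holo_intros) auto
  qed (use \<eta> in auto)
  moreover have "\<forall>\<^sub>F z in nhds a. h1 z - h2 z = (if \<alpha>' \<le> Im (a $ j) \<and> Im (a $ j) \<le> \<beta>' then h z else 0)"
    if a: "a \<in> K" "Re (a $ j) = c" for a
  proof (cases "\<alpha>' \<le> Im (a $ j) \<and> Im (a $ j) \<le> \<beta>'")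
    case True
    define V where "V = ball a \<eta> \<inter> (\<lambda>z. z $ j) -` box (Complex (c - \<eta>) \<alpha>1) (Complex (c + \<eta>) \<beta>1)"
    have "open V" unfolding V_def by (intro open_Int open_vimage open_box open_ball continuous_intros)
    moreover have "a \<in> V" using True a(2) ab1 \<eta>(1) by (simp add: V_def in_box_complex_iff)
    moreover have "h1 z - h2 z = h z" if "z \<in> V" for z
      unfolding h12 using rect_int_inside[OF hO, of "c - \<eta>" \<alpha>1 "c + \<eta>" \<beta>1 z j] inO[OF a(1), of z] that
      by (simp add: V_def R_def)
    ultimately show ?thesis using True unfolding eventually_nhds by (intro exI[of _ V]) auto
  next
    case False
    define V where "V = ball a \<eta> \<inter> (\<lambda>z. z $ j) -` (- cbox (Complex (c - \<eta>) \<alpha>1) (Complex (c + \<eta>) \<beta>1))"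
    have "open V" unfolding V_def by (intro open_Int open_vimage open_Compl closed_cbox open_ball continuous_intros)
    moreover have "\<not> (\<alpha> \<le> Im (a $ j) \<and> Im (a $ j) \<le> \<beta>)" using gap[OF a] False by blast
    then have "a \<in> V" using ab1 \<eta>(1) by (auto simp: V_def in_cbox_complex_iff)
    moreover have "h1 z - h2 z = 0" if "z \<in> V" for z
      unfolding h12 using rect_int_outside[OF hO, of "c - \<eta>" \<alpha>1 "c + \<eta>" \<beta>1 z j] inO[OF a(1), of z] that ab1 \<eta>(1)
      by (simp add: V_def R_def)
    ultimately show ?thesis using False unfolding eventually_nhds by (intro exI[of _ V]) auto
  qed
  ultimately show ?thesis by blast
qed

text \<open>A closed box from which the discs of radius \<epsilon> in the coordinates of
  \<open>S\<close> are removed. Such sets serve as the cover in the Cech argument: for a common box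
  and \<epsilon>, intersecting them amounts to uniting the sets \<open>S\<close>, and cutting one by
  a real hyperplane gives sets of the same kind.\<close>

definition abox :: "complex^'n \<Rightarrow> complex^'n \<Rightarrow> 'n set \<Rightarrow> real \<Rightarrow> (complex^'n) set" where
  "abox p q S \<epsilon> = {z. \<forall>i. z $ i \<in> cbox (p $ i) (q $ i) \<and> (i \<in> S \<longrightarrow> \<epsilon> \<le> norm (z $ i))}"

lemma compact_abox:
  fixes p q :: "complex^'n"
  shows "compact (abox p q S \<epsilon>)"
proof -
  have "abox p q S \<epsilon> = (\<Inter>i. {z. z $ i \<in> cbox (p $ i) (q $ i) \<and> (i \<in> S \<longrightarrow> \<epsilon> \<le> norm (z $ i))})"
    by (auto simp: abox_def)
  moreover have "closed {z :: complex^'n. z $ i \<in> cbox (p $ i) (q $ i) \<and> (i \<in> S \<longrightarrow> \<epsilon> \<le> norm (z $ i))}" for i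
    by (intro closed_Collect_conj closed_Collect_imp closed_Collect_le closed_vimage[unfolded vimage_def] continuous_intros) auto
  ultimately have cl: "closed (abox p q S \<epsilon>)" by auto
  have "\<exists>B. \<forall>t\<in>cbox (p $ i) (q $ i). norm t \<le> B" for i using bounded_cbox bounded_iff by blast
  then obtain B where B: "\<And>i t. t \<in> cbox (p $ i) (q $ i) \<Longrightarrow> norm t \<le> B i" by metis
  have "norm z \<le> (\<Sum>i\<in>UNIV. B i)" if "z \<in> abox p q S \<epsilon>" for z
  proof -
    have "norm z \<le> (\<Sum>i\<in>UNIV. norm (z $ i))" by (rule norm_vec_le_sum)
    also have "\<dots> \<le> (\<Sum>i\<in>UNIV. B i)" using that B by (intro sum_mono) (auto simp: abox_def)
    finally show ?thesis .
  qed
  then have "bounded (abox p q S \<epsilon>)" by (auto simp: bounded_iff)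
  with cl show ?thesis by (simp add: compact_eq_bounded_closed)
qed

definition solves_cousin :: "(complex^'n) set \<Rightarrow> 'n \<Rightarrow> (complex \<Rightarrow> real) \<Rightarrow> real \<Rightarrow> bool" where
  "solves_cousin K j \<phi> c \<longleftrightarrow> (\<forall>h. (\<forall>a\<in>K. \<phi> (a $ j) = c \<longrightarrow> holo_at h a) \<longrightarrow>
     (\<exists>h1 h2. (\<forall>a\<in>K. \<phi> (a $ j) \<le> c \<longrightarrow> holo_at h1 a) \<and> (\<forall>a\<in>K. c \<le> \<phi> (a $ j) \<longrightarrow> holo_at h2 a) \<and>
     (\<forall>a\<in>K. \<phi> (a $ j) = c \<longrightarrow> (\<forall>\<^sub>F z in nhds a. h z = h1 z - h2 z))))"

lemma holo_at_0: "holo_at (\<lambda>_. 0) a"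
  by (rule holo_atI[OF holo_on_const[OF open_UNIV]]) simp

lemma holo_at_add: "holo_at f a \<Longrightarrow> holo_at g a \<Longrightarrow> holo_at (\<lambda>z. f z + g z) a"
proof -
  assume "holo_at f a" "holo_at g a"
  then obtain U V where U: "a \<in> U" "holo_on f U" and V: "a \<in> V" "holo_on g V" unfolding holo_at_def by blast
  have o: "open (U \<inter> V)" using holo_on_open[OF U(2)] holo_on_open[OF V(2)] by blast
  show ?thesis
    by (rule holo_atI[OF holo_on_add[OF holo_on_subset[OF U(2) o] holo_on_subset[OF V(2) o]]]) (use U V in auto)
qed

lemma holo_at_mult: "holo_at f a \<Longrightarrow> holo_at g a \<Longrightarrow> holo_at (\<lambda>z. f z * g z) a"
proof -
  assume "holo_at f a" "holo_at g a"
  then obtain U V where U: "a \<in> U" "holo_on f U" and V: "a \<in> V" "holo_on g V" unfolding holo_at_def by blast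
  have o: "open (U \<inter> V)" using holo_on_open[OF U(2)] holo_on_open[OF V(2)] by blast
  show ?thesis
    by (rule holo_atI[OF holo_on_mult[OF holo_on_subset[OF U(2) o] holo_on_subset[OF V(2) o]]]) (use U V in auto)
qed

text \<open>In the coordinate \<open>j\<close> the cut Re = c is one segment, or up to two when it
  runs through a removed disc. Each segment is handled by \<open>cousin_strip\<close>, and the
  solutions are added.\<close>

lemma cousin_Re:
  fixes p q :: "complex^'n"
  shows "solves_cousin (abox p q S \<epsilon>) j Re c"
  unfolding solves_cousin_def
proof (intro allI impI)
  define K where "K = abox p q S \<epsilon>"
  have cK: "compact K" by (simp add: K_def compact_abox)
  define lo hi where "lo = Im (p $ j)" and "hi = Im (q $ j)"
  fix h assume h: "\<forall>a\<in>abox p q S \<epsilon>. Re (a $ j) = c \<longrightarrow> holo_at h a"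
  have KI: "lo \<le> Im (z $ j) \<and> Im (z $ j) \<le> hi" if "z \<in> K" for z
    using that by (auto simp: K_def abox_def lo_def hi_def in_cbox_complex_iff)
  consider "\<not> (Re (p $ j) \<le> c \<and> c \<le> Re (q $ j))" | "Re (p $ j) \<le> c" "c \<le> Re (q $ j)" "j \<notin> S \<or> \<epsilon> \<le> \<bar>c\<bar>"
    | "Re (p $ j) \<le> c" "c \<le> Re (q $ j)" "j \<in> S" "\<bar>c\<bar> < \<epsilon>" by linarith
  then have "\<exists>h1 h2. (\<forall>a\<in>K. Re (a $ j) \<le> c \<longrightarrow> holo_at h1 a) \<and> (\<forall>a\<in>K. c \<le> Re (a $ j) \<longrightarrow> holo_at h2 a) \<and>
     (\<forall>a\<in>K. Re (a $ j) = c \<longrightarrow> (\<forall>\<^sub>F z in nhds a. h z = h1 z - h2 z))"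
  proof cases
    case 1
    then have "Re (a $ j) \<noteq> c" if "a \<in> K" for a
      using that by (auto simp: K_def abox_def in_cbox_complex_iff)
    then show ?thesis using holo_at_0 by (intro exI[of _ "\<lambda>_. 0"]) auto
  next
    case 2
    have inK: "upd z j (Complex c y) \<in> K" if "z \<in> K" "lo \<le> y" "y \<le> hi" for z y
      using that 2 abs_Re_le_cmod[of "Complex c y"]
      by (auto simp: K_def abox_def in_cbox_complex_iff lo_def hi_def)
    show ?thesis
    proof (cases "lo \<le> hi")
      case True
      have "\<exists>h1 h2. (\<forall>a\<in>K. Re (a $ j) \<le> c \<longrightarrow> holo_at h1 a) \<and> (\<forall>a\<in>K. c \<le> Re (a $ j) \<longrightarrow> holo_at h2 a) \<and>
        (\<forall>a\<in>K. Re (a $ j) = c \<longrightarrow> (\<forall>\<^sub>F z in nhds a. h1 z - h2 z = (if lo \<le> Im (a $ j) \<and> Im (a $ j) \<le> hi then h z else 0)))"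
        by (rule cousin_strip[OF cK, of "lo - 1" lo hi "hi + 1"]) (use True KI inK h in \<open>auto simp: K_def\<close>)
      then show ?thesis using KI by (simp add: eq_commute)
    next
      case False
      then have "K = {}" using KI by force
      then show ?thesis by simp
    qed
  next
    case 3
    \<comment> \<open>Half the length of the chord that the line Re = c cuts out of the removed
      disc.\<close>
    define s where "s = sqrt (\<epsilon>\<^sup>2 - c\<^sup>2)"
    have "c\<^sup>2 < \<epsilon>\<^sup>2" using 3(4) by (metis abs_ge_zero power2_abs power_strict_mono zero_less_numeral)
    then have s: "s > 0" "s\<^sup>2 = \<epsilon>\<^sup>2 - c\<^sup>2" by (auto simp: s_def)
    have eps: "\<epsilon> > 0" using 3(4) by linarith
    have nrm: "\<epsilon> \<le> norm (Complex c y) \<longleftrightarrow> y \<le> - s \<or> s \<le> y" for y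
    proof -
      have "\<epsilon> \<le> norm (Complex c y) \<longleftrightarrow> \<epsilon>\<^sup>2 \<le> c\<^sup>2 + y\<^sup>2"
        using eps real_le_rsqrt[of \<epsilon> "c\<^sup>2 + y\<^sup>2"] sqrt_ge_absD[of \<epsilon> "c\<^sup>2 + y\<^sup>2"] by (auto simp: cmod_def)
      also have "\<dots> \<longleftrightarrow> s\<^sup>2 \<le> y\<^sup>2" using s(2) by linarith
      also have "\<dots> \<longleftrightarrow> s \<le> \<bar>y\<bar>" using s(1) abs_le_square_iff[of s y] by simp
      finally show ?thesis using s(1) by auto
    qed
    have KI': "Im (z $ j) \<le> - s \<or> s \<le> Im (z $ j)" if "z \<in> K" "Re (z $ j) = c" for z
    proof -
      have "z $ j = Complex c (Im (z $ j))" using that(2) by (simp add: complex_eq_iff)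
      moreover have "\<epsilon> \<le> norm (z $ j)" using that(1) 3(3) by (simp add: K_def abox_def)
      ultimately show ?thesis using nrm by metis
    qed
    have inK: "upd z j (Complex c y) \<in> K" if "z \<in> K" "lo \<le> y" "y \<le> hi" "y \<le> - s \<or> s \<le> y" for z y
      using that 3 nrm[of y] by (auto simp: K_def abox_def in_cbox_complex_iff lo_def hi_def)
    define u where "u = min hi (- s)"
    define v where "v = max lo s"
    have A: "\<exists>h1 h2. (\<forall>a\<in>K. Re (a $ j) \<le> c \<longrightarrow> holo_at h1 a) \<and> (\<forall>a\<in>K. c \<le> Re (a $ j) \<longrightarrow> holo_at h2 a) \<and>
        (\<forall>a\<in>K. Re (a $ j) = c \<longrightarrow> (\<forall>\<^sub>F z in nhds a. h1 z - h2 z = (if lo \<le> Im (a $ j) \<and> Im (a $ j) \<le> u then h z else 0)))"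
    proof (cases "lo \<le> u")
      case True
      show ?thesis
      \<comment> \<open>The height 0 lies inside the removed chord and so separates the two
        segments. Below \<open>lo\<close> there are no points of \<open>K\<close>, so any number
        smaller than \<open>lo\<close> can serve as lower bound.\<close>
      proof (rule cousin_strip[OF cK, of "lo - 1" lo u 0])
        fix z assume z: "z \<in> K" "Re (z $ j) = c" "Im (z $ j) \<le> 0"
        show "lo \<le> Im (z $ j) \<and> Im (z $ j) \<le> u" using KI[OF z(1)] KI'[OF z(1,2)] z(3) s(1) by (auto simp: u_def)
      qed (use True s inK h in \<open>auto simp: u_def K_def\<close>)
    next
      case False
      then show ?thesis using holo_at_0 by (intro exI[of _ "\<lambda>_. 0"]) auto
    qed
    have B: "\<exists>h1 h2. (\<forall>a\<in>K. Re (a $ j) \<le> c \<longrightarrow> holo_at h1 a) \<and> (\<forall>a\<in>K. c \<le> Re (a $ j) \<longrightarrow> holo_at h2 a) \<and>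
        (\<forall>a\<in>K. Re (a $ j) = c \<longrightarrow> (\<forall>\<^sub>F z in nhds a. h1 z - h2 z = (if v \<le> Im (a $ j) \<and> Im (a $ j) \<le> hi then h z else 0)))"
    proof (cases "v \<le> hi")
      case True
      show ?thesis
      proof (rule cousin_strip[OF cK, of 0 v hi "hi + 1"])
        fix z assume z: "z \<in> K" "Re (z $ j) = c" "0 \<le> Im (z $ j)"
        show "v \<le> Im (z $ j) \<and> Im (z $ j) \<le> hi" using KI[OF z(1)] KI'[OF z(1,2)] z(3) s(1) by (auto simp: v_def)
      qed (use True s inK h in \<open>auto simp: v_def K_def\<close>)
    next
      case False
      then show ?thesis using holo_at_0 by (intro exI[of _ "\<lambda>_. 0"]) auto
    qed
    obtain h1 h2 where h12: "\<forall>a\<in>K. Re (a $ j) \<le> c \<longrightarrow> holo_at h1 a" "\<forall>a\<in>K. c \<le> Re (a $ j) \<longrightarrow> holo_at h2 a"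
        "\<And>a. a \<in> K \<Longrightarrow> Re (a $ j) = c \<Longrightarrow> \<forall>\<^sub>F z in nhds a. h1 z - h2 z = (if lo \<le> Im (a $ j) \<and> Im (a $ j) \<le> u then h z else 0)"
      using A by blast
    obtain k1 k2 where k12: "\<forall>a\<in>K. Re (a $ j) \<le> c \<longrightarrow> holo_at k1 a" "\<forall>a\<in>K. c \<le> Re (a $ j) \<longrightarrow> holo_at k2 a"
        "\<And>a. a \<in> K \<Longrightarrow> Re (a $ j) = c \<Longrightarrow> \<forall>\<^sub>F z in nhds a. k1 z - k2 z = (if v \<le> Im (a $ j) \<and> Im (a $ j) \<le> hi then h z else 0)"
      using B by blast
    have "\<forall>\<^sub>F z in nhds a. h z = (h1 z + k1 z) - (h2 z + k2 z)" if a: "a \<in> K" "Re (a $ j) = c" for a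
    proof -
      have "(lo \<le> Im (a $ j) \<and> Im (a $ j) \<le> u) \<noteq> (v \<le> Im (a $ j) \<and> Im (a $ j) \<le> hi)"
        using KI[OF a(1)] KI'[OF a] s(1) by (auto simp: u_def v_def)
      note dis = this
      show ?thesis
        using h12(3)[OF a] k12(3)[OF a]
      proof eventually_elim
        case (elim z)
        then show ?case using dis by (auto simp: algebra_simps split: if_splits)
      qed
    qed
    then show ?thesis using h12(1,2) k12(1,2)
      by - (rule exI[of _ "\<lambda>z. h1 z + k1 z"], rule exI[of _ "\<lambda>z. h2 z + k2 z"], auto intro!: holo_at_add)
  qed
  then show "\<exists>h1 h2. (\<forall>a\<in>abox p q S \<epsilon>. Re (a $ j) \<le> c \<longrightarrow> holo_at h1 a) \<and> (\<forall>a\<in>abox p q S \<epsilon>. c \<le> Re (a $ j) \<longrightarrow> holo_at h2 a) \<and>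
     (\<forall>a\<in>abox p q S \<epsilon>. Re (a $ j) = c \<longrightarrow> (\<forall>\<^sub>F z in nhds a. h z = h1 z - h2 z))"
    unfolding K_def .
qed

text \<open>The cut in the imaginary direction is reduced to the real one by rotating a coordinate.\<close>

lemma cousin_Im:
  fixes p q :: "complex^'n"
  shows "solves_cousin (abox p q S \<epsilon>) j Im c"
proof -
  define \<rho> where "\<rho> z = upd z j (\<i> * z $ j)" for z :: "complex^'n"
  define \<rho>' where "\<rho>' z = upd z j (- \<i> * z $ j)" for z :: "complex^'n"
  define p' where "p' = upd p j (Complex (Im (p $ j)) (- Re (q $ j)))"
  define q' where "q' = upd q j (Complex (Im (q $ j)) (- Re (p $ j)))"
  have rr: "\<rho> (\<rho>' z) = z" "\<rho>' (\<rho> z) = z" for z by (simp_all add: \<rho>_def \<rho>'_def cvec_eq_iff)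
  have hol: "holo_on (\<lambda>z. \<rho> z $ i) UNIV" "holo_on (\<lambda>z. \<rho>' z $ i) UNIV" for i
    by (cases "i = j"; auto simp: \<rho>_def \<rho>'_def intro!: holo_intros)+
  have bi: "biholo \<rho> \<rho>' UNIV UNIV" unfolding biholo_def using rr hol by auto
  have in1: "\<rho> z \<in> abox p q S \<epsilon> \<longleftrightarrow> z \<in> abox p' q' S \<epsilon>" for z
    unfolding abox_def mem_Collect_eq
  proof (intro arg_cong[where f=All] ext)
    fix i
    show "(\<rho> z $ i \<in> cbox (p $ i) (q $ i) \<and> (i \<in> S \<longrightarrow> \<epsilon> \<le> norm (\<rho> z $ i))) =
      (z $ i \<in> cbox (p' $ i) (q' $ i) \<and> (i \<in> S \<longrightarrow> \<epsilon> \<le> norm (z $ i)))"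
      by (cases "i = j") (auto simp: \<rho>_def p'_def q'_def in_cbox_complex_iff norm_mult)
  qed
  have co: "Im (\<rho> z $ j) = Re (z $ j)" for z by (simp add: \<rho>_def)
  have ha: "holo_at (\<lambda>z. f (\<sigma> z)) a" if ass: "holo_at f (\<sigma> a)" "biholo \<tau> \<sigma> UNIV UNIV" for f \<sigma> \<tau> and a :: "complex^'n"
  proof -
    obtain U where U: "\<sigma> a \<in> U" "holo_on f U" using ass(1) unfolding holo_at_def by blast
    from biholo_holo_compose[OF ass(2) U(2)] show ?thesis
      by (rule holo_atI) (use U in auto)
  qed
  have ev: "\<forall>\<^sub>F z in nhds a. P (\<sigma> z)" if "\<forall>\<^sub>F z in nhds (\<sigma> a). P z" "biholo \<tau> \<sigma> UNIV UNIV" for P \<sigma> \<tau> and a :: "complex^'n"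
  proof -
    have "isCont \<sigma> a" using biholoD(10)[OF that(2)] continuous_on_eq_continuous_at open_UNIV by blast
    then have "filterlim \<sigma> (nhds (\<sigma> a)) (nhds a)" by (simp add: isCont_def tendsto_nhds_iff)
    then show ?thesis using that(1) by (rule eventually_compose_filterlim[rotated])
  qed
  show ?thesis
    unfolding solves_cousin_def
  proof (intro allI impI)
    fix h assume h: "\<forall>a\<in>abox p q S \<epsilon>. Im (a $ j) = c \<longrightarrow> holo_at h a"
    have hr: "\<forall>a\<in>abox p' q' S \<epsilon>. Re (a $ j) = c \<longrightarrow> holo_at (\<lambda>z. h (\<rho> z)) a"
      using h in1 co by (auto intro!: ha[where \<tau>=\<rho>' and \<sigma>=\<rho>, OF _ biholo_sym[OF bi]])
    from cousin_Re[of p' q' S \<epsilon> j c, unfolded solves_cousin_def, THEN spec, THEN mp, OF hr]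
    obtain h1 h2 where h12: "\<forall>a\<in>abox p' q' S \<epsilon>. Re (a $ j) \<le> c \<longrightarrow> holo_at h1 a"
        "\<forall>a\<in>abox p' q' S \<epsilon>. c \<le> Re (a $ j) \<longrightarrow> holo_at h2 a"
        "\<forall>a\<in>abox p' q' S \<epsilon>. Re (a $ j) = c \<longrightarrow> (\<forall>\<^sub>F z in nhds a. h (\<rho> z) = h1 z - h2 z)"
      by (elim exE conjE)
    have in2: "\<rho>' a \<in> abox p' q' S \<epsilon>" "Re (\<rho>' a $ j) = Im (a $ j)" if "a \<in> abox p q S \<epsilon>" for a
      using in1[of "\<rho>' a"] co[of "\<rho>' a"] rr that by auto
    show "\<exists>h1 h2. (\<forall>a\<in>abox p q S \<epsilon>. Im (a $ j) \<le> c \<longrightarrow> holo_at h1 a) \<and> (\<forall>a\<in>abox p q S \<epsilon>. c \<le> Im (a $ j) \<longrightarrow> holo_at h2 a) \<and>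
       (\<forall>a\<in>abox p q S \<epsilon>. Im (a $ j) = c \<longrightarrow> (\<forall>\<^sub>F z in nhds a. h z = h1 z - h2 z))"
    proof (rule exI[of _ "\<lambda>z. h1 (\<rho>' z)"], rule exI[of _ "\<lambda>z. h2 (\<rho>' z)"], intro conjI ballI impI)
      fix a assume a: "a \<in> abox p q S \<epsilon>"
      show "holo_at (\<lambda>z. h1 (\<rho>' z)) a" if "Im (a $ j) \<le> c" by (rule ha[OF _ bi]) (use h12(1) in2[OF a] that in auto)
      show "holo_at (\<lambda>z. h2 (\<rho>' z)) a" if "c \<le> Im (a $ j)" by (rule ha[OF _ bi]) (use h12(2) in2[OF a] that in auto)
      show "\<forall>\<^sub>F z in nhds a. h z = h1 (\<rho>' z) - h2 (\<rho>' z)" if "Im (a $ j) = c"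
        using ev[OF h12(3)[rule_format, OF in2(1)[OF a]] bi] in2[OF a] that rr by simp
    qed
  qed
qed

section \<open>Real coordinates and subdivision of boxes\<close>

definition setc :: "bool \<Rightarrow> real \<Rightarrow> complex \<Rightarrow> complex" where
  "setc b c t = (if b then Complex c (Im t) else Complex (Re t) c)"

definition part :: "bool \<Rightarrow> complex \<Rightarrow> real" where
  "part b = (if b then Re else Im)"

lemma part_setc [simp]: "part b' (setc b c t) = (if b = b' then c else part b' t)"
  by (auto simp: part_def setc_def)

lemma in_cbox_part: "t \<in> cbox u v \<longleftrightarrow> (\<forall>b. part b u \<le> part b t \<and> part b t \<le> part b v)"
  by (auto simp: in_cbox_complex_iff part_def all_bool_eq)

lemma continuous_part: "continuous_on S (part b)"
  by (cases b) (auto simp: part_def intro!: continuous_intros)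

lemma cousin_part: "solves_cousin (abox p q S \<epsilon>) j (part b) c"
  by (cases b) (auto simp: part_def cousin_Re cousin_Im)

text \<open>Slabs of width \<open>w\<close> are cut off one after another, one real direction at a
  time. The inner induction counts the slabs left in one direction, the outer one is over the set
  \<open>D\<close> of directions whose length is still unrestricted.\<close>

lemma abox_subdivision:
  fixes u v p q :: "complex^'n" and Q :: "complex^'n \<Rightarrow> complex^'n \<Rightarrow> bool"
  defines "sub \<equiv> \<lambda>p q. \<forall>j b. part b (u $ j) \<le> part b (p $ j) \<and> part b (q $ j) \<le> part b (v $ j)"
  assumes w: "w > 0"
    and small: "\<And>p q. sub p q \<Longrightarrow> (\<And>j b. part b (q $ j) - part b (p $ j) \<le> w) \<Longrightarrow> Q p q"
    and cut: "\<And>p q j b c. sub p q \<Longrightarrow> part b (p $ j) \<le> c \<Longrightarrow> c \<le> part b (q $ j) \<Longrightarrow>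
       Q p (upd q j (setc b c (q $ j))) \<Longrightarrow> Q (upd p j (setc b c (p $ j))) q \<Longrightarrow> Q p q"
  shows "sub p q \<Longrightarrow> Q p q"
proof -
  have "\<forall>p q. sub p q \<longrightarrow> (\<forall>j b. (j, b) \<notin> D \<longrightarrow> part b (q $ j) - part b (p $ j) \<le> w) \<longrightarrow> Q p q" if "finite D" for D :: "('n \<times> bool) set"
    using that
  proof (induction D rule: finite_induct)
    case empty
    then show ?case using small by blast
  next
    case (insert d D)
    obtain j b where d: "d = (j, b)" by (cases d)
    have "\<forall>p q. sub p q \<longrightarrow> (\<forall>j' b'. (j', b') \<notin> insert d D \<longrightarrow> part b' (q $ j') - part b' (p $ j') \<le> w) \<longrightarrow>
        part b (q $ j) - part b (p $ j) \<le> of_nat m * w \<longrightarrow> Q p q" for m :: nat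
    proof (induction m)
      case 0
      show ?case
      proof (intro allI impI)
        fix p q assume pq: "sub p q" "\<forall>j' b'. (j', b') \<notin> insert d D \<longrightarrow> part b' (q $ j') - part b' (p $ j') \<le> w"
          "part b (q $ j) - part b (p $ j) \<le> of_nat 0 * w"
        have "part b' (q $ j') - part b' (p $ j') \<le> w" if "(j', b') \<notin> D" for j' b'
          using pq(2,3) that w d by (cases "(j', b') = d") auto
        then show "Q p q" using insert.IH pq(1) by blast
      qed
    next
      case (Suc m)
      show ?case
      proof (intro allI impI)
        fix p q assume pq: "sub p q" "\<forall>j' b'. (j', b') \<notin> insert d D \<longrightarrow> part b' (q $ j') - part b' (p $ j') \<le> w"
          "part b (q $ j) - part b (p $ j) \<le> of_nat (Suc m) * w"
        show "Q p q"
        proof (cases "part b (q $ j) - part b (p $ j) \<le> w")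
          case True
          have "part b' (q $ j') - part b' (p $ j') \<le> w" if "(j', b') \<notin> D" for j' b'
            using pq(2) that True d by (cases "(j', b') = d") auto
          then show "Q p q" using insert.IH pq(1) by blast
        next
          case False
          define c where "c = part b (p $ j) + w"
          have c: "part b (p $ j) \<le> c" "c \<le> part b (q $ j)" using False w by (auto simp: c_def)
          show "Q p q"
          proof (rule cut[OF pq(1) c])
            have s: "sub p (upd q j (setc b c (q $ j)))"
              using pq(1) c(2) order_trans[of c "part b (q $ j)" "part b (v $ j)"] unfolding sub_def by auto
            moreover have "part b' (upd q j (setc b c (q $ j)) $ j') - part b' (p $ j') \<le> w" if "(j', b') \<notin> D" for j' b'
            proof (cases "(j', b') = (j, b)")
              case True
              then show ?thesis by (simp add: c_def)
            next
              case False
              then have "part b' (upd q j (setc b c (q $ j)) $ j') = part b' (q $ j')" by auto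
              then show ?thesis using pq(2) that False d by auto
            qed
            ultimately show "Q p (upd q j (setc b c (q $ j)))" using insert.IH by blast
            have s: "sub (upd p j (setc b c (p $ j))) q"
              using pq(1) c(1) order_trans[of "part b (u $ j)" "part b (p $ j)" c] unfolding sub_def by auto
            moreover have "part b' (q $ j') - part b' (upd p j (setc b c (p $ j)) $ j') \<le> w" if nin: "(j', b') \<notin> insert d D" for j' b'
            proof -
              have "part b' (upd p j (setc b c (p $ j)) $ j') = part b' (p $ j')" using nin d by auto
              then show ?thesis using pq(2) nin by auto
            qed
            moreover have "part b (q $ j) - part b (upd p j (setc b c (p $ j)) $ j) \<le> of_nat m * w"
              using pq(3) by (simp add: c_def algebra_simps)
            ultimately show "Q (upd p j (setc b c (p $ j))) q" using Suc.IH by blast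
          qed
        qed
      qed
    qed
    note main = this
    show ?case
    proof (intro allI impI)
      fix p q assume pq: "sub p q" "\<forall>j b. (j, b) \<notin> insert d D \<longrightarrow> part b (q $ j) - part b (p $ j) \<le> w"
      obtain m :: nat where "(part b (q $ j) - part b (p $ j)) / w \<le> of_nat m" using real_arch_simple by blast
      then have "part b (q $ j) - part b (p $ j) \<le> of_nat m * w" using w by (simp add: pos_divide_le_eq)
      then show "Q p q" using main[of m] pq by blast
    qed
  qed
  from this[of UNIV] show "sub p q \<Longrightarrow> Q p q" by simp
qed

subsection \<open>Cartan's theorem on boxes\<close>

text \<open>The function \<open>a k i j\<close> is the entry of \<open>f\<^bsub>k+1\<^esub> : E\<^bsub>k+1\<^esub> \<rightarrow> E\<^sub>k\<close> in row \<open>i\<close> and column \<open>j\<close>.\<close>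

locale free_complex =
  fixes a :: "nat \<Rightarrow> nat \<Rightarrow> nat \<Rightarrow> complex^'n \<Rightarrow> complex" and r :: "nat \<Rightarrow> nat"
    and \<Omega> :: "(complex^'n) set" and N :: nat
  assumes open_dom: "open \<Omega>"
    and hol: "\<And>k i j. i < r k \<Longrightarrow> j < r (Suc k) \<Longrightarrow> holo_on (a k i j) \<Omega>"
    and comp: "\<And>k i l z. z \<in> \<Omega> \<Longrightarrow> i < r k \<Longrightarrow> l < r (Suc (Suc k)) \<Longrightarrow> (\<Sum>j<r (Suc k). a k i j z * a (Suc k) j l z) = 0"
    and exact: "\<And>k \<psi> b. b \<in> \<Omega> \<Longrightarrow> (\<forall>j<r (Suc k). holo_at (\<psi> j) b) \<Longrightarrow>
       (\<forall>\<^sub>F z in nhds b. \<forall>i<r k. (\<Sum>j<r (Suc k). a k i j z * \<psi> j z) = 0) \<Longrightarrow>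
       \<exists>\<eta>. (\<forall>l<r (Suc (Suc k)). holo_at (\<eta> l) b) \<and>
         (\<forall>\<^sub>F z in nhds b. \<forall>j<r (Suc k). \<psi> j z = (\<Sum>l<r (Suc (Suc k)). a (Suc k) j l z * \<eta> l z))"
    and rank0: "\<And>k. k > N \<Longrightarrow> r k = 0"
begin

definition "sec k \<psi> b \<longleftrightarrow> (\<forall>i<r k. holo_at (\<psi> i) b)"
definition "app k \<eta> i z = (\<Sum>j<r (Suc k). a k i j z * \<eta> j z)"
definition "eqg k \<psi> \<psi>' b \<longleftrightarrow> (\<forall>\<^sub>F z in nhds b. \<forall>i<r k. \<psi> i z = \<psi>' i z)"
definition "img k \<psi> b \<longleftrightarrow> (\<exists>\<eta>. sec (Suc k) \<eta> b \<and> eqg k \<psi> (app k \<eta>) b)"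

lemma holo_at_sum: "finite I \<Longrightarrow> (\<And>i. i \<in> I \<Longrightarrow> holo_at (f i) b) \<Longrightarrow> holo_at (\<lambda>z. \<Sum>i\<in>I. f i z) b"
  by (induction I rule: finite_induct) (auto intro: holo_at_add holo_at_0)

lemma sec_app: "b \<in> \<Omega> \<Longrightarrow> sec (Suc k) \<eta> b \<Longrightarrow> sec k (app k \<eta>) b"
  unfolding sec_def app_def by (auto intro!: holo_at_sum holo_at_mult holo_atI[OF hol])

lemma sec_add: "sec k \<psi> b \<Longrightarrow> sec k \<psi>' b \<Longrightarrow> sec k (\<lambda>i z. \<psi> i z + \<psi>' i z) b"
  unfolding sec_def by (auto intro: holo_at_add)

lemma holo_at_minus: "holo_at f b \<Longrightarrow> holo_at (\<lambda>z. - f z) b"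
  using holo_at_mult[OF holo_atI[OF holo_on_const[OF open_UNIV, of "-1"]], of b f] by simp

lemma sec_minus: "sec k \<psi> b \<Longrightarrow> sec k (\<lambda>i z. - \<psi> i z) b"
  unfolding sec_def by (auto intro: holo_at_minus)

lemma sec_diff: "sec k \<psi> b \<Longrightarrow> sec k \<psi>' b \<Longrightarrow> sec k (\<lambda>i z. \<psi> i z - \<psi>' i z) b"
  using sec_add[OF _ sec_minus] by fastforce

lemma sec_0: "sec k (\<lambda>i z. 0) b"
  unfolding sec_def by (simp add: holo_at_0)

lemma app_diff: "app k (\<lambda>i z. \<psi> i z - \<psi>' i z) i z = app k \<psi> i z - app k \<psi>' i z"
  by (simp add: app_def right_diff_distrib sum_subtractf)

lemma app_add: "app k (\<lambda>i z. \<psi> i z + \<psi>' i z) i z = app k \<psi> i z + app k \<psi>' i z"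
  by (simp add: app_def distrib_left sum.distrib)

lemma app_minus: "app k (\<lambda>i z. - \<psi> i z) i z = - app k \<psi> i z"
  by (simp add: app_def sum_negf)

lemma app_0: "app k (\<lambda>i z. 0) i z = 0"
  by (simp add: app_def)

lemma app_cong: "(\<And>j. j < r (Suc k) \<Longrightarrow> \<psi> j z = \<psi>' j z) \<Longrightarrow> app k \<psi> i z = app k \<psi>' i z"
  by (simp add: app_def)

lemma app_app: "z \<in> \<Omega> \<Longrightarrow> i < r k \<Longrightarrow> app k (app (Suc k) \<eta>) i z = 0"
proof -
  assume z: "z \<in> \<Omega>" "i < r k"
  have "app k (app (Suc k) \<eta>) i z = (\<Sum>l<r (Suc (Suc k)). (\<Sum>j<r (Suc k). a k i j z * a (Suc k) j l z) * \<eta> l z)"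
    by (simp add: app_def sum_distrib_left sum_distrib_right mult.assoc) (rule sum.swap)
  then show ?thesis using comp[OF z] by simp
qed

lemma eventually_dom: "b \<in> \<Omega> \<Longrightarrow> \<forall>\<^sub>F z in nhds b. z \<in> \<Omega>"
  using open_dom eventually_nhds by blast

lemma eqg_app: "eqg (Suc k) \<eta> \<eta>' b \<Longrightarrow> eqg k (app k \<eta>) (app k \<eta>') b"
  unfolding eqg_def by (erule eventually_mono) (auto intro: app_cong)

lemma eqg_eventually: "eqg k \<psi> \<psi>' b \<Longrightarrow> \<forall>\<^sub>F b' in nhds b. eqg k \<psi> \<psi>' b'"
  unfolding eqg_def by (simp add: eventually_eventually)

lemma sec_eventually: "sec k \<psi> b \<Longrightarrow> \<forall>\<^sub>F b' in nhds b. sec k \<psi> b'"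
proof -
  assume "sec k \<psi> b"
  then have "\<forall>\<^sub>F b' in nhds b. \<forall>i\<in>{..<r k}. holo_at (\<psi> i) b'"
    by (intro eventually_ball_finite) (auto simp: sec_def holo_at_eventually)
  then show ?thesis by (simp add: sec_def Ball_def)
qed

lemma sec_cong: "sec k \<psi> b \<Longrightarrow> eqg k \<psi> \<psi>' b \<Longrightarrow> sec k \<psi>' b"
proof -
  assume s: "sec k \<psi> b" and e: "eqg k \<psi> \<psi>' b"
  show "sec k \<psi>' b"
    unfolding sec_def
  proof (intro allI impI)
    fix i assume i: "i < r k"
    obtain U where U: "b \<in> U" "holo_on (\<psi> i) U" using s i unfolding sec_def holo_at_def by blast
    obtain V where V: "open V" "b \<in> V" "\<And>z. z \<in> V \<Longrightarrow> \<psi> i z = \<psi>' i z"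
      using e i unfolding eqg_def eventually_nhds by blast
    have o: "open (U \<inter> V)" using holo_on_open[OF U(2)] V(1) by blast
    show "holo_at (\<psi>' i) b"
      by (rule holo_atI[OF holo_on_cong[OF holo_on_subset[OF U(2) o]]]) (use U V in auto)
  qed
qed

lemma exact_img:
  assumes "b \<in> \<Omega>" "sec (Suc k) \<psi> b" "eqg k (app k \<psi>) (\<lambda>_ _. 0) b"
  shows "img (Suc k) \<psi> b"
  using exact[OF assms(1), of k \<psi>] assms(2,3) unfolding img_def sec_def eqg_def app_def by blast

lemma img_app_eq_0:
  assumes "b \<in> \<Omega>" "img (Suc k) \<psi> b"
  shows "eqg k (app k \<psi>) (\<lambda>_ _. 0) b"
proof -
  obtain \<eta> where \<eta>: "eqg (Suc k) \<psi> (app (Suc k) \<eta>) b" using assms unfolding img_def by blast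
  show ?thesis
    using \<eta> eventually_dom[OF assms(1)] unfolding eqg_def
    by eventually_elim (metis app_app app_cong)
qed

text \<open>A section over \<open>K\<close> of the cokernel of \<open>f\<^bsub>k+1\<^esub>\<close>: \<open>L b \<psi>\<close> says that \<open>\<psi>\<close> represents its germ at \<open>b\<close>.
  It is solvable if it lifts to a section of \<open>\<O>(E\<^sub>k)\<close>.\<close>

definition coset_family where
  "coset_family k K L \<longleftrightarrow>
    (\<forall>b\<in>K. \<exists>\<psi>. sec k \<psi> b \<and> L b \<psi>) \<and>
    (\<forall>b\<in>K. \<forall>\<psi> \<psi>'. sec k \<psi> b \<longrightarrow> sec k \<psi>' b \<longrightarrow> L b \<psi> \<longrightarrow> L b \<psi>' \<longrightarrow> img k (\<lambda>i z. \<psi> i z - \<psi>' i z) b) \<and>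
    (\<forall>b\<in>K. \<forall>\<psi>. sec k \<psi> b \<longrightarrow> L b \<psi> \<longrightarrow> (\<forall>\<^sub>F b' in nhds b. b' \<in> K \<longrightarrow> L b' \<psi>)) \<and>
    (\<forall>b\<in>K. \<forall>\<psi> \<psi>' \<eta>. sec k \<psi> b \<longrightarrow> L b \<psi> \<longrightarrow> sec (Suc k) \<eta> b \<longrightarrow> sec k \<psi>' b \<longrightarrow>
       eqg k \<psi>' (\<lambda>i z. \<psi> i z + app k \<eta> i z) b \<longrightarrow> L b \<psi>')"

definition solvable where
  "solvable k K L \<longleftrightarrow> (\<exists>\<psi>. \<forall>b\<in>K. sec k \<psi> b \<and> L b \<psi>)"

lemma coset_familyD:
  assumes "coset_family k K L" "b \<in> K"
  shows "\<exists>\<psi>. sec k \<psi> b \<and> L b \<psi>"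
    "\<And>\<psi> \<psi>'. sec k \<psi> b \<Longrightarrow> sec k \<psi>' b \<Longrightarrow> L b \<psi> \<Longrightarrow> L b \<psi>' \<Longrightarrow> img k (\<lambda>i z. \<psi> i z - \<psi>' i z) b"
    "\<And>\<psi>. sec k \<psi> b \<Longrightarrow> L b \<psi> \<Longrightarrow> \<forall>\<^sub>F b' in nhds b. b' \<in> K \<longrightarrow> L b' \<psi>"
    "\<And>\<psi> \<psi>' \<eta>. sec k \<psi> b \<Longrightarrow> L b \<psi> \<Longrightarrow> sec (Suc k) \<eta> b \<Longrightarrow> sec k \<psi>' b \<Longrightarrow>
       eqg k \<psi>' (\<lambda>i z. \<psi> i z + app k \<eta> i z) b \<Longrightarrow> L b \<psi>'"
  using assms unfolding coset_family_def by blast+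

lemma coset_family_subset:
  assumes "coset_family k K L" "K' \<subseteq> K"
  shows "coset_family k K' L"
  unfolding coset_family_def
proof (intro conjI ballI allI impI)
  fix b assume "b \<in> K'"
  then have b: "b \<in> K" using assms by blast
  note D = coset_familyD[OF assms(1) b]
  show "\<exists>\<psi>. sec k \<psi> b \<and> L b \<psi>" by (rule D)
  show "img k (\<lambda>i z. \<psi> i z - \<psi>' i z) b" if "sec k \<psi> b" "sec k \<psi>' b" "L b \<psi>" "L b \<psi>'" for \<psi> \<psi>' by (rule D(2)[OF that])
  show "\<forall>\<^sub>F b' in nhds b. b' \<in> K' \<longrightarrow> L b' \<psi>" if "sec k \<psi> b" "L b \<psi>" for \<psi>
    using D(3)[OF that] by (rule eventually_mono) (use assms in blast)
  show "L b \<psi>'" if "sec k \<psi> b" "L b \<psi>" "sec (Suc k) \<eta> b" "sec k \<psi>' b" "eqg k \<psi>' (\<lambda>i z. \<psi> i z + app k \<eta> i z) b"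
    for \<psi> \<psi>' \<eta> by (rule D(4)[OF that])
qed

text \<open>Two lifts of the same section differ by an element of the kernel, which by exactness is
  the image of the next map. So the lifts form a coset family one level higher; this is how the
  resolution shifts the problem upwards.\<close>

lemma coset_family_lift:
  assumes K: "K \<subseteq> \<Omega>" and im: "\<And>b. b \<in> K \<Longrightarrow> img k \<psi> b"
  shows "coset_family (Suc k) K (\<lambda>b \<eta>. eqg k \<psi> (app k \<eta>) b)"
  unfolding coset_family_def
proof (intro conjI ballI allI impI)
  fix b assume b: "b \<in> K"
  then have b\<Omega>: "b \<in> \<Omega>" using K by blast
  show "\<exists>\<eta>. sec (Suc k) \<eta> b \<and> eqg k \<psi> (app k \<eta>) b" using im[OF b] unfolding img_def .
  show "img (Suc k) (\<lambda>i z. \<eta> i z - \<eta>' i z) b"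
    if s: "sec (Suc k) \<eta> b" "sec (Suc k) \<eta>' b" and e: "eqg k \<psi> (app k \<eta>) b" "eqg k \<psi> (app k \<eta>') b" for \<eta> \<eta>'
  proof (rule exact_img[OF b\<Omega> sec_diff[OF s]])
    show "eqg k (app k (\<lambda>i z. \<eta> i z - \<eta>' i z)) (\<lambda>_ _. 0) b"
      using e unfolding eqg_def by eventually_elim (auto simp: app_diff)
  qed
  show "\<forall>\<^sub>F b' in nhds b. b' \<in> K \<longrightarrow> eqg k \<psi> (app k \<eta>) b'" if "eqg k \<psi> (app k \<eta>) b" for \<eta>
    using eqg_eventually[OF that] by (rule eventually_mono) simp
  show "eqg k \<psi> (app k \<eta>') b"
    if e: "eqg k \<psi> (app k \<eta>) b" "eqg (Suc k) \<eta>' (\<lambda>i z. \<eta> i z + app (Suc k) \<xi> i z) b" for \<eta> \<eta>' \<xi>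
    using e(1) eqg_app[OF e(2)] eventually_dom[OF b\<Omega>] unfolding eqg_def
    by eventually_elim (simp add: app_add app_app)
qed

text \<open>On the cut the two solutions differ by the image of some \<eta>, obtained from the
  lifting hypothesis. The Cousin problem splits \<eta> as \<open>\<eta>1 - \<eta>2\<close>;
  subtracting the images of \<eta>1 and \<eta>2 makes the two solutions agree near the cut without
  changing their cosets.\<close>

lemma solvable_merge:
  assumes K: "K \<subseteq> \<Omega>" and co: "\<And>h. solves_cousin K j (part b) c" and fam: "coset_family k K L"
    and low: "solvable k (K \<inter> {z. part b (z $ j) \<le> c}) L" and up: "solvable k (K \<inter> {z. c \<le> part b (z $ j)}) L"
    and lift: "\<And>L'. coset_family (Suc k) (K \<inter> {z. part b (z $ j) = c}) L' \<Longrightarrow> solvable (Suc k) (K \<inter> {z. part b (z $ j) = c}) L'"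
  shows "solvable k K L"
proof -
  define ph where "ph z = part b (z $ j)" for z :: "complex^'n"
  have cont: "continuous_on UNIV ph"
    unfolding ph_def by (rule continuous_on_compose2[OF continuous_part]) (auto intro!: continuous_intros)
  obtain \<psi>1 where \<psi>1: "\<And>x. x \<in> K \<Longrightarrow> ph x \<le> c \<Longrightarrow> sec k \<psi>1 x \<and> L x \<psi>1" using low unfolding solvable_def ph_def by blast
  obtain \<psi>2 where \<psi>2: "\<And>x. x \<in> K \<Longrightarrow> c \<le> ph x \<Longrightarrow> sec k \<psi>2 x \<and> L x \<psi>2" using up unfolding solvable_def ph_def by blast
  define K0 where "K0 = K \<inter> {z. part b (z $ j) = c}"
  have "img k (\<lambda>i z. \<psi>1 i z - \<psi>2 i z) x" if x: "x \<in> K0" for x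
    using coset_familyD(2)[OF fam, of x \<psi>1 \<psi>2] \<psi>1[of x] \<psi>2[of x] x by (auto simp: K0_def ph_def)
  then have "solvable (Suc k) K0 (\<lambda>b \<eta>. eqg k (\<lambda>i z. \<psi>1 i z - \<psi>2 i z) (app k \<eta>) b)"
    unfolding K0_def by (intro lift coset_family_lift) (use K in auto)
  then obtain \<eta> where \<eta>: "\<And>x. x \<in> K0 \<Longrightarrow> sec (Suc k) \<eta> x" "\<And>x. x \<in> K0 \<Longrightarrow> eqg k (\<lambda>i z. \<psi>1 i z - \<psi>2 i z) (app k \<eta>) x"
    unfolding solvable_def by blast
  define P where "P l h1 h2 \<longleftrightarrow> (\<forall>x\<in>K. ph x \<le> c \<longrightarrow> holo_at h1 x) \<and> (\<forall>x\<in>K. c \<le> ph x \<longrightarrow> holo_at h2 x) \<and>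
     (\<forall>x\<in>K. ph x = c \<longrightarrow> (\<forall>\<^sub>F z in nhds x. \<eta> l z = h1 z - h2 z))" for l h1 h2
  have "\<exists>h1 h2. P l h1 h2" if "l < r (Suc k)" for l
  proof -
    have "\<forall>x\<in>K. part b (x $ j) = c \<longrightarrow> holo_at (\<eta> l) x" using \<eta>(1) that by (auto simp: K0_def sec_def)
    from co[unfolded solves_cousin_def, THEN spec, THEN mp, OF this] show ?thesis unfolding P_def ph_def .
  qed
  then have "\<forall>l. \<exists>h1. \<exists>h2. l < r (Suc k) \<longrightarrow> P l h1 h2" by blast
  from choice[OF this] obtain \<eta>1 where "\<forall>l. \<exists>h2. l < r (Suc k) \<longrightarrow> P l (\<eta>1 l) h2" by (rule exE)
  from choice[OF this] obtain \<eta>2 where P: "\<forall>l. l < r (Suc k) \<longrightarrow> P l (\<eta>1 l) (\<eta>2 l)" by (rule exE)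
  have \<eta>12: "\<And>l x. l < r (Suc k) \<Longrightarrow> x \<in> K \<Longrightarrow> ph x \<le> c \<Longrightarrow> holo_at (\<eta>1 l) x"
     "\<And>l x. l < r (Suc k) \<Longrightarrow> x \<in> K \<Longrightarrow> c \<le> ph x \<Longrightarrow> holo_at (\<eta>2 l) x"
     "\<And>l x. l < r (Suc k) \<Longrightarrow> x \<in> K \<Longrightarrow> ph x = c \<Longrightarrow> \<forall>\<^sub>F z in nhds x. \<eta> l z = \<eta>1 l z - \<eta>2 l z"
    using P unfolding P_def by blast+
  define \<theta>1 where "\<theta>1 i z = \<psi>1 i z - app k \<eta>1 i z" for i z
  define \<theta>2 where "\<theta>2 i z = \<psi>2 i z - app k \<eta>2 i z" for i z
  have \<theta>1: "sec k \<theta>1 x \<and> L x \<theta>1" if x: "x \<in> K" "ph x \<le> c" for x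
  proof -
    have s: "sec (Suc k) \<eta>1 x" using \<eta>12(1) x by (simp add: sec_def)
    have t: "sec k \<theta>1 x" unfolding \<theta>1_def[abs_def] using \<psi>1[OF x] sec_app s K x(1) by (intro sec_diff) auto
    show ?thesis using t coset_familyD(4)[OF fam x(1) _ _ sec_minus[OF s] t, of \<psi>1] \<psi>1[OF x]
      by (simp add: eqg_def \<theta>1_def app_minus)
  qed
  have \<theta>2: "sec k \<theta>2 x \<and> L x \<theta>2" if x: "x \<in> K" "c \<le> ph x" for x
  proof -
    have s: "sec (Suc k) \<eta>2 x" using \<eta>12(2) x by (simp add: sec_def)
    have t: "sec k \<theta>2 x" unfolding \<theta>2_def[abs_def] using \<psi>2[OF x] sec_app s K x(1) by (intro sec_diff) auto
    show ?thesis using t coset_familyD(4)[OF fam x(1) _ _ sec_minus[OF s] t, of \<psi>2] \<psi>2[OF x]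
      by (simp add: eqg_def \<theta>2_def app_minus)
  qed
  have agree: "eqg k \<theta>1 \<theta>2 x" if x: "x \<in> K" "ph x = c" for x
  proof -
    have "\<forall>\<^sub>F z in nhds x. \<forall>l\<in>{..<r (Suc k)}. \<eta> l z = \<eta>1 l z - \<eta>2 l z"
      using \<eta>12(3) x by (intro eventually_ball_finite) auto
    then have "eqg (Suc k) \<eta> (\<lambda>l z. \<eta>1 l z - \<eta>2 l z) x" by (simp add: eqg_def Ball_def)
    then have e1: "eqg k (app k \<eta>) (app k (\<lambda>l z. \<eta>1 l z - \<eta>2 l z)) x" by (rule eqg_app)
    have e2: "eqg k (\<lambda>i z. \<psi>1 i z - \<psi>2 i z) (app k \<eta>) x" using \<eta>(2)[of x] x by (simp add: K0_def ph_def)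
    show ?thesis
      using e1 e2 unfolding eqg_def by eventually_elim (simp add: app_diff \<theta>1_def \<theta>2_def algebra_simps)
  qed
  \<comment> \<open>On the cut both branches have the same germ, so the case distinction is
    invisible to germs.\<close>
  define \<theta> where "\<theta> i z = (if ph z \<le> c then \<theta>1 i z else \<theta>2 i z)" for i z
  have tr: "sec k \<theta> x \<and> L x \<theta>" if x: "x \<in> K" and \<theta>': "sec k \<theta>' x" "L x \<theta>'" and e: "eqg k \<theta>' \<theta> x" for x \<theta>'
  proof -
    have s: "sec k \<theta> x" using sec_cong[OF \<theta>'(1) e] .
    have "eqg k \<theta> (\<lambda>i z. \<theta>' i z + app k (\<lambda>_ _. 0) i z) x" using e unfolding eqg_def by eventually_elim (simp add: app_0)
    then show ?thesis using s coset_familyD(4)[OF fam x \<theta>' sec_0 s] by blast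
  qed
  have "sec k \<theta> x \<and> L x \<theta>" if x: "x \<in> K" for x
  proof -
    consider "ph x < c" | "ph x = c" | "c < ph x" by linarith
    then show ?thesis
    proof cases
      case 1
      have "open {z. ph z < c}" using cont by (intro open_Collect_less continuous_intros)
      then have "\<forall>\<^sub>F z in nhds x. ph z < c" using 1 unfolding eventually_nhds by blast
      then have "eqg k \<theta>1 \<theta> x" unfolding eqg_def by eventually_elim (simp add: \<theta>_def)
      then show ?thesis using tr[OF x, of \<theta>1] \<theta>1[OF x] 1 by simp
    next
      case 2
      have "eqg k \<theta>1 \<theta> x" using agree[OF x 2] unfolding eqg_def by eventually_elim (simp add: \<theta>_def)
      then show ?thesis using tr[OF x, of \<theta>1] \<theta>1[OF x] 2 by simp
    next
      case 3
      have "open {z. c < ph z}" using cont by (intro open_Collect_less continuous_intros)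
      then have "\<forall>\<^sub>F z in nhds x. c < ph z" using 3 unfolding eventually_nhds by blast
      then have "eqg k \<theta>2 \<theta> x" unfolding eqg_def by eventually_elim (simp add: \<theta>_def)
      then show ?thesis using tr[OF x, of \<theta>2] \<theta>2[OF x] 3 by simp
    qed
  qed
  then show ?thesis unfolding solvable_def by blast
qed

lemma mem_abox: "z \<in> abox p q S \<epsilon> \<longleftrightarrow>
    (\<forall>i b. part b (p $ i) \<le> part b (z $ i)) \<and> (\<forall>i b. part b (z $ i) \<le> part b (q $ i)) \<and> (\<forall>i\<in>S. \<epsilon> \<le> norm (z $ i))"
  unfolding abox_def in_cbox_part by blast

lemma abox_cut:
  fixes p q :: "complex^'n"
  assumes "part b (p $ j) \<le> c" "c \<le> part b (q $ j)"
  shows "abox p q S \<epsilon> \<inter> {z. part b (z $ j) \<le> c} = abox p (upd q j (setc b c (q $ j))) S \<epsilon>"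
    "abox p q S \<epsilon> \<inter> {z. c \<le> part b (z $ j)} = abox (upd p j (setc b c (p $ j))) q S \<epsilon>"
    "abox p q S \<epsilon> \<inter> {z. part b (z $ j) = c} = abox (upd p j (setc b c (p $ j))) (upd q j (setc b c (q $ j))) S \<epsilon>"
proof -
  have up: "(\<forall>i b'. part b' (z $ i) \<le> part b' (upd q j (setc b c (q $ j)) $ i)) \<longleftrightarrow>
      (\<forall>i b'. part b' (z $ i) \<le> part b' (q $ i)) \<and> part b (z $ j) \<le> c" (is "?l \<longleftrightarrow> ?r") for z
  proof
    assume l: ?l
    have "part b' (z $ i) \<le> part b' (q $ i)" for i b'
      using l[rule_format, of b' i] assms(2) by (cases "i = j"; cases "b' = b") auto
    then show ?r using l[rule_format, of b j] by simp
  next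
    assume r: ?r
    show ?l
    proof (intro allI)
      fix i b' show "part b' (z $ i) \<le> part b' (upd q j (setc b c (q $ j)) $ i)"
        using r by (cases "i = j"; cases "b' = b") auto
    qed
  qed
  have lo: "(\<forall>i b'. part b' (upd p j (setc b c (p $ j)) $ i) \<le> part b' (z $ i)) \<longleftrightarrow>
      (\<forall>i b'. part b' (p $ i) \<le> part b' (z $ i)) \<and> c \<le> part b (z $ j)" (is "?l \<longleftrightarrow> ?r") for z
  proof
    assume l: ?l
    have "part b' (p $ i) \<le> part b' (z $ i)" for i b'
      using l[rule_format, of b' i] assms(1) by (cases "i = j"; cases "b' = b") auto
    then show ?r using l[rule_format, of b j] by simp
  next
    assume r: ?r
    show ?l
    proof (intro allI)
      fix i b' show "part b' (upd p j (setc b c (p $ j)) $ i) \<le> part b' (z $ i)"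
        using r by (cases "i = j"; cases "b' = b") auto
    qed
  qed
  have 1: "z \<in> abox p q S \<epsilon> \<inter> {z. part b (z $ j) \<le> c} \<longleftrightarrow> z \<in> abox p (upd q j (setc b c (q $ j))) S \<epsilon>" for z p
    unfolding Int_iff mem_Collect_eq mem_abox up by blast
  have 2: "z \<in> abox p q S \<epsilon> \<inter> {z. c \<le> part b (z $ j)} \<longleftrightarrow> z \<in> abox (upd p j (setc b c (p $ j))) q S \<epsilon>" for z q
    unfolding Int_iff mem_Collect_eq mem_abox lo by blast
  show A: "abox p q S \<epsilon> \<inter> {z. part b (z $ j) \<le> c} = abox p (upd q j (setc b c (q $ j))) S \<epsilon>" using 1 by blast
  show "abox p q S \<epsilon> \<inter> {z. c \<le> part b (z $ j)} = abox (upd p j (setc b c (p $ j))) q S \<epsilon>" using 2 by blast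
  have "abox p q S \<epsilon> \<inter> {z. part b (z $ j) = c} = (abox p q S \<epsilon> \<inter> {z. part b (z $ j) \<le> c}) \<inter> {z. c \<le> part b (z $ j)}" by auto
  also have "\<dots> = abox (upd p j (setc b c (p $ j))) (upd q j (setc b c (q $ j))) S \<epsilon>" unfolding A using 2 by blast
  finally show "abox p q S \<epsilon> \<inter> {z. part b (z $ j) = c} = abox (upd p j (setc b c (p $ j))) (upd q j (setc b c (q $ j))) S \<epsilon>" .
qed

text \<open>Downward induction on the level, starting above \<open>N\<close>, where the modules are
  zero. On boxes below the Lebesgue number of a suitable cover one local representative works
  throughout. Larger boxes are joined by \<open>solvable_merge\<close>; the lift needed on the cut
  is the theorem one level higher, as the cut is a degenerate box of the same kind.\<close>

theorem cartan_boxes: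
  fixes p q :: "complex^'n"
  assumes "abox p q S \<epsilon> \<subseteq> \<Omega>" "coset_family k (abox p q S \<epsilon>) L"
  shows "solvable k (abox p q S \<epsilon>) L"
  using assms
proof (induction "Suc N - k" arbitrary: k p q L)
  case 0
  then have "k > N" by simp
  then have r0: "r k = 0" "r (Suc k) = 0" using rank0 by auto
  show ?case
    unfolding solvable_def
  proof (intro exI[of _ "\<lambda>_ _. 0"] ballI conjI)
    fix x assume x: "x \<in> abox p q S \<epsilon>"
    obtain \<psi> where "L x \<psi>" using coset_familyD(1)[OF 0(3) x] by blast
    then show "L x (\<lambda>_ _. 0)"
      using coset_familyD(4)[OF 0(3) x, of \<psi> "\<lambda>_ _. 0" "\<lambda>_ _. 0"] r0 by (simp add: sec_def eqg_def)
  qed (simp add: sec_0)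
next
  case (Suc n k)
  define K where "K = abox p q S \<epsilon>"
  have K: "K \<subseteq> \<Omega>" "coset_family k K L" using Suc.prems by (auto simp: K_def)
  note fam = coset_familyD[OF K(2)]
  define \<G> where "\<G> = {V. open V \<and> (\<exists>\<psi>. \<forall>x\<in>K \<inter> V. sec k \<psi> x \<and> L x \<psi>)}"
  have "K \<subseteq> \<Union>\<G>"
  proof
    fix x assume x: "x \<in> K"
    obtain \<psi> where \<psi>: "sec k \<psi> x" "L x \<psi>" using fam(1)[OF x] by blast
    have "\<forall>\<^sub>F y in nhds x. sec k \<psi> y \<and> (y \<in> K \<longrightarrow> L y \<psi>)"
      using sec_eventually[OF \<psi>(1)] fam(3)[OF x \<psi>] by eventually_elim simp
    then obtain V where "open V" "x \<in> V" "\<And>y. y \<in> V \<Longrightarrow> sec k \<psi> y \<and> (y \<in> K \<longrightarrow> L y \<psi>)"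
      unfolding eventually_nhds by blast
    then show "x \<in> \<Union>\<G>" unfolding \<G>_def by blast
  qed
  note cover = this
  have "\<exists>e>0. \<forall>x\<in>K. \<exists>V\<in>\<G>. ball x e \<subseteq> V"
  proof (rule Heine_Borel_lemma[OF _ cover])
    show "compact K" unfolding K_def by (rule compact_abox)
  qed (auto simp: \<G>_def)
  then obtain e where e: "e > 0" "\<And>x. x \<in> K \<Longrightarrow> \<exists>V\<in>\<G>. ball x e \<subseteq> V" by blast
  \<comment> \<open>A coordinate varies by at most \<open>2 * w\<close> in modulus, counting real
    and imaginary part, so a small box has diameter at most e / 2.\<close>
  define w where "w = e / (4 * CARD('n))"
  have w: "w > 0" using e(1) by (simp add: w_def)
  define sub where "sub p' q' \<longleftrightarrow> (\<forall>j b. part b (p $ j) \<le> part b (p' $ j) \<and> part b (q' $ j) \<le> part b (q $ j))" for p' q'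
  have subK: "abox p' q' S \<epsilon> \<subseteq> K" if "sub p' q'" for p' q'
    using that unfolding sub_def K_def mem_abox subset_iff by (meson order_trans)
  have "solvable k (abox p' q' S \<epsilon>) L" if "sub p' q'" for p' q'
  proof (rule abox_subdivision[where u=p and v=q and Q="\<lambda>p' q'. solvable k (abox p' q' S \<epsilon>) L", OF w])
    fix p' q' assume s: "\<forall>j b. part b (p $ j) \<le> part b (p' $ j) \<and> part b (q' $ j) \<le> part b (q $ j)"
      and len: "\<And>j b. part b (q' $ j) - part b (p' $ j) \<le> w"
    show "solvable k (abox p' q' S \<epsilon>) L"
    proof (cases "abox p' q' S \<epsilon> = {}")
      case False
      then obtain x where x: "x \<in> abox p' q' S \<epsilon>" by blast
      have "x \<in> K" using x subK[of p' q'] s by (auto simp: sub_def)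
      then obtain V where V: "V \<in> \<G>" "ball x e \<subseteq> V" using e(2) by blast
      have "y \<in> ball x e" if y: "y \<in> abox p' q' S \<epsilon>" for y
      proof -
        have "norm ((y - x) $ i) \<le> 2 * w" for i
        proof -
          have "\<bar>part b (y $ i) - part b (x $ i)\<bar> \<le> w" for b
            using x y len[of b i] unfolding abox_def in_cbox_part by (smt (verit) mem_Collect_eq)
          from this[of True] this[of False] show ?thesis
            using cmod_le[of "(y - x) $ i"] by (simp add: part_def)
        qed
        then have "norm (y - x) \<le> (\<Sum>i::'n\<in>UNIV. 2 * w)"
          by (intro order_trans[OF norm_vec_le_sum] sum_mono)
        also have "\<dots> < e" using e(1) by (simp add: w_def)
        finally show ?thesis by (simp add: dist_norm norm_minus_commute)
      qed
      then have "abox p' q' S \<epsilon> \<subseteq> K \<inter> V" using V(2) subK[of p' q'] s by (auto simp: sub_def)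
      then show ?thesis using V(1) unfolding \<G>_def solvable_def by blast
    qed (simp add: solvable_def)
  next
    fix p' q' j b c
    assume s: "\<forall>j b. part b (p $ j) \<le> part b (p' $ j) \<and> part b (q' $ j) \<le> part b (q $ j)"
      and c: "part b (p' $ j) \<le> c" "c \<le> part b (q' $ j)"
      and so: "solvable k (abox p' (upd q' j (setc b c (q' $ j))) S \<epsilon>) L" "solvable k (abox (upd p' j (setc b c (p' $ j))) q' S \<epsilon>) L"
    have sK: "abox p' q' S \<epsilon> \<subseteq> K" using subK s by (simp add: sub_def)
    show "solvable k (abox p' q' S \<epsilon>) L"
    proof (rule solvable_merge[where j=j and b=b and c=c])
      show "abox p' q' S \<epsilon> \<subseteq> \<Omega>" using sK K by blast
      show "solves_cousin (abox p' q' S \<epsilon>) j (part b) c" by (rule cousin_part)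
      show "coset_family k (abox p' q' S \<epsilon>) L" by (rule coset_family_subset[OF K(2) sK])
      show "solvable k (abox p' q' S \<epsilon> \<inter> {z. part b (z $ j) \<le> c}) L" unfolding abox_cut(1)[OF c] by (rule so)
      show "solvable k (abox p' q' S \<epsilon> \<inter> {z. c \<le> part b (z $ j)}) L" unfolding abox_cut(2)[OF c] by (rule so)
      fix L' assume fL': "coset_family (Suc k) (abox p' q' S \<epsilon> \<inter> {z. part b (z $ j) = c}) L'"
      show "solvable (Suc k) (abox p' q' S \<epsilon> \<inter> {z. part b (z $ j) = c}) L'"
        using fL' unfolding abox_cut(3)[OF c]
      proof (rule Suc.hyps(1)[rotated 2])
        show "n = Suc N - Suc k" using Suc.hyps(2) by simp
        show "abox (upd p' j (setc b c (p' $ j))) (upd q' j (setc b c (q' $ j))) S \<epsilon> \<subseteq> \<Omega>"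
          unfolding abox_cut(3)[OF c, symmetric] using sK K by blast
      qed
    qed
  qed (use that in \<open>simp add: sub_def\<close>)
  then show ?case by (simp add: sub_def)
qed

end

subsection \<open>Laurent decomposition and the Cech complex of a shell\<close>

definition cube :: "real \<Rightarrow> 'n set \<Rightarrow> real \<Rightarrow> (complex^'n) set" where
  "cube \<rho> S \<epsilon> = abox (\<chi> i. Complex (- \<rho>) (- \<rho>)) (\<chi> i. Complex \<rho> \<rho>) S \<epsilon>"

lemma mem_cube: "z \<in> cube \<rho> S \<epsilon> \<longleftrightarrow> (\<forall>i. \<bar>Re (z $ i)\<bar> \<le> \<rho> \<and> \<bar>Im (z $ i)\<bar> \<le> \<rho> \<and> (i \<in> S \<longrightarrow> \<epsilon> \<le> norm (z $ i)))"
  by (auto simp: cube_def abox_def in_cbox_complex_iff abs_le_iff) (metis minus_le_iff)+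

lemma cube_antimono: "S \<subseteq> T \<Longrightarrow> cube \<rho> T \<epsilon> \<subseteq> cube \<rho> S \<epsilon>"
  unfolding subset_iff mem_cube by blast

lemma compact_cube: "compact (cube \<rho> S \<epsilon>)"
  by (simp add: cube_def compact_abox)

lemma cube_nbhd:
  fixes U :: "(complex^'n) set"
  assumes "open U" "cube \<rho> S \<epsilon> \<subseteq> U"
  obtains \<eta> where "\<eta> > 0" "cube (\<rho> + \<eta>) S (\<epsilon> - \<eta>) \<subseteq> U"
proof -
  \<comment> \<open>The total violation of the defining inequalities. It is positive off the cube,
    hence bounded below on a compact set outside \<open>U\<close>, while it is small on slightly
    larger cubes.\<close>
  define f where "f z = (\<Sum>i\<in>UNIV. max 0 (\<bar>Re (z $ i)\<bar> - \<rho>) + max 0 (\<bar>Im (z $ i)\<bar> - \<rho>) + (if i \<in> S then max 0 (\<epsilon> - norm (z $ i)) else 0))" for z :: "complex^'n"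
  have cont: "continuous_on X f" for X
  proof -
    have "continuous_on X (\<lambda>z. if i \<in> S then max 0 (\<epsilon> - norm (z $ i)) else 0)" for i
      by (cases "i \<in> S") (auto intro!: continuous_intros)
    then show ?thesis unfolding f_def[abs_def] by (intro continuous_intros)
  qed
  have f0: "z \<in> cube \<rho> S \<epsilon>" if "f z \<le> 0" for z
  proof -
    have "f z \<ge> 0" unfolding f_def by (intro sum_nonneg) auto
    then have "f z = 0" using that by simp
    then have z: "max 0 (\<bar>Re (z $ i)\<bar> - \<rho>) + max 0 (\<bar>Im (z $ i)\<bar> - \<rho>) + (if i \<in> S then max 0 (\<epsilon> - norm (z $ i)) else 0) = 0" for i
      unfolding f_def by (subst (asm) sum_nonneg_eq_0_iff) auto
    show ?thesis
      unfolding mem_cube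
    proof (intro allI conjI impI)
      fix i
      show "\<bar>Re (z $ i)\<bar> \<le> \<rho>" "\<bar>Im (z $ i)\<bar> \<le> \<rho>" using z[of i] by (auto split: if_splits simp: max_def)
      show "\<epsilon> \<le> norm (z $ i)" if "i \<in> S" using z[of i] that by (auto split: if_splits simp: max_def)
    qed
  qed
  define C where "C = cube (\<rho> + 1) S (\<epsilon> - 1) - U"
  have "compact C" unfolding C_def using assms(1) by (intro compact_diff compact_cube)
  show ?thesis
  proof (cases "C = {}")
    case True
    then show ?thesis using that[of 1] by (auto simp: C_def)
  next
    case False
    obtain z0 where z0: "z0 \<in> C" "\<And>z. z \<in> C \<Longrightarrow> f z0 \<le> f z"
      using continuous_attains_inf[OF \<open>compact C\<close> False cont] by blast
    have pos: "f z0 > 0" using f0[of z0] z0(1) assms(2) by (force simp: C_def)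
    define \<eta> where "\<eta> = min 1 (f z0 / (4 * CARD('n)))"
    have \<eta>: "\<eta> > 0" "\<eta> \<le> 1" "\<eta> \<le> f z0 / (4 * CARD('n))" using pos by (auto simp: \<eta>_def)
    have "cube (\<rho> + \<eta>) S (\<epsilon> - \<eta>) \<subseteq> U"
    proof (rule subsetI, rule ccontr)
      fix z assume z: "z \<in> cube (\<rho> + \<eta>) S (\<epsilon> - \<eta>)" "z \<notin> U"
      have "z \<in> cube (\<rho> + 1) S (\<epsilon> - 1)" using z(1) \<eta>(2) unfolding mem_cube by (smt (verit))
      then have "f z0 \<le> f z" using z0(2) z(2) by (simp add: C_def)
      also have "f z \<le> (\<Sum>i::'n\<in>UNIV. 3 * \<eta>)"
        unfolding f_def
      proof (rule sum_mono)
        fix i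
        have "\<bar>Re (z $ i)\<bar> \<le> \<rho> + \<eta>" "\<bar>Im (z $ i)\<bar> \<le> \<rho> + \<eta>" "i \<in> S \<Longrightarrow> \<epsilon> - \<eta> \<le> norm (z $ i)" using z(1) by (auto simp: mem_cube)
        then show "max 0 (\<bar>Re (z $ i)\<bar> - \<rho>) + max 0 (\<bar>Im (z $ i)\<bar> - \<rho>) + (if i \<in> S then max 0 (\<epsilon> - norm (z $ i)) else 0) \<le> 3 * \<eta>"
          using \<eta>(1) by (auto simp: max_def)
      qed
      also have "\<dots> = 3 * (\<eta> * CARD('n))" by simp
      also have "\<dots> \<le> 3 * (f z0 / 4)" using \<eta>(3) by (simp add: field_simps)
      finally show False using pos by simp
    qed
    then show ?thesis using that \<eta>(1) by blast
  qed
qed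

definition ocube :: "real \<Rightarrow> 'n::finite set \<Rightarrow> real \<Rightarrow> (complex^'n) set" where
  "ocube \<rho> S \<epsilon> = {z. \<forall>i. \<bar>Re (z $ i)\<bar> < \<rho> \<and> \<bar>Im (z $ i)\<bar> < \<rho> \<and> (i \<in> S \<longrightarrow> \<epsilon> < norm (z $ i))}"

lemma open_ocube: "open (ocube \<rho> S \<epsilon>)"
proof -
  have "ocube \<rho> S \<epsilon> = (\<Inter>i. {z. \<bar>Re (z $ i)\<bar> < \<rho>} \<inter> {z. \<bar>Im (z $ i)\<bar> < \<rho>}) \<inter> (\<Inter>i\<in>S. {z. \<epsilon> < norm (z $ i)})"
    by (auto simp: ocube_def)
  then show ?thesis
    by (auto intro!: open_INT open_Int open_Collect_less continuous_intros)
qed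

lemma cube_subset_ocube: "\<eta> > 0 \<Longrightarrow> cube \<rho> S \<epsilon> \<subseteq> ocube (\<rho> + \<eta>) S (\<epsilon> - \<eta>)"
  unfolding subset_iff mem_cube ocube_def mem_Collect_eq by (smt (verit))

text \<open>The projection of a Laurent series in z_j onto its nonnegative powers, as a Cauchy
  integral over the boundary of the square.\<close>

definition lproj :: "real \<Rightarrow> 'n \<Rightarrow> (complex^'n \<Rightarrow> complex) \<Rightarrow> complex^'n \<Rightarrow> complex" where
  "lproj \<rho> j h z = rect_int (- \<rho>) \<rho> (- \<rho>) \<rho> j h z / (2 * pi * \<i>)"

definition square_sides :: "real \<Rightarrow> (complex \<times> complex) set" where
  "square_sides \<rho> = {(Complex (- \<rho>) (- \<rho>), Complex \<rho> (- \<rho>)), (Complex \<rho> (- \<rho>), Complex \<rho> \<rho>),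
     (Complex \<rho> \<rho>, Complex (- \<rho>) \<rho>), (Complex (- \<rho>) \<rho>, Complex (- \<rho>) (- \<rho>))}"

lemma square_side:
  assumes "(u, v) \<in> square_sides \<rho>" "\<zeta> \<in> closed_segment u v" "\<rho> \<ge> 0"
  shows "\<bar>Re \<zeta>\<bar> \<le> \<rho>" "\<bar>Im \<zeta>\<bar> \<le> \<rho>" "\<bar>Re \<zeta>\<bar> = \<rho> \<or> \<bar>Im \<zeta>\<bar> = \<rho>" "\<rho> \<le> norm \<zeta>"
proof -
  have "\<bar>Re \<zeta>\<bar> \<le> \<rho> \<and> \<bar>Im \<zeta>\<bar> \<le> \<rho> \<and> (\<bar>Re \<zeta>\<bar> = \<rho> \<or> \<bar>Im \<zeta>\<bar> = \<rho>)"
    using assms unfolding square_sides_def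
    by (auto simp: closed_segment_same_Im closed_segment_same_Re closed_segment_eq_real_ivl split: if_splits)
  then show "\<bar>Re \<zeta>\<bar> \<le> \<rho>" "\<bar>Im \<zeta>\<bar> \<le> \<rho>" "\<bar>Re \<zeta>\<bar> = \<rho> \<or> \<bar>Im \<zeta>\<bar> = \<rho>" by auto
  then show "\<rho> \<le> norm \<zeta>" using abs_Re_le_cmod[of \<zeta>] abs_Im_le_cmod[of \<zeta>] by auto
qed

lemma rect_int_sides:
  "rect_int (- \<rho>) \<rho> (- \<rho>) \<rho> j h z = slice_int (Complex (- \<rho>) (- \<rho>)) (Complex \<rho> (- \<rho>)) j h z + slice_int (Complex \<rho> (- \<rho>)) (Complex \<rho> \<rho>) j h z +
     slice_int (Complex \<rho> \<rho>) (Complex (- \<rho>) \<rho>) j h z + slice_int (Complex (- \<rho>) \<rho>) (Complex (- \<rho>) (- \<rho>)) j h z"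
  by (simp add: rect_int_def)

context
  fixes \<rho> \<epsilon> :: real and j :: "'n::finite" and R :: "'n set"
  assumes \<rho>: "\<rho> > 0" "\<epsilon> \<le> \<rho>" and jR: "j \<notin> R"
begin

text \<open>On the boundary of the square the modulus is at least \<rho> \<ge> \<epsilon>, so the
  contour avoids the removed disc. The projection thus uses only values with |z_j| \<ge> \<epsilon>,
  yet produces a function defined across z_j = 0.\<close>

lemma upd_side:
  assumes "z \<in> ocube \<rho> R \<epsilon>" "(u, v) \<in> square_sides \<rho>" "\<zeta> \<in> closed_segment u v"
  shows "upd z j \<zeta> \<in> cube \<rho> (insert j R) \<epsilon>" "\<zeta> \<noteq> z $ j"
proof -
  note s = square_side[OF assms(2,3) less_imp_le[OF \<rho>(1)]]
  show "upd z j \<zeta> \<in> cube \<rho> (insert j R) \<epsilon>"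
    using assms(1) s \<rho>(2) unfolding mem_cube ocube_def by (auto intro: less_imp_le)
  show "\<zeta> \<noteq> z $ j" using assms(1) s(3) unfolding ocube_def by auto
qed

lemma lproj_holo:
  assumes "holo_on h U" "cube \<rho> (insert j R) \<epsilon> \<subseteq> U"
  shows "holo_on (lproj \<rho> j h) (ocube \<rho> R \<epsilon>)"
proof -
  have s: "holo_on (slice_int u v j h) (ocube \<rho> R \<epsilon>)" if "(u, v) \<in> square_sides \<rho>" for u v
    by (rule holo_on_slice_int[OF open_ocube assms(1)]) (use upd_side[OF _ that] assms(2) in blast)
  show ?thesis
    unfolding lproj_def[abs_def] rect_int_sides
    by (intro holo_intros s open_ocube) (auto simp: square_sides_def)
qed

lemma lproj_id:
  assumes "holo_on h U" "cube \<rho> R \<epsilon> \<subseteq> U" "z \<in> ocube \<rho> R \<epsilon>"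
  shows "lproj \<rho> j h z = h z"
proof -
  have "rect_int (- \<rho>) \<rho> (- \<rho>) \<rho> j h z = 2 * pi * \<i> * h z"
  proof (rule rect_int_inside[OF assms(1)])
    fix \<zeta> assume \<zeta>: "\<zeta> \<in> cbox (Complex (- \<rho>) (- \<rho>)) (Complex \<rho> \<rho>)"
    have "upd z j \<zeta> \<in> cube \<rho> R \<epsilon>"
      using assms(3) \<zeta> jR unfolding mem_cube ocube_def by (auto simp: in_cbox_complex_iff intro: less_imp_le)
    then show "upd z j \<zeta> \<in> U" using assms(2) by blast
  next
    have "\<bar>Re (z $ j)\<bar> < \<rho>" "\<bar>Im (z $ j)\<bar> < \<rho>" using assms(3) by (auto simp: ocube_def)
    then show "z $ j \<in> box (Complex (- \<rho>) (- \<rho>)) (Complex \<rho> \<rho>)" by (auto simp: in_box_complex_iff)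
  qed
  then show ?thesis by (simp add: lproj_def)
qed

text \<open>Only values on the cube enter, so a linear relation known there, such as a cocycle
  condition, passes to the projections.\<close>

lemma lproj_linear:
  assumes fin: "finite I" and h: "\<And>i. i \<in> I \<Longrightarrow> holo_on (h i) (U i)" "\<And>i. i \<in> I \<Longrightarrow> cube \<rho> (insert j R) \<epsilon> \<subseteq> U i"
    and eq: "\<And>y. y \<in> cube \<rho> (insert j R) \<epsilon> \<Longrightarrow> g y = (\<Sum>i\<in>I. c i * h i y)"
    and z: "z \<in> ocube \<rho> R \<epsilon>"
  shows "lproj \<rho> j g z = (\<Sum>i\<in>I. c i * lproj \<rho> j (h i) z)"
proof -
  have s: "slice_int u v j g z = (\<Sum>i\<in>I. c i * slice_int u v j (h i) z)" if uv: "(u, v) \<in> square_sides \<rho>" for u v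
  proof -
    have "slice_int u v j g z = contour_integral (linepath u v) (\<lambda>\<zeta>. \<Sum>i\<in>I. c i * (h i (upd z j \<zeta>) / (\<zeta> - z $ j)))"
      unfolding slice_int_def
    proof (rule contour_integral_eq)
      fix \<zeta> assume "\<zeta> \<in> path_image (linepath u v)"
      then have "upd z j \<zeta> \<in> cube \<rho> (insert j R) \<epsilon>" using upd_side(1)[OF z uv] by simp
      then show "g (upd z j \<zeta>) / (\<zeta> - z $ j) = (\<Sum>i\<in>I. c i * (h i (upd z j \<zeta>) / (\<zeta> - z $ j)))"
        using eq by (simp add: sum_divide_distrib)
    qed
    also have "\<dots> = (\<Sum>i\<in>I. contour_integral (linepath u v) (\<lambda>\<zeta>. c i * (h i (upd z j \<zeta>) / (\<zeta> - z $ j))))"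
    proof (rule contour_integral_sum[OF fin])
      fix i assume i: "i \<in> I"
      show "(\<lambda>\<zeta>. c i * (h i (upd z j \<zeta>) / (\<zeta> - z $ j))) contour_integrable_on linepath u v"
        using upd_side[OF z uv] h(2)[OF i]
        by (intro contour_integrable_continuous_linepath continuous_intros continuous_on_compose2[OF holo_on_continuous[OF h(1)[OF i]]]) auto
    qed
    also have "\<dots> = (\<Sum>i\<in>I. c i * slice_int u v j (h i) z)"
    proof (intro sum.cong refl)
      fix i assume i: "i \<in> I"
      have "(\<lambda>\<zeta>. h i (upd z j \<zeta>) / (\<zeta> - z $ j)) contour_integrable_on linepath u v"
        using upd_side[OF z uv] h(2)[OF i]
        by (intro contour_integrable_continuous_linepath continuous_intros continuous_on_compose2[OF holo_on_continuous[OF h(1)[OF i]]]) auto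
      then show "contour_integral (linepath u v) (\<lambda>\<zeta>. c i * (h i (upd z j \<zeta>) / (\<zeta> - z $ j))) = c i * slice_int u v j (h i) z"
        unfolding slice_int_def by (rule contour_integral_lmul)
    qed
    finally show ?thesis .
  qed
  have m: "(Complex (- \<rho>) (- \<rho>), Complex \<rho> (- \<rho>)) \<in> square_sides \<rho>" "(Complex \<rho> (- \<rho>), Complex \<rho> \<rho>) \<in> square_sides \<rho>"
    "(Complex \<rho> \<rho>, Complex (- \<rho>) \<rho>) \<in> square_sides \<rho>" "(Complex (- \<rho>) \<rho>, Complex (- \<rho>) (- \<rho>)) \<in> square_sides \<rho>"
    by (simp_all add: square_sides_def)
  note s1 = s[OF m(1)] and s2 = s[OF m(2)] and s3 = s[OF m(3)] and s4 = s[OF m(4)]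
  show ?thesis
    unfolding lproj_def rect_int_sides
    by (simp only: s1 s2 s3 s4 sum.distrib[symmetric] distrib_left[symmetric] sum_divide_distrib times_divide_eq_right)
qed

end

section \<open>Alternating cochains and their Laurent cohomology\<close>

definition cidx :: "'n::finite \<Rightarrow> nat" where
  "cidx = to_nat_on UNIV"

lemma cidx_inj: "cidx i = cidx j \<longleftrightarrow> i = (j :: 'n::finite)"
  using inj_on_to_nat_on[OF countable_finite, of "UNIV :: 'n set"]
  by (auto simp: cidx_def inj_on_def)

definition sg :: "'n::finite \<Rightarrow> 'n set \<Rightarrow> complex" where
  "sg l T = (-1) ^ card {i\<in>T. cidx i < cidx l}"

lemma sg_square [simp]: "sg l T * sg l T = 1"
  by (simp add: sg_def power_mult_distrib[symmetric])

lemma sg_square' [simp]: "sg l T * (sg l T * x) = x"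
  by (simp add: mult.assoc[symmetric])

lemma sg_swap:
  fixes i l :: "'a::finite"
  assumes "i \<noteq> l" "i \<in> T" "l \<in> T"
  shows "sg l T * sg i (T - {l}) = - (sg i T * sg l (T - {i}))"
proof -
  have *: "sg l T * sg i (T - {l}) = - (sg i T * sg l (T - {i}))" if "cidx i < cidx l" "i \<in> T" "l \<in> T" for i l :: 'a and T
  proof -
    have "{x \<in> T - {l}. cidx x < cidx i} = {x \<in> T. cidx x < cidx i}" using that by auto
    then have 1: "sg i (T - {l}) = sg i T" by (simp add: sg_def)
    have "{x \<in> T. cidx x < cidx l} = insert i {x \<in> T - {i}. cidx x < cidx l}" using that by auto
    then have "sg l T = - sg l (T - {i})" by (simp add: sg_def)
    then show ?thesis using 1 by simp
  qed
  consider "cidx i < cidx l" | "cidx l < cidx i" using assms(1) cidx_inj[of i l] by linarith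
  then show ?thesis
  proof cases
    case 1
    then show ?thesis using * assms by blast
  next
    case 2
    then show ?thesis using *[of l i T] assms by simp
  qed
qed

text \<open>The Cech coboundary for the cover of the shell by the sets |z_l| \<ge> \<epsilon>.
  Cochains are indexed by sets of coordinates: a set of size s stands for degree s - 1, and the
  empty set for the augmentation, that is, for functions on the whole cube.\<close>

definition dl :: "('n::finite set \<Rightarrow> complex^'n \<Rightarrow> complex) \<Rightarrow> 'n set \<Rightarrow> complex^'n \<Rightarrow> complex" where
  "dl \<psi> T z = (\<Sum>l\<in>T. sg l T * \<psi> (T - {l}) z)"

lemma dl_dl: "dl (dl \<psi>) T z = 0"
proof -
  define F where "F l i = (if i \<noteq> l then sg l T * (sg i (T - {l}) * \<psi> (T - {l} - {i}) z) else 0)" for l i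
  have "dl (dl \<psi>) T z = (\<Sum>l\<in>T. \<Sum>i\<in>T - {l}. sg l T * (sg i (T - {l}) * \<psi> (T - {l} - {i}) z))"
    by (simp add: dl_def sum_distrib_left)
  also have "\<dots> = (\<Sum>l\<in>T. \<Sum>i\<in>T. F l i)"
    unfolding F_def by (intro sum.cong sum.mono_neutral_cong_left) auto
  finally have e: "dl (dl \<psi>) T z = (\<Sum>l\<in>T. \<Sum>i\<in>T. F l i)" .
  have anti: "F l i = - F i l" if "l \<in> T" "i \<in> T" for l i
  proof (cases "i = l")
    case False
    have "T - {l} - {i} = T - {i} - {l}" by blast
    then show ?thesis using sg_swap[OF False that(2,1)] False by (simp add: F_def mult.assoc[symmetric])
  qed (simp add: F_def)
  have "(\<Sum>l\<in>T. \<Sum>i\<in>T. F l i) = (\<Sum>l\<in>T. \<Sum>i\<in>T. - F i l)" by (intro sum.cong refl anti)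
  also have "\<dots> = - (\<Sum>l\<in>T. \<Sum>i\<in>T. F i l)" by (simp add: sum_negf)
  also have "\<dots> = - (\<Sum>l\<in>T. \<Sum>i\<in>T. F l i)" by (subst sum.swap) simp
  finally have "2 * (\<Sum>l\<in>T. \<Sum>i\<in>T. F l i) = 0" by (simp only: mult_2 eq_neg_iff_add_eq_0)
  then have "(\<Sum>l\<in>T. \<Sum>i\<in>T. F l i) = 0" by simp
  then show ?thesis using e by simp
qed

lemma dl_add: "dl (\<lambda>S z. \<psi> S z + \<phi> S z) T z = dl \<psi> T z + dl \<phi> T z"
  by (simp add: dl_def distrib_left sum.distrib)

lemma dl_diff: "dl (\<lambda>S z. \<psi> S z - \<phi> S z) T z = dl \<psi> T z - dl \<phi> T z"
  by (simp add: dl_def right_diff_distrib sum_subtractf)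

lemma dl_cong: "(\<And>l. l \<in> T \<Longrightarrow> \<psi> (T - {l}) z = \<phi> (T - {l}) z) \<Longrightarrow> dl \<psi> T z = dl \<phi> T z"
  by (simp add: dl_def)

lemma holo_at_dl: "(\<And>l. l \<in> T \<Longrightarrow> holo_at (\<psi> (T - {l})) b) \<Longrightarrow> holo_at (dl \<psi> T) b"
proof -
  assume h: "\<And>l. l \<in> T \<Longrightarrow> holo_at (\<psi> (T - {l})) b"
  have "holo_at (\<lambda>z. \<Sum>l\<in>I. sg l T * \<psi> (T - {l}) z) b" if "I \<subseteq> T" for I
    using finite[of I] that
  proof (induction I rule: finite_induct)
    case (insert l I)
    have "holo_at (\<lambda>z. sg l T * \<psi> (T - {l}) z) b"
      using insert h by (intro holo_at_mult holo_atI[OF holo_on_const[OF open_UNIV]]) auto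
    then show ?case using insert by (auto intro!: holo_at_add)
  qed (simp add: holo_at_0)
  then show ?thesis unfolding dl_def[abs_def] by blast
qed

text \<open>Projection onto the part of a Laurent series holomorphic at \<open>z\<^sub>j = 0\<close> is a contracting homotopy
  for the components of a cochain not involving \<open>j\<close>.\<close>

lemma laurent_step:
  fixes \<psi> :: "'n::finite set \<Rightarrow> complex^'n \<Rightarrow> complex"
  assumes \<rho>: "0 < \<rho>" "\<epsilon> \<le> \<rho>"
    and hol: "\<And>S b. S \<subseteq> J \<Longrightarrow> card S = s \<Longrightarrow> b \<in> cube \<rho> S \<epsilon> \<Longrightarrow> holo_at (\<psi> S) b"
    and coc: "\<And>T b. T \<subseteq> J \<Longrightarrow> card T = Suc s \<Longrightarrow> b \<in> cube \<rho> T \<epsilon> \<Longrightarrow> \<forall>\<^sub>F z in nhds b. dl \<psi> T z = 0"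
    and van: "\<And>S b. S \<subseteq> J \<Longrightarrow> card S = s \<Longrightarrow> \<not> X \<subseteq> S \<Longrightarrow> b \<in> cube \<rho> S \<epsilon> \<Longrightarrow> \<forall>\<^sub>F z in nhds b. \<psi> S z = 0"
    and j: "j \<in> J"
  obtains \<theta> where "\<And>R b. R \<subseteq> J \<Longrightarrow> Suc (card R) = s \<Longrightarrow> b \<in> cube \<rho> R \<epsilon> \<Longrightarrow> holo_at (\<theta> R) b"
    "\<And>S b. S \<subseteq> J \<Longrightarrow> card S = s \<Longrightarrow> \<not> insert j X \<subseteq> S \<Longrightarrow> b \<in> cube \<rho> S \<epsilon> \<Longrightarrow> \<forall>\<^sub>F z in nhds b. \<psi> S z = dl \<theta> S z"
proof -
  \<comment> \<open>The hypotheses hold for germs along compact cubes. They are transferred to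
    slightly larger cubes, with one margin for all subsets of \<open>J\<close>, so that the contour
    can be the boundary of a larger square.\<close>
  define good where "good \<eta> S \<longleftrightarrow> (\<forall>b\<in>cube (\<rho> + \<eta>) S (\<epsilon> - \<eta>). (card S = s \<longrightarrow> holo_at (\<psi> S) b) \<and>
     (card S = Suc s \<longrightarrow> dl \<psi> S b = 0) \<and> (card S = s \<longrightarrow> \<not> X \<subseteq> S \<longrightarrow> \<psi> S b = 0))" for \<eta> S
  have mono: "good \<eta>' S" if "good \<eta> S" "\<eta>' \<le> \<eta>" for \<eta> \<eta>' S
  proof -
    have "cube (\<rho> + \<eta>') S (\<epsilon> - \<eta>') \<subseteq> cube (\<rho> + \<eta>) S (\<epsilon> - \<eta>)"
      using that(2) unfolding mem_cube subset_iff by (smt (verit))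
    then show ?thesis using that(1) unfolding good_def by blast
  qed
  have ex: "\<exists>\<eta>>0. good \<eta> S" if S: "S \<subseteq> J" for S
  proof -
    define U where "U = {b. (card S = s \<longrightarrow> holo_at (\<psi> S) b) \<and>
     (card S = Suc s \<longrightarrow> (\<forall>\<^sub>F z in nhds b. dl \<psi> S z = 0)) \<and> (card S = s \<longrightarrow> \<not> X \<subseteq> S \<longrightarrow> (\<forall>\<^sub>F z in nhds b. \<psi> S z = 0))}"
    have oe: "open {b. \<forall>\<^sub>F z in nhds b. P z}" for P :: "complex^'n \<Rightarrow> bool"
    proof -
      have "{b. \<forall>\<^sub>F z in nhds b. P z} = interior {b. P b}" by (auto simp: interior_def eventually_nhds)
      then show ?thesis by simp
    qed
    have "open U"
    proof -
      have "U = {b. card S = s \<longrightarrow> holo_at (\<psi> S) b} \<inter> {b. card S = Suc s \<longrightarrow> (\<forall>\<^sub>F z in nhds b. dl \<psi> S z = 0)} \<inter>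
        {b. card S = s \<and> \<not> X \<subseteq> S \<longrightarrow> (\<forall>\<^sub>F z in nhds b. \<psi> S z = 0)}" by (auto simp: U_def)
      moreover have "open {b. P \<longrightarrow> Q b}" if "open {b. Q b}" for P and Q :: "complex^'n \<Rightarrow> bool"
        using that by (cases P) auto
      ultimately show ?thesis using open_holo_at oe by (auto intro!: open_Int)
    qed
    moreover have "cube \<rho> S \<epsilon> \<subseteq> U" using hol[OF S] coc[OF S] van[OF S] unfolding U_def by blast
    ultimately obtain \<eta> where "\<eta> > 0" "cube (\<rho> + \<eta>) S (\<epsilon> - \<eta>) \<subseteq> U" by (rule cube_nbhd)
    then have "good \<eta> S" unfolding good_def U_def by (auto dest: eventually_nhds_x_imp_x)
    then show ?thesis using \<open>\<eta> > 0\<close> by blast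
  qed
  then have "\<forall>S\<in>Pow J. \<exists>\<eta>>0. good \<eta> S" by blast
  from bchoice[OF this] obtain H where H: "\<And>S. S \<subseteq> J \<Longrightarrow> H S > 0 \<and> good (H S) S" by blast
  define \<eta> where "\<eta> = Min (H ` Pow J)"
  have \<eta>: "\<eta> > 0" "\<And>S. S \<subseteq> J \<Longrightarrow> good \<eta> S"
  proof -
    show "\<eta> > 0" unfolding \<eta>_def using H by (subst Min_gr_iff) auto
    fix S assume S: "S \<subseteq> J"
    have "\<eta> \<le> H S" unfolding \<eta>_def using S by (intro Min_le) auto
    then show "good \<eta> S" using mono H[OF S] by blast
  qed
  define r where "r = \<rho> + \<eta>"
  define e where "e = \<epsilon> - \<eta>"
  have re: "r > 0" "e \<le> r" using \<rho> \<eta>(1) by (auto simp: r_def e_def)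
  define U where "U S = {b. holo_at (\<psi> S) b}" for S
  have hU: "holo_on (\<psi> S) (U S)" for S unfolding U_def by (rule holo_on_holo_at)
  have subU: "cube r S e \<subseteq> U S" if "S \<subseteq> J" "card S = s" for S
    using \<eta>(2)[OF that(1)] that(2) by (auto simp: good_def U_def r_def e_def)
  \<comment> \<open>The homotopy: the component with \<open>j\<close> added, projected. It is put to
    zero where that component vanishes by the hypothesis on \<open>X\<close>, or where
    \<open>j\<close> cannot be added.\<close>
  define \<theta> where "\<theta> R = (if j \<in> R \<or> \<not> X \<subseteq> insert j R then (\<lambda>z. 0) else (\<lambda>z. sg j (insert j R) * lproj r j (\<psi> (insert j R)) z))" for R
  have near: "\<forall>\<^sub>F z in nhds b. z \<in> ocube r S e" if "b \<in> cube \<rho> S \<epsilon>" for b S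
    using cube_subset_ocube[OF \<eta>(1), of \<rho> S \<epsilon>] that open_ocube unfolding eventually_nhds r_def e_def by blast
  show ?thesis
  proof (rule that[of \<theta>])
    fix R b assume R: "R \<subseteq> J" "Suc (card R) = s" "b \<in> cube \<rho> R \<epsilon>"
    show "holo_at (\<theta> R) b"
    proof (cases "j \<in> R \<or> \<not> X \<subseteq> insert j R")
      case False
      have bo: "b \<in> ocube r R e" using cube_subset_ocube[OF \<eta>(1), of \<rho> R \<epsilon>] R(3) unfolding r_def e_def by blast
      have c: "card (insert j R) = s" "insert j R \<subseteq> J" using False R j by (auto simp: finite_subset)
      have "holo_on (\<lambda>z. sg j (insert j R) * lproj r j (\<psi> (insert j R)) z) (ocube r R e)"
        using False by (intro holo_intros lproj_holo[OF re _ hU subU[OF c(2,1)]] open_ocube) auto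
      then show ?thesis using False bo by (simp add: \<theta>_def holo_atI)
    qed (simp add: \<theta>_def holo_at_0)
  next
    fix S b assume S: "S \<subseteq> J" "card S = s" "\<not> insert j X \<subseteq> S" "b \<in> cube \<rho> S \<epsilon>"
    show "\<forall>\<^sub>F z in nhds b. \<psi> S z = dl \<theta> S z"
    proof (cases "j \<in> S")
      case True
      then have X: "\<not> X \<subseteq> S" using S(3) by blast
      have "\<theta> (S - {l}) = (\<lambda>z. 0)" if "l \<in> S" for l
        using that True X by (cases "l = j") (auto simp: \<theta>_def insert_absorb)
      then have "dl \<theta> S z = 0" for z by (simp add: dl_def)
      then show ?thesis using van[OF S(1,2) X S(4)] by simp
    next
      case False
      define T where "T = insert j S"
      have T: "T \<subseteq> J" "card T = Suc s" "T - {j} = S" using S j False by (auto simp: T_def finite_subset)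
      have Ti: "T - {i} = insert j (S - {i})" "T - {i} \<subseteq> J" "card (T - {i}) = s" "j \<notin> S - {i}" if "i \<in> S" for i
        using that False T by (auto simp: T_def)
      \<comment> \<open>The cocycle condition on \<open>insert j S\<close>, solved for
        \<open>\<psi> S\<close>. As \<open>j\<close> is not in \<open>S\<close>, the projection
        leaves \<open>\<psi> S\<close> unchanged, and it turns the right side into the coboundary of
        \<theta>.\<close>
      have eqT: "\<psi> S y = (\<Sum>i\<in>S. (- (sg j T * sg i T)) * \<psi> (T - {i}) y)" if y: "y \<in> cube r (insert j S) e" for y
      proof -
        have "dl \<psi> T y = 0" using \<eta>(2)[OF T(1)] T(2) y by (simp add: good_def r_def e_def T_def)
        moreover have "dl \<psi> T y = sg j T * \<psi> S y + (\<Sum>i\<in>S. sg i T * \<psi> (T - {i}) y)"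
          using False T(3) unfolding dl_def by (simp add: T_def sum.insert)
        ultimately have "sg j T * \<psi> S y = - (\<Sum>i\<in>S. sg i T * \<psi> (T - {i}) y)" by (simp add: eq_neg_iff_add_eq_0)
        then have "sg j T * (sg j T * \<psi> S y) = sg j T * - (\<Sum>i\<in>S. sg i T * \<psi> (T - {i}) y)" by simp
        then show ?thesis by (simp add: sum_distrib_left sum_negf mult.assoc)
      qed
      have "\<psi> S z = dl \<theta> S z" if z: "z \<in> ocube r S e" for z
      proof -
        have "\<psi> S z = lproj r j (\<psi> S) z"
          using lproj_id[OF re False hU subU[OF S(1,2)] z] by simp
        also have "\<dots> = (\<Sum>i\<in>S. (- (sg j T * sg i T)) * lproj r j (\<psi> (T - {i})) z)"
        proof (rule lproj_linear[OF re False _ hU _ eqT z])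
          fix i assume i: "i \<in> S"
          have "cube r (insert j S) e \<subseteq> cube r (T - {i}) e" by (rule cube_antimono) (auto simp: T_def)
          then show "cube r (insert j S) e \<subseteq> U (T - {i})" using subU[OF Ti(2,3)[OF i]] by blast
        qed simp
        also have "\<dots> = (\<Sum>i\<in>S. sg i S * \<theta> (S - {i}) z)"
        proof (intro sum.cong refl)
          fix i assume i: "i \<in> S"
          have sgn: "- (sg j T * sg i T) = sg i S * sg j (T - {i})"
          proof -
            have "sg j T * sg i S = - (sg i T * sg j (T - {i}))"
              using sg_swap[of i j T] i False T(3) by (auto simp: T_def)
            then have "sg j T * (sg j T * sg i S) * sg j (T - {i}) = sg j T * (- (sg i T * sg j (T - {i}))) * sg j (T - {i})" by simp
            then show ?thesis by (simp add: mult.assoc)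
          qed
          show "- (sg j T * sg i T) * lproj r j (\<psi> (T - {i})) z = sg i S * \<theta> (S - {i}) z"
          proof (cases "X \<subseteq> insert j (S - {i})")
            case True
            then have "\<theta> (S - {i}) z = sg j (T - {i}) * lproj r j (\<psi> (T - {i})) z"
              using False unfolding \<theta>_def Ti(1)[OF i] by simp
            then show ?thesis by (simp only: sgn mult.assoc)
          next
            case X: False
            have "lproj r j (\<psi> (T - {i})) z = (\<Sum>x\<in>{}. 0 * lproj r j (\<psi> x) z)"
            proof (rule lproj_linear[OF re Ti(4)[OF i]])
              fix y assume "y \<in> cube r (insert j (S - {i})) e"
              then show "\<psi> (T - {i}) y = (\<Sum>x\<in>{}. 0 * \<psi> x y)"
                using \<eta>(2)[OF Ti(2)[OF i]] Ti(1,3)[OF i] X by (simp add: good_def r_def e_def)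
            next
              show "z \<in> ocube r (S - {i}) e" using z by (auto simp: ocube_def)
            qed auto
            then show ?thesis using X by (simp add: \<theta>_def)
          qed
        qed
        also have "\<dots> = dl \<theta> S z" by (simp add: dl_def)
        finally show ?thesis .
      qed
      then show ?thesis using near[OF S(4)] by (auto elim: eventually_mono)
    qed
  qed
qed

text \<open>\<open>laurent_step\<close> is applied to the coordinates of \<open>J\<close> in turn.
  After each one, the remaining cochain lives only on sets containing all coordinates treated so
  far; a set of size \<open>s < card J\<close> cannot contain all of \<open>J\<close>, so in the end
  nothing remains.\<close>

lemma laurent_exact:
  fixes \<psi> :: "'n::finite set \<Rightarrow> complex^'n \<Rightarrow> complex"
  assumes \<rho>: "0 < \<rho>" "\<epsilon> \<le> \<rho>" and s: "s < card J"
    and hol: "\<And>S b. S \<subseteq> J \<Longrightarrow> card S = s \<Longrightarrow> b \<in> cube \<rho> S \<epsilon> \<Longrightarrow> holo_at (\<psi> S) b"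
    and coc: "\<And>T b. T \<subseteq> J \<Longrightarrow> card T = Suc s \<Longrightarrow> b \<in> cube \<rho> T \<epsilon> \<Longrightarrow> \<forall>\<^sub>F z in nhds b. dl \<psi> T z = 0"
  shows "\<exists>\<theta>. (\<forall>R b. R \<subseteq> J \<longrightarrow> Suc (card R) = s \<longrightarrow> b \<in> cube \<rho> R \<epsilon> \<longrightarrow> holo_at (\<theta> R) b) \<and>
    (\<forall>S b. S \<subseteq> J \<longrightarrow> card S = s \<longrightarrow> b \<in> cube \<rho> S \<epsilon> \<longrightarrow> (\<forall>\<^sub>F z in nhds b. \<psi> S z = dl \<theta> S z))"
proof -
  define P where "P X \<theta> \<longleftrightarrow> (\<forall>R b. R \<subseteq> J \<longrightarrow> Suc (card R) = s \<longrightarrow> b \<in> cube \<rho> R \<epsilon> \<longrightarrow> holo_at (\<theta> R) b) \<and>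
    (\<forall>S b. S \<subseteq> J \<longrightarrow> card S = s \<longrightarrow> \<not> X \<subseteq> S \<longrightarrow> b \<in> cube \<rho> S \<epsilon> \<longrightarrow> (\<forall>\<^sub>F z in nhds b. \<psi> S z = dl \<theta> S z))" for X \<theta>
  have "\<exists>\<theta>. P X \<theta>" if "X \<subseteq> J" for X
    using finite[of X] that
  proof (induction X rule: finite_induct)
    case empty
    have "P {} (\<lambda>_ _. 0)" unfolding P_def by (simp add: holo_at_0)
    then show ?case by blast
  next
    case (insert j X)
    then obtain \<theta> where \<theta>: "P X \<theta>" by blast
    define \<psi>' where "\<psi>' S z = \<psi> S z - dl \<theta> S z" for S z
    have hol': "holo_at (\<psi>' S) b" if S: "S \<subseteq> J" "card S = s" "b \<in> cube \<rho> S \<epsilon>" for S b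
    proof -
      have "holo_at (dl \<theta> S) b"
      proof (rule holo_at_dl)
        fix l assume l: "l \<in> S"
        have "Suc (card (S - {l})) = s" using l S(2) by (metis card_Suc_Diff1 finite)
        moreover have "b \<in> cube \<rho> (S - {l}) \<epsilon>" using cube_antimono[of "S - {l}" S] S(3) by blast
        moreover have "S - {l} \<subseteq> J" using S(1) by blast
        ultimately show "holo_at (\<theta> (S - {l})) b" using \<theta>[unfolded P_def, THEN conjunct1] by simp
      qed
      then have "holo_at (\<lambda>z. (-1) * dl \<theta> S z) b"
        by (intro holo_at_mult holo_atI[OF holo_on_const[OF open_UNIV]]) auto
      from holo_at_add[OF hol[OF S] this] show ?thesis by (simp add: \<psi>'_def[abs_def])
    qed
    have dd: "dl \<psi>' T z = dl \<psi> T z" for T z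
      unfolding \<psi>'_def[abs_def] dl_diff dl_dl by simp
    have van: "\<forall>\<^sub>F z in nhds b. \<psi>' S z = 0" if "S \<subseteq> J" "card S = s" "\<not> X \<subseteq> S" "b \<in> cube \<rho> S \<epsilon>" for S b
      using \<theta> that unfolding P_def \<psi>'_def by simp
    obtain \<theta>' where \<theta>': "\<And>R b. R \<subseteq> J \<Longrightarrow> Suc (card R) = s \<Longrightarrow> b \<in> cube \<rho> R \<epsilon> \<Longrightarrow> holo_at (\<theta>' R) b"
      "\<And>S b. S \<subseteq> J \<Longrightarrow> card S = s \<Longrightarrow> \<not> insert j X \<subseteq> S \<Longrightarrow> b \<in> cube \<rho> S \<epsilon> \<Longrightarrow> \<forall>\<^sub>F z in nhds b. \<psi>' S z = dl \<theta>' S z"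
      by (rule laurent_step[where \<psi>=\<psi>' and X=X and j=j and J=J and s=s, OF \<rho> hol'])
         (use coc van insert.prems in \<open>auto simp: dd\<close>)
    have "P (insert j X) (\<lambda>R z. \<theta> R z + \<theta>' R z)"
      unfolding P_def
    proof (intro conjI allI impI)
      fix R b assume "R \<subseteq> J" "Suc (card R) = s" "b \<in> cube \<rho> R \<epsilon>"
      then show "holo_at (\<lambda>z. \<theta> R z + \<theta>' R z) b" 
        using \<theta>[unfolded P_def, THEN conjunct1] \<theta>'(1) by (intro holo_at_add) simp_all
    next
      fix S b assume S: "S \<subseteq> J" "card S = s" "\<not> insert j X \<subseteq> S" "b \<in> cube \<rho> S \<epsilon>"
      show "\<forall>\<^sub>F z in nhds b. \<psi> S z = dl (\<lambda>R z. \<theta> R z + \<theta>' R z) S z"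
        using \<theta>'(2)[OF S] by eventually_elim (simp add: dl_add \<psi>'_def algebra_simps)
    qed
    then show ?case by blast
  qed
  then obtain \<theta> where "P J \<theta>" by blast
  moreover have "\<not> J \<subseteq> S" if "card S = s" for S using s that card_mono[of S J] by auto
  ultimately show ?thesis unfolding P_def by (intro exI[of _ \<theta>]) simp
qed

subsection \<open>Extension of sections across a coordinate plane\<close>

lemma cube_empty: "cube \<rho> {} \<epsilon> = cube \<rho> {} \<epsilon>'"
  by (auto simp: mem_cube)

definition dlv :: "('n::finite set \<Rightarrow> nat \<Rightarrow> complex^'n \<Rightarrow> complex) \<Rightarrow> 'n set \<Rightarrow> nat \<Rightarrow> complex^'n \<Rightarrow> complex" where
  "dlv \<psi> T i z = dl (\<lambda>S. \<psi> S i) T z"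

lemma sg_singleton [simp]: "sg j {j} = 1"
proof -
  have e: "{i\<in>{j}. cidx i < cidx j} = {}" by auto
  show ?thesis by (simp only: sg_def e card.empty power_0)
qed

lemma dlv_singleton: "dlv \<psi> {j} i z = \<psi> {} i z"
  by (simp add: dlv_def dl_def)

lemma dlv_pair: "j \<noteq> (l :: 'a::finite) \<Longrightarrow> \<exists>c. \<forall>\<psi> i z. dlv \<psi> {j, l} i z = c * (\<psi> {l} i z - \<psi> {j} i z)"
proof -
  assume jl: "j \<noteq> (l :: 'a)"
  have d: "{j, l} - {j} = {l}" "{j, l} - {l} = {j}" using jl by auto
  have "sg j {j, l} = - sg l {j, l}"
    using sg_swap[OF jl, of "{j, l}"] by (simp add: d)
  moreover note d
  ultimately have "\<forall>\<psi> i z. dlv \<psi> {j, l} i z = sg j {j, l} * (\<psi> {l} i z - \<psi> {j} i z)"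
    using jl by (simp add: dlv_def dl_def algebra_simps)
  then show ?thesis by blast
qed

context free_complex
begin

lemma app_dlv: "app k (dlv \<xi> T) i z = dlv (\<lambda>S. app k (\<xi> S)) T i z"
  unfolding app_def dlv_def dl_def sum_distrib_left
  by (subst sum.swap) (simp add: algebra_simps)

lemma sec_dlv: "(\<And>l. l \<in> T \<Longrightarrow> sec k (\<psi> (T - {l})) b) \<Longrightarrow> sec k (dlv \<psi> T) b"
  unfolding sec_def dlv_def[abs_def] by (blast intro: holo_at_dl)

lemma eqg_dlv: "(\<And>l. l \<in> T \<Longrightarrow> eqg k (\<psi> (T - {l})) (\<phi> (T - {l})) b) \<Longrightarrow> eqg k (dlv \<psi> T) (dlv \<phi> T) b"
proof -
  assume "\<And>l. l \<in> T \<Longrightarrow> eqg k (\<psi> (T - {l})) (\<phi> (T - {l})) b"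
  then have "\<forall>\<^sub>F z in nhds b. \<forall>l\<in>T. \<forall>i<r k. \<psi> (T - {l}) i z = \<phi> (T - {l}) i z"
    unfolding eqg_def by (intro eventually_ball_finite) auto
  then show ?thesis unfolding eqg_def dlv_def
    by eventually_elim (blast intro: dl_cong)
qed

lemma img_scale: "img k \<psi> b \<Longrightarrow> img k (\<lambda>i z. c * \<psi> i z) b"
proof -
  assume "img k \<psi> b"
  then obtain \<eta> where \<eta>: "sec (Suc k) \<eta> b" "eqg k \<psi> (app k \<eta>) b" unfolding img_def by blast
  have "sec (Suc k) (\<lambda>i z. c * \<eta> i z) b"
    using \<eta>(1) unfolding sec_def by (auto intro!: holo_at_mult holo_atI[OF holo_on_const[OF open_UNIV]])
  moreover have "eqg k (\<lambda>i z. c * \<psi> i z) (app k (\<lambda>i z. c * \<eta> i z)) b"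
    using \<eta>(2) unfolding eqg_def by eventually_elim (simp add: app_def sum_distrib_left mult.left_commute)
  ultimately show ?thesis unfolding img_def by blast
qed

lemma laurent_exact_sec:
  assumes \<rho>: "0 < \<rho>" "\<epsilon> \<le> \<rho>" and s: "s < card J"
    and hol: "\<And>S b. S \<subseteq> J \<Longrightarrow> card S = s \<Longrightarrow> b \<in> cube \<rho> S \<epsilon> \<Longrightarrow> sec k (\<psi> S) b"
    and coc: "\<And>T b. T \<subseteq> J \<Longrightarrow> card T = Suc s \<Longrightarrow> b \<in> cube \<rho> T \<epsilon> \<Longrightarrow> eqg k (dlv \<psi> T) (\<lambda>_ _. 0) b"
  shows "\<exists>\<xi>. (\<forall>R b. R \<subseteq> J \<longrightarrow> Suc (card R) = s \<longrightarrow> b \<in> cube \<rho> R \<epsilon> \<longrightarrow> sec k (\<xi> R) b) \<and>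
    (\<forall>S b. S \<subseteq> J \<longrightarrow> card S = s \<longrightarrow> b \<in> cube \<rho> S \<epsilon> \<longrightarrow> eqg k (\<psi> S) (dlv \<xi> S) b)"
proof -
  define P where "P i \<theta> \<longleftrightarrow> (\<forall>R b. R \<subseteq> J \<longrightarrow> Suc (card R) = s \<longrightarrow> b \<in> cube \<rho> R \<epsilon> \<longrightarrow> holo_at (\<theta> R) b) \<and>
    (\<forall>S b. S \<subseteq> J \<longrightarrow> card S = s \<longrightarrow> b \<in> cube \<rho> S \<epsilon> \<longrightarrow> (\<forall>\<^sub>F z in nhds b. \<psi> S i z = dl \<theta> S z))" for i \<theta>
  have "\<exists>\<theta>. P i \<theta>" if i: "i < r k" for i
    unfolding P_def
  proof (rule laurent_exact[OF \<rho> s])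
    fix S b assume "S \<subseteq> J" "card S = s" "b \<in> cube \<rho> S \<epsilon>"
    then show "holo_at (\<psi> S i) b" using hol i by (simp add: sec_def)
  next
    fix T b assume "T \<subseteq> J" "card T = Suc s" "b \<in> cube \<rho> T \<epsilon>"
    from coc[OF this] show "\<forall>\<^sub>F z in nhds b. dl (\<lambda>S. \<psi> S i) T z = 0"
      unfolding eqg_def by eventually_elim (use i in \<open>simp add: dlv_def\<close>)
  qed
  then have "\<forall>i. \<exists>\<theta>. i < r k \<longrightarrow> P i \<theta>" by blast
  from choice[OF this] obtain \<theta> where \<theta>: "\<And>i. i < r k \<Longrightarrow> P i (\<theta> i)" by blast
  show ?thesis
  proof (intro exI[of _ "\<lambda>R i. \<theta> i R"] conjI allI impI)
    fix R b assume "R \<subseteq> J" "Suc (card R) = s" "b \<in> cube \<rho> R \<epsilon>"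
    then show "sec k (\<lambda>i. \<theta> i R) b" using \<theta>[unfolded P_def, THEN conjunct1] by (simp add: sec_def)
  next
    fix S b assume S: "S \<subseteq> J" "card S = s" "b \<in> cube \<rho> S \<epsilon>"
    have "\<forall>\<^sub>F z in nhds b. \<forall>i\<in>{..<r k}. \<psi> S i z = dl (\<theta> i) S z"
      using \<theta>[unfolded P_def, THEN conjunct2] S by (intro eventually_ball_finite) auto
    then show "eqg k (\<psi> S) (dlv (\<lambda>R i. \<theta> i R) S) b" by (simp add: eqg_def dlv_def Ball_def)
  qed
qed

context
  fixes q :: "nat \<Rightarrow> nat \<Rightarrow> complex^'n \<Rightarrow> complex" and k :: nat and J :: "'n set" and \<rho> :: real
  assumes q_hol: "\<And>i j. i < r k \<Longrightarrow> j < r (Suc k) \<Longrightarrow> holo_on (q j i) \<Omega>"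
    and q_inv: "\<And>\<eta> i z. z \<in> \<Omega> \<Longrightarrow> i < r k \<Longrightarrow> app k (\<lambda>j z. \<Sum>i<r k. q j i z * app k \<eta> i z) i z = app k \<eta> i z"
    and \<rho>: "\<rho> > 0" and dom: "cube \<rho> {} \<rho> \<subseteq> \<Omega>"
begin

text \<open>Since \<open>q\<close> is a generalized inverse, \<open>app k\<close> after
  \<open>Qapp\<close> is a projection onto the image. Subtracting it gives a representative of the
  coset that depends linearly on \<psi> and is zero for elements of the image.\<close>

definition "Qapp \<psi> j z = (\<Sum>i<r k. q j i z * \<psi> i z)"

lemma cube_dom: "b \<in> cube \<rho> S \<epsilon> \<Longrightarrow> b \<in> \<Omega>"
  using dom cube_empty[of \<rho> \<epsilon> \<rho>] cube_antimono[of "{}" S \<rho> \<epsilon>] by blast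

lemma sec_Qapp: "b \<in> \<Omega> \<Longrightarrow> sec k \<psi> b \<Longrightarrow> sec (Suc k) (Qapp \<psi>) b"
  unfolding sec_def Qapp_def[abs_def] by (auto intro!: holo_at_sum holo_at_mult holo_atI[OF q_hol])

text \<open>Downward induction along the resolution: at the level \<open>k\<close> the generalized inverse splits off the
  image, and below it lifts to the next level come from Cartan's theorem.\<close>

lemma cochain_step:
  assumes "k' + d = k" "s + d < card J" "\<epsilon> \<le> \<rho>"
    and "\<And>S b. S \<subseteq> J \<Longrightarrow> card S = s \<Longrightarrow> b \<in> cube \<rho> S \<epsilon> \<Longrightarrow> sec k' (\<psi> S) b"
    and "\<And>T b. T \<subseteq> J \<Longrightarrow> card T = Suc s \<Longrightarrow> b \<in> cube \<rho> T \<epsilon> \<Longrightarrow> img k' (dlv \<psi> T) b"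
  shows "\<exists>\<xi>. (\<forall>R b. R \<subseteq> J \<longrightarrow> Suc (card R) = s \<longrightarrow> b \<in> cube \<rho> R \<epsilon> \<longrightarrow> sec k' (\<xi> R) b) \<and>
    (\<forall>S b. S \<subseteq> J \<longrightarrow> card S = s \<longrightarrow> b \<in> cube \<rho> S \<epsilon> \<longrightarrow> img k' (\<lambda>i z. \<psi> S i z - dlv \<xi> S i z) b)"
  using assms
proof (induction d arbitrary: k' s \<psi>)
  case 0
  then have k: "k' = k" and s: "s < card J" by auto
  \<comment> \<open>With these representatives a coboundary lying in the image becomes exactly zero,
    so \<psi>' is a true cocycle.\<close>
  define \<psi>' where "\<psi>' S i z = \<psi> S i z - app k (Qapp (\<psi> S)) i z" for S i z
  have "\<exists>\<xi>. (\<forall>R b. R \<subseteq> J \<longrightarrow> Suc (card R) = s \<longrightarrow> b \<in> cube \<rho> R \<epsilon> \<longrightarrow> sec k (\<xi> R) b) \<and>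
    (\<forall>S b. S \<subseteq> J \<longrightarrow> card S = s \<longrightarrow> b \<in> cube \<rho> S \<epsilon> \<longrightarrow> eqg k (\<psi>' S) (dlv \<xi> S) b)"
  proof (rule laurent_exact_sec[OF \<rho> 0(3) s])
    fix S b assume S: "S \<subseteq> J" "card S = s" "b \<in> cube \<rho> S \<epsilon>"
    show "sec k (\<psi>' S) b"
      unfolding \<psi>'_def[abs_def] using cube_dom[OF S(3)] 0(4)[OF S] by (auto intro!: sec_diff sec_app sec_Qapp simp: k)
  next
    fix T b assume T: "T \<subseteq> J" "card T = Suc s" "b \<in> cube \<rho> T \<epsilon>"
    obtain \<eta> where \<eta>: "eqg k (dlv \<psi> T) (app k \<eta>) b" using 0(5)[OF T] unfolding img_def k by blast
    have lin: "dlv \<psi>' T i z = dlv \<psi> T i z - app k (Qapp (dlv \<psi> T)) i z" for i z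
    proof -
      have "Qapp (dlv \<psi> T) j z = dlv (\<lambda>S. Qapp (\<psi> S)) T j z" for j z
        unfolding Qapp_def dlv_def dl_def sum_distrib_left by (subst sum.swap) (simp add: algebra_simps)
      then have "app k (Qapp (dlv \<psi> T)) i z = app k (dlv (\<lambda>S. Qapp (\<psi> S)) T) i z" by (intro app_cong) simp
      then show ?thesis unfolding app_dlv by (simp add: dlv_def \<psi>'_def[abs_def] dl_diff[symmetric])
    qed
    show "eqg k (dlv \<psi>' T) (\<lambda>_ _. 0) b"
      using \<eta> eventually_dom[OF cube_dom[OF T(3)]] unfolding eqg_def
    proof eventually_elim
      case (elim z)
      have "app k (Qapp (dlv \<psi> T)) i z = app k (Qapp (app k \<eta>)) i z" if "i < r k" for i
        using elim(1) by (intro app_cong) (simp add: Qapp_def)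
      moreover have "app k (Qapp (app k \<eta>)) i z = app k \<eta> i z" if "i < r k" for i
        using q_inv[OF elim(2) that] unfolding Qapp_def[abs_def] .
      ultimately show ?case using elim(1) by (simp add: lin)
    qed
  qed
  then obtain \<xi> where \<xi>: "\<And>R b. R \<subseteq> J \<Longrightarrow> Suc (card R) = s \<Longrightarrow> b \<in> cube \<rho> R \<epsilon> \<Longrightarrow> sec k (\<xi> R) b"
    "\<And>S b. S \<subseteq> J \<Longrightarrow> card S = s \<Longrightarrow> b \<in> cube \<rho> S \<epsilon> \<Longrightarrow> eqg k (\<psi>' S) (dlv \<xi> S) b" by blast
  show ?case
    unfolding k
  proof (intro exI[of _ \<xi>] conjI allI impI)
    fix S b assume S: "S \<subseteq> J" "card S = s" "b \<in> cube \<rho> S \<epsilon>"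
    have "sec (Suc k) (Qapp (\<psi> S)) b" using sec_Qapp[OF cube_dom[OF S(3)]] 0(4)[OF S] by (simp add: k)
    moreover have "eqg k (\<lambda>i z. \<psi> S i z - dlv \<xi> S i z) (app k (Qapp (\<psi> S))) b"
      using \<xi>(2)[OF S] unfolding eqg_def by eventually_elim (auto simp: \<psi>'_def algebra_simps)
    ultimately show "img k (\<lambda>i z. \<psi> S i z - dlv \<xi> S i z) b" unfolding img_def by blast
  qed (rule \<xi>)
next
  case (Suc d)
  \<comment> \<open>The coboundary of \<psi> lies in the image germ by germ; Cartan's theorem turns
    the germwise lifts into one lift over each cube.\<close>
  define P where "P T \<eta> \<longleftrightarrow> (\<forall>b\<in>cube \<rho> T \<epsilon>. sec (Suc k') \<eta> b \<and> eqg k' (dlv \<psi> T) (app k' \<eta>) b)" for T \<eta>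
  have "\<exists>\<eta>. P T \<eta>" if T: "T \<subseteq> J" "card T = Suc s" for T
  proof -
    have sub: "cube \<rho> T \<epsilon> \<subseteq> \<Omega>" using cube_dom by blast
    have "coset_family (Suc k') (cube \<rho> T \<epsilon>) (\<lambda>b \<eta>. eqg k' (dlv \<psi> T) (app k' \<eta>) b)"
      by (rule coset_family_lift[OF sub Suc.prems(5)[OF T]])
    then have "solvable (Suc k') (cube \<rho> T \<epsilon>) (\<lambda>b \<eta>. eqg k' (dlv \<psi> T) (app k' \<eta>) b)"
      using sub unfolding cube_def by (intro cartan_boxes)
    then show ?thesis unfolding P_def solvable_def .
  qed
  then have "\<forall>T. \<exists>\<eta>. T \<subseteq> J \<longrightarrow> card T = Suc s \<longrightarrow> P T \<eta>" by blast
  from choice[OF this] obtain \<eta> where \<eta>P: "\<forall>T. T \<subseteq> J \<longrightarrow> card T = Suc s \<longrightarrow> P T (\<eta> T)" by (rule exE)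
  have \<eta>: "sec (Suc k') (\<eta> T) b" "eqg k' (dlv \<psi> T) (app k' (\<eta> T)) b"
    if "T \<subseteq> J" "card T = Suc s" "b \<in> cube \<rho> T \<epsilon>" for T b
    using \<eta>P that unfolding P_def by simp_all
  have "\<exists>\<xi>. (\<forall>R b. R \<subseteq> J \<longrightarrow> Suc (card R) = Suc s \<longrightarrow> b \<in> cube \<rho> R \<epsilon> \<longrightarrow> sec (Suc k') (\<xi> R) b) \<and>
    (\<forall>S b. S \<subseteq> J \<longrightarrow> card S = Suc s \<longrightarrow> b \<in> cube \<rho> S \<epsilon> \<longrightarrow> img (Suc k') (\<lambda>i z. \<eta> S i z - dlv \<xi> S i z) b)"
  \<comment> \<open>A lift raises \<open>s\<close> by one and lowers the number of remaining levels
    by one, so \<open>s + d\<close> keeps its value and stays below \<open>card J\<close>.\<close>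
  proof (rule Suc.IH)
    show "Suc k' + d = k" "Suc s + d < card J" "\<epsilon> \<le> \<rho>" using Suc.prems(1-3) by auto
    fix U b assume U: "U \<subseteq> J" "card U = Suc (Suc s)" "b \<in> cube \<rho> U \<epsilon>"
    have Ul: "U - {l} \<subseteq> J" "card (U - {l}) = Suc s" "b \<in> cube \<rho> (U - {l}) \<epsilon>" if "l \<in> U" for l
      using U that cube_antimono[of "U - {l}" U \<rho> \<epsilon>] by auto
    \<comment> \<open>Applying the map to the coboundary of \<eta> gives the double coboundary of
      \<psi>, which is zero; exactness then puts it into the next image.\<close>
    show "img (Suc k') (dlv \<eta> U) b"
    proof (rule exact_img[OF cube_dom[OF U(3)]])
      show "sec (Suc k') (dlv \<eta> U) b" by (intro sec_dlv \<eta>(1) Ul)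
      have "eqg k' (dlv (dlv \<psi>) U) (dlv (\<lambda>T. app k' (\<eta> T)) U) b"
        by (intro eqg_dlv \<eta>(2) Ul)
      moreover have "dlv (dlv \<psi>) U i z = 0" for i z
        unfolding dlv_def dl_dl ..
      ultimately show "eqg k' (app k' (dlv \<eta> U)) (\<lambda>_ _. 0) b"
        by (simp add: eqg_def app_dlv)
    qed
  qed (rule \<eta>(1))
  then obtain \<xi>' where *: "\<forall>R b. R \<subseteq> J \<longrightarrow> Suc (card R) = Suc s \<longrightarrow> b \<in> cube \<rho> R \<epsilon> \<longrightarrow> sec (Suc k') (\<xi>' R) b"
    "\<forall>S b. S \<subseteq> J \<longrightarrow> card S = Suc s \<longrightarrow> b \<in> cube \<rho> S \<epsilon> \<longrightarrow> img (Suc k') (\<lambda>i z. \<eta> S i z - dlv \<xi>' S i z) b" by blast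
  have \<xi>': "sec (Suc k') (\<xi>' R) b" if "R \<subseteq> J" "card R = s" "b \<in> cube \<rho> R \<epsilon>" for R b
    using *(1) that by simp
  have \<xi>'2: "img (Suc k') (\<lambda>i z. \<eta> S i z - dlv \<xi>' S i z) b" if "S \<subseteq> J" "card S = Suc s" "b \<in> cube \<rho> S \<epsilon>" for S b
    using *(2) that by simp
  \<comment> \<open>The correction by the image of \<xi>' does not change cosets and makes \<psi> a
    true cocycle of functions, to which Laurent exactness applies.\<close>
  define \<psi>' where "\<psi>' S i z = \<psi> S i z - app k' (\<xi>' S) i z" for S i z
  have s: "s < card J" using Suc.prems(2) by simp
  have "\<exists>\<xi>. (\<forall>R b. R \<subseteq> J \<longrightarrow> Suc (card R) = s \<longrightarrow> b \<in> cube \<rho> R \<epsilon> \<longrightarrow> sec k' (\<xi> R) b) \<and>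
    (\<forall>S b. S \<subseteq> J \<longrightarrow> card S = s \<longrightarrow> b \<in> cube \<rho> S \<epsilon> \<longrightarrow> eqg k' (\<psi>' S) (dlv \<xi> S) b)"
  proof (rule laurent_exact_sec[OF \<rho> Suc.prems(3) s])
    fix S b assume S: "S \<subseteq> J" "card S = s" "b \<in> cube \<rho> S \<epsilon>"
    show "sec k' (\<psi>' S) b"
      unfolding \<psi>'_def[abs_def] by (intro sec_diff sec_app Suc.prems(4)[OF S] cube_dom[OF S(3)] \<xi>'[OF S])
  next
    fix T b assume T: "T \<subseteq> J" "card T = Suc s" "b \<in> cube \<rho> T \<epsilon>"
    have 1: "eqg k' (app k' (\<lambda>i z. \<eta> T i z - dlv \<xi>' T i z)) (\<lambda>_ _. 0) b"
      by (rule img_app_eq_0[OF cube_dom[OF T(3)] \<xi>'2[OF T]])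
    have lin: "dlv \<psi>' T i z = dlv \<psi> T i z - app k' (dlv \<xi>' T) i z" for i z
      unfolding app_dlv by (simp add: dlv_def \<psi>'_def[abs_def] dl_diff[symmetric])
    show "eqg k' (dlv \<psi>' T) (\<lambda>_ _. 0) b"
      using 1 \<eta>(2)[OF T] unfolding eqg_def by eventually_elim (simp add: lin app_diff)
  qed
  then obtain \<xi> where \<xi>: "\<And>R b. R \<subseteq> J \<Longrightarrow> Suc (card R) = s \<Longrightarrow> b \<in> cube \<rho> R \<epsilon> \<Longrightarrow> sec k' (\<xi> R) b"
    "\<And>S b. S \<subseteq> J \<Longrightarrow> card S = s \<Longrightarrow> b \<in> cube \<rho> S \<epsilon> \<Longrightarrow> eqg k' (\<psi>' S) (dlv \<xi> S) b" by blast
  show ?case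
  proof (intro exI[of _ \<xi>] conjI allI impI)
    fix S b assume S: "S \<subseteq> J" "card S = s" "b \<in> cube \<rho> S \<epsilon>"
    have "eqg k' (\<lambda>i z. \<psi> S i z - dlv \<xi> S i z) (app k' (\<xi>' S)) b"
      using \<xi>(2)[OF S] unfolding eqg_def by eventually_elim (auto simp: \<psi>'_def algebra_simps)
    then show "img k' (\<lambda>i z. \<psi> S i z - dlv \<xi> S i z) b" using \<xi>'[OF S] unfolding img_def by blast
  qed (rule \<xi>)
qed

text \<open>The uniqueness half: a section of the cokernel that is zero on the shell is zero across
  the plane. It is \<open>cochain_step\<close> with \<open>s = 0\<close>, where \<open>u\<close> is
  a cochain on the empty set and \<xi> contributes nothing.\<close>

lemma img_extends:
  assumes k: "k < card J" and \<epsilon>: "\<epsilon> \<le> \<rho>"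
    and u: "\<And>b. b \<in> cube \<rho> {} \<epsilon> \<Longrightarrow> sec 0 u b"
    and im: "\<And>j b. j \<in> J \<Longrightarrow> b \<in> cube \<rho> {j} \<epsilon> \<Longrightarrow> img 0 u b"
    and b: "b \<in> cube \<rho> {} \<epsilon>"
  shows "img 0 u b"
proof -
  have "\<exists>\<xi>. (\<forall>R b. R \<subseteq> J \<longrightarrow> Suc (card R) = 0 \<longrightarrow> b \<in> cube \<rho> R \<epsilon> \<longrightarrow> sec 0 (\<xi> R) b) \<and>
    (\<forall>S b. S \<subseteq> J \<longrightarrow> card S = 0 \<longrightarrow> b \<in> cube \<rho> S \<epsilon> \<longrightarrow> img 0 (\<lambda>i z. u i z - dlv \<xi> S i z) b)"
  proof (rule cochain_step[where \<psi>="\<lambda>S. u" and d=k, OF _ _ \<epsilon>])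
    show "0 + k = k" "0 + k < card J" using k by auto
    fix S b assume "S \<subseteq> J" "card S = 0" "b \<in> cube \<rho> S \<epsilon>"
    then show "sec 0 u b" using u by simp
  next
    fix T b assume T: "T \<subseteq> J" "card T = Suc 0" "b \<in> cube \<rho> T \<epsilon>"
    then obtain j where j: "T = {j}" using card_1_singletonE by (metis One_nat_def)
    have "dlv (\<lambda>S. u) T = u" by (intro ext) (simp add: j dlv_singleton)
    then show "img 0 (dlv (\<lambda>S. u) T) b" using im[of j b] T j by simp
  qed
  then obtain \<xi> where "\<And>S b. S \<subseteq> J \<Longrightarrow> card S = 0 \<Longrightarrow> b \<in> cube \<rho> S \<epsilon> \<Longrightarrow> img 0 (\<lambda>i z. u i z - dlv \<xi> S i z) b" by blast
  from this[of "{}", OF _ _ b] have "img 0 (\<lambda>i z. u i z - dlv \<xi> {} i z) b" by simp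
  then show ?thesis by (simp add: dlv_def dl_def)
qed

text \<open>Cartan's theorem gives a representative \<open>h j\<close> on each perforated cube, and
  their differences lie in the image. \<open>cochain_step\<close> with \<open>s = 1\<close> replaces
  them by a single section \<open>\<xi> {}\<close> over the full cube; this uses
  \<open>1 + k < card J\<close>.\<close>

lemma coset_extends_shell:
  assumes k: "k + 2 \<le> card J" and \<epsilon>: "0 < \<epsilon>" "\<epsilon> \<le> \<rho>"
    and fam: "coset_family 0 {z\<in>cube \<rho> {} \<rho>. \<exists>j\<in>J. z $ j \<noteq> 0} L"
  shows "\<exists>g. (\<forall>b\<in>cube \<rho> {} \<rho>. sec 0 g b) \<and> (\<forall>j\<in>J. \<forall>b\<in>cube \<rho> {j} \<epsilon>. L b g)"
proof -
  define D where "D = {z\<in>cube \<rho> {} \<rho>. \<exists>j\<in>J. z $ j \<noteq> 0}"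
  have sub: "cube \<rho> S \<epsilon> \<subseteq> D" if "j \<in> J" "j \<in> S" for j S
  proof
    fix z assume z: "z \<in> cube \<rho> S \<epsilon>"
    then have "\<epsilon> \<le> norm (z $ j)" using that by (simp add: mem_cube)
    then have "z $ j \<noteq> 0" using \<epsilon>(1) by auto
    moreover have "z \<in> cube \<rho> {} \<rho>" using z by (simp add: mem_cube)
    ultimately show "z \<in> D" using that(1) unfolding D_def by blast
  qed
  note fam = fam[folded D_def]
  note D = coset_familyD[OF fam]
  have "\<exists>h. \<forall>b\<in>cube \<rho> {j} \<epsilon>. sec 0 h b \<and> L b h" if j: "j \<in> J" for j
  proof -
    have "coset_family 0 (cube \<rho> {j} \<epsilon>) L" by (rule coset_family_subset[OF fam sub[OF j]]) simp
    then have "solvable 0 (cube \<rho> {j} \<epsilon>) L"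
      using cube_dom unfolding cube_def by (intro cartan_boxes) auto
    then show ?thesis unfolding solvable_def .
  qed
  then have "\<forall>j\<in>J. \<exists>h. \<forall>b\<in>cube \<rho> {j} \<epsilon>. sec 0 h b \<and> L b h" by blast
  from bchoice[OF this] obtain h where h: "\<And>j b. j \<in> J \<Longrightarrow> b \<in> cube \<rho> {j} \<epsilon> \<Longrightarrow> sec 0 (h j) b"
    "\<And>j b. j \<in> J \<Longrightarrow> b \<in> cube \<rho> {j} \<epsilon> \<Longrightarrow> L b (h j)" by blast
  define \<psi> where "\<psi> S = h (the_elem S)" for S
  have "\<exists>\<xi>. (\<forall>R b. R \<subseteq> J \<longrightarrow> Suc (card R) = Suc 0 \<longrightarrow> b \<in> cube \<rho> R \<epsilon> \<longrightarrow> sec 0 (\<xi> R) b) \<and>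
    (\<forall>S b. S \<subseteq> J \<longrightarrow> card S = Suc 0 \<longrightarrow> b \<in> cube \<rho> S \<epsilon> \<longrightarrow> img 0 (\<lambda>i z. \<psi> S i z - dlv \<xi> S i z) b)"
  proof (rule cochain_step[where d=k, OF _ _ \<epsilon>(2)])
    show "0 + k = k" "Suc 0 + k < card J" using k by auto
    fix S b assume S: "S \<subseteq> J" "card S = Suc 0" "b \<in> cube \<rho> S \<epsilon>"
    then obtain j where "S = {j}" using card_1_singletonE by (metis One_nat_def)
    then show "sec 0 (\<psi> S) b" using h(1)[of j b] S by (simp add: \<psi>_def)
  next
    fix T b assume T: "T \<subseteq> J" "card T = Suc (Suc 0)" "b \<in> cube \<rho> T \<epsilon>"
    then obtain j l where jl: "T = {j, l}" "j \<noteq> l" by (metis card_2_iff numeral_2_eq_2)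
    obtain c where c: "\<forall>\<psi> i z. dlv \<psi> T i z = c * (\<psi> {l} i z - \<psi> {j} i z)" using dlv_pair[OF jl(2)] jl(1) by blast
    have "dlv \<psi> T = (\<lambda>i z. c * (h l i z - h j i z))" by (intro ext) (simp add: c \<psi>_def)
    moreover have "j \<in> J" "l \<in> J" "b \<in> cube \<rho> {j} \<epsilon>" "b \<in> cube \<rho> {l} \<epsilon>" "b \<in> D"
      using T jl cube_antimono[of "{j}" T \<rho> \<epsilon>] cube_antimono[of "{l}" T \<rho> \<epsilon>] sub[of j T] by auto
    ultimately show "img 0 (dlv \<psi> T) b" using D(2)[of b "h l" "h j"] h by (simp add: img_scale)
  qed
  then obtain \<xi> where \<xi>: "\<And>R b. R \<subseteq> J \<Longrightarrow> Suc (card R) = Suc 0 \<Longrightarrow> b \<in> cube \<rho> R \<epsilon> \<Longrightarrow> sec 0 (\<xi> R) b"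
    "\<And>S b. S \<subseteq> J \<Longrightarrow> card S = Suc 0 \<Longrightarrow> b \<in> cube \<rho> S \<epsilon> \<Longrightarrow> img 0 (\<lambda>i z. \<psi> S i z - dlv \<xi> S i z) b" by blast
  have s\<xi>: "sec 0 (\<xi> {}) b" if "b \<in> cube \<rho> {} \<rho>" for b
    using \<xi>(1)[of "{}" b] that unfolding cube_empty[of \<rho> \<rho> \<epsilon>] by simp
  show ?thesis
  proof (intro exI[of _ "\<xi> {}"] conjI ballI)
    fix j b assume j: "j \<in> J" and b: "b \<in> cube \<rho> {j} \<epsilon>"
    have bD: "b \<in> D" using sub[of j "{j}"] j b by blast
    have "img 0 (\<lambda>i z. h j i z - \<xi> {} i z) b"
      using \<xi>(2)[of "{j}" b] j b by (simp add: \<psi>_def dlv_singleton)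
    then obtain \<eta> where \<eta>: "sec (Suc 0) \<eta> b" "eqg 0 (\<lambda>i z. h j i z - \<xi> {} i z) (app 0 \<eta>) b" unfolding img_def by blast
    have "eqg 0 (\<xi> {}) (\<lambda>i z. h j i z + app 0 (\<lambda>i z. - \<eta> i z) i z) b"
      using \<eta>(2) unfolding eqg_def by eventually_elim (auto simp: app_minus algebra_simps)
    moreover have "sec 0 (\<xi> {}) b" using bD by (intro s\<xi>) (simp add: D_def)
    ultimately show "L b (\<xi> {})" using D(4)[OF bD h(1)[OF j b] h(2)[OF j b] sec_minus[OF \<eta>(1)]] by blast
  qed (rule s\<xi>)
qed

text \<open>The shell with \<epsilon> = \<rho> misses the points near the plane. At such a point a
  thinner \<epsilon> supplies another extension; the two agree modulo the image on the first shell,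
  hence everywhere by \<open>img_extends\<close>.\<close>

theorem coset_extends:
  assumes k: "k + 2 \<le> card J"
    and fam: "coset_family 0 {z\<in>cube \<rho> {} \<rho>. \<exists>j\<in>J. z $ j \<noteq> 0} L"
  shows "\<exists>g. (\<forall>b\<in>cube \<rho> {} \<rho>. sec 0 g b) \<and> (\<forall>b\<in>cube \<rho> {} \<rho>. (\<exists>j\<in>J. b $ j \<noteq> 0) \<longrightarrow> L b g)"
proof -
  define D where "D = {z\<in>cube \<rho> {} \<rho>. \<exists>j\<in>J. z $ j \<noteq> 0}"
  note Df = coset_familyD[OF fam[folded D_def]]
  obtain g where g: "\<And>b. b \<in> cube \<rho> {} \<rho> \<Longrightarrow> sec 0 g b" "\<And>j b. j \<in> J \<Longrightarrow> b \<in> cube \<rho> {j} \<rho> \<Longrightarrow> L b g"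
    using coset_extends_shell[OF k \<rho> order_refl fam] by blast
  have "L b g" if b: "b \<in> cube \<rho> {} \<rho>" "j \<in> J" "b $ j \<noteq> 0" for b j
  proof -
    define \<epsilon> where "\<epsilon> = min \<rho> (norm (b $ j))"
    have \<epsilon>: "0 < \<epsilon>" "\<epsilon> \<le> \<rho>" using \<rho> b(3) by (auto simp: \<epsilon>_def)
    have bj: "b \<in> cube \<rho> {j} \<epsilon>" using b by (simp add: mem_cube \<epsilon>_def)
    obtain g' where g': "\<And>b. b \<in> cube \<rho> {} \<rho> \<Longrightarrow> sec 0 g' b" "\<And>j b. j \<in> J \<Longrightarrow> b \<in> cube \<rho> {j} \<epsilon> \<Longrightarrow> L b g'"
      using coset_extends_shell[OF k \<epsilon> fam] by blast
    have "img 0 (\<lambda>i z. g' i z - g i z) b"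
    proof (rule img_extends[OF _ order_refl _ _ b(1)])
      show "k < card J" using k by simp
      show "sec 0 (\<lambda>i z. g' i z - g i z) b'" if "b' \<in> cube \<rho> {} \<rho>" for b' using g g' that by (intro sec_diff)
      fix l b' assume l: "l \<in> J" "b' \<in> cube \<rho> {l} \<rho>"
      have e: "b' \<in> cube \<rho> {l} \<epsilon>" "b' \<in> cube \<rho> {} \<rho>" "\<rho> \<le> norm (b' $ l)" using l(2) \<epsilon>(2) by (auto simp: mem_cube)
      have "b' \<in> D" using e(2,3) l(1) \<rho> unfolding D_def by force
      then show "img 0 (\<lambda>i z. g' i z - g i z) b'"
        using Df(2)[of b' g' g] g(1)[OF e(2)] g'(1)[OF e(2)] g(2)[OF l] g'(2)[OF l(1) e(1)] by blast
    qed
    then obtain \<eta> where \<eta>: "sec (Suc 0) \<eta> b" "eqg 0 (\<lambda>i z. g' i z - g i z) (app 0 \<eta>) b" unfolding img_def by blast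
    have bD: "b \<in> D" using b unfolding D_def by blast
    have "eqg 0 g (\<lambda>i z. g' i z + app 0 (\<lambda>i z. - \<eta> i z) i z) b"
      using \<eta>(2) unfolding eqg_def by eventually_elim (auto simp: app_minus algebra_simps)
    then show ?thesis using Df(4)[OF bD g'(1)[OF b(1)] g'(2)[OF b(2) bj] sec_minus[OF \<eta>(1)] g(1)[OF b(1)]] by blast
  qed
  then show ?thesis using g(1) by blast
qed

end

end

subsection \<open>Minors and rank\<close>

definition nmat :: "nat \<Rightarrow> (nat \<Rightarrow> nat \<Rightarrow> complex) \<Rightarrow> complex mat" where
  "nmat s M = Matrix.mat s s (\<lambda>(a, b). M a b)"

lemma nmat_carrier [simp]: "nmat s M \<in> carrier_mat s s"
  and dim_nmat [simp]: "dim_row (nmat s M) = s" "dim_col (nmat s M) = s"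
  and nmat_index [simp]: "a < s \<Longrightarrow> b < s \<Longrightarrow> nmat s M $$ (a, b) = M a b"
  by (simp_all add: nmat_def)

lemma mult_mat_vec_index:
  assumes "A \<in> carrier_mat m n" "v \<in> carrier_vec n" "i < m"
  shows "vec_index (A *\<^sub>v v) i = (\<Sum>j<n. A $$ (i, j) * vec_index v j)"
  using assms by (simp add: scalar_prod_def lessThan_atLeast0)

lemma det_nmat_eq_0:
  "det (nmat s M) = 0 \<longleftrightarrow> (\<exists>v. (\<exists>b<s. v b \<noteq> 0) \<and> (\<forall>a<s. (\<Sum>b<s. M a b * v b) = 0))"
proof
  assume "det (nmat s M) = 0"
  then obtain v where v: "v \<in> carrier_vec s" "v \<noteq> 0\<^sub>v s" "nmat s M *\<^sub>v v = 0\<^sub>v s"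
    using det_0_iff_vec_prod_zero_field[OF nmat_carrier] by blast
  have "\<exists>b<s. vec_index v b \<noteq> 0"
  proof (rule ccontr)
    assume "\<not> (\<exists>b<s. vec_index v b \<noteq> 0)"
    then have "v = 0\<^sub>v s" using v(1) by (intro eq_vecI) auto
    then show False using v(2) by simp
  qed
  moreover have "(\<Sum>b<s. M a b * vec_index v b) = 0" if "a < s" for a
    using mult_mat_vec_index[OF nmat_carrier v(1) that, of M, unfolded v(3)] that by simp
  ultimately show "\<exists>v. (\<exists>b<s. v b \<noteq> 0) \<and> (\<forall>a<s. (\<Sum>b<s. M a b * v b) = 0)" by blast
next
  assume "\<exists>v. (\<exists>b<s. v b \<noteq> 0) \<and> (\<forall>a<s. (\<Sum>b<s. M a b * v b) = 0)"
  then obtain v b where v: "b < s" "v b \<noteq> 0" "\<And>a. a < s \<Longrightarrow> (\<Sum>b<s. M a b * v b) = 0" by blast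
  define w where "w = Matrix.vec s v"
  have w: "w \<in> carrier_vec s" by (simp add: w_def)
  have "nmat s M *\<^sub>v w = 0\<^sub>v s"
  proof (rule eq_vecI)
    fix i assume "i < dim_vec (0\<^sub>v s)"
    then have i: "i < s" by simp
    show "vec_index (nmat s M *\<^sub>v w) i = vec_index (0\<^sub>v s) i"
      using mult_mat_vec_index[OF nmat_carrier w i, of M] v(3)[OF i] i by (simp add: nmat_def w_def)
  qed (simp add: nmat_def)
  moreover have "w \<noteq> 0\<^sub>v s" using v(1,2) by (metis index_vec index_zero_vec(1) w_def)
  ultimately show "det (nmat s M) = 0" using det_0_iff_vec_prod_zero_field[OF nmat_carrier] w by blast
qed

lemma det_nmat_transpose: "det (nmat s (\<lambda>a b. M b a)) = det (nmat s M)"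
proof -
  have "nmat s (\<lambda>a b. M b a) = transpose_mat (nmat s M)" by (rule eq_matI) (auto simp: nmat_def)
  then show ?thesis using det_transpose[OF nmat_carrier] by simp
qed

lemma det_nmat_neq_0_D:
  assumes "det (nmat s M) \<noteq> 0" "\<And>b. b < s \<Longrightarrow> (\<Sum>a<s. w a * M a b) = 0" "a < s"
  shows "w a = 0"
proof (rule ccontr)
  assume "w a \<noteq> 0"
  then have "det (nmat s (\<lambda>a b. M b a)) = 0"
    unfolding det_nmat_eq_0
  proof (intro exI[of _ w] conjI allI impI)
    fix b assume "b < s"
    then show "(\<Sum>a<s. M a b * w a) = 0" using assms(2)[of b] by (simp only: mult.commute[of "M _ _"])
  qed (use assms(3) \<open>w a \<noteq> 0\<close> in blast)
  then show False using assms(1) det_nmat_transpose[of s M] by simp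
qed

text \<open>The system is padded with zero rows to a square one, whose determinant vanishes.\<close>

lemma wide_kernel:
  assumes "s < t"
  obtains v :: "nat \<Rightarrow> complex" where "\<exists>i<t. v i \<noteq> 0" "\<And>a. a < s \<Longrightarrow> (\<Sum>i<t. M a i * v i) = 0"
proof -
  define M' where "M' a i = (if a < s then M a i else 0)" for a i
  have "det (nmat t (\<lambda>i a. M' a i)) = 0"
    unfolding det_nmat_eq_0
  proof (intro exI[of _ "\<lambda>a. if a = s then 1 else 0"] conjI allI impI)
    fix i show "(\<Sum>a<t. M' a i * (if a = s then 1 else 0)) = 0" by (intro sum.neutral ballI) (simp add: M'_def)
  qed (use assms in auto)
  then have "det (nmat t M') = 0" using det_nmat_transpose[of t M'] by simp
  then obtain v where v: "\<exists>i<t. v i \<noteq> 0" "\<And>a. a < t \<Longrightarrow> (\<Sum>i<t. M' a i * v i) = 0"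
    unfolding det_nmat_eq_0 by blast
  show ?thesis
  proof (rule that[OF v(1)])
    fix a assume "a < s"
    then show "(\<Sum>i<t. M a i * v i) = 0" using v(2)[of a] assms by (simp add: M'_def)
  qed
qed

definition nadj :: "nat \<Rightarrow> (nat \<Rightarrow> nat \<Rightarrow> complex) \<Rightarrow> nat \<Rightarrow> nat \<Rightarrow> complex" where
  "nadj s M b a = adj_mat (nmat s M) $$ (b, a)"

lemma nadj_mult:
  assumes "a < s" "c < s"
  shows "(\<Sum>b<s. nadj s M a b * M b c) = (if a = c then det (nmat s M) else 0)"
proof -
  have "(adj_mat (nmat s M) * nmat s M) $$ (a, c) = (det (nmat s M) \<cdot>\<^sub>m 1\<^sub>m s) $$ (a, c)"
    using adj_mat(3)[OF nmat_carrier] by simp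
  moreover have "(adj_mat (nmat s M) * nmat s M) $$ (a, c) = (\<Sum>b<s. nadj s M a b * M b c)"
    using assms carrier_matD[OF adj_mat(1)[OF nmat_carrier, of s M]]
    by (simp add: scalar_prod_def lessThan_atLeast0 nadj_def)
  ultimately show ?thesis using assms by simp
qed

abbreviation minor :: "(nat \<Rightarrow> nat \<Rightarrow> complex) \<Rightarrow> nat \<Rightarrow> (nat \<Rightarrow> nat) \<Rightarrow> (nat \<Rightarrow> nat) \<Rightarrow> complex" where
  "minor A s I J \<equiv> det (nmat s (\<lambda>a b. A (I a) (J b)))"

text \<open>Where the bordered minors vanish, \<open>A\<close> factors through the block of an invertible minor.\<close>

lemma minor_factor:
  fixes A :: "nat \<Rightarrow> nat \<Rightarrow> complex"
  defines "adj \<equiv> \<lambda>s I J. nadj s (\<lambda>a b. A (I a) (J b))"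
  assumes D: "minor A s I J \<noteq> 0" and bd: "minor A (Suc s) (I(s := i)) (J(s := l)) = 0"
  shows "A i l = (\<Sum>b<s. A i (J b) * (\<Sum>a<s. adj s I J b a * A (I a) l)) / minor A s I J"
proof -
  obtain v where v: "\<exists>b<Suc s. v b \<noteq> 0"
    "\<And>a. a < Suc s \<Longrightarrow> (\<Sum>b<Suc s. A ((I(s := i)) a) ((J(s := l)) b) * v b) = 0"
    using bd unfolding det_nmat_eq_0 by blast
  define D where "D = minor A s I J"
  have row: "(\<Sum>b<s. A i' (J b) * v b) = - (A i' l * v s)" if "a < Suc s" "i' = (I(s := i)) a" for a i'
  proof -
    have "(\<Sum>b<s. A i' ((J(s := l)) b) * v b) = (\<Sum>b<s. A i' (J b) * v b)" by (intro sum.cong) auto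
    then show ?thesis using v(2)[OF that(1)] that(2) by (simp add: eq_neg_iff_add_eq_0)
  qed
  \<comment> \<open>Cramer's rule: the adjugate of the block solves the first \<open>s\<close>
    relations for \<open>v b\<close> in terms of \<open>v s\<close>.\<close>
  have vb: "D * v b = - (v s * (\<Sum>a<s. adj s I J b a * A (I a) l))" if b: "b < s" for b
  proof -
    have "D * v b = (\<Sum>c<s. (if b = c then D else 0) * v c)" using b by (simp add: if_distrib[of "\<lambda>x. x * _"] cong: if_cong)
    also have "\<dots> = (\<Sum>c<s. (\<Sum>a<s. adj s I J b a * A (I a) (J c)) * v c)"
      by (intro sum.cong refl) (simp add: nadj_mult[OF b, of _ "\<lambda>a b. A (I a) (J b)"] adj_def D_def)
    also have "\<dots> = (\<Sum>a<s. adj s I J b a * (\<Sum>c<s. A (I a) (J c) * v c))"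
      unfolding sum_distrib_left sum_distrib_right by (subst sum.swap) (simp add: mult.assoc)
    also have "\<dots> = (\<Sum>a<s. adj s I J b a * - (A (I a) l * v s))"
    proof (intro sum.cong refl)
      fix a assume "a \<in> {..<s}"
      then show "adj s I J b a * (\<Sum>c<s. A (I a) (J c) * v c) = adj s I J b a * - (A (I a) l * v s)" using row[of a "I a"] by simp
    qed
    finally show ?thesis by (simp add: sum_distrib_left sum_negf mult_ac)
  qed
  \<comment> \<open>Otherwise the kernel vector would live on the invertible block alone.\<close>
  have vs: "v s \<noteq> 0"
  proof
    assume "v s = 0"
    then have "v b = 0" if "b < s" for b using vb[OF that] D by (simp add: D_def)
    then show False using v(1) \<open>v s = 0\<close> less_Suc_eq by metis
  qed
  have "D * (A i l * v s) = - (D * (\<Sum>b<s. A i (J b) * v b))"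
    using row[of s i] by simp
  also have "\<dots> = - (\<Sum>b<s. A i (J b) * (D * v b))"
    by (simp add: sum_distrib_left mult_ac)
  also have "\<dots> = v s * (\<Sum>b<s. A i (J b) * (\<Sum>a<s. adj s I J b a * A (I a) l))"
    by (simp add: vb sum_distrib_left sum_negf mult_ac)
  finally have "v s * (D * A i l) = v s * (\<Sum>b<s. A i (J b) * (\<Sum>a<s. adj s I J b a * A (I a) l))" by (simp add: mult_ac)
  then have "D * A i l = (\<Sum>b<s. A i (J b) * (\<Sum>a<s. adj s I J b a * A (I a) l))" using vs by simp
  then show ?thesis using D by (simp add: D_def field_simps)
qed

lemma maximal_minor:
  obtains s I J where "\<And>a. a < s \<Longrightarrow> I a < m \<and> J a < n" "minor A s I J \<noteq> 0" "s \<le> t"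
    "s < t \<Longrightarrow> (\<And>I J. (\<And>a. a < Suc s \<Longrightarrow> I a < m \<and> J a < n) \<Longrightarrow> minor A (Suc s) I J = 0)"
proof -
  define P where "P s \<longleftrightarrow> s \<le> t \<and> (\<exists>I J. (\<forall>a<s. I a < m \<and> J a < n) \<and> minor A s I J \<noteq> 0)" for s
  have "P 0" by (simp add: P_def nmat_def)
  then have g: "P (Greatest P)" "\<And>s. P s \<Longrightarrow> s \<le> Greatest P"
    using GreatestI_nat[of P 0 t] Greatest_le_nat[of P _ t] unfolding P_def by blast+
  define s where "s = Greatest P"
  from g(1) obtain I J where IJ: "\<forall>a<s. I a < m \<and> J a < n" "minor A s I J \<noteq> 0" "s \<le> t" unfolding P_def s_def by blast
  have mx: "\<not> P (Suc s)" using g(2)[of "Suc s"] by (auto simp: s_def)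
  show ?thesis
  proof (rule that[of s I J])
    fix I' J' assume "s < t" "\<And>a. a < Suc s \<Longrightarrow> I' a < m \<and> J' a < n"
    then show "minor A (Suc s) I' J' = 0" using mx unfolding P_def by (metis Suc_leI)
  qed (use IJ in auto)
qed

lemma minor_le_rank:
  assumes A: "A \<in> carrier_mat m n" and J: "\<And>a. a < s \<Longrightarrow> I a < m \<and> J a < n"
    and D: "minor (\<lambda>i j. A $$ (i, j)) s I J \<noteq> 0"
  shows "s \<le> vec_space.rank m A"
proof -
  interpret vec_space "TYPE(complex)" m .
  define B where "B = Matrix.mat m s (\<lambda>(i, b). A $$ (i, J b))"
  have B: "B \<in> carrier_mat m s" by (simp add: B_def)
  have ker: "vec_index v b = 0" if v: "v \<in> carrier_vec s" "B *\<^sub>v v = 0\<^sub>v m" "b < s" for v b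
  proof (rule ccontr)
    assume ne: "vec_index v b \<noteq> 0"
    have "minor (\<lambda>i j. A $$ (i, j)) s I J = 0"
      unfolding det_nmat_eq_0
    proof (intro exI[of _ "vec_index v"] conjI allI impI)
      fix a assume a: "a < s"
      then show "(\<Sum>b<s. A $$ (I a, J b) * vec_index v b) = 0"
        using mult_mat_vec_index[OF B v(1), of "I a", unfolded v(2)] J[OF a] by (simp add: B_def)
    qed (use ne v(3) in blast)
    then show False using D by simp
  qed
  have col: "col B b = col A (J b)" if "b < s" for b
    using that J[OF that] A by (intro eq_vecI) (auto simp: B_def)
  have dist: "distinct (cols B)"
    unfolding distinct_conv_nth
  proof (intro allI impI)
    fix b c assume bc: "b < length (cols B)" "c < length (cols B)" "b \<noteq> c"
    then have bs: "b < s" "c < s" using B by auto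
    show "cols B ! b \<noteq> cols B ! c"
    proof
      assume eq: "cols B ! b = cols B ! c"
      define v where "v = (Matrix.vec s (\<lambda>x. (if x = b then 1 else 0) - (if x = c then 1 else 0)) :: complex Matrix.vec)"
      have v: "v \<in> carrier_vec s" by (simp add: v_def)
      have "B *\<^sub>v v = 0\<^sub>v m"
      proof (rule eq_vecI)
        fix i assume "i < dim_vec (0\<^sub>v m)"
        then have i: "i < m" by simp
        have "B $$ (i, b) = B $$ (i, c)"
          using arg_cong[OF eq, of "\<lambda>w. vec_index w i"] bc(1,2) i B by simp
        then show "vec_index (B *\<^sub>v v) i = vec_index (0\<^sub>v m) i"
          using mult_mat_vec_index[OF B v i] bs i
          by (simp add: v_def right_diff_distrib sum_subtractf if_distrib[of "\<lambda>x. _ * x"] cong: if_cong)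
      qed (use B in simp)
      from ker[OF v this bs(1)] show False using bs bc(3) by (simp add: v_def)
    qed
  qed
  have "lin_indpt (set (cols B))"
  proof
    assume "lin_dep (set (cols B))"
    then obtain v where v: "v \<in> carrier_vec s" "v \<noteq> 0\<^sub>v s" "B *\<^sub>v v = 0\<^sub>v m"
      using lin_depE[OF B _ dist] by blast
    have "v = 0\<^sub>v s" using ker[OF v(1,3)] v(1) by (intro eq_vecI) auto
    then show False using v(2) by simp
  qed
  moreover have "set (cols B) \<subseteq> set (cols A)"
  proof
    fix x assume "x \<in> set (cols B)"
    then obtain b where b: "b < s" "x = col B b" using B by (auto simp: cols_def)
    then show "x \<in> set (cols A)" using col J[OF b(1)] A by (auto simp: cols_def)
  qed
  ultimately have "card (set (cols B)) \<le> rank A" by (intro rank_ge_card_indpt[OF A])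
  moreover have "card (set (cols B)) = s" using distinct_card[OF dist] B by simp
  ultimately show ?thesis by simp
qed

text \<open>By \<open>minor_factor\<close> every column is a combination of the \<open>s\<close>
  columns of the block, with coefficients \<open>E\<close>; so any \<open>Suc s\<close> columns are
  dependent.\<close>

lemma rank_le_minor:
  assumes A: "A \<in> carrier_mat m n"
    and IJ: "\<And>a. a < s \<Longrightarrow> I a < m \<and> J a < n"
    and D: "minor (\<lambda>i j. A $$ (i, j)) s I J \<noteq> 0"
    and van: "\<And>I J. (\<And>a. a < Suc s \<Longrightarrow> I a < m \<and> J a < n) \<Longrightarrow> minor (\<lambda>i j. A $$ (i, j)) (Suc s) I J = 0"
  shows "vec_space.rank m A \<le> s"
proof (rule ccontr)
  interpret vec_space "TYPE(complex)" m .
  assume "\<not> vec_space.rank m A \<le> s"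
  then have rk: "Suc s \<le> rank A" by simp
  have sub: "set (cols A) \<subseteq> carrier_vec m" using cols_dim A by blast
  obtain T where T: "maximal T (\<lambda>T. T \<subseteq> set (cols A) \<and> lin_indpt T)"
    using maximal_exists_superset[of "set (cols A)" "\<lambda>T. T \<subseteq> set (cols A) \<and> lin_indpt T" "{}"] finite_lin_indpt2[of "{}"]
    by auto
  then have T': "T \<subseteq> set (cols A)" "lin_indpt T" "Suc s \<le> card T"
    using rank_card_indpt[OF A T] rk by (auto simp: maximal_def)
  obtain S where S: "S \<subseteq> T" "card S = Suc s" and fS: "finite S" by (rule obtain_subset_with_card_n[OF T'(3)])
  obtain xs where xs: "set xs = S" "distinct xs" using finite_distinct_list[OF fS] by blast
  then have len: "length xs = Suc s" using S(2) distinct_card[OF xs(2)] by simp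
  have "\<forall>b. \<exists>j. b < Suc s \<longrightarrow> j < n \<and> xs ! b = col A j"
  proof (intro allI)
    fix b
    have "xs ! b \<in> set (cols A)" if "b < Suc s"
    proof -
      have "xs ! b \<in> set xs" using that len by simp
      then show ?thesis using xs(1) S(1) T'(1) by blast
    qed
    then show "\<exists>j. b < Suc s \<longrightarrow> j < n \<and> xs ! b = col A j" using A by (auto simp: cols_def) blast
  qed
  from choice[OF this] obtain c where c: "\<And>b. b < Suc s \<Longrightarrow> c b < n \<and> xs ! b = col A (c b)" by blast
  define B where "B = mat_of_cols m xs"
  have B: "B \<in> carrier_mat m (Suc s)" using len by (simp add: B_def mat_of_cols_def)
  have colsB: "cols B = xs" unfolding B_def using xs S T' sub by (intro cols_mat_of_cols) blast
  define E where "E b l = (\<Sum>a<s. nadj s (\<lambda>a b. A $$ (I a, J b)) b a * A $$ (I a, l)) / minor (\<lambda>i j. A $$ (i, j)) s I J" for b l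
  have fac: "A $$ (i, l) = (\<Sum>b<s. A $$ (i, J b) * E b l)" if "i < m" "l < n" for i l
  proof -
    have "minor (\<lambda>i j. A $$ (i, j)) (Suc s) (I(s := i)) (J(s := l)) = 0"
      using IJ that by (intro van) (auto simp: less_Suc_eq)
    from minor_factor[OF D this] show ?thesis
      by (simp only: E_def times_divide_eq_right sum_divide_distrib[symmetric])
  qed
  obtain v :: "nat \<Rightarrow> complex" where v: "\<exists>b<Suc s. v b \<noteq> 0" "\<And>a. a < s \<Longrightarrow> (\<Sum>b<Suc s. E a (c b) * v b) = 0"
    using wide_kernel[of s "Suc s" "\<lambda>a b. E a (c b)"] by blast
  define w where "w = Matrix.vec (Suc s) v"
  have w: "w \<in> carrier_vec (Suc s)" by (simp add: w_def)
  have "B *\<^sub>v w = 0\<^sub>v m"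
  proof (rule eq_vecI)
    fix i assume "i < dim_vec (0\<^sub>v m)"
    then have i: "i < m" by simp
    have "vec_index (B *\<^sub>v w) i = (\<Sum>b<Suc s. B $$ (i, b) * vec_index w b)" by (rule mult_mat_vec_index[OF B w i])
    also have "\<dots> = (\<Sum>b<Suc s. A $$ (i, c b) * v b)"
      using c i A len by (intro sum.cong refl) (auto simp: B_def mat_of_cols_def w_def)
    also have "\<dots> = (\<Sum>b<Suc s. (\<Sum>a<s. A $$ (i, J a) * E a (c b)) * v b)"
      using fac[OF i] c by (intro sum.cong refl) simp
    also have "\<dots> = (\<Sum>a<s. A $$ (i, J a) * (\<Sum>b<Suc s. E a (c b) * v b))"
      unfolding sum_distrib_left sum_distrib_right by (subst sum.swap) (simp add: mult.assoc)
    also have "\<dots> = 0" using v(2) by simp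
    finally show "vec_index (B *\<^sub>v w) i = vec_index (0\<^sub>v m) i" using i by simp
  qed (use B in simp)
  moreover have "w \<noteq> 0\<^sub>v (Suc s)" using v(1) by (metis index_vec index_zero_vec(1) w_def)
  ultimately have "lin_dep (set (cols B))" using lin_depI[OF B w] colsB xs(2) by simp
  moreover have "lin_indpt S" using subset_li_is_li[OF T'(2) S(1)] .
  ultimately show False using colsB xs(1) by simp
qed

lemma rank_less_iff_minors:
  assumes A: "A \<in> carrier_mat m n"
  shows "vec_space.rank m A < t \<longleftrightarrow> (\<forall>I J. (\<forall>a<t. I a < m \<and> J a < n) \<longrightarrow> minor (\<lambda>i j. A $$ (i, j)) t I J = 0)"
proof
  assume "vec_space.rank m A < t"
  then show "\<forall>I J. (\<forall>a<t. I a < m \<and> J a < n) \<longrightarrow> minor (\<lambda>i j. A $$ (i, j)) t I J = 0"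
    using minor_le_rank[OF A, of t] by (metis not_le)
next
  assume z: "\<forall>I J. (\<forall>a<t. I a < m \<and> J a < n) \<longrightarrow> minor (\<lambda>i j. A $$ (i, j)) t I J = 0"
  show "vec_space.rank m A < t"
  proof (rule maximal_minor[of m n "\<lambda>i j. A $$ (i, j)" t])
    fix s I J assume s: "\<And>a. a < s \<Longrightarrow> I a < m \<and> J a < n" "minor (\<lambda>i j. A $$ (i, j)) s I J \<noteq> 0" "s \<le> t"
      "s < t \<Longrightarrow> (\<And>I J. (\<And>a. a < Suc s \<Longrightarrow> I a < m \<and> J a < n) \<Longrightarrow> minor (\<lambda>i j. A $$ (i, j)) (Suc s) I J = 0)"
    have "s \<noteq> t" using z s(1,2) by blast
    then have st: "s < t" using s(3) by simp
    have "vec_space.rank m A \<le> s" by (rule rank_le_minor[OF A s(1,2) s(4)[OF st]])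
    then show "vec_space.rank m A < t" using st by simp
  qed
qed

lemma holo_det:
  assumes U: "open U" and M: "\<And>z. z \<in> U \<Longrightarrow> M z \<in> carrier_mat s s" and h: "\<And>i j. i < s \<Longrightarrow> j < s \<Longrightarrow> holo_on (\<lambda>z. M z $$ (i, j)) U"
  shows "holo_on (\<lambda>z. det (M z)) U"
proof -
  have "holo_on (\<lambda>z. \<Sum>p\<in>{p. p permutes {0..<s}}. signof p * (\<Prod>i = 0..<s. M z $$ (i, p i))) U"
  proof (intro holo_on_sum holo_on_mult holo_on_prod holo_on_const U)
    fix p i assume "p \<in> {p. p permutes {0..<s}}" "i \<in> {0..<s}"
    then show "holo_on (\<lambda>z. M z $$ (i, p i)) U" using h[of i "p i"] permutes_in_image[of p "{0..<s}" i] by simp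
  qed
  moreover have "det (M z) = (\<Sum>p\<in>{p. p permutes {0..<s}}. signof p * (\<Prod>i = 0..<s. M z $$ (i, p i)))" if "z \<in> U" for z
    using M[OF that] by (simp add: det_def)
  ultimately show ?thesis using holo_on_cong by (metis (no_types, lifting))
qed

lemma holo_det_nmat:
  assumes U: "open U" and h: "\<And>a b. a < s \<Longrightarrow> b < s \<Longrightarrow> holo_on (M a b) U"
  shows "holo_on (\<lambda>z. det (nmat s (\<lambda>a b. M a b z))) U"
  by (rule holo_det[OF U nmat_carrier]) (simp add: nmat_def h)

lemma holo_nadj:
  assumes U: "open U" and h: "\<And>a b. a < s \<Longrightarrow> b < s \<Longrightarrow> holo_on (M a b) U" and ab: "a < s" "b < s"
  shows "holo_on (\<lambda>z. nadj s (\<lambda>a b. M a b z) b a) U"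
proof -
  have "holo_on (\<lambda>z. det (mat_delete (nmat s (\<lambda>a b. M a b z)) a b)) U"
  proof (rule holo_det[OF U mat_delete_carrier[OF nmat_carrier]])
    fix i j assume ij: "i < s - 1" "j < s - 1"
    have "mat_delete (nmat s (\<lambda>a b. M a b z)) a b $$ (i, j) = M (if i < a then i else Suc i) (if j < b then j else Suc j) z" for z
      using ij ab by (auto simp: mat_delete_def nmat_def)
    then show "holo_on (\<lambda>z. mat_delete (nmat s (\<lambda>a b. M a b z)) a b $$ (i, j)) U"
      using ij h[of "if i < a then i else Suc i" "if j < b then j else Suc j"] by (auto split: if_splits)
  qed
  moreover have "nadj s (\<lambda>a b. M a b z) b a = (-1) ^ (a + b) * det (mat_delete (nmat s (\<lambda>a b. M a b z)) a b)" for z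
    using ab by (simp add: nadj_def adj_mat_def cofactor_def nmat_def)
  ultimately show ?thesis by (simp only:) (intro holo_on_mult holo_on_const U)
qed

text \<open>Index functions on all naturals are infinitely many; only their values below
  \<open>t\<close> count, so they may be restricted to extensional functions.\<close>

lemma finite_index_family:
  fixes h :: "(nat \<Rightarrow> 'a) \<Rightarrow> (nat \<Rightarrow> 'b) \<Rightarrow> 'c"
  assumes "finite A" "finite B"
    and cong: "\<And>I J I' J'. (\<And>a. a < t \<Longrightarrow> I a = I' a \<and> J a = J' a) \<Longrightarrow> h I J = h I' J'"
  shows "finite {h I J |I J. \<forall>a<t. I a \<in> A \<and> J a \<in> B}"
proof (rule finite_subset)
  let ?P = "(\<Pi>\<^sub>E a\<in>{..<t}. A) \<times> (\<Pi>\<^sub>E a\<in>{..<t}. B)"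
  show "{h I J |I J. \<forall>a<t. I a \<in> A \<and> J a \<in> B} \<subseteq> (\<lambda>(I, J). h I J) ` ?P"
  proof
    fix x assume "x \<in> {h I J |I J. \<forall>a<t. I a \<in> A \<and> J a \<in> B}"
    then obtain I J where IJ: "x = h I J" "\<forall>a<t. I a \<in> A \<and> J a \<in> B" by blast
    have "h I J = h (restrict I {..<t}) (restrict J {..<t})" by (rule cong) auto
    moreover have "(restrict I {..<t}, restrict J {..<t}) \<in> ?P" using IJ(2) by auto
    ultimately show "x \<in> (\<lambda>(I, J). h I J) ` ?P" unfolding IJ(1) by (intro image_eqI[where x="(restrict I {..<t}, restrict J {..<t})"]) simp_all
  qed
  show "finite ((\<lambda>(I, J). h I J) ` ?P)" using assms(1,2) by (intro finite_imageI finite_cartesian_product finite_PiE) auto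
qed

lemma nmat_cong: "(\<And>a b. a < s \<Longrightarrow> b < s \<Longrightarrow> M a b = M' a b) \<Longrightarrow> nmat s M = nmat s M'"
  by (rule eq_matI) auto

lemma holo_at_const: "holo_at (\<lambda>_. c) b"
  by (rule holo_atI[OF holo_on_const[OF open_UNIV]]) simp

lemma section_at_vec: "section_at m b (\<lambda>z. Matrix.vec m (\<lambda>i. \<psi> i z)) \<longleftrightarrow> (\<forall>i<m. holo_at (\<psi> i) b)"
  unfolding section_at_def by simp

lemma common_holo_nbhd:
  assumes "\<And>i. i < (n::nat) \<Longrightarrow> holo_at (h i) b"
  shows "\<exists>U. open U \<and> b \<in> U \<and> (\<forall>i<n. holo_on (h i) U)"
proof (rule finite_nbhd)
  fix i assume "i < n"
  then obtain U where "b \<in> U" "holo_on (h i) U" using assms unfolding holo_at_def by blast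
  then show "\<exists>U. open U \<and> b \<in> U \<and> holo_on (h i) U" using holo_on_open by blast
qed (rule holo_on_subset)

lemma indep_at_eventually:
  assumes "\<And>i. i < n \<Longrightarrow> holo_at (h i) b" "\<And>i. i < n \<Longrightarrow> h i b = 0" "indep_at n h b"
  shows "\<forall>\<^sub>F z in nhds b. indep_at n h z"
proof -
  have "\<exists>U. open U \<and> b \<in> U \<and> (\<forall>i<n. holo_on (h i) U)" by (rule common_holo_nbhd) (rule assms(1))
  then obtain U where U: "open U" "b \<in> U" "\<forall>i<n. holo_on (h i) U" by (elim exE conjE)
  obtain G H V W J \<sigma> where ch: "biholo G H V W" "b \<in> V" "V \<subseteq> U" "card J = n" "bij_betw \<sigma> J {..<n}"
    "\<And>z j. z \<in> V \<Longrightarrow> j \<in> J \<Longrightarrow> G z $ j = h (\<sigma> j) z" "G b = 0"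
    by (rule straightening[of n h U b]) (use U assms in auto)
  show ?thesis
    unfolding eventually_nhds
  proof (intro exI[of _ V] conjI ballI)
    show "indep_at n h z" if "z \<in> V" for z by (rule chart_indep[OF ch(1,5,6) that])
  qed (rule biholoD(1)[OF ch(1)] ch(2))+
qed

section \<open>Codimension at a point\<close>

lemma codim_at_le:
  assumes "codim_at A x \<ge> enat m" "x \<in> closure {z. regular_point A c z}"
  shows "m \<le> c"
proof -
  have "codim_at A x \<le> enat c" unfolding codim_at_def using assms(2) by (intro Inf_lower) blast
  then show ?thesis using assms(1) by (meson enat_ord_simps(1) order_trans)
qed

text \<open>A nonempty set of extended naturals attains its infimum, and the empty set has infinite
  infimum.\<close>

lemma codim_at_attained:
  assumes "codim_at A x = enat c"
  shows "x \<in> closure {z. regular_point A c z}"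
proof -
  let ?S = "{enat c |c. x \<in> closure {z. regular_point A c z}}"
  have "?S \<noteq> {}"
  proof
    assume "?S = {}"
    then have "codim_at A x = Inf {}" unfolding codim_at_def by (rule arg_cong)
    then show False using assms by (simp add: Inf_enat_def)
  qed
  then obtain a where "a \<in> ?S" by blast
  then have "(LEAST x. x \<in> ?S) \<in> ?S" by (rule LeastI)
  then have "Inf ?S \<in> ?S" unfolding Inf_enat_def using \<open>?S \<noteq> {}\<close> by (simp only: if_False)
  then show ?thesis using assms unfolding codim_at_def by auto
qed

text \<open>The form in which the codimension hypotheses are used: small codimensions are excluded
  on a whole neighbourhood and not only at \<open>x\<close>.\<close>

lemma codim_at_nbhd:
  assumes "codim_at A x \<ge> enat m"
  shows "\<exists>V. open V \<and> x \<in> V \<and> (\<forall>c<m. \<forall>z\<in>V. \<not> regular_point A c z)"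
proof (rule finite_nbhd)
  fix c assume "c < m"
  then have "x \<notin> closure {z. regular_point A c z}" using codim_at_le[OF assms, of c] by auto
  then show "\<exists>V. open V \<and> x \<in> V \<and> (\<forall>z\<in>V. \<not> regular_point A c z)"
  proof (intro exI[of _ "- closure {z. regular_point A c z}"] conjI ballI)
    show "\<not> regular_point A c z" if "z \<in> - closure {z. regular_point A c z}" for z
      using that subsetD[OF closure_subset, of z "{z. regular_point A c z}"] by auto
  qed (auto intro: open_Compl)
qed blast

subsection \<open>Singular sets of a resolved variety\<close>

locale resolved_variety =
  fixes \<Omega> Z :: "(complex^'n) set" and p N :: nat and r :: "nat \<Rightarrow> nat"
    and f :: "nat \<Rightarrow> complex^'n \<Rightarrow> complex mat"
  assumes open_Omega: "open \<Omega>" and variety: "analytic_variety_in \<Omega> Z" and pure: "pure_codim Z p"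
    and resolution: "free_resolution \<Omega> Z N r f"
begin

definition "ent k i j z = f (Suc k) z $$ (i, j)"

lemma rank_0: "r 0 = 1" and rank_gt: "k > N \<Longrightarrow> r k = 0"
  and f_carrier: "z \<in> \<Omega> \<Longrightarrow> f (Suc k) z \<in> carrier_mat (r k) (r (Suc k))"
  and ent_holo: "i < r k \<Longrightarrow> j < r (Suc k) \<Longrightarrow> holo_on (ent k i j) \<Omega>"
  and stalk_im_1: "b \<in> \<Omega> \<Longrightarrow> stalk_im 1 (r 1) (f 1) b = {\<phi>. section_at 1 b \<phi> \<and> (\<lambda>z. vec_index (\<phi> z) 0) \<in> ideal_at Z b}"
  and stalk_exact: "b \<in> \<Omega> \<Longrightarrow> stalk_ker (r k) (r (Suc k)) (f (Suc k)) b = stalk_im (r (Suc k)) (r (Suc (Suc k))) (f (Suc (Suc k))) b"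
proof -
  note R = resolution[unfolded free_resolution_def]
  show "r 0 = 1" using R by blast
  show "r k = 0" if "k > N" using R that by blast
  show "f (Suc k) z \<in> carrier_mat (r k) (r (Suc k))" if "z \<in> \<Omega>"
    using R[THEN conjunct2, THEN conjunct2, THEN conjunct1, THEN spec[of _ "Suc k"]] that by simp
  show "holo_on (ent k i j) \<Omega>" if "i < r k" "j < r (Suc k)"
    using R[THEN conjunct2, THEN conjunct2, THEN conjunct1, THEN spec[of _ "Suc k"]] that by (simp add: ent_def[abs_def])
  note S = R[THEN conjunct2, THEN conjunct2, THEN conjunct2]
  show "stalk_im 1 (r 1) (f 1) b = {\<phi>. section_at 1 b \<phi> \<and> (\<lambda>z. vec_index (\<phi> z) 0) \<in> ideal_at Z b}" if "b \<in> \<Omega>"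
    using S that by blast
  show "stalk_ker (r k) (r (Suc k)) (f (Suc k)) b = stalk_im (r (Suc k)) (r (Suc (Suc k))) (f (Suc (Suc k))) b" if "b \<in> \<Omega>"
    using S[THEN bspec, OF that, THEN conjunct2, THEN spec[of _ "Suc k"]] by simp
qed

lemma eventually_Omega: "b \<in> \<Omega> \<Longrightarrow> \<forall>\<^sub>F z in nhds b. z \<in> \<Omega>"
  using open_Omega eventually_nhds by blast

lemma f_mult: "z \<in> \<Omega> \<Longrightarrow> v \<in> carrier_vec (r (Suc k)) \<Longrightarrow> i < r k \<Longrightarrow>
   vec_index (f (Suc k) z *\<^sub>v v) i = (\<Sum>j<r (Suc k). ent k i j z * vec_index v j)"
  unfolding ent_def by (rule mult_mat_vec_index[OF f_carrier])

lemma stalk_im_iff: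
  assumes b: "b \<in> \<Omega>"
  shows "(\<lambda>z. Matrix.vec (r k) (\<lambda>i. \<psi> i z)) \<in> stalk_im (r k) (r (Suc k)) (f (Suc k)) b \<longleftrightarrow>
    (\<forall>i<r k. holo_at (\<psi> i) b) \<and> (\<exists>\<eta>. (\<forall>j<r (Suc k). holo_at (\<eta> j) b) \<and>
      (\<forall>\<^sub>F z in nhds b. \<forall>i<r k. \<psi> i z = (\<Sum>j<r (Suc k). ent k i j z * \<eta> j z)))"
    (is "?l \<longleftrightarrow> _ \<and> ?r")
proof -
  have "?l \<longleftrightarrow> (\<forall>i<r k. holo_at (\<psi> i) b) \<and> (\<exists>\<Psi>. section_at (r (Suc k)) b \<Psi> \<and>
      (\<forall>\<^sub>F z in nhds b. Matrix.vec (r k) (\<lambda>i. \<psi> i z) = f (Suc k) z *\<^sub>v \<Psi> z))" (is "_ \<longleftrightarrow> _ \<and> ?r'")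
    by (simp add: stalk_im_def section_at_vec)
  moreover have "?r' \<longleftrightarrow> ?r"
  proof
    assume ?r'
    then obtain \<Psi> where \<Psi>: "section_at (r (Suc k)) b \<Psi>" "\<forall>\<^sub>F z in nhds b. Matrix.vec (r k) (\<lambda>i. \<psi> i z) = f (Suc k) z *\<^sub>v \<Psi> z" by blast
    have c: "\<forall>\<^sub>F z in nhds b. \<Psi> z \<in> carrier_vec (r (Suc k))" using \<Psi>(1) by (simp add: section_at_def)
    have "\<forall>\<^sub>F z in nhds b. \<forall>i<r k. \<psi> i z = (\<Sum>j<r (Suc k). ent k i j z * vec_index (\<Psi> z) j)"
      using \<Psi>(2) c eventually_Omega[OF b]
    proof eventually_elim
      case (elim z)
      show ?case
      proof (intro allI impI)
        fix i assume i: "i < r k"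
        have "\<psi> i z = vec_index (f (Suc k) z *\<^sub>v \<Psi> z) i" using i by (simp flip: elim(1))
        then show "\<psi> i z = (\<Sum>j<r (Suc k). ent k i j z * vec_index (\<Psi> z) j)" using f_mult[OF elim(3,2) i] by simp
      qed
    qed
    moreover have "\<forall>j<r (Suc k). holo_at (\<lambda>z. vec_index (\<Psi> z) j) b" using \<Psi>(1) by (simp add: section_at_def)
    ultimately show ?r by (intro exI[of _ "\<lambda>j z. vec_index (\<Psi> z) j"] conjI)
  next
    assume ?r
    then obtain \<eta> where \<eta>: "\<forall>j<r (Suc k). holo_at (\<eta> j) b"
      "\<forall>\<^sub>F z in nhds b. \<forall>i<r k. \<psi> i z = (\<Sum>j<r (Suc k). ent k i j z * \<eta> j z)" by blast
    have "\<forall>\<^sub>F z in nhds b. Matrix.vec (r k) (\<lambda>i. \<psi> i z) = f (Suc k) z *\<^sub>v Matrix.vec (r (Suc k)) (\<lambda>j. \<eta> j z)"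
      using \<eta>(2) eventually_Omega[OF b]
    proof eventually_elim
      case (elim z)
      show ?case
      proof (rule eq_vecI)
        show "dim_vec (Matrix.vec (r k) (\<lambda>i. \<psi> i z)) = dim_vec (f (Suc k) z *\<^sub>v Matrix.vec (r (Suc k)) (\<lambda>j. \<eta> j z))"
          using f_carrier[OF elim(2), of k] by simp
        fix i assume "i < dim_vec (f (Suc k) z *\<^sub>v Matrix.vec (r (Suc k)) (\<lambda>j. \<eta> j z))"
        then have i: "i < r k" using f_carrier[OF elim(2), of k] by simp
        have "vec_index (f (Suc k) z *\<^sub>v Matrix.vec (r (Suc k)) (\<lambda>j. \<eta> j z)) i = (\<Sum>j<r (Suc k). ent k i j z * \<eta> j z)"
          using f_mult[OF elim(2) vec_carrier i] by simp
        then show "vec_index (Matrix.vec (r k) (\<lambda>i. \<psi> i z)) i = vec_index (f (Suc k) z *\<^sub>v Matrix.vec (r (Suc k)) (\<lambda>j. \<eta> j z)) i"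
          using elim(1) i by simp
      qed
    qed
    then show ?r' using \<eta>(1) by (intro exI[of _ "\<lambda>z. Matrix.vec (r (Suc k)) (\<lambda>j. \<eta> j z)"]) (simp add: section_at_vec)
  qed
  ultimately show ?thesis by blast
qed

lemma stalk_ker_iff:
  assumes b: "b \<in> \<Omega>"
  shows "(\<lambda>z. Matrix.vec (r (Suc k)) (\<lambda>i. \<psi> i z)) \<in> stalk_ker (r k) (r (Suc k)) (f (Suc k)) b \<longleftrightarrow>
    (\<forall>i<r (Suc k). holo_at (\<psi> i) b) \<and> (\<forall>\<^sub>F z in nhds b. \<forall>i<r k. (\<Sum>j<r (Suc k). ent k i j z * \<psi> j z) = 0)"
proof -
  have "f (Suc k) z *\<^sub>v Matrix.vec (r (Suc k)) (\<lambda>i. \<psi> i z) = 0\<^sub>v (r k) \<longleftrightarrow> (\<forall>i<r k. (\<Sum>j<r (Suc k). ent k i j z * \<psi> j z) = 0)"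
    if z: "z \<in> \<Omega>" for z
  proof -
    have "f (Suc k) z *\<^sub>v Matrix.vec (r (Suc k)) (\<lambda>i. \<psi> i z) = 0\<^sub>v (r k) \<longleftrightarrow>
       (\<forall>i<r k. vec_index (f (Suc k) z *\<^sub>v Matrix.vec (r (Suc k)) (\<lambda>i. \<psi> i z)) i = 0)"
      using f_carrier[OF z, of k] by (auto simp: Matrix.vec_eq_iff simp del: index_mult_mat_vec)
    moreover have "vec_index (f (Suc k) z *\<^sub>v Matrix.vec (r (Suc k)) (\<lambda>i. \<psi> i z)) i = (\<Sum>j<r (Suc k). ent k i j z * \<psi> j z)" if "i < r k" for i
      using f_mult[OF z vec_carrier that] by simp
    ultimately show ?thesis by simp
  qed
  then have "(\<forall>\<^sub>F z in nhds b. f (Suc k) z *\<^sub>v Matrix.vec (r (Suc k)) (\<lambda>i. \<psi> i z) = 0\<^sub>v (r k)) \<longleftrightarrow>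
      (\<forall>\<^sub>F z in nhds b. \<forall>i<r k. (\<Sum>j<r (Suc k). ent k i j z * \<psi> j z) = 0)"
    by (intro eventually_cong[OF eventually_Omega[OF b]])
  then show ?thesis by (simp add: stalk_ker_def section_at_vec)
qed

sublocale free_complex ent r \<Omega> N
proof
  fix k i l z assume z: "z \<in> \<Omega>" "i < r k" "l < r (Suc (Suc k))"
  \<comment> \<open>A unit vector, whose image is the l-th column of the matrix; exactness places
    this column in the kernel.\<close>
  define \<eta> :: "nat \<Rightarrow> complex^'n \<Rightarrow> complex" where "\<eta> m y = (if m = l then 1 else 0)" for m y
  have h: "holo_at (\<eta> m) z" for m
    by (simp only: \<eta>_def[abs_def] holo_at_const)
  have e: "(\<Sum>m<r (Suc (Suc k)). ent (Suc k) j m y * \<eta> m y) = ent (Suc k) j l y" for j y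
    using z(3) by (simp add: \<eta>_def if_distrib[of "\<lambda>x. _ * x"] cong: if_cong)
  have "(\<lambda>y. Matrix.vec (r (Suc k)) (\<lambda>j. ent (Suc k) j l y)) \<in> stalk_im (r (Suc k)) (r (Suc (Suc k))) (f (Suc (Suc k))) z"
    unfolding stalk_im_iff[OF z(1)] using h e z holo_atI[OF ent_holo] by (intro conjI allI impI exI[of _ \<eta>]) auto
  then have "(\<lambda>y. Matrix.vec (r (Suc k)) (\<lambda>j. ent (Suc k) j l y)) \<in> stalk_ker (r k) (r (Suc k)) (f (Suc k)) z"
    using stalk_exact[OF z(1)] by simp
  then have "\<forall>\<^sub>F y in nhds z. \<forall>i<r k. (\<Sum>j<r (Suc k). ent k i j y * ent (Suc k) j l y) = 0"
    unfolding stalk_ker_iff[OF z(1)] by blast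
  then show "(\<Sum>j<r (Suc k). ent k i j z * ent (Suc k) j l z) = 0" using z(2) by (auto dest: eventually_nhds_x_imp_x)
next
  fix k \<psi> b assume b: "b \<in> \<Omega>" "\<forall>j<r (Suc k). holo_at (\<psi> j) b"
    "\<forall>\<^sub>F z in nhds b. \<forall>i<r k. (\<Sum>j<r (Suc k). ent k i j z * \<psi> j z) = 0"
  have "(\<lambda>z. Matrix.vec (r (Suc k)) (\<lambda>i. \<psi> i z)) \<in> stalk_im (r (Suc k)) (r (Suc (Suc k))) (f (Suc (Suc k))) b"
    unfolding stalk_exact[OF b(1), symmetric] stalk_ker_iff[OF b(1)] using b by blast
  then show "\<exists>\<eta>. (\<forall>l<r (Suc (Suc k)). holo_at (\<eta> l) b) \<and>
         (\<forall>\<^sub>F z in nhds b. \<forall>j<r (Suc k). \<psi> j z = (\<Sum>l<r (Suc (Suc k)). ent (Suc k) j l z * \<eta> l z))"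
    unfolding stalk_im_iff[OF b(1)] by blast
qed (use open_Omega ent_holo rank_gt in auto)

lemma ideal_iff_img:
  assumes b: "b \<in> \<Omega>"
  shows "h \<in> ideal_at Z b \<longleftrightarrow> holo_at h b \<and> img 0 (\<lambda>i. h) b"
proof -
  have "h \<in> ideal_at Z b \<longleftrightarrow> (\<lambda>z. Matrix.vec (r 0) (\<lambda>i. h z)) \<in> stalk_im (r 0) (r (Suc 0)) (f (Suc 0)) b"
    using stalk_im_1[OF b] rank_0 section_at_vec[of 1 b "\<lambda>_. h"] by (auto simp: ideal_at_def)
  also have "\<dots> \<longleftrightarrow> holo_at h b \<and> img 0 (\<lambda>i. h) b"
    unfolding stalk_im_iff[OF b] img_def sec_def eqg_def app_def using rank_0 by simp
  finally show ?thesis .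
qed

lemma ideal_expand:
  assumes "b \<in> \<Omega>" "h \<in> ideal_at Z b"
  shows "\<exists>\<eta>. (\<forall>j<r 1. holo_at (\<eta> j) b) \<and> (\<forall>\<^sub>F z in nhds b. h z = (\<Sum>j<r 1. ent 0 0 j z * \<eta> j z))"
  using assms(2) rank_0 unfolding ideal_iff_img[OF assms(1)] img_def sec_def eqg_def app_def by simp

lemma gen_in_ideal:
  assumes b: "b \<in> \<Omega>" and j: "j < r 1"
  shows "ent 0 0 j \<in> ideal_at Z b"
  unfolding ideal_iff_img[OF b]
proof
  show "holo_at (ent 0 0 j) b" using holo_atI[OF ent_holo b] j rank_0 by simp
  define \<eta> :: "nat \<Rightarrow> complex^'n \<Rightarrow> complex" where "\<eta> m y = (if m = j then 1 else 0)" for m y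
  have "sec (Suc 0) \<eta> b"
    by (simp only: \<eta>_def[abs_def] sec_def holo_at_const simp_thms)
  moreover have "app 0 \<eta> 0 z = ent 0 0 j z" for z
    using j by (simp add: app_def \<eta>_def if_distrib[of "\<lambda>x. _ * x"] cong: if_cong)
  ultimately show "img 0 (\<lambda>i. ent 0 0 j) b"
    unfolding img_def eqg_def using rank_0 by (intro exI[of _ \<eta>]) simp
qed

lemma Z_subset: "Z \<subseteq> \<Omega>"
  using variety by (simp add: analytic_variety_in_def)

lemma eventually_not_Z:
  assumes "z \<in> \<Omega>" "z \<notin> Z"
  shows "\<forall>\<^sub>F y in nhds z. y \<notin> Z"
proof -
  obtain U F where U: "z \<in> U" "open U" "\<forall>g\<in>F. holo_on g U" "Z \<inter> U = {z\<in>U. \<forall>g\<in>F. g z = 0}"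
    using variety assms(1) unfolding analytic_variety_in_def by blast
  then obtain g where g: "g \<in> F" "g z \<noteq> 0" using assms(2) by blast
  have "continuous_on U g" using holo_on_continuous U(3) g(1) by blast
  then have "open (U \<inter> g -` (- {0}))" using U(2) by (rule continuous_open_preimage) (rule open_Compl, rule closed_singleton)
  then show ?thesis unfolding eventually_nhds using U g by (intro exI[of _ "U \<inter> g -` (- {0})"]) auto
qed

lemma gen_zero: "z \<in> Z \<Longrightarrow> j < r 1 \<Longrightarrow> ent 0 0 j z = 0"
  using gen_in_ideal[of z j] Z_subset by (auto simp: ideal_at_def dest: eventually_nhds_x_imp_x)

text \<open>Off \<open>Z\<close> the germ 1 lies in the ideal, so the generators cannot all vanish
  there.\<close>

lemma Z_eq: "Z = {z\<in>\<Omega>. \<forall>j<r 1. ent 0 0 j z = 0}"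
proof
  show "Z \<subseteq> {z\<in>\<Omega>. \<forall>j<r 1. ent 0 0 j z = 0}" using Z_subset gen_zero by blast
  show "{z\<in>\<Omega>. \<forall>j<r 1. ent 0 0 j z = 0} \<subseteq> Z"
  proof
    fix z assume z: "z \<in> {z\<in>\<Omega>. \<forall>j<r 1. ent 0 0 j z = 0}"
    show "z \<in> Z"
    proof (rule ccontr)
      assume n: "z \<notin> Z"
      have "(\<lambda>_. 1) \<in> ideal_at Z z"
        using eventually_not_Z[OF _ n] z by (auto simp: ideal_at_def holo_at_const elim: eventually_mono)
      then obtain \<eta> where "\<forall>\<^sub>F y in nhds z. 1 = (\<Sum>j<r 1. ent 0 0 j y * \<eta> j y)" using ideal_expand z by blast
      then have "1 = (\<Sum>j<r 1. ent 0 0 j z * \<eta> j z)" by (rule eventually_nhds_x_imp_x)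
      then show False using z by simp
    qed
  qed
qed

lemma regular_dense:
  assumes "z \<in> Z" "open V" "z \<in> V"
  shows "\<exists>y\<in>V. regular_point Z p y"
proof -
  have "codim_at Z z = enat p" using pure assms(1) by (simp add: pure_codim_def)
  then have "z \<in> closure {z. regular_point Z p z}" by (rule codim_at_attained)
  then show ?thesis using assms(2,3) unfolding closure_iff_nhds_not_empty by blast
qed

text \<open>Independence persists at nearby points, and purity puts regular points of codimension
  \<open>p\<close> arbitrarily close, where \<open>regular_rank_bound\<close> applies.\<close>

lemma ideal_rank_bound:
  assumes z: "z \<in> Z" and h: "\<And>i. i < k \<Longrightarrow> h i \<in> ideal_at Z z" and ind: "indep_at k h z"
  shows "k \<le> p"
proof -
  have "\<forall>i\<in>{..<k}. \<forall>\<^sub>F y in nhds z. holo_at (h i) y \<and> (\<forall>\<^sub>F x in nhds y. x \<in> Z \<longrightarrow> h i x = 0)"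
  proof
    fix i assume "i \<in> {..<k}"
    then have "h i \<in> ideal_at Z z" using h by simp
    then show "\<forall>\<^sub>F y in nhds z. holo_at (h i) y \<and> (\<forall>\<^sub>F x in nhds y. x \<in> Z \<longrightarrow> h i x = 0)"
      using holo_at_eventually by (auto simp: ideal_at_def eventually_eventually intro!: eventually_conj)
  qed
  then have "\<forall>\<^sub>F y in nhds z. \<forall>i\<in>{..<k}. h i \<in> ideal_at Z y"
    by (intro eventually_ball_finite) (auto simp: ideal_at_def)
  moreover have "\<forall>\<^sub>F y in nhds z. indep_at k h y"
    using h z ind by (intro indep_at_eventually) (auto simp: ideal_at_def dest: eventually_nhds_x_imp_x)
  ultimately have "\<forall>\<^sub>F y in nhds z. (\<forall>i\<in>{..<k}. h i \<in> ideal_at Z y) \<and> indep_at k h y" by eventually_elim blast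
  then obtain V where V: "open V" "z \<in> V" "\<And>y. y \<in> V \<Longrightarrow> (\<forall>i\<in>{..<k}. h i \<in> ideal_at Z y) \<and> indep_at k h y"
    unfolding eventually_nhds by blast
  obtain y where "y \<in> V" "regular_point Z p y" using regular_dense[OF z V(1,2)] by blast
  then show ?thesis using regular_rank_bound[of Z p y k h] V(3) by blast
qed

lemma regular_point_ideal:
  assumes "regular_point Z c y"
  obtains h where "\<And>i. i < c \<Longrightarrow> h i \<in> ideal_at Z y" "indep_at c h y"
proof -
  obtain U g where U: "y \<in> Z" "y \<in> U" "open U" "\<forall>i<c. holo_on (g i) U"
     "Z \<inter> U = {z\<in>U. \<forall>i<c. g i z = 0}" "indep_at c g y" using assms unfolding regular_point_iff by blast
  show ?thesis
    by (rule that[OF ideal_atI U(6)]) (use U in blast)+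
qed

lemma regular_codim:
  assumes "regular_point Z c z"
  shows "c = p"
proof (rule antisym)
  have z: "z \<in> Z" using assms by (simp add: regular_point_def)
  show "c \<le> p"
    by (rule regular_point_ideal[OF assms]) (rule ideal_rank_bound[OF z])
  have "codim_at Z z \<ge> enat p" using pure z by (simp add: pure_codim_def)
  then show "p \<le> c" by (rule codim_at_le) (rule subsetD[OF closure_subset], simp add: assms)
qed

lemma reg_part_eq: "reg_part Z = {z. regular_point Z p z}"
  unfolding reg_part_def using regular_codim by blast

text \<open>More than \<open>p\<close> germs of \<open>\<I>\<^sub>Z\<close> never have independent differentials, so \<open>hull_core\<close> applies with \<open>B = Z\<close>.\<close>

lemma jacobian_regular:
  assumes b: "b \<in> Z" and h: "\<And>i. i < p \<Longrightarrow> h i \<in> ideal_at Z b" and ind: "indep_at p h b"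
  shows "regular_point Z p b"
proof -
  have hh: "holo_at (h i) b" "\<forall>\<^sub>F z in nhds b. z \<in> Z \<longrightarrow> h i z = 0" if "i < p" for i
    using h[OF that] by (auto simp: ideal_at_def)
  have "\<exists>U1. open U1 \<and> b \<in> U1 \<and> (\<forall>i<p. holo_on (h i) U1)" by (rule common_holo_nbhd) (rule hh(1))
  then obtain U1 where U1: "open U1" "b \<in> U1" "\<forall>i<p. holo_on (h i) U1" by (elim exE conjE)
  have "\<forall>\<^sub>F z in nhds b. \<forall>i\<in>{..<p}. z \<in> Z \<longrightarrow> h i z = 0" using hh(2) by (intro eventually_ball_finite) auto
  then obtain U2 where U2: "open U2" "b \<in> U2" "\<And>z. z \<in> U2 \<Longrightarrow> \<forall>i\<in>{..<p}. z \<in> Z \<longrightarrow> h i z = 0"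
    unfolding eventually_nhds by blast
  define U where "U = U1 \<inter> U2"
  have U: "open U" "b \<in> U" using U1 U2 by (auto simp: U_def)
  have hol: "\<And>i. i < p \<Longrightarrow> holo_on (h i) U" using U1(3) holo_on_subset[OF _ U(1)] by (auto simp: U_def)
  have van: "\<And>i y. i < p \<Longrightarrow> y \<in> Z \<Longrightarrow> y \<in> U \<Longrightarrow> h i y = 0" using U2(3) by (auto simp: U_def)
  have mx: "\<not> indep_at (Suc p) q y" if "y \<in> Z" "y \<in> U" "\<And>i. i < Suc p \<Longrightarrow> q i \<in> ideal_at Z y" for y q
    using ideal_rank_bound[of y "Suc p" q] that by auto
  have "\<forall>j\<in>{..<r 1}. \<forall>\<^sub>F z in nhds b. (\<forall>i<p. h i z = 0) \<longrightarrow> ent 0 0 j z = 0"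
    using hull_core[OF b U hol van ind mx] gen_in_ideal b Z_subset by blast
  then have "\<forall>\<^sub>F z in nhds b. \<forall>j\<in>{..<r 1}. (\<forall>i<p. h i z = 0) \<longrightarrow> ent 0 0 j z = 0"
    by (intro eventually_ball_finite) auto
  then obtain V where V: "open V" "b \<in> V" "\<And>z. z \<in> V \<Longrightarrow> \<forall>j\<in>{..<r 1}. (\<forall>i<p. h i z = 0) \<longrightarrow> ent 0 0 j z = 0"
    unfolding eventually_nhds by blast
  define W where "W = U \<inter> V \<inter> \<Omega>"
  have W: "open W" "b \<in> W" using U V open_Omega b Z_subset by (auto simp: W_def)
  have eq: "Z \<inter> W = {z\<in>W. \<forall>i<p. h i z = 0}"
  proof (intro Set.set_eqI iffI)
    fix z assume "z \<in> Z \<inter> W"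
    then show "z \<in> {z\<in>W. \<forall>i<p. h i z = 0}" using van by (auto simp: W_def)
  next
    fix z assume z: "z \<in> {z\<in>W. \<forall>i<p. h i z = 0}"
    then have "\<forall>j<r 1. ent 0 0 j z = 0" using V(3)[of z] by (auto simp: W_def)
    then show "z \<in> Z \<inter> W" using z by (subst Z_eq) (auto simp: W_def)
  qed
  have "\<forall>i<p. holo_on (h i) W" using hol holo_on_subset[OF _ W(1)] by (auto simp: W_def)
  then show ?thesis unfolding regular_point_iff using b W eq ind by blast
qed

definition "jac \<sigma> \<tau> z = det (nmat p (\<lambda>a b. pd (\<tau> b) (ent 0 0 (\<sigma> a)) z))"

lemma jac_neq_0_regular:
  assumes z: "z \<in> Z" and \<sigma>: "\<And>a. a < p \<Longrightarrow> \<sigma> a < r 1" and j: "jac \<sigma> \<tau> z \<noteq> 0"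
  shows "regular_point Z p z"
proof (rule jacobian_regular[OF z])
  show "ent 0 0 (\<sigma> i) \<in> ideal_at Z z" if "i < p" for i using gen_in_ideal \<sigma>[OF that] z Z_subset by blast
  show "indep_at p (\<lambda>i. ent 0 0 (\<sigma> i)) z"
    unfolding indep_at_def
  proof (intro allI impI)
    fix \<beta> i assume s: "\<forall>l. (\<Sum>i<p. \<beta> i * pd l (ent 0 0 (\<sigma> i)) z) = 0" and i: "i < p"
    show "\<beta> i = 0" by (rule det_nmat_neq_0_D[where w=\<beta>, OF j[unfolded jac_def] _ i]) (rule s[rule_format])
  qed
qed

text \<open>The local equations are combinations of the generators. On \<open>Z\<close> the
  generators vanish, so by the product rule the differentials are combinations with the same
  coefficients. If all minors of size \<open>p\<close> vanished, the Jacobian would factor through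
  fewer than \<open>p\<close> columns, and the \<open>p\<close> differentials would be
  dependent.\<close>

lemma regular_jac_neq_0:
  assumes "regular_point Z p z"
  shows "\<exists>\<sigma> \<tau>. (\<forall>a<p. \<sigma> a < r 1) \<and> jac \<sigma> \<tau> z \<noteq> 0"
proof -
  have z: "z \<in> Z" "z \<in> \<Omega>" using assms Z_subset by (auto simp: regular_point_def)
  obtain h where h: "\<And>i. i < p \<Longrightarrow> h i \<in> ideal_at Z z" "indep_at p h z" by (rule regular_point_ideal[OF assms]) blast
  have "\<forall>i. \<exists>\<eta>. i < p \<longrightarrow> (\<forall>j<r 1. holo_at (\<eta> j) z) \<and> (\<forall>\<^sub>F y in nhds z. h i y = (\<Sum>j<r 1. ent 0 0 j y * \<eta> j y))"
  proof
    fix i show "\<exists>\<eta>. i < p \<longrightarrow> (\<forall>j<r 1. holo_at (\<eta> j) z) \<and> (\<forall>\<^sub>F y in nhds z. h i y = (\<Sum>j<r 1. ent 0 0 j y * \<eta> j y))"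
      using ideal_expand[OF z(2) h(1)[of i]] by (cases "i < p") simp_all
  qed
  from choice[OF this] obtain \<eta> where \<eta>: "\<forall>i. i < p \<longrightarrow> (\<forall>j<r 1. holo_at (\<eta> i j) z) \<and>
      (\<forall>\<^sub>F y in nhds z. h i y = (\<Sum>j<r 1. ent 0 0 j y * \<eta> i j y))" by (rule exE)
  have pdh: "pd l (h i) z = (\<Sum>j<r 1. \<eta> i j z * pd l (ent 0 0 j) z)" if i: "i < p" for i l
  proof -
    have \<eta>i: "\<And>j. j < r 1 \<Longrightarrow> holo_at (\<eta> i j) z" "\<forall>\<^sub>F y in nhds z. h i y = (\<Sum>j<r 1. ent 0 0 j y * \<eta> i j y)"
      using \<eta> i by blast+
    have "\<exists>U. open U \<and> z \<in> U \<and> (\<forall>j<r 1. holo_on (\<eta> i j) U)" by (rule common_holo_nbhd) (rule \<eta>i(1))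
    then obtain U where U: "open U" "z \<in> U" "\<forall>j<r 1. holo_on (\<eta> i j) U" by (elim exE conjE)
    define V where "V = U \<inter> \<Omega>"
    have V: "open V" "z \<in> V" using U z open_Omega by (auto simp: V_def)
    have hV: "holo_on (ent 0 0 j) V" "holo_on (\<eta> i j) V" if "j < r 1" for j
      using holo_on_subset[OF _ V(1)] ent_holo[of 0 0 j] U(3) that rank_0 by (auto simp: V_def)
    have "pd l (h i) z = pd l (\<lambda>y. \<Sum>j<r 1. ent 0 0 j y * \<eta> i j y) z"
      by (rule pd_cong_nhds[OF _ \<eta>i(2)]) (use h(1)[OF i] in \<open>simp add: ideal_at_def\<close>)
    also have "\<dots> = (\<Sum>j<r 1. pd l (\<lambda>y. ent 0 0 j y * \<eta> i j y) z)"
      by (rule pd_sum[OF _ V(1) _ V(2)]) (auto intro!: holo_on_mult hV)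
    also have "\<dots> = (\<Sum>j<r 1. \<eta> i j z * pd l (ent 0 0 j) z)"
      by (intro sum.cong refl) (simp add: pd_mult[OF hV V(2)] gen_zero[OF z(1)])
    finally show ?thesis .
  qed
  obtain e :: "nat \<Rightarrow> 'n" where e: "bij_betw e {..<CARD('n)} UNIV"
    using ex_bij_betw_nat_finite[of "UNIV :: 'n set"] by (auto simp: lessThan_atLeast0)
  define M where "M j l = pd (e l) (ent 0 0 j) z" for j l
  show ?thesis
  proof (rule maximal_minor[of "r 1" "CARD('n)" M p])
    fix s I J assume s: "\<And>a. a < s \<Longrightarrow> I a < r 1 \<and> J a < CARD('n)" "minor M s I J \<noteq> 0" "s \<le> p"
      "s < p \<Longrightarrow> (\<And>I J. (\<And>a. a < Suc s \<Longrightarrow> I a < r 1 \<and> J a < CARD('n)) \<Longrightarrow> minor M (Suc s) I J = 0)"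
    have "s = p"
    proof (rule ccontr)
      assume "s \<noteq> p"
      then have sp: "s < p" using s(3) by simp
      define E where "E b l = (\<Sum>a<s. nadj s (\<lambda>a b. M (I a) (J b)) b a * M (I a) l) / minor M s I J" for b l
      have fac: "M j l = (\<Sum>b<s. M j (J b) * E b l)" if "j < r 1" "l < CARD('n)" for j l
      proof -
        have "minor M (Suc s) (I(s := j)) (J(s := l)) = 0"
          by (rule s(4)[OF sp]) (use s(1) that in \<open>auto simp: less_Suc_eq\<close>)
        from minor_factor[OF s(2) this] show ?thesis
          by (simp only: E_def times_divide_eq_right sum_divide_distrib[symmetric])
      qed
      obtain \<beta> :: "nat \<Rightarrow> complex" where \<beta>: "\<exists>i<p. \<beta> i \<noteq> 0" "\<And>b. b < s \<Longrightarrow> (\<Sum>i<p. (\<Sum>j<r 1. \<eta> i j z * M j (J b)) * \<beta> i) = 0"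
        using wide_kernel[OF sp, of "\<lambda>b i. \<Sum>j<r 1. \<eta> i j z * M j (J b)"] by blast
      have "(\<Sum>i<p. \<beta> i * pd l (h i) z) = 0" for l
      proof -
        obtain m where m: "m < CARD('n)" "e m = l" using e unfolding bij_betw_def by (metis UNIV_I imageE lessThan_iff)
        have pm: "pd l (h i) z = (\<Sum>b<s. (\<Sum>j<r 1. \<eta> i j z * M j (J b)) * E b m)" if "i < p" for i
        proof -
          have "pd l (h i) z = (\<Sum>j<r 1. \<eta> i j z * (\<Sum>b<s. M j (J b) * E b m))"
            unfolding pdh[OF that] using fac[OF _ m(1)] m(2) by (intro sum.cong refl) (simp add: M_def)
          also have "\<dots> = (\<Sum>b<s. (\<Sum>j<r 1. \<eta> i j z * M j (J b)) * E b m)"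
            unfolding sum_distrib_left sum_distrib_right by (subst sum.swap) (simp add: mult.assoc)
          finally show ?thesis .
        qed
        have "(\<Sum>i<p. \<beta> i * pd l (h i) z) = (\<Sum>i<p. \<beta> i * (\<Sum>b<s. (\<Sum>j<r 1. \<eta> i j z * M j (J b)) * E b m))"
          using pm by (intro sum.cong refl) simp
        also have "\<dots> = (\<Sum>b<s. E b m * (\<Sum>i<p. (\<Sum>j<r 1. \<eta> i j z * M j (J b)) * \<beta> i))"
          unfolding sum_distrib_left[of "\<beta> _"] sum_distrib_left[of "E _ _"] by (subst sum.swap) (simp add: mult_ac)
        also have "\<dots> = 0" using \<beta>(2) by simp
        finally show ?thesis .
      qed
      then show False using h(2) \<beta>(1) unfolding indep_at_def by blast
    qed
    then have "jac I (\<lambda>b. e (J b)) z \<noteq> 0" using s(2) by (simp add: jac_def M_def)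
    then show ?thesis using s(1) \<open>s = p\<close> by blast
  qed
qed

text \<open>The Jacobian criterion, with finitely many equations on all of \<Omega>. An explicit
  description by functions is what lets containment in the singular set pass from \<open>B\<close>
  to the manifold that replaces it.\<close>

lemma sing_part_zero_set:
  "\<exists>F. finite F \<and> (\<forall>q\<in>F. holo_on q \<Omega>) \<and> sing_part Z = {z\<in>\<Omega>. \<forall>q\<in>F. q z = 0}"
proof -
  define F where "F = ent 0 0 ` {..<r 1} \<union> {jac \<sigma> \<tau> |\<sigma> \<tau>. \<forall>a<p. \<sigma> a \<in> {..<r 1} \<and> \<tau> a \<in> UNIV}"
  have "finite {jac \<sigma> \<tau> |\<sigma> \<tau>. \<forall>a<p. \<sigma> a \<in> {..<r 1} \<and> \<tau> a \<in> (UNIV :: 'n set)}"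
  proof (rule finite_index_family)
    fix \<sigma> \<sigma>' :: "nat \<Rightarrow> nat" and \<tau> \<tau>' :: "nat \<Rightarrow> 'n" assume "\<And>a. a < p \<Longrightarrow> \<sigma> a = \<sigma>' a \<and> \<tau> a = \<tau>' a"
    then show "jac \<sigma> \<tau> = jac \<sigma>' \<tau>'" unfolding jac_def by (intro ext arg_cong[of _ _ det] nmat_cong) simp
  qed auto
  then have "finite F" by (simp add: F_def)
  moreover have "holo_on q \<Omega>" if q: "q \<in> F" for q
  proof -
    have g: "holo_on (ent 0 0 j) \<Omega>" if "j < r 1" for j using ent_holo[of 0 0 j] that rank_0 by simp
    have "holo_on (jac \<sigma> \<tau>) \<Omega>" if "\<forall>a<p. \<sigma> a < r 1" for \<sigma> \<tau>
      unfolding jac_def[abs_def] using that g by (intro holo_det_nmat[OF open_Omega] holo_on_pd) auto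
    then show ?thesis using q g unfolding F_def by auto
  qed
  moreover have "sing_part Z = {z\<in>\<Omega>. \<forall>q\<in>F. q z = 0}"
  proof (intro Set.set_eqI iffI)
    fix z assume z: "z \<in> sing_part Z"
    then have "z \<in> Z" "\<not> regular_point Z p z" by (auto simp: sing_part_def reg_part_eq)
    moreover have "jac \<sigma> \<tau> z = 0" if "\<forall>a<p. \<sigma> a < r 1" for \<sigma> \<tau>
      using jac_neq_0_regular[of z \<sigma> \<tau>] calculation that by blast
    ultimately show "z \<in> {z\<in>\<Omega>. \<forall>q\<in>F. q z = 0}"
      using Z_subset gen_zero unfolding F_def by auto
  next
    fix z assume z: "z \<in> {z\<in>\<Omega>. \<forall>q\<in>F. q z = 0}"
    then have "z \<in> Z" by (subst Z_eq) (auto simp: F_def)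
    moreover have "\<not> regular_point Z p z"
    proof
      assume "regular_point Z p z"
      then obtain \<sigma> \<tau> where *: "\<forall>a<p. \<sigma> a < r 1" "jac \<sigma> \<tau> z \<noteq> 0" using regular_jac_neq_0 by blast
      then have "jac \<sigma> \<tau> \<in> F" by (auto simp: F_def)
      then show False using z *(2) by blast
    qed
    ultimately show "z \<in> sing_part Z" by (simp add: sing_part_def reg_part_eq)
  qed
  ultimately show ?thesis by blast
qed

definition "top_rank k = Max ((\<lambda>w. vec_space.rank (r k) (f (Suc k) w)) ` \<Omega>)"

lemma nonoptimal_iff:
  "z \<in> nonoptimal_rank_set \<Omega> r f (Suc k) \<longleftrightarrow> z \<in> \<Omega> \<and> vec_space.rank (r k) (f (Suc k) z) < top_rank k"
  by (simp add: nonoptimal_rank_set_def top_rank_def)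

text \<open>\<open>Max\<close> is meaningful only on a finite set: the ranks are bounded by the
  number of columns.\<close>

lemma rank_le_top: "z \<in> \<Omega> \<Longrightarrow> vec_space.rank (r k) (f (Suc k) z) \<le> top_rank k"
proof -
  have "(\<lambda>w. vec_space.rank (r k) (f (Suc k) w)) ` \<Omega> \<subseteq> {..r (Suc k)}"
    using vec_space.rank_le_nc[OF f_carrier] by auto
  then have "finite ((\<lambda>w. vec_space.rank (r k) (f (Suc k) w)) ` \<Omega>)" using finite_subset by blast
  then show "z \<in> \<Omega> \<Longrightarrow> ?thesis" unfolding top_rank_def by (intro Max_ge) auto
qed

lemma nonoptimal_zero_set:
  "\<exists>F. finite F \<and> (\<forall>q\<in>F. holo_on q \<Omega>) \<and> nonoptimal_rank_set \<Omega> r f (Suc k) = {z\<in>\<Omega>. \<forall>q\<in>F. q z = 0}"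
proof -
  define mn where "mn I J z = minor (\<lambda>i j. ent k i j z) (top_rank k) I J" for I J z
  define F where "F = {mn I J |I J. \<forall>a<top_rank k. I a \<in> {..<r k} \<and> J a \<in> {..<r (Suc k)}}"
  have "finite F"
    unfolding F_def
  proof (rule finite_index_family)
    fix I I' J J' :: "nat \<Rightarrow> nat" assume "\<And>a. a < top_rank k \<Longrightarrow> I a = I' a \<and> J a = J' a"
    then show "mn I J = mn I' J'" unfolding mn_def by (intro ext arg_cong[of _ _ det] nmat_cong) simp
  qed auto
  moreover have "holo_on q \<Omega>" if "q \<in> F" for q
    using that ent_holo unfolding F_def mn_def[abs_def] by (auto intro!: holo_det_nmat[OF open_Omega])
  moreover have "nonoptimal_rank_set \<Omega> r f (Suc k) = {z\<in>\<Omega>. \<forall>q\<in>F. q z = 0}"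
  proof (intro Set.set_eqI)
    fix z
    have "z \<in> nonoptimal_rank_set \<Omega> r f (Suc k) \<longleftrightarrow> z \<in> \<Omega> \<and> (\<forall>I J. (\<forall>a<top_rank k. I a < r k \<and> J a < r (Suc k)) \<longrightarrow> mn I J z = 0)"
      unfolding nonoptimal_iff mn_def ent_def using rank_less_iff_minors[OF f_carrier] by blast
    then show "z \<in> nonoptimal_rank_set \<Omega> r f (Suc k) \<longleftrightarrow> z \<in> {z\<in>\<Omega>. \<forall>q\<in>F. q z = 0}" by (auto simp: F_def)
  qed
  ultimately show ?thesis by blast
qed

lemma nonoptimal_gt_N: "k > N \<Longrightarrow> nonoptimal_rank_set \<Omega> r f k = {}"
proof -
  assume k: "k > N"
  then obtain k' where k': "k = Suc k'" using gr0_implies_Suc by (metis gr_zeroI less_nat_zero_code)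
  have rk: "vec_space.rank (r k') (f (Suc k') w) = 0" if "w \<in> \<Omega>" for w
    using vec_space.rank_le_nc[OF f_carrier[OF that, of k']] rank_gt[OF k] k' by simp
  have "top_rank k' = 0" if "z \<in> \<Omega>" for z
  proof -
    have "(\<lambda>w. vec_space.rank (r k') (f (Suc k') w)) ` \<Omega> = {0}" using rk that by (auto simp: image_iff)
    then show ?thesis by (simp add: top_rank_def)
  qed
  then show ?thesis using nonoptimal_iff[of _ k'] k' by auto
qed

text \<open>At points of optimal rank \<open>A Q A = A\<close> with the inverse of a maximal minor as the block of \<open>Q\<close>.\<close>

lemma generalized_inverse:
  assumes b: "b \<in> \<Omega>" "b \<notin> nonoptimal_rank_set \<Omega> r f (Suc k)"
  shows "\<exists>U q. open U \<and> b \<in> U \<and> U \<subseteq> \<Omega> \<and> (\<forall>i<r k. \<forall>j<r (Suc k). holo_on (q j i) U) \<and>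
    (\<forall>z\<in>U. \<forall>i<r k. \<forall>l<r (Suc k). (\<Sum>j<r (Suc k). \<Sum>i'<r k. ent k i j z * q j i' z * ent k i' l z) = ent k i l z)"
proof -
  define s where "s = top_rank k"
  have "\<not> vec_space.rank (r k) (f (Suc k) b) < s" using b by (simp add: nonoptimal_iff s_def)
  then obtain I J where IJ: "\<And>a. a < s \<Longrightarrow> I a < r k \<and> J a < r (Suc k)" "minor (\<lambda>i j. ent k i j b) s I J \<noteq> 0"
    unfolding rank_less_iff_minors[OF f_carrier[OF b(1)]] ent_def by blast
  define D where "D z = minor (\<lambda>i j. ent k i j z) s I J" for z
  have hD: "holo_on D \<Omega>" unfolding D_def[abs_def] using IJ(1) by (intro holo_det_nmat open_Omega ent_holo) auto
  define U where "U = \<Omega> \<inter> D -` (- {0})"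
  have oU: "open U" unfolding U_def by (rule continuous_open_preimage[OF holo_on_continuous[OF hD] open_Omega]) (rule open_Compl, rule closed_singleton)
  define ad where "ad z c a = nadj s (\<lambda>a c. ent k (I a) (J c) z) c a" for z c a
  \<comment> \<open>The inverse of the chosen block, placed at the rows \<open>J c\<close> and
    columns \<open>I a\<close>, and zero elsewhere.\<close>
  define q where "q j i z = (\<Sum>c<s. \<Sum>a<s. (if J c = j \<and> I a = i then ad z c a / D z else 0))" for j i z
  have "holo_on (\<lambda>z. ad z c a) \<Omega>" if "c < s" "a < s" for c a
    unfolding ad_def using IJ(1) that by (intro holo_nadj open_Omega ent_holo) auto
  then have had: "holo_on (\<lambda>z. ad z c a) U" if "c < s" "a < s" for c a
    using holo_on_subset[OF _ oU] that by (auto simp: U_def)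
  have hq: "holo_on (q j i) U" for j i
    unfolding q_def[abs_def]
  proof (intro holo_on_sum oU)
    fix c a assume ca: "c \<in> {..<s}" "a \<in> {..<s}"
    have "holo_on (\<lambda>z. ad z c a / D z) U"
      using ca holo_on_subset[OF hD oU] by (intro holo_intros had) (auto simp: U_def)
    moreover have "(\<lambda>z. if J c = j \<and> I a = i then ad z c a / D z else 0) =
       (if J c = j \<and> I a = i then (\<lambda>z. ad z c a / D z) else (\<lambda>z. 0))" by auto
    ultimately show "holo_on (\<lambda>z. if J c = j \<and> I a = i then ad z c a / D z else 0) U"
      using holo_on_const[OF oU, of 0] by (simp only: split: if_split) simp
  qed
  have id: "(\<Sum>j<r (Suc k). \<Sum>i'<r k. ent k i j z * q j i' z * ent k i' l z) = ent k i l z"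
    if z: "z \<in> U" and il: "i < r k" "l < r (Suc k)" for z i l
  proof -
    have z\<Omega>: "z \<in> \<Omega>" and Dz: "D z \<noteq> 0" using z by (auto simp: U_def)
    have "minor (\<lambda>i j. ent k i j z) (Suc s) (I(s := i)) (J(s := l)) = 0"
    proof -
      have "vec_space.rank (r k) (f (Suc k) z) < Suc s" using rank_le_top[OF z\<Omega>] by (simp add: s_def le_imp_less_Suc)
      moreover have "\<forall>a<Suc s. (I(s := i)) a < r k \<and> (J(s := l)) a < r (Suc k)" using IJ(1) il by (auto simp: less_Suc_eq)
      ultimately show ?thesis unfolding rank_less_iff_minors[OF f_carrier[OF z\<Omega>]] ent_def by blast
    qed
    from minor_factor[OF _ this] have "ent k i l z = (\<Sum>c<s. ent k i (J c) z * (\<Sum>a<s. ad z c a * ent k (I a) l z)) / D z"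
      using Dz unfolding D_def ad_def by blast
    also have "\<dots> = (\<Sum>c<s. \<Sum>a<s. ent k i (J c) z * (ad z c a / D z) * ent k (I a) l z)"
      by (simp add: sum_divide_distrib sum_distrib_left mult.assoc)
    also have "\<dots> = (\<Sum>c<s. \<Sum>a<s. \<Sum>j<r (Suc k). \<Sum>i'<r k. ent k i j z * (if J c = j \<and> I a = i' then ad z c a / D z else 0) * ent k i' l z)"
    proof (intro sum.cong refl)
      fix c a assume ca: "c \<in> {..<s}" "a \<in> {..<s}"
      have "(\<Sum>j<r (Suc k). \<Sum>i'<r k. ent k i j z * (if J c = j \<and> I a = i' then ad z c a / D z else 0) * ent k i' l z) =
         (\<Sum>j<r (Suc k). if J c = j then ent k i j z * (ad z c a / D z) * ent k (I a) l z else 0)"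
      proof (intro sum.cong refl)
        fix j
        have "(\<Sum>i'<r k. ent k i j z * (if J c = j \<and> I a = i' then ad z c a / D z else 0) * ent k i' l z) =
          (\<Sum>i'<r k. if I a = i' then (if J c = j then ent k i j z * (ad z c a / D z) * ent k i' l z else 0) else 0)"
          by (intro sum.cong refl) auto
        also have "\<dots> = (if J c = j then ent k i j z * (ad z c a / D z) * ent k (I a) l z else 0)"
          using IJ(1)[of a] ca by (simp add: sum.delta')
        finally show "(\<Sum>i'<r k. ent k i j z * (if J c = j \<and> I a = i' then ad z c a / D z else 0) * ent k i' l z) =
          (if J c = j then ent k i j z * (ad z c a / D z) * ent k (I a) l z else 0)" .
      qed
      also have "\<dots> = ent k i (J c) z * (ad z c a / D z) * ent k (I a) l z"
        using IJ(1)[of c] ca by (simp add: sum.delta')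
      finally show "ent k i (J c) z * (ad z c a / D z) * ent k (I a) l z =
         (\<Sum>j<r (Suc k). \<Sum>i'<r k. ent k i j z * (if J c = j \<and> I a = i' then ad z c a / D z else 0) * ent k i' l z)" by simp
    qed
    also have "\<dots> = (\<Sum>j<r (Suc k). \<Sum>i'<r k. \<Sum>c<s. \<Sum>a<s. ent k i j z * (if J c = j \<and> I a = i' then ad z c a / D z else 0) * ent k i' l z)"
      by (subst sum.swap[of _ "{..<r (Suc k)}" "{..<s}"], subst sum.swap[of _ "{..<r (Suc k)}" "{..<s}"],
          subst sum.swap[of _ "{..<r k}" "{..<s}"], subst sum.swap[of _ "{..<r k}" "{..<s}"]) (rule refl)
    also have "\<dots> = (\<Sum>j<r (Suc k). \<Sum>i'<r k. ent k i j z * q j i' z * ent k i' l z)"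
      unfolding q_def sum_distrib_left sum_distrib_right ..
    finally show ?thesis by simp
  qed
  have "b \<in> U" using IJ(2) b(1) by (simp add: U_def D_def)
  moreover have "U \<subseteq> \<Omega>" by (auto simp: U_def)
  ultimately show ?thesis using oU hq id by (intro exI[of _ U] exI[of _ q] conjI) blast+
qed

end

subsection \<open>Extension of strongly holomorphic functions\<close>

lemma eventually_biholo:
  assumes "biholo G H V W" "z \<in> V" "\<forall>\<^sub>F y in nhds (G z). P y"
  shows "\<forall>\<^sub>F z' in nhds z. P (G z')"
proof -
  note b = biholoD[OF assms(1)]
  obtain S where S: "open S" "G z \<in> S" "\<And>y. y \<in> S \<Longrightarrow> P y" using assms(3) unfolding eventually_nhds by blast
  have "open (V \<inter> G -` S)" using b(9,1) S(1) by (rule continuous_open_preimage)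
  then show ?thesis unfolding eventually_nhds using S assms(2) by (intro exI[of _ "V \<inter> G -` S"]) auto
qed

lemma eventually_biholo':
  assumes "biholo G H V W" "y \<in> W" "\<forall>\<^sub>F z in nhds (H y). P z"
  shows "\<forall>\<^sub>F y' in nhds y. P (H y')"
  using eventually_biholo[OF biholo_sym[OF assms(1)] assms(2,3)] .

lemma holo_at_biholo:
  assumes "biholo G H V W" "y \<in> W" "holo_at f (H y)"
  shows "holo_at (\<lambda>y. f (H y)) y"
proof -
  obtain U where "H y \<in> U" "holo_on f U" using assms(3) unfolding holo_at_def by blast
  then show ?thesis using holo_atI[OF biholo_holo_compose[OF assms(1)]] assms(2) by blast
qed

lemma holo_at_biholo':
  assumes "biholo G H V W" "z \<in> V" "holo_at f (G z)"
  shows "holo_at (\<lambda>z. f (G z)) z"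
  using holo_at_biholo[OF biholo_sym[OF assms(1)] assms(2,3)] .

text \<open>Exactness is a condition on germs, so the complex can be read in the coordinates of a
  chart.\<close>

lemma (in free_complex) free_complex_transport:
  assumes bi: "biholo G H V W" and V: "V \<subseteq> \<Omega>"
  shows "free_complex (\<lambda>k i j w. a k i j (H w)) r W N"
proof
  note b = biholoD[OF bi]
  show "open W" by (rule b)
  have in_dom: "H w \<in> \<Omega>" if "w \<in> W" for w using b(5)[OF that] V by blast
  show "holo_on (\<lambda>w. a k i j (H w)) W" if "i < r k" "j < r (Suc k)" for k i j
  proof -
    have "W \<inter> H -` \<Omega> = W" using in_dom by blast
    then show ?thesis using biholo_holo_compose[OF bi hol[OF that]] by simp
  qed
  show "(\<Sum>j<r (Suc k). a k i j (H z) * a (Suc k) j l (H z)) = 0" if "z \<in> W" "i < r k" "l < r (Suc (Suc k))" for k i l z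
    using comp[OF in_dom] that by blast
  show "r k = 0" if "k > N" for k using rank0[OF that] .
  fix k \<psi> w
  assume w: "w \<in> W" and \<psi>: "\<forall>j<r (Suc k). holo_at (\<psi> j) w"
    and z: "\<forall>\<^sub>F z in nhds w. \<forall>i<r k. (\<Sum>j<r (Suc k). a k i j (H z) * \<psi> j z) = 0"
  have GH: "G (H w) = w" using b(6)[OF w] .
  have "\<forall>\<^sub>F z in nhds (H w). z \<in> V" using b(1) b(5)[OF w] eventually_nhds by blast
  moreover have "\<forall>\<^sub>F z in nhds (H w). \<forall>i<r k. (\<Sum>j<r (Suc k). a k i j (H (G z)) * \<psi> j (G z)) = 0"
    by (rule eventually_biholo[OF bi b(5)[OF w]]) (simp add: GH z)
  ultimately have "\<forall>\<^sub>F z in nhds (H w). \<forall>i<r k. (\<Sum>j<r (Suc k). a k i j z * \<psi> j (G z)) = 0"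
    by eventually_elim (simp add: b(4))
  moreover have "\<forall>j<r (Suc k). holo_at (\<lambda>z. \<psi> j (G z)) (H w)"
    using \<psi> by (intro allI impI holo_at_biholo'[OF bi b(5)[OF w]]) (simp add: GH)
  ultimately obtain \<eta> where \<eta>: "\<forall>l<r (Suc (Suc k)). holo_at (\<eta> l) (H w)"
    "\<forall>\<^sub>F z in nhds (H w). \<forall>j<r (Suc k). \<psi> j (G z) = (\<Sum>l<r (Suc (Suc k)). a (Suc k) j l z * \<eta> l z)"
    using exact[OF in_dom[OF w], of k "\<lambda>j z. \<psi> j (G z)"] by blast
  have "\<forall>\<^sub>F y in nhds w. y \<in> W" using b(2) w eventually_nhds by blast
  moreover have "\<forall>\<^sub>F y in nhds w. \<forall>j<r (Suc k). \<psi> j (G (H y)) = (\<Sum>l<r (Suc (Suc k)). a (Suc k) j l (H y) * \<eta> l (H y))"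
    by (rule eventually_biholo'[OF bi w \<eta>(2)])
  ultimately have "\<forall>\<^sub>F y in nhds w. \<forall>j<r (Suc k). \<psi> j y = (\<Sum>l<r (Suc (Suc k)). a (Suc k) j l (H y) * \<eta> l (H y))"
    by eventually_elim (simp add: b(6))
  moreover have "\<forall>l<r (Suc (Suc k)). holo_at (\<lambda>y. \<eta> l (H y)) w"
    using \<eta>(1) by (intro allI impI holo_at_biholo[OF bi w]) simp
  ultimately show "\<exists>\<eta>. (\<forall>l<r (Suc (Suc k)). holo_at (\<eta> l) w) \<and>
      (\<forall>\<^sub>F z in nhds w. \<forall>j<r (Suc k). \<psi> j z = (\<Sum>l<r (Suc (Suc k)). a (Suc k) j l (H z) * \<eta> l z))"
    by (intro exI[of _ "\<lambda>l y. \<eta> l (H y)"] conjI)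
qed

lemma cube_subset_ball:
  assumes "0 < e"
  shows "\<exists>\<rho>>0. cube \<rho> {} \<rho> \<subseteq> ball (0 :: complex^'n) e"
proof -
  define \<rho> where "\<rho> = e / (4 * CARD('n))"
  have \<rho>: "\<rho> > 0" using assms by (simp add: \<rho>_def)
  have "z \<in> ball 0 e" if z: "z \<in> cube \<rho> {} \<rho>" for z :: "complex^'n"
  proof -
    have "norm z \<le> (\<Sum>i::'n\<in>UNIV. norm (z $ i))" by (rule norm_vec_le_sum)
    also have "\<dots> \<le> (\<Sum>i::'n\<in>UNIV. 2 * \<rho>)"
    proof (rule sum_mono)
      fix i have "\<bar>Re (z $ i)\<bar> \<le> \<rho>" "\<bar>Im (z $ i)\<bar> \<le> \<rho>" using z by (simp_all add: mem_cube)
      then show "norm (z $ i) \<le> 2 * \<rho>" using cmod_le[of "z $ i"] by linarith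
    qed
    also have "\<dots> < e" using assms by (simp add: \<rho>_def)
    finally show ?thesis by simp
  qed
  then show ?thesis using \<rho> by blast
qed

lemma ball_subset_cube: "ball (0 :: complex^'n) \<rho> \<subseteq> cube \<rho> {} \<epsilon>"
proof
  fix z :: "complex^'n" assume "z \<in> ball 0 \<rho>"
  then have "norm (z $ i) \<le> \<rho>" for i using Finite_Cartesian_Product.norm_nth_le[of z i] by simp
  then show "z \<in> cube \<rho> {} \<epsilon>"
    unfolding mem_cube using abs_Re_le_cmod abs_Im_le_cmod by (metis empty_iff order_trans)
qed

context resolved_variety
begin

text \<open>Strong holomorphy compares values only on the regular part; by density of that part and
  continuity this already determines the class modulo the ideal of \<open>Z\<close>.\<close>

lemma vanishing_on_regular:
  assumes z: "z \<in> \<Omega>" and h: "holo_at h z" and van: "\<forall>\<^sub>F y in nhds z. y \<in> reg_part Z \<longrightarrow> h y = 0"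
  shows "h \<in> ideal_at Z z"
proof -
  obtain U where U: "z \<in> U" "holo_on h U" using h unfolding holo_at_def by blast
  obtain V where V: "open V" "z \<in> V" "\<And>y. y \<in> V \<Longrightarrow> y \<in> reg_part Z \<Longrightarrow> h y = 0" using van unfolding eventually_nhds by blast
  have o: "open (U \<inter> V)" using holo_on_open[OF U(2)] V(1) by blast
  have "h y = 0" if y: "y \<in> U \<inter> V" "y \<in> Z" for y
  proof (rule ccontr)
    assume ne: "h y \<noteq> 0"
    have "open ((U \<inter> V) \<inter> h -` (- {0}))"
      by (rule continuous_open_preimage[OF _ o]) (use continuous_on_subset[OF holo_on_continuous[OF U(2)]] in \<open>auto intro: open_Compl\<close>)
    then obtain y' where "y' \<in> (U \<inter> V) \<inter> h -` (- {0})" "regular_point Z p y'"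
      using regular_dense[OF y(2)] y(1) ne by blast
    then show False using V(3)[of y'] by (auto simp: reg_part_eq)
  qed
  then show ?thesis using U V by (intro ideal_atI[OF holo_on_subset[OF U(2) o]]) auto
qed

text \<open>In the chart the zero set of \<open>g\<close> is a coordinate plane. Off it the germs
  extending \<phi> form a coset family for the cokernel of f_1, and \<open>coset_extends\<close>
  supplies one function across the plane. Its values on the plane need no comparison with \<phi>,
  because the plane contains no regular points of \<open>Z\<close>.\<close>

lemma strongly_holomorphic_extension:
  assumes b0: "b0 \<in> U" and U: "open U" "U \<subseteq> \<Omega>"
    and g: "\<And>i. i < c \<Longrightarrow> holo_on (g i) U" "indep_at c g b0" "\<And>i. i < c \<Longrightarrow> g i b0 = 0"
    and c: "k + 2 \<le> c"
    and q: "\<And>i j. i < r k \<Longrightarrow> j < r (Suc k) \<Longrightarrow> holo_on (q j i) U"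
      "\<And>z i l. z \<in> U \<Longrightarrow> i < r k \<Longrightarrow> l < r (Suc k) \<Longrightarrow>
         (\<Sum>j<r (Suc k). \<Sum>i'<r k. ent k i j z * q j i' z * ent k i' l z) = ent k i l z"
    and str: "\<And>b i. b \<in> U \<Longrightarrow> i < c \<Longrightarrow> g i b \<noteq> 0 \<Longrightarrow> strongly_holomorphic_at Z \<phi> b"
    and sing: "\<And>b. b \<in> U \<Longrightarrow> \<forall>i<c. g i b = 0 \<Longrightarrow> b \<notin> reg_part Z"
  shows "strongly_holomorphic_at Z \<phi> b0"
proof -
  obtain G H V W J \<sigma> where ch: "biholo G H V W" "b0 \<in> V" "V \<subseteq> U" "card J = c" "bij_betw \<sigma> J {..<c}"
    "\<And>z j. z \<in> V \<Longrightarrow> j \<in> J \<Longrightarrow> G z $ j = g (\<sigma> j) z" "G b0 = 0"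
    by (rule straightening[of c g U b0]) (use g U b0 in auto)
  note bi = biholoD[OF ch(1)]
  have V\<Omega>: "V \<subseteq> \<Omega>" using ch(3) U(2) by blast
  have H\<Omega>: "H w \<in> \<Omega>" "H w \<in> U" if "w \<in> W" for w using bi(5)[OF that] V\<Omega> ch(3) by blast+
  interpret T: free_complex "\<lambda>k i j w. ent k i j (H w)" r W N
    by (rule free_complex_transport[OF ch(1) V\<Omega>])
  have "0 \<in> W" using bi(3)[OF ch(2)] ch(7) by simp
  then obtain e where "e > 0" "ball 0 e \<subseteq> W" using bi(2) open_contains_ball by blast
  then obtain \<rho> where \<rho>: "\<rho> > 0" "cube \<rho> {} \<rho> \<subseteq> W" using cube_subset_ball by (metis subset_trans)
  define D where "D = {z\<in>cube \<rho> {} \<rho>. \<exists>j\<in>J. z $ j \<noteq> 0}"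
  have DW: "D \<subseteq> W" using \<rho>(2) by (auto simp: D_def)
  \<comment> \<open>The germ of \<psi> agrees with \<phi> on the regular part. Such germs differ by
    elements of the ideal of \<open>Z\<close>, which is the image of f_1.\<close>
  define L where "L b \<psi> \<longleftrightarrow> (\<forall>\<^sub>F w in nhds b. H w \<in> reg_part Z \<longrightarrow> \<phi> (H w) = \<psi> (0::nat) w)" for b and \<psi> :: "nat \<Rightarrow> complex^'n \<Rightarrow> complex"
  have fam: "T.coset_family 0 D L"
    unfolding T.coset_family_def
  proof (intro conjI ballI allI impI)
    fix b assume b: "b \<in> D"
    then have bW: "b \<in> W" using DW by blast
    obtain j where j: "j \<in> J" "b $ j \<noteq> 0" using b by (auto simp: D_def)
    have "g (\<sigma> j) (H b) \<noteq> 0" using ch(6)[OF bi(5)[OF bW] j(1)] bi(6)[OF bW] j(2) by simp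
    moreover have "\<sigma> j < c" using ch(5) j(1) by (auto simp: bij_betw_def)
    ultimately have "strongly_holomorphic_at Z \<phi> (H b)" using str[OF H\<Omega>(2)[OF bW]] by blast
    then obtain h where h: "holo_at h (H b)" "\<forall>\<^sub>F z in nhds (H b). z \<in> reg_part Z \<longrightarrow> \<phi> z = h z"
      unfolding strongly_holomorphic_at_def by blast
    have "T.sec 0 (\<lambda>_ w. h (H w)) b" unfolding T.sec_def using holo_at_biholo[OF ch(1) bW h(1)] by simp
    moreover have "L b (\<lambda>_ w. h (H w))" unfolding L_def by (rule eventually_biholo'[OF ch(1) bW h(2)])
    ultimately show "\<exists>\<psi>. T.sec 0 \<psi> b \<and> L b \<psi>" by blast
  next
    fix b \<psi> \<psi>' assume b: "b \<in> D" and s: "T.sec 0 \<psi> b" "T.sec 0 \<psi>' b" "L b \<psi>" "L b \<psi>'"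
    have bW: "b \<in> W" using b DW by blast
    have GH: "G (H b) = b" using bi(6)[OF bW] .
    define d where "d w = \<psi> 0 w - \<psi>' 0 w" for w
    have "T.sec 0 (\<lambda>i z. \<psi> i z - \<psi>' i z) b" using s by (intro T.sec_diff)
    then have hd: "holo_at d b" using rank_0 by (simp add: T.sec_def d_def[abs_def])
    have "\<forall>\<^sub>F w in nhds b. H w \<in> reg_part Z \<longrightarrow> d w = 0"
      using s(3,4) unfolding L_def by eventually_elim (simp add: d_def)
    then have "\<forall>\<^sub>F z in nhds (H b). H (G z) \<in> reg_part Z \<longrightarrow> d (G z) = 0"
      by (intro eventually_biholo[OF ch(1) bi(5)[OF bW]]) (simp add: GH)
    moreover have "\<forall>\<^sub>F z in nhds (H b). z \<in> V" using bi(1) bi(5)[OF bW] eventually_nhds by blast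
    ultimately have "\<forall>\<^sub>F z in nhds (H b). z \<in> reg_part Z \<longrightarrow> d (G z) = 0" by eventually_elim (simp add: bi(4))
    then have "(\<lambda>z. d (G z)) \<in> ideal_at Z (H b)"
      by (rule vanishing_on_regular[OF H\<Omega>(1)[OF bW] holo_at_biholo'[OF ch(1) bi(5)[OF bW]], rotated]) (simp add: GH hd)
    then obtain \<eta> where \<eta>: "\<forall>j<r 1. holo_at (\<eta> j) (H b)" "\<forall>\<^sub>F z in nhds (H b). d (G z) = (\<Sum>j<r 1. ent 0 0 j z * \<eta> j z)"
      using ideal_expand[OF H\<Omega>(1)[OF bW]] by blast
    have "\<forall>\<^sub>F w in nhds b. d (G (H w)) = (\<Sum>j<r 1. ent 0 0 j (H w) * \<eta> j (H w))"
      by (rule eventually_biholo'[OF ch(1) bW \<eta>(2)])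
    moreover have "\<forall>\<^sub>F w in nhds b. w \<in> W" using bi(2) bW eventually_nhds by blast
    ultimately have "T.eqg 0 (\<lambda>i z. \<psi> i z - \<psi>' i z) (T.app 0 (\<lambda>j w. \<eta> j (H w))) b"
      unfolding T.eqg_def T.app_def by eventually_elim (simp add: bi(6) rank_0 d_def)
    moreover have "T.sec (Suc 0) (\<lambda>j w. \<eta> j (H w)) b"
      unfolding T.sec_def using \<eta>(1) by (intro allI impI holo_at_biholo[OF ch(1) bW]) simp
    ultimately show "T.img 0 (\<lambda>i z. \<psi> i z - \<psi>' i z) b" unfolding T.img_def by blast
  next
    fix b \<psi> assume "L b \<psi>"
    then have "\<forall>\<^sub>F b' in nhds b. L b' \<psi>" unfolding L_def by (simp add: eventually_eventually)
    then show "\<forall>\<^sub>F b' in nhds b. b' \<in> D \<longrightarrow> L b' \<psi>" by (rule eventually_mono) simp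
  next
    fix b \<psi> \<psi>' \<eta>
    assume b: "b \<in> D" and l: "L b \<psi>" and e: "T.eqg 0 \<psi>' (\<lambda>i z. \<psi> i z + T.app 0 \<eta> i z) b"
    show "L b \<psi>'"
      using l e unfolding L_def T.eqg_def
    proof eventually_elim
      case (elim w)
      have "T.app 0 \<eta> 0 w = 0" if "H w \<in> reg_part Z"
      proof -
        have "H w \<in> Z" using that by (auto simp: reg_part_eq regular_point_def)
        then show ?thesis by (simp add: T.app_def gen_zero)
      qed
      then show ?case using elim rank_0 by simp
    qed
  qed
  have "\<exists>h. (\<forall>b\<in>cube \<rho> {} \<rho>. T.sec 0 h b) \<and> (\<forall>b\<in>cube \<rho> {} \<rho>. (\<exists>j\<in>J. b $ j \<noteq> 0) \<longrightarrow> L b h)"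
  proof (rule T.coset_extends[where q="\<lambda>j i w. q j i (H w)" and k=k and J=J])
    show "holo_on (\<lambda>w. q j i (H w)) W" if "i < r k" "j < r (Suc k)" for i j
    proof -
      have "W \<inter> H -` U = W" using H\<Omega>(2) by blast
      then show ?thesis using biholo_holo_compose[OF ch(1) q(1)[OF that]] by simp
    qed
    show "T.app k (\<lambda>j z. \<Sum>i<r k. q j i (H z) * T.app k \<eta> i z) i z = T.app k \<eta> i z" if zi: "z \<in> W" "i < r k" for \<eta> i z
    proof -
      have "T.app k (\<lambda>j z. \<Sum>i<r k. q j i (H z) * T.app k \<eta> i z) i z =
          (\<Sum>j<r (Suc k). \<Sum>i'<r k. \<Sum>l<r (Suc k). ent k i j (H z) * q j i' (H z) * ent k i' l (H z) * \<eta> l z)"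
        by (simp add: T.app_def sum_distrib_left mult.assoc)
      also have "\<dots> = (\<Sum>j<r (Suc k). \<Sum>l<r (Suc k). \<Sum>i'<r k. ent k i j (H z) * q j i' (H z) * ent k i' l (H z) * \<eta> l z)"
        by (rule sum.cong[OF refl], rule sum.swap)
      also have "\<dots> = (\<Sum>l<r (Suc k). \<Sum>j<r (Suc k). \<Sum>i'<r k. ent k i j (H z) * q j i' (H z) * ent k i' l (H z) * \<eta> l z)"
        by (rule sum.swap)
      also have "\<dots> = (\<Sum>l<r (Suc k). (\<Sum>j<r (Suc k). \<Sum>i'<r k. ent k i j (H z) * q j i' (H z) * ent k i' l (H z)) * \<eta> l z)"
        by (simp add: sum_distrib_right)
      also have "\<dots> = T.app k \<eta> i z"
        unfolding T.app_def using q(2)[OF H\<Omega>(2)[OF zi(1)] zi(2)] by (intro sum.cong refl) simp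
      finally show ?thesis .
    qed
    show "T.coset_family 0 {z\<in>cube \<rho> {} \<rho>. \<exists>j\<in>J. z $ j \<noteq> 0} L" using fam by (simp add: D_def)
  qed (use \<rho> c ch(4) in auto)
  then obtain h where h: "\<forall>b\<in>cube \<rho> {} \<rho>. T.sec 0 h b" "\<forall>b\<in>cube \<rho> {} \<rho>. (\<exists>j\<in>J. b $ j \<noteq> 0) \<longrightarrow> L b h" by blast
  have "(0 :: complex^'n) \<in> cube \<rho> {} \<rho>" using ball_subset_cube[of \<rho> \<rho>] \<rho>(1) by auto
  then have "holo_at (h 0) (G b0)" using h(1) rank_0 ch(7) by (simp add: T.sec_def)
  then have hol: "holo_at (\<lambda>z. h 0 (G z)) b0" by (rule holo_at_biholo'[OF ch(1,2)])
  have "\<forall>\<^sub>F y in nhds (G b0). y \<in> cube \<rho> {} \<rho>"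
    unfolding eventually_nhds ch(7) using ball_subset_cube[of \<rho> \<rho>] \<rho>(1) by (intro exI[of _ "ball 0 \<rho>"]) auto
  then have "\<forall>\<^sub>F z in nhds b0. G z \<in> cube \<rho> {} \<rho>" by (rule eventually_biholo[OF ch(1,2)])
  moreover have "\<forall>\<^sub>F z in nhds b0. z \<in> V" using bi(1) ch(2) eventually_nhds by blast
  ultimately have "\<forall>\<^sub>F z in nhds b0. z \<in> reg_part Z \<longrightarrow> \<phi> z = h 0 (G z)"
  proof eventually_elim
    case (elim z)
    show ?case
    proof
      assume z: "z \<in> reg_part Z"
      have "z \<in> U" using elim(2) ch(3) by blast
      then obtain i where i: "i < c" "g i z \<noteq> 0" using sing z by blast
      obtain j where j: "j \<in> J" "\<sigma> j = i" using bij_betw_lessThan_obtain[OF ch(5) i(1)] by blast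
      have "G z $ j \<noteq> 0" using ch(6)[OF elim(2) j(1)] i(2) j(2) by simp
      then have "L (G z) h" using h(2) elim(1) j(1) by blast
      then have "H (G z) \<in> reg_part Z \<longrightarrow> \<phi> (H (G z)) = h 0 (G z)" unfolding L_def by (rule eventually_nhds_x_imp_x)
      then show "\<phi> z = h 0 (G z)" using z bi(4)[OF elim(2)] by simp
    qed
  qed
  then show ?thesis unfolding strongly_holomorphic_at_def using hol by blast
qed

text \<open>The equations of \<open>A\<close> vanish on \<open>B\<close> near \<open>b0\<close>,
  hence on the manifold of the hull. So \<open>A\<close> contains this manifold near
  \<open>b0\<close>, and \<open>dimension_le\<close> yields a regular point of \<open>A\<close> in
  \<open>U\<close> of codimension at most \<open>c\<close>.\<close>

lemma codim_le_hull:
  assumes F: "finite F" "\<forall>q\<in>F. holo_on q \<Omega>" "A = {z\<in>\<Omega>. \<forall>q\<in>F. q z = 0}"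
    and U: "open U" "b0 \<in> U" "U \<subseteq> \<Omega>" and b0: "b0 \<in> B" and BA: "B \<inter> U \<subseteq> A"
    and g: "\<And>i. i < c \<Longrightarrow> holo_on (g i) U" "\<And>i. i < c \<Longrightarrow> g i b0 = 0" "indep_at c g b0"
    and hull: "\<And>h. h \<in> ideal_at B b0 \<Longrightarrow> \<forall>\<^sub>F z in nhds b0. (\<forall>i<c. g i z = 0) \<longrightarrow> h z = 0"
  shows "\<forall>\<^sub>F z in nhds b0. (\<forall>i<c. g i z = 0) \<longrightarrow> z \<in> A"
    and "(\<forall>c'<m. \<forall>z\<in>U. \<not> regular_point A c' z) \<Longrightarrow> m \<le> c"
proof -
  have hq: "holo_on q U" if "q \<in> F" for q using F(2) that holo_on_subset[OF _ U(1,3)] by blast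
  have van: "\<forall>\<^sub>F z in nhds b0. (\<forall>i<c. g i z = 0) \<longrightarrow> q z = 0" if "q \<in> F" for q
    by (rule hull, rule ideal_atI[OF hq[OF that] U(2)]) (use BA F(3) that in blast)
  have "\<forall>\<^sub>F z in nhds b0. \<forall>q\<in>F. (\<forall>i<c. g i z = 0) \<longrightarrow> q z = 0"
    using van F(1) by (intro eventually_ball_finite) auto
  moreover have "\<forall>\<^sub>F z in nhds b0. z \<in> \<Omega>" using eventually_Omega U by blast
  ultimately show "\<forall>\<^sub>F z in nhds b0. (\<forall>i<c. g i z = 0) \<longrightarrow> z \<in> A"
    by eventually_elim (simp add: F(3))
  assume m: "\<forall>c'<m. \<forall>z\<in>U. \<not> regular_point A c' z"
  obtain y c' where y: "y \<in> U" "c' \<le> c" "regular_point {z\<in>U. \<forall>q\<in>F. q z = 0} c' y"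
    by (rule dimension_le[OF U(1,2) F(1) hq _ g(2,3) van]) (use holo_atI[OF g(1) U(2)] in auto)
  have "regular_point A c' y"
    by (rule regular_point_local[OF y(3) U(1) y(1)]) (use F(3) U(3) in auto)
  then have "m \<le> c'" using m y(1) by (meson not_le)
  then show "m \<le> c" using y(2) by simp
qed

theorem normal_point_of_codim:
  assumes x: "x \<in> Z"
    and sing: "codim_at (sing_part Z) x \<ge> enat (2 + p)"
    and opt: "\<And>k. k > p \<Longrightarrow> codim_at (nonoptimal_rank_set \<Omega> r f k) x \<ge> enat (2 + k)"
  shows "normal_point Z x"
  unfolding normal_point_def
proof (intro allI impI, elim conjE)
  fix U \<phi> assume U: "open U" "x \<in> U" and weak: "weakly_holomorphic_on Z U \<phi>"
  let ?Z = "nonoptimal_rank_set \<Omega> r f"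
  have "\<exists>V. open V \<and> x \<in> V \<and> (\<forall>c<2 + p. \<forall>z\<in>V. \<not> regular_point (sing_part Z) c z)" by (rule codim_at_nbhd[OF sing])
  then obtain V0 where V0: "open V0" "x \<in> V0" "\<forall>c<2 + p. \<forall>z\<in>V0. \<not> regular_point (sing_part Z) c z" by (elim exE conjE)
  \<comment> \<open>Finitely many neighbourhoods suffice, as the rank sets are empty beyond
    \<open>N\<close>.\<close>
  have "\<exists>V. open V \<and> x \<in> V \<and> (\<forall>k<Suc N. p < k \<longrightarrow> (\<forall>c<2 + k. \<forall>z\<in>V. \<not> regular_point (?Z k) c z))"
  proof (rule finite_nbhd)
    fix k
    show "\<exists>V. open V \<and> x \<in> V \<and> (p < k \<longrightarrow> (\<forall>c<2 + k. \<forall>z\<in>V. \<not> regular_point (?Z k) c z))"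
    proof (cases "p < k")
      case True
      then show ?thesis using codim_at_nbhd[OF opt[OF True]] by simp
    qed (intro exI[of _ UNIV], simp)
  qed blast
  then obtain V1 where V1: "open V1" "x \<in> V1" "\<forall>k<Suc N. p < k \<longrightarrow> (\<forall>c<2 + k. \<forall>z\<in>V1. \<not> regular_point (?Z k) c z)"
    by (elim exE conjE)
  define U0 where "U0 = U \<inter> \<Omega> \<inter> V0 \<inter> V1"
  have U0: "open U0" "x \<in> U0" "U0 \<subseteq> \<Omega>" using U V0 V1 open_Omega x Z_subset by (auto simp: U0_def)
  define B where "B = {b\<in>U0. \<not> strongly_holomorphic_at Z \<phi> b}"
  have Bsing: "B \<subseteq> sing_part Z"
  proof
    fix b assume b: "b \<in> B"
    have "b \<in> Z"
    proof (rule ccontr)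
      assume "b \<notin> Z"
      then have "\<forall>\<^sub>F z in nhds b. z \<notin> Z" using eventually_not_Z b U0(3) by (auto simp: B_def)
      then have "\<forall>\<^sub>F z in nhds b. z \<in> reg_part Z \<longrightarrow> \<phi> z = 0"
        by (rule eventually_mono) (auto simp: reg_part_def regular_point_def)
      then have "strongly_holomorphic_at Z \<phi> b"
        unfolding strongly_holomorphic_at_def by (intro exI[of _ "\<lambda>_. 0"]) (simp add: holo_at_0)
      then show False using b by (simp add: B_def)
    qed
    moreover have "b \<notin> reg_part Z"
      using weak b unfolding weakly_holomorphic_on_def B_def U0_def by blast
    ultimately show "b \<in> sing_part Z" by (simp add: sing_part_def)
  qed
  show "strongly_holomorphic_at Z \<phi> x"
  proof (rule ccontr)
    assume "\<not> strongly_holomorphic_at Z \<phi> x"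
    then have xB: "x \<in> B" using U0 by (simp add: B_def)
    define P where "P k \<longleftrightarrow> k = p \<or> p < k \<and> (\<exists>V. open V \<and> B \<inter> V \<noteq> {} \<and> B \<inter> V \<subseteq> ?Z k)" for k
    have bound: "k \<le> max p N" if "P k" for k
      using that nonoptimal_gt_N[of k] unfolding P_def by (cases "k > N") auto
    have "P p" by (simp add: P_def)
    then have Pk: "P (Greatest P)" and mx: "\<And>k. P k \<Longrightarrow> k \<le> Greatest P"
      using GreatestI_nat[of P p "max p N"] Greatest_le_nat[of P _ "max p N"] bound by blast+
    define k where "k = Greatest P"
    have kp: "p \<le> k" and kN: "k \<le> max p N" using Pk bound by (auto simp: P_def k_def)
    have "\<exists>V. open V \<and> B \<inter> V \<noteq> {} \<and> (p < k \<longrightarrow> B \<inter> V \<subseteq> ?Z k)"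
      using Pk xB unfolding P_def k_def[symmetric] by (cases "k = p") (auto intro: exI[of _ UNIV])
    then obtain V where V: "open V" "B \<inter> V \<noteq> {}" "p < k \<longrightarrow> B \<inter> V \<subseteq> ?Z k" by (elim exE conjE)
    \<comment> \<open>Maximality gives a point of \<open>B\<close> in \<open>V\<close> off the next
      rank set; near it \<open>f (Suc k)\<close> keeps its top rank and has a generalized
      inverse.\<close>
    have "\<not> P (Suc k)" using mx[of "Suc k"] by (auto simp: k_def)
    then have "\<not> B \<inter> V \<subseteq> ?Z (Suc k)" using V(1,2) kp unfolding P_def by auto
    then obtain b1 where b1: "b1 \<in> B" "b1 \<in> V" "b1 \<notin> ?Z (Suc k)" by blast
    have "b1 \<in> \<Omega>" using b1(1) U0(3) by (auto simp: B_def)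
    from generalized_inverse[OF this b1(3)] obtain U1 q where U1: "open U1" "b1 \<in> U1" "U1 \<subseteq> \<Omega>"
      and q: "\<forall>i<r k. \<forall>j<r (Suc k). holo_on (q j i) U1"
        "\<forall>z\<in>U1. \<forall>i<r k. \<forall>l<r (Suc k). (\<Sum>j<r (Suc k). \<Sum>i'<r k. ent k i j z * q j i' z * ent k i' l z) = ent k i l z"
      by (elim exE conjE)
    define V' where "V' = V \<inter> U1 \<inter> U0"
    have V': "open V'" "B \<inter> V' \<noteq> {}" using V(1) U1 U0 b1 by (auto simp: V'_def B_def)
    obtain b0 c g U2 where h: "b0 \<in> B" "b0 \<in> U2" "open U2" "U2 \<subseteq> V'" "\<And>i. i < c \<Longrightarrow> holo_on (g i) U2"
      "\<And>i b. i < c \<Longrightarrow> b \<in> B \<Longrightarrow> b \<in> U2 \<Longrightarrow> g i b = 0" "indep_at c g b0"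
      "\<And>h. h \<in> ideal_at B b0 \<Longrightarrow> \<forall>\<^sub>F z in nhds b0. (\<forall>i<c. g i z = 0) \<longrightarrow> h z = 0"
      by (rule analytic_hull[OF V']) blast
    have U2: "U2 \<subseteq> \<Omega>" "U2 \<subseteq> U0" "U2 \<subseteq> V" "U2 \<subseteq> U1" using h(4) U0(3) by (auto simp: V'_def)
    have g0: "\<And>i. i < c \<Longrightarrow> g i b0 = 0" using h(6)[OF _ h(1,2)] .
    obtain F where F: "finite F" "\<forall>q\<in>F. holo_on q \<Omega>" "sing_part Z = {z\<in>\<Omega>. \<forall>q\<in>F. q z = 0}"
      using sing_part_zero_set by blast
    have BS: "B \<inter> U2 \<subseteq> sing_part Z" using Bsing by blast
    note S = codim_le_hull[OF F h(3,2) U2(1) h(1) BS h(5) g0 h(7,8)]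
    have kc: "k + 2 \<le> c"
    proof (cases "k = p")
      case True
      have "2 + p \<le> c"
        by (rule S(2)) (use V0(3) U2(2) in \<open>auto simp: U0_def\<close>)
      then show ?thesis using True by simp
    next
      case False
      then have kp': "p < k" "k < Suc N" using kp kN by auto
      then obtain k' where k': "k = Suc k'" by (cases k) auto
      obtain F' where F': "finite F'" "\<forall>q\<in>F'. holo_on q \<Omega>" "?Z k = {z\<in>\<Omega>. \<forall>q\<in>F'. q z = 0}"
        using nonoptimal_zero_set[of k'] unfolding k' by blast
      have BZ: "B \<inter> U2 \<subseteq> ?Z k" using V(3) kp'(1) U2(3) by blast
      have "2 + k \<le> c"
        by (rule codim_le_hull(2)[OF F' h(3,2) U2(1) h(1) BZ h(5) g0 h(7,8)])
           (use V1(3) kp' U2(2) in \<open>auto simp: U0_def\<close>)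
      then show ?thesis by simp
    qed
    \<comment> \<open>On \<open>U3\<close> the manifold lies in the singular set, so regular points
      of \<open>Z\<close> all lie off the manifold.\<close>
    obtain U3 where U3: "open U3" "b0 \<in> U3" "\<And>z. z \<in> U3 \<Longrightarrow> (\<forall>i<c. g i z = 0) \<longrightarrow> z \<in> sing_part Z"
      using S(1) unfolding eventually_nhds by blast
    have o: "open (U2 \<inter> U3)" using h(3) U3(1) by blast
    have "strongly_holomorphic_at Z \<phi> b0"
    proof (rule strongly_holomorphic_extension[where U="U2 \<inter> U3" and c=c and g=g and k=k and q=q, OF _ o _ _ h(7) g0 kc])
      show "holo_on (g i) (U2 \<inter> U3)" if "i < c" for i using holo_on_subset[OF h(5)[OF that] o] by simp
      show "holo_on (q j i) (U2 \<inter> U3)" if "i < r k" "j < r (Suc k)" for i j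
        using holo_on_subset[OF q(1)[rule_format, OF that] o] U2(4) by blast
      \<comment> \<open>The functions \<open>g\<close> vanish on \<open>B\<close>, so a point where
        one of them is nonzero lies off \<open>B\<close>.\<close>
      show "strongly_holomorphic_at Z \<phi> b" if "b \<in> U2 \<inter> U3" "i < c" "g i b \<noteq> 0" for b i
        using h(6)[OF that(2), of b] that U2(2) by (auto simp: B_def)
      show "b \<notin> reg_part Z" if "b \<in> U2 \<inter> U3" "\<forall>i<c. g i b = 0" for b
        using U3(3)[of b] that by (simp add: sing_part_def)
    qed (use h(2) U3(2) U2 q(2) in auto)
    then show False using h(1) by (simp add: B_def)
  qed
qed

end

theorem corollary1p3:
  fixes \<Omega> Z :: "(complex^'n) set" and x :: "complex^'n"
    and p N :: nat and r :: "nat \<Rightarrow> nat"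
    and f :: "nat \<Rightarrow> complex^'n \<Rightarrow> complex mat"
  assumes "open \<Omega>" and "cball 0 1 \<subseteq> \<Omega>"
    and "analytic_variety_in \<Omega> Z"
    and "pure_codim Z p"
    and "x \<in> Z"
    and "free_resolution \<Omega> Z N r f"
    and "codim_at (sing_part Z) x \<ge> enat (2 + p)"
    and "\<And>k. k > p \<Longrightarrow> codim_at (nonoptimal_rank_set \<Omega> r f k) x \<ge> enat (2 + k)"
  shows "normal_point Z x"
proof -
  interpret resolved_variety \<Omega> Z p N r f by unfold_locales (use assms in blast)+
  show ?thesis using assms by (intro normal_point_of_codim)
qed

end
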